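(* Assume that conditions (C1)–(C6) listed in the context hold. Then $$\sup_{s,t\in[a,b]}|\widehat R(s,t)-R(s,t)|=O\bigl(h_\mu^2+\delta_{n1}(h_\mu)+h_R^2+\delta_{n2}(h_R)\bigr)\quad\text{almost surely, as } n\to\infty.$$
   Context: Model. $X=\{X(t):t\in[a,b]\}$ is a stochastic process on a fixed interval $[a,b]$ with mean function $\mu(t)=\mathbb{E}\{X(t)\}$ and covariance function $R(s,t)=\operatorname{cov}\{X(s),X(t)\}$, assumed to exist. One observes $Y_{ij}=X_i(T_{ij})+U_{ij}$, $i=1,\dots,n$, $j=1,\dots,m_i$, where the $X_i$ are independent realizations of $X$, the $T_{ij}$ are random points in $[a,b]$ with density $f_T$, and the $U_{ij}$ are identically distributed errors with mean zero and finite variance $\sigma^2$; the $X_i$, $T_{ij}$, $U_{ij}$ are all independent. The numbers $m_i\ge 2$ may depend on $n$ ($m_i=m_{in}$), and $N_i=m_i(m_i-1)$. Notation. $K$ is a kernel and $K_h(t)=(1/h)K(t/h)$. $\gamma_{nk}=\bigl(n^{-1}\sum_{i=1}^n m_i^{-k}\bigr)^{-1}$ for $k=1,2,\dots$, and for a bandwidth $h$, $\delta_{n1}(h)=[\{1+(h\gamma_{n1})^{-1}\}\log n/n]^{1/2}$, $\delta_{n2}(h)=[\{1+(h\gamma_{n1})^{-1}+(h^2\gamma_{n2})^{-1}\}\log n/n]^{1/2}$. $h_\mu,h_R>0$ are bandwidths depending on $n$. $\sum_{k\ne j}$ denotes the sum over all $k,j=1,\dots,m_i$ with $k\neq j$.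 Estimators. $\widehat\mu(t)=\widehat a_0$, where $(\widehat a_0,\widehat a_1)$ minimizes over $(a_0,a_1)$ $$\frac1n\sum_{i=1}^n\frac1{m_i}\sum_{j=1}^{m_i}\{Y_{ij}-a_0-a_1(T_{ij}-t)\}^2K_{h_\mu}(T_{ij}-t).$$ $\widehat C(s,t)=\widehat a_0$, where $(\widehat a_0,\widehat a_1,\widehat a_2)$ minimizes over $(a_0,a_1,a_2)$ $$\frac1n\sum_{i=1}^n\Bigl[\frac1{N_i}\sum_{k\ne j}\{Y_{ij}Y_{ik}-a_0-a_1(T_{ij}-s)-a_2(T_{ik}-t)\}^2K_{h_R}(T_{ij}-s)K_{h_R}(T_{ik}-t)\Bigr]$$ (an estimator of $C(s,t)=\mathbb{E}\{X(s)X(t)\}$). Finally $\widehat R(s,t)=\widehat C(s,t)-\widehat\mu(s)\widehat\mu(t)$. Conditions. (C1) For some constants $m_T>0$ and $M_T<\infty$, $m_T\le f_T(t)\le M_T$ for all $t\in[a,b]$; $f_T$ is differentiable with a bounded derivative. (C2) $K$ is a symmetric probability density function on $[-1,1]$ and is of bounded variation on $[-1,1]$. (C3) $\mu$ is twice differentiable and its second derivative is bounded on $[a,b]$. (C4) All second-order partial derivatives of $R(s,t)$ exist and are bounded on $[a,b]^2$. (C5) $\mathbb{E}(|U_{ij}|^{\lambda_\mu})<\infty$ and $\mathbb{E}(\sup_{t\in[a,b]}|X(t)|^{\lambda_\mu})<\infty$ for some $\lambda_\mu\in(2,\infty)$; $h_\mu\to0$ and $(h_\mu^2+h_\mu/\gamma_{n1})^{-1}(\log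 n/n)^{1-2/\lambda_\mu}\to0$ as $n\to\infty$. (C6) $\mathbb{E}(|U_{ij}|^{2\lambda_R})<\infty$ and $\mathbb{E}(\sup_{t\in[a,b]}|X(t)|^{2\lambda_R})<\infty$ for some $\lambda_R\in(2,\infty)$; $h_R\to0$ and $(h_R^4+h_R^3/\gamma_{n1}+h_R^2/\gamma_{n2})^{-1}(\log n/n)^{1-2/\lambda_R}\to0$ as $n\to\infty$. *)

theory Defs
  imports "HOL-Probability.Probability"
begin

definition mean_fun :: "'p measure \<Rightarrow> (real \<Rightarrow> 'p \<Rightarrow> real) \<Rightarrow> real \<Rightarrow> real" where
  "mean_fun P X t = (\<integral>\<omega>. X t \<omega> \<partial>P)"

definition cov_fun :: "'p measure \<Rightarrow> (real \<Rightarrow> 'p \<Rightarrow> real) \<Rightarrow> real \<Rightarrow> real \<Rightarrow> real" where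
  "cov_fun P X s t = (\<integral>\<omega>. (X s \<omega> - mean_fun P X s) * (X t \<omega> - mean_fun P X t) \<partial>P)"

text \<open>
  Joint measurability in \<open>(t, \<omega>)\<close> is what makes \<open>X(T)\<close> a random variable for a random time \<open>T\<close>;
  square integrability is the existence of the mean and covariance functions.
\<close>

definition second_order_process ::
    "real \<Rightarrow> real \<Rightarrow> 'p measure \<Rightarrow> (real \<Rightarrow> 'p \<Rightarrow> real) \<Rightarrow> bool" where
  "second_order_process a b P X \<longleftrightarrow>
     prob_space P \<and>
     (\<lambda>(t, \<omega>). X t \<omega>) \<in> borel_measurable (restrict_space borel {a..b} \<Otimes>\<^sub>M P) \<and>
     (\<forall>t\<in>{a..b}. integrable P (\<lambda>\<omega>. (X t \<omega>)\<^sup>2))"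

text \<open>
  The process \<open>X\<close> lives on its own probability space \<open>P\<close>. Independent realizations of \<open>X\<close> on
  the probability space \<open>M\<close> are obtained from independent draws \<open>\<xi> i\<close> of an outcome of \<open>P\<close>:
  the \<open>i\<close>-th realization is \<open>t \<mapsto> X t (\<xi> i \<omega>)\<close>. Equality of the finite-dimensional distributions
  alone would not suffice, since these do not control \<open>X\<^sub>i(T\<^sub>i\<^sub>j)\<close> or \<open>sup\<^sub>t |X\<^sub>i(t)|\<close>.
\<close>

definition realization ::
    "(real \<Rightarrow> 'p \<Rightarrow> real) \<Rightarrow> (nat \<Rightarrow> 'w \<Rightarrow> 'p) \<Rightarrow> nat \<Rightarrow> real \<Rightarrow> 'w \<Rightarrow> real" where
  "realization X \<xi> i t \<omega> = X t (\<xi> i \<omega>)"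

definition obs ::
    "(real \<Rightarrow> 'p \<Rightarrow> real) \<Rightarrow> (nat \<Rightarrow> 'w \<Rightarrow> 'p) \<Rightarrow> (nat \<Rightarrow> nat \<Rightarrow> 'w \<Rightarrow> real) \<Rightarrow>
     (nat \<Rightarrow> nat \<Rightarrow> 'w \<Rightarrow> real) \<Rightarrow> nat \<Rightarrow> nat \<Rightarrow> 'w \<Rightarrow> real" where
  "obs X \<xi> T U i j \<omega> = realization X \<xi> i (T i j \<omega>) \<omega> + U i j \<omega>"

text \<open>
  The curves, the observation times and the errors take values in different types, so their joint
  independence is expressed through the sigma-algebras they generate, over a common index type.
\<close>

datatype source = Curve nat | Time nat nat | Error nat nat

fun source_events ::
    "'w measure \<Rightarrow> 'p measure \<Rightarrow> (nat \<Rightarrow> 'w \<Rightarrow> 'p) \<Rightarrow> (nat \<Rightarrow> nat \<Rightarrow> 'w \<Rightarrow> real) \<Rightarrow>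
     (nat \<Rightarrow> nat \<Rightarrow> 'w \<Rightarrow> real) \<Rightarrow> source \<Rightarrow> 'w set set" where
  "source_events M P \<xi> T U (Curve i) = sets (vimage_algebra (space M) (\<xi> i) P)"
| "source_events M P \<xi> T U (Time i j) = sets (vimage_algebra (space M) (T i j) borel)"
| "source_events M P \<xi> T U (Error i j) = sets (vimage_algebra (space M) (U i j) borel)"

text \<open>
  Curves and points are numbered from 0. The variables form one array that does not depend on the
  sample size \<open>n\<close>; only the numbers \<open>m n i\<close> of points used on curve \<open>i\<close> do.
\<close>

definition sampling_model ::
    "real \<Rightarrow> real \<Rightarrow> 'w measure \<Rightarrow> 'p measure \<Rightarrow> (nat \<Rightarrow> 'w \<Rightarrow> 'p) \<Rightarrow>
     (nat \<Rightarrow> nat \<Rightarrow> 'w \<Rightarrow> real) \<Rightarrow> (nat \<Rightarrow> nat \<Rightarrow> 'w \<Rightarrow> real) \<Rightarrow> (real \<Rightarrow> real) \<Rightarrow> real \<Rightarrow> bool" where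
  "sampling_model a b M P \<xi> T U f\<^sub>T \<sigma> \<longleftrightarrow>
     prob_space M \<and>
     (\<forall>i. \<xi> i \<in> measurable M P \<and> distr M P (\<xi> i) = P) \<and>
     (\<forall>i j. (\<forall>\<omega>\<in>space M. T i j \<omega> \<in> {a..b}) \<and>
            distributed M lborel (T i j) (\<lambda>t. ennreal (f\<^sub>T t * indicator {a..b} t))) \<and>
     (\<forall>i j. U i j \<in> borel_measurable M \<and>
            distr M borel (U i j) = distr M borel (U 0 0) \<and>
            integrable M (\<lambda>\<omega>. (U i j \<omega>)\<^sup>2) \<and>
            (\<integral>\<omega>. U i j \<omega> \<partial>M) = 0 \<and> (\<integral>\<omega>. (U i j \<omega>)\<^sup>2 \<partial>M) = \<sigma>\<^sup>2) \<and>
     prob_space.indep_sets M (source_events M P \<xi> T U) UNIV"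

definition kern_scale :: "(real \<Rightarrow> real) \<Rightarrow> real \<Rightarrow> real \<Rightarrow> real" where
  "kern_scale K h t = (1 / h) * K (t / h)"

definition gam :: "(nat \<Rightarrow> nat \<Rightarrow> nat) \<Rightarrow> nat \<Rightarrow> nat \<Rightarrow> real" where
  "gam m n k = inverse ((1 / real n) * (\<Sum>i<n. 1 / real (m n i) ^ k))"

definition delta1 :: "(nat \<Rightarrow> nat \<Rightarrow> nat) \<Rightarrow> nat \<Rightarrow> real \<Rightarrow> real" where
  "delta1 m n h = sqrt ((1 + 1 / (h * gam m n 1)) * ln (real n) / real n)"

definition delta2 :: "(nat \<Rightarrow> nat \<Rightarrow> nat) \<Rightarrow> nat \<Rightarrow> real \<Rightarrow> real" where
  "delta2 m n h =
     sqrt ((1 + 1 / (h * gam m n 1) + 1 / (h\<^sup>2 * gam m n 2)) * ln (real n) / real n)"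

text \<open>
  Least-squares criteria for observed values \<open>y\<close> at points \<open>\<tau>\<close>, with \<open>m i\<close> points on curve \<open>i\<close>.
\<close>

definition mean_loss ::
    "(real \<Rightarrow> real) \<Rightarrow> real \<Rightarrow> nat \<Rightarrow> (nat \<Rightarrow> nat) \<Rightarrow> (nat \<Rightarrow> nat \<Rightarrow> real) \<Rightarrow> (nat \<Rightarrow> nat \<Rightarrow> real) \<Rightarrow>
     real \<Rightarrow> real \<times> real \<Rightarrow> real" where
  "mean_loss K h n m y \<tau> t = (\<lambda>(a0, a1).
     (1 / real n) * (\<Sum>i<n. (1 / real (m i)) * (\<Sum>j<m i.
        (y i j - a0 - a1 * (\<tau> i j - t))\<^sup>2 * kern_scale K h (\<tau> i j - t))))"

definition cov_loss ::
    "(real \<Rightarrow> real) \<Rightarrow> real \<Rightarrow> nat \<Rightarrow> (nat \<Rightarrow> nat) \<Rightarrow> (nat \<Rightarrow> nat \<Rightarrow> real) \<Rightarrow> (nat \<Rightarrow> nat \<Rightarrow> real) \<Rightarrow>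
     real \<Rightarrow> real \<Rightarrow> real \<times> real \<times> real \<Rightarrow> real" where
  "cov_loss K h n m y \<tau> s t = (\<lambda>(a0, a1, a2).
     (1 / real n) * (\<Sum>i<n. (1 / (real (m i) * (real (m i) - 1))) *
        (\<Sum>j<m i. \<Sum>k\<in>{..<m i} - {j}.
          (y i j * y i k - a0 - a1 * (\<tau> i j - s) - a2 * (\<tau> i k - t))\<^sup>2
            * kern_scale K h (\<tau> i j - s) * kern_scale K h (\<tau> i k - t))))"

text \<open>
  A minimizer always exists but may fail to be unique for a given sample, so being an estimate is
  a predicate on values: \<open>v\<close> is the intercept of some minimizer.
\<close>

definition is_mean_estimate ::
    "(real \<Rightarrow> real) \<Rightarrow> real \<Rightarrow> nat \<Rightarrow> (nat \<Rightarrow> nat) \<Rightarrow> (nat \<Rightarrow> nat \<Rightarrow> real) \<Rightarrow> (nat \<Rightarrow> nat \<Rightarrow> real) \<Rightarrow>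
     real \<Rightarrow> real \<Rightarrow> bool" where
  "is_mean_estimate K h n m y \<tau> t v \<longleftrightarrow>
     (\<exists>a1. is_arg_min (mean_loss K h n m y \<tau> t) (\<lambda>_. True) (v, a1))"

definition is_cov_estimate ::
    "(real \<Rightarrow> real) \<Rightarrow> real \<Rightarrow> nat \<Rightarrow> (nat \<Rightarrow> nat) \<Rightarrow> (nat \<Rightarrow> nat \<Rightarrow> real) \<Rightarrow> (nat \<Rightarrow> nat \<Rightarrow> real) \<Rightarrow>
     real \<Rightarrow> real \<Rightarrow> real \<Rightarrow> bool" where
  "is_cov_estimate K h n m y \<tau> s t v \<longleftrightarrow>
     (\<exists>a1 a2. is_arg_min (cov_loss K h n m y \<tau> s t) (\<lambda>_. True) (v, a1, a2))"

definition R_hat ::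
    "(nat \<Rightarrow> real \<Rightarrow> real \<Rightarrow> 'w \<Rightarrow> real) \<Rightarrow> (nat \<Rightarrow> real \<Rightarrow> 'w \<Rightarrow> real) \<Rightarrow>
     nat \<Rightarrow> real \<Rightarrow> real \<Rightarrow> 'w \<Rightarrow> real" where
  "R_hat C_hat mu_hat n s t \<omega> = C_hat n s t \<omega> - mu_hat n s \<omega> * mu_hat n t \<omega>"

definition bounded_variation_on :: "(real \<Rightarrow> real) \<Rightarrow> real \<Rightarrow> real \<Rightarrow> bool" where
  "bounded_variation_on f c d \<longleftrightarrow>
     (\<exists>B. \<forall>N. \<forall>x :: nat \<Rightarrow> real. (\<forall>k\<le>N. x k \<in> {c..d}) \<and> (\<forall>k<N. x k \<le> x (Suc k))
            \<longrightarrow> (\<Sum>k<N. \<bar>f (x (Suc k)) - f (x k)\<bar>) \<le> B)"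

text \<open>Derivatives at the endpoints of \<open>[a, b]\<close> are one-sided.\<close>

definition condC1 :: "real \<Rightarrow> real \<Rightarrow> (real \<Rightarrow> real) \<Rightarrow> bool" where
  "condC1 a b f\<^sub>T \<longleftrightarrow>
     (\<exists>m\<^sub>T M\<^sub>T. 0 < m\<^sub>T \<and> (\<forall>t\<in>{a..b}. m\<^sub>T \<le> f\<^sub>T t \<and> f\<^sub>T t \<le> M\<^sub>T)) \<and>
     (\<exists>f'. (\<forall>t\<in>{a..b}. (f\<^sub>T has_real_derivative f' t) (at t within {a..b})) \<and>
           bounded (f' ` {a..b}))"

definition condC2 :: "(real \<Rightarrow> real) \<Rightarrow> bool" where
  "condC2 K \<longleftrightarrow>
     (\<forall>u. 0 \<le> K u) \<and> (\<forall>u. K (- u) = K u) \<and> (\<forall>u. u \<notin> {-1..1} \<longrightarrow> K u = 0) \<and>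
     integrable lborel K \<and> (\<integral>u. K u \<partial>lborel) = 1 \<and>
     bounded_variation_on K (-1) 1"

definition condC3 :: "real \<Rightarrow> real \<Rightarrow> (real \<Rightarrow> real) \<Rightarrow> bool" where
  "condC3 a b \<mu> \<longleftrightarrow>
     (\<exists>\<mu>' \<mu>''. (\<forall>t\<in>{a..b}. (\<mu> has_real_derivative \<mu>' t) (at t within {a..b})) \<and>
              (\<forall>t\<in>{a..b}. (\<mu>' has_real_derivative \<mu>'' t) (at t within {a..b})) \<and>
              bounded (\<mu>'' ` {a..b}))"

definition has_partial1 ::
    "real \<Rightarrow> real \<Rightarrow> (real \<Rightarrow> real \<Rightarrow> real) \<Rightarrow> (real \<Rightarrow> real \<Rightarrow> real) \<Rightarrow> bool" where
  "has_partial1 a b F G \<longleftrightarrow>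
     (\<forall>s\<in>{a..b}. \<forall>t\<in>{a..b}. ((\<lambda>u. F u t) has_real_derivative G s t) (at s within {a..b}))"

definition has_partial2 ::
    "real \<Rightarrow> real \<Rightarrow> (real \<Rightarrow> real \<Rightarrow> real) \<Rightarrow> (real \<Rightarrow> real \<Rightarrow> real) \<Rightarrow> bool" where
  "has_partial2 a b F G \<longleftrightarrow>
     (\<forall>s\<in>{a..b}. \<forall>t\<in>{a..b}. ((\<lambda>u. F s u) has_real_derivative G s t) (at t within {a..b}))"

definition condC4 :: "real \<Rightarrow> real \<Rightarrow> (real \<Rightarrow> real \<Rightarrow> real) \<Rightarrow> bool" where
  "condC4 a b R \<longleftrightarrow>
     (\<exists>R1 R2 R11 R12 R21 R22.
        has_partial1 a b R R1 \<and> has_partial2 a b R R2 \<and>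
        has_partial1 a b R1 R11 \<and> has_partial2 a b R1 R12 \<and>
        has_partial1 a b R2 R21 \<and> has_partial2 a b R2 R22 \<and>
        (\<forall>D\<in>{R11, R12, R21, R22}. bounded ((\<lambda>(s, t). D s t) ` ({a..b} \<times> {a..b}))))"

text \<open>
  The supremum is taken in \<open>[0, \<infinity>]\<close>. Its measurability is not automatic (the index set is
  uncountable) and is part of the existence of the expectation.
\<close>

definition finite_sup_moment ::
    "real \<Rightarrow> real \<Rightarrow> 'p measure \<Rightarrow> (real \<Rightarrow> 'p \<Rightarrow> real) \<Rightarrow> real \<Rightarrow> bool" where
  "finite_sup_moment a b P X p \<longleftrightarrow>
     (\<lambda>\<omega>. SUP t\<in>{a..b}. ennreal (\<bar>X t \<omega>\<bar> powr p)) \<in> borel_measurable P \<and>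
     (\<integral>\<^sup>+ \<omega>. (SUP t\<in>{a..b}. ennreal (\<bar>X t \<omega>\<bar> powr p)) \<partial>P) < \<infinity>"

definition condC5 ::
    "real \<Rightarrow> real \<Rightarrow> 'w measure \<Rightarrow> 'p measure \<Rightarrow> (real \<Rightarrow> 'p \<Rightarrow> real) \<Rightarrow>
     (nat \<Rightarrow> nat \<Rightarrow> 'w \<Rightarrow> real) \<Rightarrow> (nat \<Rightarrow> nat \<Rightarrow> nat) \<Rightarrow> (nat \<Rightarrow> real) \<Rightarrow> bool" where
  "condC5 a b M P X U m h \<longleftrightarrow> h \<longlonglongrightarrow> 0 \<and>
     (\<exists>l>2. (\<forall>i j. integrable M (\<lambda>\<omega>. \<bar>U i j \<omega>\<bar> powr l)) \<and>
        finite_sup_moment a b P X l \<and>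
        (\<lambda>n. inverse ((h n)\<^sup>2 + h n / gam m n 1) * (ln (real n) / real n) powr (1 - 2 / l))
          \<longlonglongrightarrow> 0)"

definition condC6 ::
    "real \<Rightarrow> real \<Rightarrow> 'w measure \<Rightarrow> 'p measure \<Rightarrow> (real \<Rightarrow> 'p \<Rightarrow> real) \<Rightarrow>
     (nat \<Rightarrow> nat \<Rightarrow> 'w \<Rightarrow> real) \<Rightarrow> (nat \<Rightarrow> nat \<Rightarrow> nat) \<Rightarrow> (nat \<Rightarrow> real) \<Rightarrow> bool" where
  "condC6 a b M P X U m h \<longleftrightarrow> h \<longlonglongrightarrow> 0 \<and>
     (\<exists>l>2. (\<forall>i j. integrable M (\<lambda>\<omega>. \<bar>U i j \<omega>\<bar> powr (2 * l))) \<and>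
        finite_sup_moment a b P X (2 * l) \<and>
        (\<lambda>n. inverse ((h n) ^ 4 + (h n) ^ 3 / gam m n 1 + (h n)\<^sup>2 / gam m n 2)
             * (ln (real n) / real n) powr (1 - 2 / l)) \<longlonglongrightarrow> 0)"

end

theory Submission
  imports Defs "HOL-Real_Asymp.Real_Asymp"
begin

text \<open>
  Minimality turns the error of a local linear fit into the normal equations for the residuals, so
  \<open>mu_hat - \<mu>\<close> is at most the size of the kernel averages of noise and Taylor remainder, divided by a lower
  bound for the smallest eigenvalue of the empirical design form; likewise for \<open>C\<close>, with products of
  observations. The Taylor remainder contributes \<open>h\<^sup>2\<close>. Hence it suffices that all kernel averages
  deviate from their expectations by \<open>O(\<delta>)\<close>, almost surely and uniformly in the centre: the noise
  averages have expectation 0 because the curve can be integrated out at fixed times, and the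
  expected design is nondegenerate on \<open>[a, b]\<close>, including the endpoints.

  A kernel of bounded variation is a difference of monotone functions on \<open>[-1, 1]\<close>, and these are
  limits of averages of indicators of intervals. So only intervals (in two dimensions, rectangles)
  matter, and sandwiching them in a grid of mesh \<open>1 / n\<^sup>2\<close> leaves polynomially many. There a Chernoff
  bound applies after truncation, and the truncated part is governed by averages of \<open>n\<close> independent
  envelopes, one for each curve, which dominate the \<open>p\<close>-th powers of the means of the amplitudes
  over the first \<open>m\<close> points for all \<open>m\<close> at once. This makes the dependence of \<open>m n i\<close> on \<open>n\<close> harmless.
\<close>

subsection \<open>Averages of independent variables\<close>

text \<open>Observations on one curve are dependent through the common path, so concentration can
  only come from the \<open>n\<close> independent curves, and the second moment of a window average
  over a single curve decides the rate. Averaged over the curves it is of order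
  \<open>beta1\<close>, or \<open>beta2\<close> for pairs; with \<rho> = ln n / n the deviation is
  of order sqrt (\<beta> \<rho>), and dividing by the window normalisation h or h squared gives
  exactly \<open>delta1\<close> or \<open>delta2\<close>. The exponent 1 - 2 / l in the bandwidth
  conditions is what lets the l-th moment pay for truncation at sqrt (\<beta> / \<rho>). The
  estimates are arbitrary selections of minimizers and the suprema run over uncountable sets, so
  neither need be measurable. All exceptional sets therefore come from countably many grid events
  and domination statements; outside them the estimators are handled outcome by outcome. The
  constant in the rate may depend on the outcome, but not on the sample size or the centre.\<close>

lemma (in prob_space) integrable_of_square:
  fixes f :: "'a \<Rightarrow> real"
  assumes [measurable]: "f \<in> borel_measurable M" and "integrable M (\<lambda>\<omega>. (f \<omega>)\<^sup>2)"
  shows "integrable M f"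
  by (rule square_integrable_imp_integrable) (use assms in auto)

text \<open>Expanding the square leaves products of pairs; for distinct indices independence
  factorises the expectation and centring makes it 0, so only the diagonal survives.\<close>

lemma (in prob_space) expectation_square_sum_indep:
  fixes Y :: "'i \<Rightarrow> 'a \<Rightarrow> real"
  assumes fin: "finite I" and indep: "indep_vars (\<lambda>_. borel) Y I"
    and sq: "\<And>i. i \<in> I \<Longrightarrow> integrable M (\<lambda>\<omega>. (Y i \<omega>)\<^sup>2)"
    and mean: "\<And>i. i \<in> I \<Longrightarrow> expectation (Y i) = 0"
  shows "integrable M (\<lambda>\<omega>. (\<Sum>i\<in>I. Y i \<omega>)\<^sup>2)"
    and "expectation (\<lambda>\<omega>. (\<Sum>i\<in>I. Y i \<omega>)\<^sup>2) = (\<Sum>i\<in>I. expectation (\<lambda>\<omega>. (Y i \<omega>)\<^sup>2))"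
proof -
  have rv: "random_variable borel (Y i)" if "i \<in> I" for i
    using indep that by (auto simp: indep_vars_def)
  have int: "integrable M (Y i)" if "i \<in> I" for i
    using integrable_of_square[OF rv sq] that by auto
  have pair: "integrable M (\<lambda>\<omega>. Y i \<omega> * Y j \<omega>) \<and>
      expectation (\<lambda>\<omega>. Y i \<omega> * Y j \<omega>) = (if i = j then expectation (\<lambda>\<omega>. (Y i \<omega>)\<^sup>2) else 0)"
    if "i \<in> I" "j \<in> I" for i j
  proof (cases "i = j")
    case True
    then show ?thesis using sq[OF that(1)] by (simp add: power2_eq_square)
  next
    case False
    have ind: "indep_vars (\<lambda>_. borel) Y {i, j}"
      by (rule indep_vars_subset[OF indep]) (use that in auto)
    have "integrable M (\<lambda>\<omega>. \<Prod>k\<in>{i,j}. Y k \<omega>)"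
      by (rule indep_vars_integrable[OF _ ind]) (use int that in auto)
    moreover have "expectation (\<lambda>\<omega>. \<Prod>k\<in>{i,j}. Y k \<omega>) = (\<Prod>k\<in>{i,j}. expectation (Y k))"
      by (rule indep_vars_lebesgue_integral[OF _ ind]) (use int that in auto)
    ultimately show ?thesis using False mean that by simp
  qed
  have eq: "(\<lambda>\<omega>. (\<Sum>i\<in>I. Y i \<omega>)\<^sup>2) = (\<lambda>\<omega>. \<Sum>i\<in>I. \<Sum>j\<in>I. Y i \<omega> * Y j \<omega>)"
    by (simp add: power2_eq_square sum_product)
  show "integrable M (\<lambda>\<omega>. (\<Sum>i\<in>I. Y i \<omega>)\<^sup>2)"
    unfolding eq using pair by auto
  have "expectation (\<lambda>\<omega>. (\<Sum>i\<in>I. Y i \<omega>)\<^sup>2) = (\<Sum>i\<in>I. \<Sum>j\<in>I. expectation (\<lambda>\<omega>. Y i \<omega> * Y j \<omega>))"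
    unfolding eq using pair by simp
  also have "\<dots> = (\<Sum>i\<in>I. \<Sum>j\<in>I. if i = j then expectation (\<lambda>\<omega>. (Y i \<omega>)\<^sup>2) else 0)"
    using pair by (intro sum.cong) auto
  also have "\<dots> = (\<Sum>i\<in>I. expectation (\<lambda>\<omega>. (Y i \<omega>)\<^sup>2))"
    using fin by (intro sum.cong) auto
  finally show "expectation (\<lambda>\<omega>. (\<Sum>i\<in>I. Y i \<omega>)\<^sup>2) = (\<Sum>i\<in>I. expectation (\<lambda>\<omega>. (Y i \<omega>)\<^sup>2))" .
qed

text \<open>The variance is at most the raw second moment. The bound uses raw second moments because
  these decrease under truncation of a nonnegative variable, whereas variances need not.\<close>

lemma (in prob_space) expectation_square_centered_sum:
  fixes Y :: "'i \<Rightarrow> 'a \<Rightarrow> real"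
  assumes fin: "finite I" and indep: "indep_vars (\<lambda>_. borel) Y I"
    and sq: "\<And>i. i \<in> I \<Longrightarrow> integrable M (\<lambda>\<omega>. (Y i \<omega>)\<^sup>2)"
  shows "integrable M (\<lambda>\<omega>. ((\<Sum>i\<in>I. Y i \<omega>) - (\<Sum>i\<in>I. expectation (Y i)))\<^sup>2)"
    and "expectation (\<lambda>\<omega>. ((\<Sum>i\<in>I. Y i \<omega>) - (\<Sum>i\<in>I. expectation (Y i)))\<^sup>2)
           \<le> (\<Sum>i\<in>I. expectation (\<lambda>\<omega>. (Y i \<omega>)\<^sup>2))"
proof -
  have rv: "random_variable borel (Y i)" if "i \<in> I" for i
    using indep that by (auto simp: indep_vars_def)
  have int: "integrable M (Y i)" if "i \<in> I" for i
    using integrable_of_square[OF rv sq] that by auto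
  let ?Y = "\<lambda>i \<omega>. Y i \<omega> - expectation (Y i)"
  have indep': "indep_vars (\<lambda>_. borel) ?Y I"
    by (rule indep_vars_compose2[OF indep, where Y = "\<lambda>i y. y - expectation (Y i)"]) auto
  have sq': "integrable M (\<lambda>\<omega>. (?Y i \<omega>)\<^sup>2)" and
    le: "expectation (\<lambda>\<omega>. (?Y i \<omega>)\<^sup>2) \<le> expectation (\<lambda>\<omega>. (Y i \<omega>)\<^sup>2)" if "i \<in> I" for i
    using sq[OF that] int[OF that] variance_eq[OF int[OF that] sq[OF that]]
    by (auto simp: power2_diff)
  have mean: "expectation (?Y i) = 0" if "i \<in> I" for i
    using int[OF that] by (simp add: prob_space)
  have eq: "(\<Sum>i\<in>I. Y i \<omega>) - (\<Sum>i\<in>I. expectation (Y i)) = (\<Sum>i\<in>I. ?Y i \<omega>)" for \<omega>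
    by (simp add: sum_subtractf)
  show "integrable M (\<lambda>\<omega>. ((\<Sum>i\<in>I. Y i \<omega>) - (\<Sum>i\<in>I. expectation (Y i)))\<^sup>2)"
    unfolding eq by (rule expectation_square_sum_indep(1)[OF fin indep' sq' mean])
  show "expectation (\<lambda>\<omega>. ((\<Sum>i\<in>I. Y i \<omega>) - (\<Sum>i\<in>I. expectation (Y i)))\<^sup>2)
           \<le> (\<Sum>i\<in>I. expectation (\<lambda>\<omega>. (Y i \<omega>)\<^sup>2))"
    unfolding eq using expectation_square_sum_indep(2)[OF fin indep' sq' mean] sum_mono[of I, OF le] by simp
qed

section \<open>Dyadic truncation and almost sure boundedness of averages\<close>

lemma sum_pow2_below_le:
  fixes v :: real assumes "0 \<le> v"
  shows "(\<Sum>k<K. if 2 ^ k < v then 2 ^ k else 0) \<le> 2 * v \<and>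
         (\<Sum>k<K. if 2 ^ k < v then 2 ^ k else 0 :: real) \<le> 2 ^ K - 1"
  \<comment> \<open>The second conjunct feeds the first: a new term \<open>2 ^ K < v\<close> makes
    the sum at most \<open>2 ^ (K + 1) - 1\<close>, which is below \<open>2 * v\<close>.\<close>
  using assms by (induction K) (auto simp: not_less)

text \<open>A geometric tail: the first \<open>k\<close> with \<open>v \<le> 2 ^ k\<close>
  contributes at most \<open>v\<close>, and from then on the terms halve.\<close>

lemma sum_pow2_above_le:
  fixes v :: real assumes "0 \<le> v"
  shows "(\<Sum>k<K. if v \<le> 2 ^ k then v\<^sup>2 / 2 ^ k else 0) \<le> 2 * v"
proof -
  \<comment> \<open>The subtracted \<open>2 * v\<^sup>2 / 2 ^ K\<close> is the tail of the geometric
    series from index \<open>K\<close> on; with it the induction step is exact.\<close>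
  have "(2 ^ K < v \<longrightarrow> (\<Sum>k<K. if v \<le> 2 ^ k then v\<^sup>2 / 2 ^ k else 0) = 0) \<and>
    (v \<le> 2 ^ K \<longrightarrow> (\<Sum>k<K. if v \<le> 2 ^ k then v\<^sup>2 / 2 ^ k else 0) \<le> 2 * v - 2 * v\<^sup>2 / 2 ^ K)" (is "?P K")
  proof (induction K)
    case 0
    show ?case using assms by (auto simp: power2_eq_square mult_left_le)
  next
    case (Suc K)
    show ?case
    proof (cases "v \<le> 2 ^ K")
      case True
      then show ?thesis using Suc assms by (auto simp: divide_simps)
    next
      case False
      then have 0: "(\<Sum>k<Suc K. if v \<le> 2 ^ k then v\<^sup>2 / 2 ^ k else 0) = 0"
        using Suc by (simp add: not_le)
      have "0 \<le> 2 * v - 2 * v\<^sup>2 / 2 ^ Suc K" if "v \<le> 2 ^ Suc K"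
      proof -
        have "v * v \<le> v * 2 ^ Suc K" using that assms by (intro mult_left_mono)
        then show ?thesis by (simp add: field_simps power2_eq_square)
      qed
      then show ?thesis unfolding 0 by auto
    qed
  qed
  moreover have "2 * v - 2 * v\<^sup>2 / 2 ^ K \<le> 2 * v" by simp
  ultimately show ?thesis using assms by (smt (verit))
qed

text \<open>
  A weak law of large numbers along \<open>n = 2 ^ k\<close> after truncation at \<open>2 ^ k\<close>; monotonicity of the
  partial sums then controls all \<open>n\<close>.
\<close>

lemma (in prob_space) AE_bounded_averages:
  fixes V :: "nat \<Rightarrow> 'a \<Rightarrow> real"
  assumes indep: "indep_vars (\<lambda>_. borel) V UNIV" and nonneg: "\<And>i \<omega>. 0 \<le> V i \<omega>"
    and same: "\<And>i. distr M borel (V i) = distr M borel (V 0)" and int0: "integrable M (V 0)"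
  shows "AE \<omega> in M. \<exists>B. \<forall>n. (\<Sum>i<n. V i \<omega>) \<le> B * real n"
proof -
  have rv[measurable]: "random_variable borel (V i)" for i
    using indep by (auto simp: indep_vars_def)
  have transfer: "integrable M (\<lambda>\<omega>. f (V i \<omega>)) = integrable M (\<lambda>\<omega>. f (V 0 \<omega>))"
      "expectation (\<lambda>\<omega>. f (V i \<omega>)) = expectation (\<lambda>\<omega>. f (V 0 \<omega>))"
    if [measurable]: "f \<in> borel_measurable borel" for f :: "real \<Rightarrow> real" and i
    using integrable_distr_eq[of "V i" M borel f] integrable_distr_eq[of "V 0" M borel f]
      integral_distr[of "V i" M borel f] integral_distr[of "V 0" M borel f] same[of i] by simp_all
  define e where "e = expectation (V 0)"
  have e0: "0 \<le> e" unfolding e_def by (rule integral_nonneg_AE) (simp add: nonneg)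
  define tr where "tr k v = (if v \<le> 2 ^ k then v else 0)" for k and v :: real
  have [measurable]: "tr k \<in> borel_measurable borel" for k unfolding tr_def by measurable
  \<comment> \<open>Its expectation bounds the failure probability of block \<open>k\<close>: the
    first summand stands for \<open>2 ^ k\<close> variables times the chance of exceeding
    \<open>2 ^ k\<close>, the second for the Chebyshev bound of the truncated sum. Over all
    \<open>k\<close> the two dyadic series sum to at most \<open>4 * v\<close>, so one first moment
    makes the failures summable.\<close>
  define f where "f k v = (if 2 ^ k < v then 2 ^ k else 0) + (tr k v)\<^sup>2 / 2 ^ k" for k and v :: real
  have f_nonneg: "0 \<le> f k v" for k v unfolding f_def by simp
  have f_sum: "(\<Sum>k<K. f k v) \<le> 4 * v" if "0 \<le> v" for v K
  proof -
    have "(\<Sum>k<K. f k v) = (\<Sum>k<K. if 2 ^ k < v then 2 ^ k else 0) + (\<Sum>k<K. if v \<le> 2 ^ k then v\<^sup>2 / 2 ^ k else 0)"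
      unfolding f_def tr_def sum.distrib by (intro arg_cong2[where f="(+)"] sum.cong) auto
    then show ?thesis using sum_pow2_below_le[OF that, of K] sum_pow2_above_le[OF that, of K] by linarith
  qed
  have [measurable]: "f k \<in> borel_measurable borel" for k unfolding f_def by measurable
  have tr_bd: "\<bar>tr k v\<bar> \<le> 2 ^ k" if "0 \<le> v" for k v unfolding tr_def using that by auto
  have int_tr2: "integrable M (\<lambda>\<omega>. (tr k (V i \<omega>))\<^sup>2)" for k i
  proof (rule integrable_const_bound[where B = "(2 ^ k)\<^sup>2"])
    show "AE \<omega> in M. norm ((tr k (V i \<omega>))\<^sup>2) \<le> (2 ^ k)\<^sup>2"
      using tr_bd[OF nonneg, of k i] by (auto simp: abs_le_square_iff[symmetric])
  qed simp
  have int_tr: "integrable M (\<lambda>\<omega>. tr k (V i \<omega>))" for k i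
    by (rule integrable_const_bound[where B = "2 ^ k"]) (use tr_bd nonneg in auto)
  have int_ind: "integrable M (\<lambda>\<omega>. if 2 ^ k < V i \<omega> then 2 ^ k else 0 :: real)" for k i
    by (rule integrable_const_bound[where B = "2 ^ k"]) auto
  have int_f: "integrable M (\<lambda>\<omega>. f k (V i \<omega>))" for k i
    unfolding f_def by (intro Bochner_Integration.integrable_add int_ind integrable_divide_zero) (auto intro: int_tr2)
  \<comment> \<open>Failure of block \<open>k\<close>: some variable exceeds the truncation level,
    or the truncated sum is at least \<open>2 ^ k\<close> away from its mean (squared and divided by
    \<open>4 ^ k\<close>).\<close>
  define A where "A k = (\<Union>i<2 ^ k. {\<omega>\<in>space M. 2 ^ k < V i \<omega>}) \<union>
     {\<omega>\<in>space M. 1 \<le> ((\<Sum>i<2 ^ k. tr k (V i \<omega>)) - (\<Sum>i<2 ^ k. expectation (\<lambda>\<omega>. tr k (V i \<omega>))))\<^sup>2 / 4 ^ k}"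
    for k :: nat
  have A_meas[measurable]: "A k \<in> sets M" for k unfolding A_def by measurable
  have prob_A: "prob (A k) \<le> expectation (\<lambda>\<omega>. f k (V 0 \<omega>))" for k
  proof -
    let ?S = "\<lambda>\<omega>. ((\<Sum>i<2 ^ k. tr k (V i \<omega>)) - (\<Sum>i<2 ^ k. expectation (\<lambda>\<omega>. tr k (V i \<omega>))))\<^sup>2"
    have "prob {\<omega>\<in>space M. 2 ^ k < V i \<omega>} = expectation (\<lambda>\<omega>. if 2 ^ k < V 0 \<omega> then 1 else 0)" for i
    proof -
      have "prob {\<omega>\<in>space M. 2 ^ k < V i \<omega>} = expectation (indicator {\<omega>\<in>space M. 2 ^ k < V i \<omega>})"
        by simp
      also have "\<dots> = expectation (\<lambda>\<omega>. if 2 ^ k < V i \<omega> then 1 else 0)"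
        by (intro Bochner_Integration.integral_cong) (auto simp: indicator_def)
      also have "\<dots> = expectation (\<lambda>\<omega>. if 2 ^ k < V 0 \<omega> then 1 else 0)"
        by (rule transfer(2)[of "\<lambda>v. if 2 ^ k < v then 1 else 0"]) measurable
      finally show ?thesis .
    qed
    then have "prob (\<Union>i<2 ^ k. {\<omega>\<in>space M. 2 ^ k < V i \<omega>}) \<le> (\<Sum>i<(2::nat) ^ k. expectation (\<lambda>\<omega>. if 2 ^ k < V 0 \<omega> then 1 else 0))"
      using finite_measure_subadditive_finite[of "{..<(2::nat)^k}" "\<lambda>i. {\<omega>\<in>space M. 2 ^ k < V i \<omega>}"]
      by (simp add: image_subset_iff)
    also have "\<dots> = expectation (\<lambda>\<omega>. 2 ^ k * (if 2 ^ k < V 0 \<omega> then 1 else 0))"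
      by simp
    also have "\<dots> = expectation (\<lambda>\<omega>. if 2 ^ k < V 0 \<omega> then 2 ^ k else 0)"
      by (intro Bochner_Integration.integral_cong) auto
    finally have 1: "prob (\<Union>i<2 ^ k. {\<omega>\<in>space M. 2 ^ k < V i \<omega>}) \<le> \<dots>" .
    have ind: "indep_vars (\<lambda>_. borel) (\<lambda>i \<omega>. tr k (V i \<omega>)) {..<(2::nat)^k}"
      by (rule indep_vars_compose2[OF indep_vars_subset[OF indep]]) auto
    note S = expectation_square_centered_sum[OF _ ind int_tr2]
    have "prob {\<omega>\<in>space M. 1 \<le> ?S \<omega> / 4 ^ k} \<le> expectation (\<lambda>\<omega>. ?S \<omega> / 4 ^ k) / 1"
      using S(1) by (intro integral_Markov_inequality_measure[where A = "{}"]) auto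
    also have "\<dots> = expectation ?S / 4 ^ k" by simp
    also have "\<dots> \<le> (\<Sum>i<(2::nat) ^ k. expectation (\<lambda>\<omega>. (tr k (V i \<omega>))\<^sup>2)) / 4 ^ k"
      using S(2) by (intro divide_right_mono) auto
    also have "\<dots> = (\<Sum>i<(2::nat) ^ k. expectation (\<lambda>\<omega>. (tr k (V 0 \<omega>))\<^sup>2)) / 4 ^ k"
      by (intro arg_cong2[where f = "(/)"] sum.cong refl transfer(2)[of "\<lambda>v. (tr k v)\<^sup>2"]) measurable
    also have "\<dots> = expectation (\<lambda>\<omega>. (tr k (V 0 \<omega>))\<^sup>2 / 2 ^ k)"
      using power_mult_distrib[of "2::real" 2 k] by (simp add: field_simps)
    finally have 2: "prob {\<omega>\<in>space M. 1 \<le> ?S \<omega> / 4 ^ k} \<le> \<dots>" .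
    have "prob (A k) \<le> prob (\<Union>i<2 ^ k. {\<omega>\<in>space M. 2 ^ k < V i \<omega>}) + prob {\<omega>\<in>space M. 1 \<le> ?S \<omega> / 4 ^ k}"
      unfolding A_def by (rule measure_Un_le) measurable
    also have "\<dots> \<le> expectation (\<lambda>\<omega>. f k (V 0 \<omega>))"
      using 1 2 int_ind[of k 0] int_tr2[of k 0] unfolding f_def
      by (subst Bochner_Integration.integral_add) auto
    finally show ?thesis .
  qed
  have "summable (\<lambda>k. prob (A k))"
  proof (rule summable_comparison_test[OF _ summableI_nonneg_bounded[of _ "4 * e"]])
    show "\<exists>N. \<forall>k\<ge>N. norm (prob (A k)) \<le> expectation (\<lambda>\<omega>. f k (V 0 \<omega>))" using prob_A by auto
    show "0 \<le> expectation (\<lambda>\<omega>. f k (V 0 \<omega>))" for k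
      by (rule integral_nonneg_AE) (simp add: f_nonneg)
    fix K
    have "(\<Sum>k<K. expectation (\<lambda>\<omega>. f k (V 0 \<omega>))) = expectation (\<lambda>\<omega>. \<Sum>k<K. f k (V 0 \<omega>))"
      using int_f by simp
    also have "\<dots> \<le> expectation (\<lambda>\<omega>. 4 * V 0 \<omega>)"
      using int_f int0 f_sum nonneg by (intro integral_mono) auto
    finally show "(\<Sum>k<K. expectation (\<lambda>\<omega>. f k (V 0 \<omega>))) \<le> 4 * e" unfolding e_def by simp
  qed
  then have "AE \<omega> in M. eventually (\<lambda>k. \<omega> \<in> space M - A k) sequentially"
    by (intro borel_cantelli_AE1) (auto simp: less_top[symmetric])
  then show ?thesis
  proof eventually_elim
    fix \<omega> assume "eventually (\<lambda>k. \<omega> \<in> space M - A k) sequentially"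
    then obtain k0 where k0: "\<And>k. k \<ge> k0 \<Longrightarrow> \<omega> \<in> space M - A k" by (auto simp: eventually_sequentially)
    have block: "(\<Sum>i<2 ^ k. V i \<omega>) \<le> (e + 1) * 2 ^ k" if "k \<ge> k0" for k
    proof -
      have small: "V i \<omega> \<le> 2 ^ k" if "i < 2 ^ k" for i
        using k0[OF \<open>k \<ge> k0\<close>] that by (auto simp: A_def not_less)
      have "((\<Sum>i<2 ^ k. tr k (V i \<omega>)) - (\<Sum>i<(2::nat) ^ k. expectation (\<lambda>\<omega>. tr k (V i \<omega>))))\<^sup>2 < 4 ^ k"
        using k0[OF that] by (auto simp: A_def not_le divide_simps)
      then have "((\<Sum>i<2 ^ k. tr k (V i \<omega>)) - (\<Sum>i<(2::nat) ^ k. expectation (\<lambda>\<omega>. tr k (V i \<omega>))))\<^sup>2 < (2 ^ k)\<^sup>2"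
        by (simp add: power2_eq_square power_mult_distrib[symmetric])
      then have "(\<Sum>i<2 ^ k. tr k (V i \<omega>)) - (\<Sum>i<(2::nat) ^ k. expectation (\<lambda>\<omega>. tr k (V i \<omega>))) < 2 ^ k"
        by (rule power_less_imp_less_base) simp
      moreover have "expectation (\<lambda>\<omega>. tr k (V i \<omega>)) \<le> e" for i
      proof -
        have "expectation (\<lambda>\<omega>. tr k (V i \<omega>)) = expectation (\<lambda>\<omega>. tr k (V 0 \<omega>))"
          by (rule transfer(2)) measurable
        also have "\<dots> \<le> e" unfolding e_def
          using int_tr int0 nonneg by (intro integral_mono) (auto simp: tr_def)
        finally show ?thesis .
      qed
      then have "(\<Sum>i<(2::nat) ^ k. expectation (\<lambda>\<omega>. tr k (V i \<omega>))) \<le> 2 ^ k * e"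
        using sum_bounded_above[of "{..<(2::nat)^k}" "\<lambda>i. expectation (\<lambda>\<omega>. tr k (V i \<omega>))" e] by simp
      moreover have "(\<Sum>i<2 ^ k. tr k (V i \<omega>)) = (\<Sum>i<2 ^ k. V i \<omega>)"
        using small by (intro sum.cong) (auto simp: tr_def)
      ultimately show ?thesis by (simp add: algebra_simps)
    qed
    \<comment> \<open>The next power of two after \<open>n\<close> is at most \<open>2 * n\<close>.
      The factor \<open>2 ^ k0\<close> covers the finitely many \<open>n\<close> whose block lies
      before \<open>k0\<close>.\<close>
    have "(\<Sum>i<n. V i \<omega>) \<le> (2 * (e + 1) * 2 ^ k0) * real n" for n
    proof (cases "n = 0")
      case False
      define k where "k = max k0 (Discrete_Functions.floor_log n + 1)"
      have n: "n < 2 ^ (Discrete_Functions.floor_log n + 1)" "2 ^ (Discrete_Functions.floor_log n) \<le> n"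
        using floor_log_exp2_gt[of n] floor_log_exp2_le[of n] False by auto
      have "n \<le> 2 ^ k"
        using n(1) power_increasing[of "Discrete_Functions.floor_log n + 1" k "2::nat"] unfolding k_def by linarith
      then have "(\<Sum>i<n. V i \<omega>) \<le> (\<Sum>i<2 ^ k. V i \<omega>)"
        by (intro sum_mono2) (auto simp: nonneg)
      also have "\<dots> \<le> (e + 1) * 2 ^ k" by (rule block) (simp add: k_def)
      also have "(2::nat) ^ k \<le> 2 ^ k0 * (2 * n)"
      proof (cases "k = k0")
        case True then show ?thesis using False by simp
      next
        case f: False
        then have "k = Discrete_Functions.floor_log n + 1" unfolding k_def by linarith
        then have "(2::nat) ^ k \<le> 2 * n" using n(2) by simp
        also have "\<dots> \<le> 2 ^ k0 * (2 * n)" by simp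
        finally show ?thesis .
      qed
      then have "(2::real) ^ k \<le> 2 ^ k0 * (2 * real n)"
        using of_nat_mono[of "2 ^ k" "2 ^ k0 * (2 * n)", where 'a = real] by simp
      then have "(e + 1) * 2 ^ k \<le> (e + 1) * (2 ^ k0 * (2 * real n))" using e0 by (intro mult_left_mono) auto
      finally show ?thesis by (simp only: mult_ac)
    qed simp
    then show "\<exists>B. \<forall>n. (\<Sum>i<n. V i \<omega>) \<le> B * real n" by blast
  qed
qed

text \<open>The measures \<open>G i\<close> play the role of sub-sigma-algebras of \<open>M\<close>.
  Independence is known for these and passes to whatever is measurable with respect to them, because
  preimages stay inside \<open>G i\<close>.\<close>

lemma (in prob_space) indep_vars_of_subalgebras:
  assumes indep: "indep_sets (\<lambda>i. sets (G i)) I"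
    and sp: "\<And>i. i \<in> I \<Longrightarrow> space (G i) = space M"
    and Y: "\<And>i. i \<in> I \<Longrightarrow> Y i \<in> measurable (G i) (N i)"
  shows "indep_vars N Y I"
  unfolding indep_vars_def2
proof (intro conjI ballI)
  fix i assume i: "i \<in> I"
  have "sets (G i) \<subseteq> events" using indep i by (auto simp: indep_sets_def)
  then show "random_variable (N i) (Y i)"
    using Y[OF i] sp[OF i] by (auto simp: measurable_def)
next
  show "indep_sets (\<lambda>i. {Y i -` A \<inter> space M |A. A \<in> sets (N i)}) I"
  proof (rule indep_sets_mono_sets[OF indep])
    fix i assume i: "i \<in> I"
    show "{Y i -` A \<inter> space M |A. A \<in> sets (N i)} \<subseteq> sets (G i)"
      using measurable_sets[OF Y[OF i]] sp[OF i] by auto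
  qed
qed

section \<open>Exponential moments and a Chernoff bound\<close>

lemma exp_le_quadratic:
  fixes z :: real assumes "\<bar>z\<bar> \<le> 1" shows "exp z \<le> 1 + z + z\<^sup>2"
proof (cases "0 \<le> z")
  case True then show ?thesis using exp_bound[of z] assms by auto
next
  case False
  define x where "x = - z"
  have x: "0 \<le> x" "x \<le> 1" using False assms unfolding x_def by auto
  \<comment> \<open>The Taylor bound \<open>1 + x + x\<^sup>2 / 2 \<le> exp x\<close> reduces the
    claim for \<open>exp (- x)\<close> to this polynomial inequality.\<close>
  have "1 \<le> (1 - x + x\<^sup>2) * (1 + x + x\<^sup>2 / 2)"
  proof -
    have "(1 - x + x\<^sup>2) * (1 + x + x\<^sup>2 / 2) - 1 = x\<^sup>2 * (1/2 + x / 2 + x\<^sup>2 / 2)"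
      by (simp add: field_simps power2_eq_square)
    also have "\<dots> \<ge> 0" using x by simp
    finally show ?thesis by simp
  qed
  also have "\<dots> \<le> (1 - x + x\<^sup>2) * exp x"
  proof (rule mult_left_mono)
    show "1 + x + x\<^sup>2 / 2 \<le> exp x" using exp_lower_Taylor_quadratic x by auto
    have "0 \<le> (x - 1)\<^sup>2 + x" using x by simp
    then show "0 \<le> 1 - x + x\<^sup>2" by (simp add: power2_diff)
  qed
  finally have "exp (- x) \<le> 1 - x + x\<^sup>2"
    by (simp add: exp_minus field_simps)
  then show ?thesis unfolding x_def by simp
qed

text \<open>Markov's inequality for the exponential of the centred sum. By the quadratic bound on
  \<open>exp\<close> each factor is at most 1 plus \<open>s\<^sup>2\<close> times the variance, the
  linear term integrating to 0. The sign of \<open>s\<close> is free, so both tails follow from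
  it.\<close>

lemma (in prob_space) exp_moment_sum_le:
  fixes Y :: "'i \<Rightarrow> 'a \<Rightarrow> real"
  assumes fin: "finite I" and indep: "indep_vars (\<lambda>_. borel) Y I"
    and bd: "\<And>i \<omega>. i \<in> I \<Longrightarrow> \<bar>s * (Y i \<omega> - expectation (Y i))\<bar> \<le> 1"
    and sq: "\<And>i. i \<in> I \<Longrightarrow> integrable M (\<lambda>\<omega>. (Y i \<omega>)\<^sup>2)"
  shows "prob {\<omega>\<in>space M. t \<le> s * (\<Sum>i\<in>I. Y i \<omega> - expectation (Y i))}
           \<le> exp (- t + s\<^sup>2 * (\<Sum>i\<in>I. expectation (\<lambda>\<omega>. (Y i \<omega>)\<^sup>2)))"
proof -
  have rv[measurable]: "random_variable borel (Y i)" if "i \<in> I" for i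
    using indep that by (auto simp: indep_vars_def)
  have int: "integrable M (Y i)" if "i \<in> I" for i
    using integrable_of_square[OF rv sq] that by auto
  let ?e = "\<lambda>i \<omega>. exp (s * (Y i \<omega> - expectation (Y i)))"
  have ind: "indep_vars (\<lambda>_. borel) ?e I"
    by (rule indep_vars_compose2[OF indep, where Y = "\<lambda>i y. exp (s * (y - expectation (Y i)))"]) auto
  have int_e: "integrable M (?e i)" if "i \<in> I" for i
  proof (rule integrable_const_bound[where B = "exp 1"])
    show "AE \<omega> in M. norm (?e i \<omega>) \<le> exp 1" using bd[OF that] by (auto simp: abs_le_iff)
    show "?e i \<in> borel_measurable M" using rv[OF that] by measurable
  qed
  have "expectation (?e i) \<le> exp (s\<^sup>2 * expectation (\<lambda>\<omega>. (Y i \<omega>)\<^sup>2))" if i: "i \<in> I" for i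
  proof -
    have int_c: "integrable M (\<lambda>\<omega>. (Y i \<omega> - expectation (Y i))\<^sup>2)"
      using int[OF i] sq[OF i] by (simp add: power2_diff)
    have "expectation (?e i) \<le> expectation (\<lambda>\<omega>. 1 + s * (Y i \<omega> - expectation (Y i)) + s\<^sup>2 * (Y i \<omega> - expectation (Y i))\<^sup>2)"
    proof (rule integral_mono)
      show "integrable M (\<lambda>\<omega>. 1 + s * (Y i \<omega> - expectation (Y i)) + s\<^sup>2 * (Y i \<omega> - expectation (Y i))\<^sup>2)"
        using int[OF i] int_c by auto
      show "?e i \<omega> \<le> 1 + s * (Y i \<omega> - expectation (Y i)) + s\<^sup>2 * (Y i \<omega> - expectation (Y i))\<^sup>2" for \<omega>
        using exp_le_quadratic[OF bd[OF i, of \<omega>]] by (simp add: power_mult_distrib)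
    qed (rule int_e[OF i])
    also have "\<dots> = 1 + s\<^sup>2 * variance (Y i)"
      using int[OF i] int_c by (simp add: prob_space)
    also have "\<dots> \<le> 1 + s\<^sup>2 * expectation (\<lambda>\<omega>. (Y i \<omega>)\<^sup>2)"
      using variance_eq[OF int[OF i] sq[OF i]] by (simp add: mult_left_mono)
    also have "\<dots> \<le> exp (s\<^sup>2 * expectation (\<lambda>\<omega>. (Y i \<omega>)\<^sup>2))"
      by simp
    finally show ?thesis .
  qed
  then have prod: "(\<Prod>i\<in>I. expectation (?e i)) \<le> exp (s\<^sup>2 * (\<Sum>i\<in>I. expectation (\<lambda>\<omega>. (Y i \<omega>)\<^sup>2)))"
    unfolding sum_distrib_left exp_sum[OF fin] by (intro prod_mono) auto
  let ?E = "\<lambda>\<omega>. \<Prod>i\<in>I. ?e i \<omega>"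
  have E: "?E \<omega> = exp (s * (\<Sum>i\<in>I. Y i \<omega> - expectation (Y i)))" for \<omega>
    by (simp add: exp_sum[OF fin] sum_distrib_left)
  have int_E: "integrable M ?E" by (rule indep_vars_integrable[OF fin ind int_e])
  have "{\<omega>\<in>space M. t \<le> s * (\<Sum>i\<in>I. Y i \<omega> - expectation (Y i))} = {\<omega>\<in>space M. exp t \<le> ?E \<omega>}"
    unfolding E by simp
  also have "prob \<dots> \<le> expectation ?E / exp t"
    using int_E by (intro integral_Markov_inequality_measure[where A = "{}"]) (auto intro!: AE_I2 prod_nonneg)
  also have "expectation ?E = (\<Prod>i\<in>I. expectation (?e i))"
    by (rule indep_vars_lebesgue_integral[OF fin ind int_e])
  also have "(\<Prod>i\<in>I. expectation (?e i)) / exp t \<le> exp (s\<^sup>2 * (\<Sum>i\<in>I. expectation (\<lambda>\<omega>. (Y i \<omega>)\<^sup>2))) / exp t"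
    using prod by (intro divide_right_mono) auto
  also have "\<dots> = exp (- t + s\<^sup>2 * (\<Sum>i\<in>I. expectation (\<lambda>\<omega>. (Y i \<omega>)\<^sup>2)))"
    by (simp add: exp_diff[symmetric])
  finally show ?thesis .
qed

text \<open>Both tails with slopes \<open>1 / Q\<close> and \<open>- 1 / Q\<close>, the largest
  allowed: \<open>Y i\<close> and its mean lie in the same interval of length \<open>Q\<close>, so
  the exponents are bounded by 1 in modulus.\<close>

lemma (in prob_space) Chernoff_bounded_sum:
  fixes Y :: "'i \<Rightarrow> 'a \<Rightarrow> real"
  assumes fin: "finite I" and indep: "indep_vars (\<lambda>_. borel) Y I"
    and bd: "\<And>i \<omega>. i \<in> I \<Longrightarrow> 0 \<le> Y i \<omega> \<and> Y i \<omega> \<le> Q" and Q: "0 < Q"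
  shows "prob {\<omega>\<in>space M. t \<le> \<bar>\<Sum>i\<in>I. Y i \<omega> - expectation (Y i)\<bar>}
           \<le> 2 * exp (- t / Q + (\<Sum>i\<in>I. expectation (\<lambda>\<omega>. (Y i \<omega>)\<^sup>2)) / Q\<^sup>2)"
proof -
  have rv[measurable]: "random_variable borel (Y i)" if "i \<in> I" for i
    using indep that by (auto simp: indep_vars_def)
  have int: "integrable M (Y i)" if "i \<in> I" for i
    using bd[OF that] by (intro integrable_const_bound[where B = Q] rv that) auto
  have sq: "integrable M (\<lambda>\<omega>. (Y i \<omega>)\<^sup>2)" if "i \<in> I" for i
    using bd[OF that] rv[OF that]
    by (intro integrable_const_bound[where B = "Q\<^sup>2"]) (auto intro!: AE_I2 power_mono)
  have e: "0 \<le> expectation (Y i)" "expectation (Y i) \<le> Q" if "i \<in> I" for i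
  proof -
    show "0 \<le> expectation (Y i)" using bd[OF that] by (intro integral_nonneg_AE) auto
    have "expectation (Y i) \<le> expectation (\<lambda>_. Q)" using bd[OF that] int[OF that] by (intro integral_mono) auto
    then show "expectation (Y i) \<le> Q" by (simp add: prob_space)
  qed
  have abs: "\<bar>s * (Y i \<omega> - expectation (Y i))\<bar> \<le> 1" if "i \<in> I" "\<bar>s\<bar> = 1 / Q" for i \<omega> s
  proof -
    have "\<bar>Y i \<omega> - expectation (Y i)\<bar> \<le> Q" using bd[OF that(1), of \<omega>] e[OF that(1)] by linarith
    then have "\<bar>s\<bar> * \<bar>Y i \<omega> - expectation (Y i)\<bar> \<le> (1 / Q) * Q" unfolding that(2) using Q by (intro mult_left_mono) auto
    then show ?thesis using Q by (simp add: abs_mult)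
  qed
  let ?S = "\<lambda>\<omega>. \<Sum>i\<in>I. Y i \<omega> - expectation (Y i)"
  let ?b = "exp (- t / Q + (\<Sum>i\<in>I. expectation (\<lambda>\<omega>. (Y i \<omega>)\<^sup>2)) / Q\<^sup>2)"
  have one: "prob {\<omega>\<in>space M. t / Q \<le> s * ?S \<omega>} \<le> ?b" if "\<bar>s\<bar> = 1 / Q" for s
  proof -
    have "s\<^sup>2 = 1 / Q\<^sup>2" using that by (metis power2_abs power_one_over)
    then show ?thesis using exp_moment_sum_le[OF fin indep abs sq, of s "t / Q"] that by simp
  qed
  have [measurable]: "?S \<in> borel_measurable M" using rv by (intro borel_measurable_sum borel_measurable_diff) auto
  have "{\<omega>\<in>space M. t \<le> \<bar>?S \<omega>\<bar>} \<subseteq> {\<omega>\<in>space M. t / Q \<le> (1 / Q) * ?S \<omega>} \<union> {\<omega>\<in>space M. t / Q \<le> (- 1 / Q) * ?S \<omega>}"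
    using Q by (auto simp: divide_simps)
  then have "prob {\<omega>\<in>space M. t \<le> \<bar>?S \<omega>\<bar>} \<le> prob ({\<omega>\<in>space M. t / Q \<le> (1 / Q) * ?S \<omega>} \<union> {\<omega>\<in>space M. t / Q \<le> (- 1 / Q) * ?S \<omega>})"
    by (intro finite_measure_mono) auto
  also have "\<dots> \<le> prob {\<omega>\<in>space M. t / Q \<le> (1 / Q) * ?S \<omega>} + prob {\<omega>\<in>space M. t / Q \<le> (- 1 / Q) * ?S \<omega>}"
    by (rule measure_Un_le) measurable
  also have "\<dots> \<le> ?b + ?b" using Q by (intro add_mono one) auto
  finally show ?thesis by simp
qed

text \<open>Raised to the power \<open>l / 2\<close>, the hypothesis reads
  \<open>r powr (l / 2 - 1) \<le> b powr (l / 2)\<close>, and the product in the conclusion equals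
  the quotient of these two. This is where the exponent \<open>1 - 2 / l\<close> of the bandwidth
  conditions comes from.\<close>

lemma truncation_scale:
  fixes b r l :: real
  assumes b: "0 < b" and r: "0 < r" and l: "2 < l" and small: "inverse b * r powr (1 - 2 / l) \<le> 1"
  shows "1 \<le> sqrt (b * r) * sqrt (b / r) powr (l - 1)"
proof -
  have "r powr (1 - 2 / l) \<le> b" using small b by (simp add: field_simps)
  then have "(r powr (1 - 2 / l)) powr (l / 2) \<le> b powr (l / 2)"
    using l by (intro powr_mono2) auto
  then have *: "r powr (l / 2 - 1) \<le> b powr (l / 2)"
  proof -
    have "(1 - 2 / l) * (l / 2) = l / 2 - 1" using l by (simp add: field_simps)
    then show ?thesis using \<open>(r powr (1 - 2 / l)) powr (l / 2) \<le> b powr (l / 2)\<close> by (simp only: powr_powr)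
  qed
  have "sqrt (b * r) * sqrt (b / r) powr (l - 1) = (b * r) powr (1/2) * (b / r) powr ((l - 1) / 2)"
    using b r by (simp add: powr_half_sqrt[symmetric] powr_powr)
  also have "\<dots> = (b powr (1/2) * b powr ((l - 1) / 2)) * (r powr (1/2) * r powr (- ((l - 1) / 2)))"
    using b r by (simp add: powr_mult powr_divide powr_minus field_simps)
  also have "\<dots> = b powr (l / 2) * r powr (1 - l / 2)"
    by (simp add: powr_add[symmetric] diff_divide_distrib)
  also have "\<dots> = b powr (l / 2) / r powr (l / 2 - 1)"
    using powr_minus_divide[of r "l / 2 - 1"] by simp
  finally show ?thesis using * r by simp
qed

text \<open>
  Truncation at \<open>V i \<le> Q powr l\<close> with \<open>Q = sqrt (\<beta> / \<rho>)\<close>, where \<open>\<rho> = ln n / n\<close>: the exponent in the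
  Chernoff bound is then a multiple of \<open>ln n\<close>, and the discarded part is at most \<open>sqrt (\<beta> \<rho>)\<close> times
  the average of the \<open>V i\<close>.
\<close>

lemma (in prob_space) AE_deviation_finite_classes:
  fixes D :: "nat \<Rightarrow> nat \<Rightarrow> 't \<Rightarrow> 'a \<Rightarrow> real" and V :: "nat \<Rightarrow> 'a \<Rightarrow> real"
    and \<Theta> :: "nat \<Rightarrow> 't set" and \<beta> :: "nat \<Rightarrow> real" and G :: "nat \<Rightarrow> 'a measure"
  assumes indep: "indep_sets (\<lambda>i. sets (G i)) UNIV" and spG: "\<And>i. space (G i) = space M"
    and D_meas: "\<And>n i \<theta>. D n i \<theta> \<in> borel_measurable (G i)"
    and V_meas: "\<And>i. V i \<in> borel_measurable (G i)"
    and D_nonneg: "\<And>n i \<theta> \<omega>. 0 \<le> D n i \<theta> \<omega>"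
    and dom: "AE \<omega> in M. \<forall>n. \<forall>i<n. \<forall>\<theta>\<in>\<Theta> n. D n i \<theta> \<omega> powr l \<le> V i \<omega>"
    and V_int: "\<And>i. integrable M (V i)" and V_mean: "\<And>i. expectation (V i) \<le> v"
    and V_avg: "AE \<omega> in M. \<exists>B. \<forall>n. (\<Sum>i<n. V i \<omega>) \<le> B * real n"
    and fin: "\<And>n. finite (\<Theta> n)" and card: "\<And>n. real (card (\<Theta> n)) \<le> c * real n ^ p"
    and D_int: "\<And>n i \<theta>. i < n \<Longrightarrow> \<theta> \<in> \<Theta> n \<Longrightarrow> integrable M (\<lambda>\<omega>. (D n i \<theta> \<omega>)\<^sup>2)"
    and second: "\<forall>\<^sub>F n in sequentially. \<forall>\<theta>\<in>\<Theta> n. (\<Sum>i<n. expectation (\<lambda>\<omega>. (D n i \<theta> \<omega>)\<^sup>2)) \<le> C * real n * \<beta> n"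
    and \<beta>_pos: "\<forall>\<^sub>F n in sequentially. 0 < \<beta> n"
    and l: "2 < l" and rate: "(\<lambda>n. inverse (\<beta> n) * (ln (real n) / real n) powr (1 - 2 / l)) \<longlonglongrightarrow> 0"
  shows "AE \<omega> in M. \<exists>B. \<forall>\<^sub>F n in sequentially. \<forall>\<theta>\<in>\<Theta> n.
           \<bar>(\<Sum>i<n. D n i \<theta> \<omega> - expectation (D n i \<theta>)) / real n\<bar> \<le> B * sqrt (\<beta> n * (ln (real n) / real n))"
proof -
  have ev: "sets (G i) \<subseteq> events" for i using indep by (auto simp: indep_sets_def)
  have sub: "f \<in> borel_measurable M" if "f \<in> borel_measurable (G i)" for f :: "'a \<Rightarrow> real" and i
    using that spG[of i] ev[of i] by (auto simp: measurable_def)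
  note [measurable] = sub[OF D_meas] sub[OF V_meas]
  define \<rho> where "\<rho> n = ln (real n) / real n" for n
  define Q where "Q n = sqrt (\<beta> n / \<rho> n)" for n
  define a where "a n = sqrt (\<beta> n * \<rho> n)" for n
  \<comment> \<open>Domination of \<open>D\<close> by the envelope \<open>V\<close> holds almost
    surely only, whereas the Chernoff bound asks for a bound at every outcome; hence the second
    condition \<open>D n i \<theta> \<omega> \<le> Q n\<close>.\<close>
  define Tr where "Tr n i \<theta> \<omega> = (if V i \<omega> \<le> Q n powr l \<and> D n i \<theta> \<omega> \<le> Q n then D n i \<theta> \<omega> else 0)" for n i \<theta> \<omega>
  have Tr_meas: "Tr n i \<theta> \<in> borel_measurable (G i)" for n i \<theta>
    unfolding Tr_def using D_meas[measurable] V_meas[measurable] by measurable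
  note [measurable] = sub[OF Tr_meas]
  \<comment> \<open>\<open>C\<close> cancels the variance term of the exponent, \<open>p\<close>
    pays for the union over the at most \<open>c * real n ^ p\<close> elements of the class, and 2
    leaves a summable probability.\<close>
  define Bc where "Bc = C + real p + 2"
  define good where "good n \<longleftrightarrow> 3 \<le> n \<and> 0 < \<beta> n \<and> inverse (\<beta> n) * \<rho> n powr (1 - 2 / l) \<le> 1 \<and>
     (\<forall>\<theta>\<in>\<Theta> n. (\<Sum>i<n. expectation (\<lambda>\<omega>. (D n i \<theta> \<omega>)\<^sup>2)) \<le> C * real n * \<beta> n)" for n
  have "\<forall>\<^sub>F n in sequentially. inverse (\<beta> n) * \<rho> n powr (1 - 2 / l) < 1"
    using order_tendstoD(2)[OF rate, of 1] unfolding \<rho>_def by simp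
  with second \<beta>_pos eventually_ge_at_top[of 3] have ev_good: "\<forall>\<^sub>F n in sequentially. good n"
    unfolding good_def by eventually_elim auto
  have gd: "0 < \<rho> n" "0 < Q n" "0 < a n" "1 \<le> a n * Q n powr (l - 1)" if "good n" for n
  proof -
    show r: "0 < \<rho> n" using that unfolding \<rho>_def good_def by auto
    then show "0 < Q n" "0 < a n" using that unfolding Q_def a_def good_def by auto
    show "1 \<le> a n * Q n powr (l - 1)"
      unfolding Q_def a_def using that l r by (intro truncation_scale) (auto simp: good_def)
  qed
  have Tr_bd: "0 \<le> Tr n i \<theta> \<omega> \<and> Tr n i \<theta> \<omega> \<le> Q n" if "good n" for n i \<theta> \<omega>
    using D_nonneg[of n i \<theta> \<omega>] gd[OF that] unfolding Tr_def by auto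
  have Tr_le: "Tr n i \<theta> \<omega> \<le> D n i \<theta> \<omega>" for n i \<theta> \<omega>
    using D_nonneg[of n i \<theta> \<omega>] unfolding Tr_def by auto
  \<comment> \<open>On the discarded part \<open>Q n powr (l - 1) * D \<le> V\<close>: if
    \<open>D \<le> Q n\<close>, because then \<open>V\<close> exceeds \<open>Q n powr l\<close>, and
    otherwise because \<open>D powr l \<le> V\<close>. The factor \<open>a n\<close> then comes from
    \<open>1 \<le> a n * Q n powr (l - 1)\<close>.\<close>
  have rem: "D n i \<theta> \<omega> - Tr n i \<theta> \<omega> \<le> a n * V i \<omega>"
    if g: "good n" and d: "D n i \<theta> \<omega> powr l \<le> V i \<omega>" for n i \<theta> \<omega>
  proof (cases "V i \<omega> \<le> Q n powr l \<and> D n i \<theta> \<omega> \<le> Q n")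
    case True
    have "0 \<le> V i \<omega>" using d powr_ge_zero[of "D n i \<theta> \<omega>" l] by linarith
    then show ?thesis using True gd[OF g] unfolding Tr_def by auto
  next
    case False
    have Dn: "0 \<le> D n i \<theta> \<omega>" by (rule D_nonneg)
    have "Q n powr (l - 1) * D n i \<theta> \<omega> \<le> V i \<omega>"
    proof (cases "D n i \<theta> \<omega> \<le> Q n")
      case True
      then have "Q n powr l < V i \<omega>" using False by auto
      moreover have "Q n powr (l - 1) * D n i \<theta> \<omega> \<le> Q n powr (l - 1) * Q n"
        using True by (intro mult_left_mono) auto
      moreover have "Q n powr (l - 1) * Q n = Q n powr l"
        using gd(2)[OF g] by (simp add: powr_diff)
      ultimately show ?thesis by linarith
    next
      case f: False
      then have pos: "0 < D n i \<theta> \<omega>" using gd(2)[OF g] by linarith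
      have "Q n powr (l - 1) * D n i \<theta> \<omega> \<le> D n i \<theta> \<omega> powr (l - 1) * D n i \<theta> \<omega>"
        using f gd(2)[OF g] l Dn by (intro mult_right_mono powr_mono2) auto
      also have "\<dots> = D n i \<theta> \<omega> powr l" using pos by (simp add: powr_diff)
      finally show ?thesis using d by linarith
    qed
    then have "a n * (Q n powr (l - 1) * D n i \<theta> \<omega>) \<le> a n * V i \<omega>"
      using gd(3)[OF g] by (intro mult_left_mono) auto
    moreover have "1 * D n i \<theta> \<omega> \<le> (a n * Q n powr (l - 1)) * D n i \<theta> \<omega>"
      using gd(4)[OF g] Dn by (intro mult_right_mono) auto
    ultimately show ?thesis using False unfolding Tr_def by (auto simp: mult_ac)
  qed
  have D_int1: "integrable M (D n i \<theta>)" if "i < n" "\<theta> \<in> \<Theta> n" for n i \<theta>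
    by (rule integrable_of_square[OF _ D_int[OF that]]) measurable
  have Tr_int: "integrable M (Tr n i \<theta>)" and Tr_sq: "integrable M (\<lambda>\<omega>. (Tr n i \<theta> \<omega>)\<^sup>2)" if "good n" for n i \<theta>
    using Tr_bd[OF that] power_mono[of "Tr n i \<theta> _" "Q n" 2]
    by (auto intro!: integrable_const_bound[where B = "Q n"] integrable_const_bound[where B = "(Q n)\<^sup>2" and f = "\<lambda>\<omega>. (Tr n i \<theta> \<omega>)\<^sup>2"] AE_I2)
  define A where "A n = (if good n then (\<Union>\<theta>\<in>\<Theta> n. {\<omega>\<in>space M. real n * Bc * a n \<le> \<bar>\<Sum>i<n. Tr n i \<theta> \<omega> - expectation (Tr n i \<theta>)\<bar>}) else {})" for n
  have A_meas: "A n \<in> events" for n unfolding A_def using fin[of n] by (auto intro!: sets.finite_UN)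
  have prob_A: "prob (A n) \<le> 2 * c * (1 / real n ^ 2)" for n
  proof (cases "good n")
    case False
    have "0 \<le> c * real n ^ p" using card[of n] by (meson of_nat_0_le_iff order_trans)
    moreover have "0 \<le> c" using card[of 1] by (auto intro: order_trans[OF of_nat_0_le_iff])
    ultimately show ?thesis using False unfolding A_def by simp
  next
    case g: True
    have n: "3 \<le> n" using g by (simp add: good_def)
    have b: "0 < \<beta> n" using g by (simp add: good_def)
    have each: "prob {\<omega>\<in>space M. real n * Bc * a n \<le> \<bar>\<Sum>i<n. Tr n i \<theta> \<omega> - expectation (Tr n i \<theta>)\<bar>} \<le> 2 / real n ^ (p + 2)"
      if th: "\<theta> \<in> \<Theta> n" for \<theta>
    proof -
      have ind: "indep_vars (\<lambda>_. borel) (\<lambda>i. Tr n i \<theta>) {..<n}"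
        by (rule indep_vars_of_subalgebras[OF indep_sets_mono_index[OF _ indep]]) (auto simp: spG Tr_meas)
      have "(\<Sum>i<n. expectation (\<lambda>\<omega>. (Tr n i \<theta> \<omega>)\<^sup>2)) \<le> (\<Sum>i<n. expectation (\<lambda>\<omega>. (D n i \<theta> \<omega>)\<^sup>2))"
        using Tr_bd[OF g] Tr_le Tr_sq[OF g] D_int th by (intro sum_mono integral_mono power_mono) auto
      also have "\<dots> \<le> C * real n * \<beta> n" using g th by (auto simp: good_def)
      finally have "(\<Sum>i<n. expectation (\<lambda>\<omega>. (Tr n i \<theta> \<omega>)\<^sup>2)) / (Q n)\<^sup>2 \<le> C * real n * \<beta> n / (Q n)\<^sup>2"
        by (intro divide_right_mono) auto
      also have "\<dots> = C * ln (real n)"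
        using gd(1)[OF g] b n unfolding Q_def by (simp add: \<rho>_def field_simps)
      finally have 1: "(\<Sum>i<n. expectation (\<lambda>\<omega>. (Tr n i \<theta> \<omega>)\<^sup>2)) / (Q n)\<^sup>2 \<le> C * ln (real n)" .
      have "a n / Q n = \<rho> n"
        using gd(1)[OF g] b unfolding a_def Q_def by (simp add: real_sqrt_divide[symmetric] power2_eq_square[symmetric] flip: real_sqrt_mult)
      then have 2: "real n * Bc * a n / Q n = Bc * ln (real n)"
        using n unfolding times_divide_eq_right[symmetric] by (simp add: \<rho>_def)
      have "prob {\<omega>\<in>space M. real n * Bc * a n \<le> \<bar>\<Sum>i<n. Tr n i \<theta> \<omega> - expectation (Tr n i \<theta>)\<bar>}
          \<le> 2 * exp (- (real n * Bc * a n) / Q n + (\<Sum>i<n. expectation (\<lambda>\<omega>. (Tr n i \<theta> \<omega>)\<^sup>2)) / (Q n)\<^sup>2)"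
        using Tr_bd[OF g] gd(2)[OF g] by (intro Chernoff_bounded_sum ind) auto
      also have "\<dots> \<le> 2 * exp (- (real (p + 2) * ln (real n)))"
      proof -
        have "Bc * ln (real n) = C * ln (real n) + real (p + 2) * ln (real n)" by (simp add: Bc_def algebra_simps)
        then show ?thesis using 1 2 by simp
      qed
      also have "exp (- (real (p + 2) * ln (real n))) = 1 / real n ^ (p + 2)"
        using n by (simp only: exp_minus exp_of_nat_mult) (simp add: inverse_eq_divide)
      finally show ?thesis by simp
    qed
    have "prob (A n) \<le> (\<Sum>\<theta>\<in>\<Theta> n. prob {\<omega>\<in>space M. real n * Bc * a n \<le> \<bar>\<Sum>i<n. Tr n i \<theta> \<omega> - expectation (Tr n i \<theta>)\<bar>})"
      unfolding A_def using g by (auto intro!: finite_measure_subadditive_finite fin)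
    also have "\<dots> \<le> (\<Sum>\<theta>\<in>\<Theta> n. 2 / real n ^ (p + 2))" by (intro sum_mono each)
    also have "\<dots> = real (card (\<Theta> n)) * (2 / real n ^ (p + 2))" by simp
    also have "\<dots> \<le> c * real n ^ p * (2 / real n ^ (p + 2))" by (intro mult_right_mono card) auto
    also have "\<dots> = 2 * c * (1 / real n ^ 2)" using n by (simp add: power_add field_simps power2_eq_square)
    finally show ?thesis .
  qed
  have "summable (\<lambda>n. prob (A n))"
    by (rule summable_comparison_test'[OF summable_mult[OF inverse_power_summable[of 2, where 'a = real], of "2 * c"], of 0])
      (use prob_A in \<open>auto simp: inverse_eq_divide\<close>)
  then have "AE \<omega> in M. \<forall>\<^sub>F n in sequentially. \<omega> \<in> space M - A n"
    by (intro borel_cantelli_AE1 A_meas) (auto simp: less_top[symmetric])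
  with dom V_avg show ?thesis
  proof eventually_elim
    fix \<omega> assume d: "\<forall>n. \<forall>i<n. \<forall>\<theta>\<in>\<Theta> n. D n i \<theta> \<omega> powr l \<le> V i \<omega>"
      and "\<exists>B. \<forall>n. (\<Sum>i<n. V i \<omega>) \<le> B * real n" and notA: "\<forall>\<^sub>F n in sequentially. \<omega> \<in> space M - A n"
    then obtain B where B: "\<And>n. (\<Sum>i<n. V i \<omega>) \<le> B * real n" by auto
    have "\<forall>\<^sub>F n in sequentially. \<forall>\<theta>\<in>\<Theta> n. \<bar>(\<Sum>i<n. D n i \<theta> \<omega> - expectation (D n i \<theta>)) / real n\<bar> \<le> (B + v + Bc) * a n"
      using notA ev_good
    proof eventually_elim
      fix n assume w: "\<omega> \<in> space M - A n" and g: "good n"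
      have n: "0 < real n" using g by (simp add: good_def)
      show "\<forall>\<theta>\<in>\<Theta> n. \<bar>(\<Sum>i<n. D n i \<theta> \<omega> - expectation (D n i \<theta>)) / real n\<bar> \<le> (B + v + Bc) * a n"
      proof
        fix \<theta> assume th: "\<theta> \<in> \<Theta> n"
        have 1: "\<bar>\<Sum>i<n. Tr n i \<theta> \<omega> - expectation (Tr n i \<theta>)\<bar> \<le> real n * Bc * a n"
          using w g th unfolding A_def by force
        have 2: "0 \<le> (\<Sum>i<n. D n i \<theta> \<omega> - Tr n i \<theta> \<omega>)" using Tr_le by (intro sum_nonneg) auto
        have "(\<Sum>i<n. D n i \<theta> \<omega> - Tr n i \<theta> \<omega>) \<le> (\<Sum>i<n. a n * V i \<omega>)"
          using d th by (intro sum_mono rem g) auto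
        also have "\<dots> \<le> a n * (B * real n)"
          unfolding sum_distrib_left[symmetric] using B gd(3)[OF g] by (intro mult_left_mono) auto
        finally have 3: "(\<Sum>i<n. D n i \<theta> \<omega> - Tr n i \<theta> \<omega>) \<le> a n * (B * real n)" .
        have 4: "0 \<le> (\<Sum>i<n. expectation (D n i \<theta>) - expectation (Tr n i \<theta>))"
          using Tr_le D_int1 th Tr_int[OF g] by (intro sum_nonneg) (auto intro!: integral_mono)
        have "(\<Sum>i<n. expectation (D n i \<theta>) - expectation (Tr n i \<theta>)) \<le> (\<Sum>i<n. a n * v)"
        proof (rule sum_mono)
          fix i assume "i \<in> {..<n}"
          then have i: "i < n" by simp
          have "expectation (D n i \<theta>) - expectation (Tr n i \<theta>) = expectation (\<lambda>\<omega>. D n i \<theta> \<omega> - Tr n i \<theta> \<omega>)"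
            using D_int1[OF i th] Tr_int[OF g] by simp
          also have "\<dots> \<le> expectation (\<lambda>\<omega>. a n * V i \<omega>)"
          proof (rule integral_mono_AE)
            show "AE \<omega> in M. D n i \<theta> \<omega> - Tr n i \<theta> \<omega> \<le> a n * V i \<omega>"
              using dom by eventually_elim (use i th rem[OF g] in auto)
          qed (use D_int1[OF i th] Tr_int[OF g] V_int in auto)
          also have "\<dots> \<le> a n * v" using V_mean[of i] gd(3)[OF g] by simp
          finally show "expectation (D n i \<theta>) - expectation (Tr n i \<theta>) \<le> a n * v" .
        qed
        then have 5: "(\<Sum>i<n. expectation (D n i \<theta>) - expectation (Tr n i \<theta>)) \<le> a n * (v * real n)"
          by (simp add: mult_ac)
        \<comment> \<open>Truncated deviation plus discarded part minus expected discarded part. The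
          last two are nonnegative and at most \<open>a n\<close> times a sum of envelopes or of
          their means.\<close>
        have "(\<Sum>i<n. D n i \<theta> \<omega> - expectation (D n i \<theta>)) = (\<Sum>i<n. Tr n i \<theta> \<omega> - expectation (Tr n i \<theta>))
            + (\<Sum>i<n. D n i \<theta> \<omega> - Tr n i \<theta> \<omega>) - (\<Sum>i<n. expectation (D n i \<theta>) - expectation (Tr n i \<theta>))"
          by (simp add: sum_subtractf)
        then have "\<bar>\<Sum>i<n. D n i \<theta> \<omega> - expectation (D n i \<theta>)\<bar> \<le> real n * Bc * a n + a n * (B * real n) + a n * (v * real n)"
          using 1 2 3 4 5 by linarith
        then show "\<bar>(\<Sum>i<n. D n i \<theta> \<omega> - expectation (D n i \<theta>)) / real n\<bar> \<le> (B + v + Bc) * a n"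
          using n by (simp add: abs_divide divide_simps algebra_simps)
      qed
    qed
    then show "\<exists>B. \<forall>\<^sub>F n in sequentially. \<forall>\<theta>\<in>\<Theta> n.
           \<bar>(\<Sum>i<n. D n i \<theta> \<omega> - expectation (D n i \<theta>)) / real n\<bar> \<le> B * sqrt (\<beta> n * (ln (real n) / real n))"
      unfolding a_def \<rho>_def by blast
  qed
qed

subsection \<open>Envelopes for running means\<close>

text \<open>Jensen's inequality is applied to the positive numbers
  \<open>x j + 1 / real (Suc n)\<close>; entries equal to 0 are reached in the limit.\<close>

lemma powr_mean_le:
  fixes x :: "nat \<Rightarrow> real" and q :: real
  assumes q: "1 \<le> q" and x: "\<And>j. 0 \<le> x j" and m: "0 < m"
  shows "((\<Sum>j<m. x j) / real m) powr q \<le> (\<Sum>j<m. x j powr q) / real m"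
proof (rule LIMSEQ_le)
  let ?x = "\<lambda>n j. x j + 1 / real (Suc n)"
  have lim: "(\<lambda>n. ?x n j) \<longlonglongrightarrow> x j" for j
    using tendsto_add[OF tendsto_const[of "x j"] LIMSEQ_inverse_real_of_nat] by (simp add: inverse_eq_divide)
  have pos: "0 < ?x n j" for n j using x[of j] by (simp add: add_nonneg_pos)
  show "(\<lambda>n. ((\<Sum>j<m. ?x n j) / real m) powr q) \<longlonglongrightarrow> ((\<Sum>j<m. x j) / real m) powr q"
    using q m less_imp_le[OF pos]
    by (intro tendsto_powr' tendsto_divide tendsto_sum lim) (auto intro!: always_eventually divide_nonneg_nonneg sum_nonneg)
  show "(\<lambda>n. (\<Sum>j<m. ?x n j powr q) / real m) \<longlonglongrightarrow> (\<Sum>j<m. x j powr q) / real m"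
    using q m less_imp_le[OF pos]
    by (intro tendsto_powr' tendsto_divide tendsto_sum lim) (auto intro!: always_eventually)
  have "((\<Sum>j<m. ?x n j) / real m) powr q \<le> (\<Sum>j<m. ?x n j powr q) / real m" for n
  proof -
    have "(\<Sum>j<m. (1 / real m) *\<^sub>R ?x n j) powr q \<le> (\<Sum>j<m. (1 / real m) * ?x n j powr q)"
      using m pos by (intro convex_on_sum[OF _ _ powr_convex[OF q]]) (auto simp: sum_divide_distrib[symmetric])
    then show ?thesis by (simp add: sum_divide_distrib)
  qed
  then show "\<exists>N. \<forall>n\<ge>N. ((\<Sum>j<m. ?x n j) / real m) powr q \<le> (\<Sum>j<m. ?x n j powr q) / real m" by blast
qed

text \<open>
  Dominates \<open>((\<Sum>j<m. \<bar>u j\<bar>) / m) powr p\<close> for all \<open>m > 0\<close> at once. By Jensen it suffices to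
  dominate the squared averages of \<open>\<bar>u j\<bar> powr (p / 2)\<close>, and for these the \<open>L\<^sup>2\<close> bound along
  \<open>m = 2 ^ k\<close> is summable, so that no maximal inequality is needed.
\<close>

definition mean_envelope :: "real \<Rightarrow> real \<Rightarrow> (nat \<Rightarrow> real) \<Rightarrow> real" where
  "mean_envelope p e u = 8 * (e\<^sup>2 + enn2real (\<Sum>k. ennreal (((\<Sum>j<2 ^ k. \<bar>u j\<bar> powr (p / 2)) / 2 ^ k - e)\<^sup>2)))"

lemma mean_envelope_nonneg: "0 \<le> mean_envelope p e u"
  unfolding mean_envelope_def by simp

lemma measurable_mean_envelope[measurable]:
  "mean_envelope p e \<in> borel_measurable (Pi\<^sub>M UNIV (\<lambda>_. borel))"
  unfolding mean_envelope_def by measurable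

text \<open>The next power of two after \<open>m\<close> is at most \<open>2 * m\<close>, so an
  average over \<open>m\<close> terms is at most twice the average over that dyadic block, which is
  \<open>e\<close> plus a deviation controlled by a single term of the series. Squaring gives the
  factor 8. Finiteness is assumed because \<open>enn2real\<close> sends an infinite series to 0,
  which would bound nothing.\<close>

lemma mean_powr_le_envelope:
  assumes p: "2 \<le> p" and m: "0 < m"
    and fin: "(\<Sum>k. ennreal (((\<Sum>j<2 ^ k. \<bar>u j\<bar> powr (p / 2)) / 2 ^ k - e)\<^sup>2)) < \<infinity>"
  shows "((\<Sum>j<m. \<bar>u j\<bar>) / real m) powr p \<le> mean_envelope p e u"
proof -
  let ?g = "\<lambda>j. \<bar>u j\<bar> powr (p / 2)"
  let ?A = "\<lambda>m. (\<Sum>j<m. ?g j) / real m"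
  define s where "s k = ((\<Sum>j<2 ^ k. ?g j) / 2 ^ k - e)\<^sup>2" for k
  define S where "S = enn2real (\<Sum>k. ennreal (s k))"
  have s_le: "s k \<le> S" for k
  proof -
    have "ennreal (s k) \<le> (\<Sum>k. ennreal (s k))" using ennreal_suminf_lessD[of "\<lambda>k. ennreal (s k)"] 
      by (metis linorder_not_less order.irrefl)
    then have "enn2real (ennreal (s k)) \<le> S" unfolding S_def using fin[folded s_def] by (intro enn2real_mono) auto
    moreover have "0 \<le> s k" unfolding s_def by (rule zero_le_power2)
    ultimately show ?thesis by simp
  qed
  have "((\<Sum>j<m. \<bar>u j\<bar>) / real m) powr p = (((\<Sum>j<m. \<bar>u j\<bar>) / real m) powr (p / 2)) powr 2"
    by (simp add: powr_powr)
  also have "\<dots> \<le> (?A m) powr 2"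
    using p m by (intro powr_mono2 powr_mean_le) auto
  also have "\<dots> = (?A m)\<^sup>2" using m by (simp add: powr_numeral sum_nonneg divide_nonneg_nonneg)
  also have "\<dots> \<le> 8 * (e\<^sup>2 + S)"
  proof -
    define k where "k = Discrete_Functions.floor_log m + 1"
    have k: "m \<le> 2 ^ k" "2 ^ k \<le> 2 * m"
      using floor_log_exp2_gt[of m] floor_log_exp2_le[of m] m by (auto simp: k_def)
    have k': "(2::real) ^ k \<le> 2 * real m" using of_nat_mono[OF k(2), where 'a = real] by simp
    have "?A m \<le> (\<Sum>j<2 ^ k. ?g j) / real m"
      using k(1) by (intro divide_right_mono sum_mono2) auto
    also have "\<dots> \<le> (\<Sum>j<2 ^ k. ?g j) / (2 ^ k / 2)"
      using k' m by (intro divide_left_mono) (auto intro: sum_nonneg)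
    finally have "?A m \<le> 2 * ((\<Sum>j<2 ^ k. ?g j) / 2 ^ k)" by (simp add: field_simps)
    then have "(?A m)\<^sup>2 \<le> (2 * ((\<Sum>j<2 ^ k. ?g j) / 2 ^ k))\<^sup>2"
      by (intro power_mono) (auto intro!: sum_nonneg divide_nonneg_nonneg)
    also have "\<dots> = (2 * e + 2 * ((\<Sum>j<2 ^ k. ?g j) / 2 ^ k - e))\<^sup>2" by (simp add: algebra_simps)
    also have "\<dots> \<le> 8 * e\<^sup>2 + 8 * s k"
    proof -
      have "(2 * a + 2 * b)\<^sup>2 \<le> 8 * a\<^sup>2 + 8 * b\<^sup>2" for a b :: real
        using zero_le_power2[of "a - b"] by (simp add: power2_eq_square algebra_simps)
      then show ?thesis unfolding s_def .
    qed
    also have "\<dots> \<le> 8 * (e\<^sup>2 + S)" using s_le[of k] by simp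
    finally show ?thesis .
  qed
  finally show ?thesis unfolding mean_envelope_def S_def s_def .
qed

text \<open>\<open>e\<close> is the common mean of \<open>\<bar>U j\<bar> powr (p / 2)\<close>,
  whose square is \<open>\<bar>U j\<bar> powr p\<close>. The deviation at \<open>2 ^ k\<close> thus
  has expected square at most the \<open>p\<close>-th moment times \<open>(1 / 2) ^ k\<close>, so
  the series has finite expectation; this gives integrability and, almost surely, the finiteness on
  which domination rests.\<close>

lemma (in prob_space) mean_envelope_bounds:
  fixes U :: "nat \<Rightarrow> 'a \<Rightarrow> real"
  assumes indep: "indep_vars (\<lambda>_. borel) U UNIV"
    and same: "\<And>j. distr M borel (U j) = D"
    and p: "2 \<le> p" and int: "\<And>j. integrable M (\<lambda>\<omega>. \<bar>U j \<omega>\<bar> powr p)"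
    and e: "e = (\<integral>x. \<bar>x\<bar> powr (p / 2) \<partial>D)"
  shows "integrable M (\<lambda>\<omega>. mean_envelope p e (\<lambda>j. U j \<omega>))"
    and "AE \<omega> in M. \<forall>m>0. ((\<Sum>j<m. \<bar>U j \<omega>\<bar>) / real m) powr p \<le> mean_envelope p e (\<lambda>j. U j \<omega>)"
proof -
  have rv[measurable]: "random_variable borel (U j)" for j
    using indep by (auto simp: indep_vars_def)
  let ?g = "\<lambda>j \<omega>. \<bar>U j \<omega>\<bar> powr (p / 2)"
  have sq: "(?g j \<omega>)\<^sup>2 = \<bar>U j \<omega>\<bar> powr p" for j \<omega>
    by (simp add: power2_eq_square powr_add[symmetric])
  have int2: "integrable M (\<lambda>\<omega>. (?g j \<omega>)\<^sup>2)" for j unfolding sq by (rule int)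
  have ind: "indep_vars (\<lambda>_. borel) ?g UNIV"
    by (rule indep_vars_compose2[OF indep, where Y = "\<lambda>_ x. \<bar>x\<bar> powr (p / 2)"]) measurable
  have mean: "expectation (?g j) = e" for j
    unfolding e same[of j, symmetric] by (subst integral_distr) auto
  have second: "expectation (\<lambda>\<omega>. (?g j \<omega>)\<^sup>2) = (\<integral>x. \<bar>x\<bar> powr p \<partial>D)" for j
    unfolding sq same[of j, symmetric] by (subst integral_distr) auto
  define e2 where "e2 = (\<integral>x. \<bar>x\<bar> powr p \<partial>D)"
  have e2: "0 \<le> e2" unfolding second[of 0, folded e2_def, symmetric] by simp
  define s where "s k \<omega> = ((\<Sum>j<2 ^ k. ?g j \<omega>) / 2 ^ k - e)\<^sup>2" for k \<omega>
  have [measurable]: "s k \<in> borel_measurable M" for k unfolding s_def by measurable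
  have s_int: "(\<integral>\<^sup>+ \<omega>. ennreal (s k \<omega>) \<partial>M) \<le> ennreal (e2 * (1 / 2) ^ k)" for k
  proof -
    have ind': "indep_vars (\<lambda>_. borel) ?g {..<(2::nat) ^ k}" by (rule indep_vars_subset[OF ind]) auto
    note V = expectation_square_centered_sum[OF _ ind' int2]
    have eq: "s k \<omega> = ((\<Sum>j<2 ^ k. ?g j \<omega>) - (\<Sum>j<(2::nat) ^ k. expectation (?g j)))\<^sup>2 / 4 ^ k" for \<omega>
    proof -
      have "(4::real) ^ k = (2 ^ k)\<^sup>2" by (simp add: power2_eq_square power_mult_distrib[symmetric])
      then show ?thesis unfolding mean s_def by (simp add: power_divide[symmetric] diff_divide_distrib)
    qed
    have "(\<integral>\<^sup>+ \<omega>. ennreal (s k \<omega>) \<partial>M) = ennreal (expectation (s k))"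
      unfolding eq using V(1) by (intro nn_integral_eq_integral) auto
    also have "expectation (s k) \<le> (\<Sum>j<(2::nat) ^ k. e2) / 4 ^ k"
      unfolding eq using V(2) by (simp add: second e2_def divide_right_mono)
    also have "\<dots> = e2 * (1 / 2) ^ k"
      using power_mult_distrib[of "2::real" 2 k] by (simp add: field_simps power_divide)
    finally show ?thesis by (simp add: ennreal_leI)
  qed
  have "(\<integral>\<^sup>+ \<omega>. (\<Sum>k. ennreal (s k \<omega>)) \<partial>M) = (\<Sum>k. \<integral>\<^sup>+ \<omega>. ennreal (s k \<omega>) \<partial>M)"
    by (rule nn_integral_suminf) measurable
  also have "\<dots> \<le> (\<Sum>k. ennreal (e2 * (1 / 2) ^ k))"
    by (intro suminf_le s_int) auto
  also have "\<dots> < \<infinity>"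
  proof -
    have "summable (\<lambda>k. e2 * (1 / 2) ^ k)" by (intro summable_mult summable_geometric) simp
    then have "(\<Sum>k. ennreal (e2 * (1 / 2) ^ k)) = ennreal (\<Sum>k. e2 * (1 / 2) ^ k)"
      using e2 by (intro suminf_ennreal2) auto
    then show ?thesis by (simp only: ennreal_less_top infinity_ennreal_def)
  qed
  finally have fin: "(\<integral>\<^sup>+ \<omega>. (\<Sum>k. ennreal (s k \<omega>)) \<partial>M) < \<infinity>" .
  then have AEfin: "AE \<omega> in M. (\<Sum>k. ennreal (s k \<omega>)) < \<infinity>"
    using nn_integral_noteq_infinite[of "\<lambda>\<omega>. \<Sum>k. ennreal (s k \<omega>)" M] by (auto simp: less_top)
  then show "AE \<omega> in M. \<forall>m>0. ((\<Sum>j<m. \<bar>U j \<omega>\<bar>) / real m) powr p \<le> mean_envelope p e (\<lambda>j. U j \<omega>)"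
    by eventually_elim (use mean_powr_le_envelope[OF p, folded s_def] in \<open>auto simp: s_def\<close>)
  have "integrable M (\<lambda>\<omega>. enn2real (\<Sum>k. ennreal (s k \<omega>)))"
  proof (rule integrableI_nonneg)
    have "(\<integral>\<^sup>+ \<omega>. ennreal (enn2real (\<Sum>k. ennreal (s k \<omega>))) \<partial>M) = (\<integral>\<^sup>+ \<omega>. (\<Sum>k. ennreal (s k \<omega>)) \<partial>M)"
      using AEfin by (intro nn_integral_cong_AE) (auto elim!: eventually_mono)
    then show "(\<integral>\<^sup>+ \<omega>. ennreal (enn2real (\<Sum>k. ennreal (s k \<omega>))) \<partial>M) < \<infinity>" using fin by simp
  qed auto
  then show "integrable M (\<lambda>\<omega>. mean_envelope p e (\<lambda>j. U j \<omega>))"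
    unfolding mean_envelope_def s_def by auto
qed

subsection \<open>Kernels of bounded variation\<close>

text \<open>Test functions for which every expectation below exists. Deviations are additive on this
  class, and it contains the kernels as well as the step functions that approximate them.\<close>

definition bounded_borel :: "(real \<Rightarrow> real) \<Rightarrow> bool" where
  "bounded_borel f \<longleftrightarrow> f \<in> borel_measurable borel \<and> (\<exists>B. \<forall>u. \<bar>f u\<bar> \<le> B)"

lemma bounded_borel_indicator: "A \<in> sets borel \<Longrightarrow> bounded_borel (indicator A)"
  unfolding bounded_borel_def by (auto intro!: exI[of _ 1] simp: indicator_def)

lemma bounded_borel_add:
  assumes "bounded_borel f" "bounded_borel g" shows "bounded_borel (\<lambda>u. f u + g u)"
proof -
  obtain B C where "\<And>u. \<bar>f u\<bar> \<le> B" "\<And>u. \<bar>g u\<bar> \<le> C" using assms by (auto simp: bounded_borel_def)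
  then have "\<forall>u. \<bar>f u + g u\<bar> \<le> B + C" by (meson abs_triangle_ineq add_mono order_trans)
  then show ?thesis using assms unfolding bounded_borel_def by (intro conjI exI[of _ "B + C"]) auto
qed

lemma bounded_borel_scale:
  assumes "bounded_borel f" shows "bounded_borel (\<lambda>u. c * f u)"
proof -
  obtain B where "\<And>u. \<bar>f u\<bar> \<le> B" using assms by (auto simp: bounded_borel_def)
  then have "\<bar>c * f u\<bar> \<le> \<bar>c\<bar> * B" for u by (simp add: abs_mult mult_left_mono)
  then show ?thesis using assms by (auto simp: bounded_borel_def)
qed

lemma bounded_borel_sum:
  "(\<And>k. k \<in> I \<Longrightarrow> bounded_borel (f k)) \<Longrightarrow> bounded_borel (\<lambda>u. \<Sum>k\<in>I. f k u)"
proof (induction I rule: infinite_finite_induct)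
  case (insert x F)
  then show ?case using bounded_borel_add[of "f x" "\<lambda>u. \<Sum>k\<in>F. f k u"] by simp
qed (auto simp: bounded_borel_def)

text \<open>Values are normalised to \<open>[0, 1]\<close> so that \<open>N\<close> equal layers
  approximate the function to within \<open>1 / N\<close>. Monotonicity is asked on
  \<open>[-1, 1]\<close>, leaving jumps to 0 at both ends.\<close>

definition mono_kernel :: "(real \<Rightarrow> real) \<Rightarrow> bool" where
  "mono_kernel g \<longleftrightarrow> (\<forall>u. u \<notin> {-1..1} \<longrightarrow> g u = 0) \<and>
     (\<forall>u v. -1 \<le> u \<longrightarrow> u \<le> v \<longrightarrow> v \<le> 1 \<longrightarrow> g u \<le> g v) \<and> (\<forall>u. 0 \<le> g u \<and> g u \<le> 1)"

text \<open>At a positive height the level set avoids the outside of \<open>[-1, 1]\<close>, where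
  the kernel is 0, and inside it monotonicity leaves no gaps.\<close>

lemma mono_kernel_level_interval:
  assumes "mono_kernel g" "0 < y"
  shows "is_interval {u. y \<le> g u}" "{u. y \<le> g u} \<subseteq> {-1..1}"
proof -
  show sub: "{u. y \<le> g u} \<subseteq> {-1..1}"
    using assms by (force simp: mono_kernel_def)
  show "is_interval {u. y \<le> g u}"
    unfolding is_interval_1
  proof (intro ballI allI impI)
    fix u v w assume *: "u \<in> {u. y \<le> g u}" "v \<in> {u. y \<le> g u}" "u \<le> w \<and> w \<le> v"
    then have "-1 \<le> u" "w \<le> 1" using sub by (auto simp: subset_iff)
    then have "g u \<le> g w" using assms(1) * by (auto simp: mono_kernel_def)
    then show "w \<in> {u. y \<le> g u}" using * by auto
  qed
qed

lemma mono_kernel_borel: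
  assumes "mono_kernel g" shows "g \<in> borel_measurable borel"
proof (unfold borel_measurable_iff_ge, rule allI)
  fix y :: real
  show "{u \<in> space borel. y \<le> g u} \<in> sets borel"
  proof (cases "0 < y")
    case True
    then show ?thesis using real_interval_borel_measurable mono_kernel_level_interval[OF assms True] by simp
  next
    case False
    then have "y \<le> g u" for u using assms by (smt (verit) mono_kernel_def)
    then show ?thesis by simp
  qed
qed

lemma mono_kernel_bounded_borel: "mono_kernel g \<Longrightarrow> bounded_borel g"
  using mono_kernel_borel by (auto simp: bounded_borel_def mono_kernel_def intro!: exI[of _ 1])

text \<open>Discretised layer-cake formula: the number of layers \<open>k\<close> with
  \<open>k / N \<le> g u\<close> is the floor of \<open>N * g u\<close>, so the sum is
  \<open>g u\<close> rounded down to a multiple of \<open>1 / N\<close>.\<close>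

lemma mono_kernel_layers:
  assumes g: "mono_kernel g" and N: "0 < (N::nat)"
  shows "\<bar>g u - (\<Sum>k\<in>{1..N}. (1 / real N) * indicator {u. real k / real N \<le> g u} u)\<bar> \<le> 1 / real N"
proof -
  define y where "y = g u"
  have y: "0 \<le> y" "y \<le> 1" using g by (auto simp: mono_kernel_def y_def)
  define q where "q = nat \<lfloor>real N * y\<rfloor>"
  have "real N * y \<le> real N * 1" using y by (intro mult_left_mono) auto
  then have q: "real q \<le> real N * y" "real N * y < real q + 1" "q \<le> N"
    using y unfolding q_def by (auto simp: of_nat_nat nat_le_iff floor_le_iff)
  have "(\<Sum>k\<in>{1..N}. (1 / real N) * indicator {u. real k / real N \<le> g u} u) = (\<Sum>k\<in>{1..N}. if k \<le> q then 1 / real N else 0)"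
  proof (rule sum.cong)
    fix k assume "k \<in> {1..N}"
    have "real k / real N \<le> y \<longleftrightarrow> k \<le> q"
      using N q by (simp add: field_simps) linarith
    then show "(1 / real N) * indicator {u. real k / real N \<le> g u} u = (if k \<le> q then 1 / real N else 0)"
      by (simp add: y_def[symmetric])
  qed simp
  also have "\<dots> = (\<Sum>k\<in>{1..q}. 1 / real N)"
    using q(3) by (intro sum.mono_neutral_cong_right) auto
  also have "\<dots> = real q / real N" by simp
  finally show ?thesis using q N unfolding y_def[symmetric] by (simp add: abs_le_iff field_simps)
qed

text \<open>The \<open>N\<close> layers have weights \<open>1 / N\<close> summing to 1, so the bound
  for intervals is not multiplied by the number of layers. The constant \<open>C\<close> of the
  sup-norm bound may be large and may depend on the outcome; it meets only the layer error
  \<open>1 / N\<close>, which tends to 0.\<close>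

lemma mono_kernel_functional_le:
  fixes D :: "(real \<Rightarrow> real) \<Rightarrow> real"
  assumes add: "\<And>f g. bounded_borel f \<Longrightarrow> bounded_borel g \<Longrightarrow> D (\<lambda>u. f u + g u) = D f + D g"
    and scale: "\<And>c f. bounded_borel f \<Longrightarrow> D (\<lambda>u. c * f u) = c * D f"
    and bd: "\<And>f e. bounded_borel f \<Longrightarrow> (\<And>u. \<bar>f u\<bar> \<le> e) \<Longrightarrow> \<bar>D f\<bar> \<le> C * e"
    and ints: "\<And>I. is_interval I \<Longrightarrow> I \<subseteq> {-1..1} \<Longrightarrow> \<bar>D (indicator I)\<bar> \<le> \<epsilon>"
    and g: "mono_kernel g"
  shows "\<bar>D g\<bar> \<le> \<epsilon>"
proof -
  have D_sum: "D (\<lambda>u. \<Sum>k\<in>I. f k u) = (\<Sum>k\<in>I. D (f k))"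
    if "finite I" "\<And>k. k \<in> I \<Longrightarrow> bounded_borel (f k)" for I :: "nat set" and f
    using that
  proof (induction I)
    case empty
    show ?case using scale[of "indicator {}" 0] bounded_borel_indicator[of "{}"] by simp
  next
    case (insert x F)
    then show ?case using add[of "f x" "\<lambda>u. \<Sum>k\<in>F. f k u"] bounded_borel_sum[of F f] by simp
  qed
  have step: "\<bar>D g\<bar> \<le> \<epsilon> + C * (1 / real (Suc N'))" for N'
  proof -
    define N where "N = Suc N'"
    have N: "0 < N" by (simp add: N_def)
    let ?I = "\<lambda>k. {u. real k / real N \<le> g u}"
    have I: "is_interval (?I k)" "?I k \<subseteq> {-1..1}" if "k \<in> {1..N}" for k
      using mono_kernel_level_interval[OF g, of "real k / real N"] that by auto
    have bI: "bounded_borel (indicator (?I k))" if "k \<in> {1..N}" for k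
      by (intro bounded_borel_indicator real_interval_borel_measurable I that)
    define gN where "gN u = (\<Sum>k\<in>{1..N}. (1 / real N) * indicator (?I k) u)" for u
    have bN: "bounded_borel gN" unfolding gN_def by (intro bounded_borel_sum bounded_borel_scale bI)
    have bR: "bounded_borel (\<lambda>u. g u + (-1) * gN u)"
      by (intro bounded_borel_add bounded_borel_scale bN mono_kernel_bounded_borel g)
    have "D gN = (\<Sum>k\<in>{1..N}. D (\<lambda>u. (1 / real N) * indicator (?I k) u))"
      unfolding gN_def by (intro D_sum bounded_borel_scale bI) auto
    also have "\<dots> = (\<Sum>k\<in>{1..N}. (1 / real N) * D (indicator (?I k)))"
      by (intro sum.cong refl scale bI)
    finally have "\<bar>D gN\<bar> \<le> (\<Sum>k\<in>{1..N}. \<bar>(1 / real N) * D (indicator (?I k))\<bar>)"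
      by (simp only: sum_abs)
    also have "\<dots> \<le> (\<Sum>k\<in>{1..N}. (1 / real N) * \<epsilon>)"
    proof (rule sum_mono)
      fix k assume "k \<in> {1..N}"
      then show "\<bar>(1 / real N) * D (indicator (?I k))\<bar> \<le> (1 / real N) * \<epsilon>"
        unfolding abs_mult using ints[OF I] by (intro mult_mono) auto
    qed
    also have "\<dots> = \<epsilon>" using N by simp
    finally have 1: "\<bar>D gN\<bar> \<le> \<epsilon>" .
    have "\<bar>g u + (-1) * gN u\<bar> \<le> 1 / real N" for u
      using mono_kernel_layers[OF g N, of u] unfolding gN_def by simp
    then have 2: "\<bar>D (\<lambda>u. g u + (-1) * gN u)\<bar> \<le> C * (1 / real N)" by (intro bd bR)
    have "D g = D (\<lambda>u. gN u + (g u + (-1) * gN u))" by simp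
    also have "\<dots> = D gN + D (\<lambda>u. g u + (-1) * gN u)" by (rule add[OF bN bR])
    finally show ?thesis using 1 2 unfolding N_def by linarith
  qed
  have "(\<lambda>N. \<epsilon> + C * (1 / real (Suc N))) \<longlonglongrightarrow> \<epsilon> + C * 0"
    using LIMSEQ_inverse_real_of_nat by (intro tendsto_add tendsto_mult tendsto_const) (simp add: inverse_eq_divide)
  then show ?thesis using LIMSEQ_le_const[of _ "\<epsilon> + C * 0" "\<bar>D g\<bar>"] step by auto
qed

text \<open>Jordan form of a function of bounded variation vanishing outside \<open>[-1, 1]\<close>;
  the factor \<open>c\<close> undoes the normalisation of the monotone parts.\<close>

definition bv_kernel :: "(real \<Rightarrow> real) \<Rightarrow> bool" where
  "bv_kernel \<phi> \<longleftrightarrow> (\<exists>c g1 g2. mono_kernel g1 \<and> mono_kernel g2 \<and> 0 \<le> c \<and> \<phi> = (\<lambda>u. c * (g1 u - g2 u)))"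

lemma mono_kernel_zero: "mono_kernel (\<lambda>_. 0)" by (simp add: mono_kernel_def)

lemma mono_kernel_imp_bv: "mono_kernel g \<Longrightarrow> bv_kernel g"
  unfolding bv_kernel_def by (intro exI[of _ 1] exI[of _ g] exI[of _ "\<lambda>_. 0"]) (auto simp: mono_kernel_zero)

lemma bv_kernel_bounded_borel: "bv_kernel f \<Longrightarrow> bounded_borel f"
proof -
  assume "bv_kernel f"
  then obtain c g1 g2 where g: "mono_kernel g1" "mono_kernel g2" and f: "f = (\<lambda>u. c * (g1 u - g2 u))" by (auto simp: bv_kernel_def)
  have "bounded_borel (\<lambda>u. c * (g1 u + (- 1) * g2 u))"
    by (intro bounded_borel_scale bounded_borel_add mono_kernel_bounded_borel g)
  then show ?thesis unfolding f by simp
qed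

text \<open>The identity changes sign on \<open>[-1, 1]\<close>, but \<open>u + 1\<close> is
  nonnegative and increasing, so its product with a monotone kernel is monotone again. Writing
  \<open>u = (u + 1) - 1\<close> and moving the subtracted terms to the other part of the difference
  keeps both parts monotone; division by 3 restores the range, as they are at most 2 + 1.\<close>

lemma bv_kernel_times_id:
  assumes "bv_kernel \<phi>" shows "bv_kernel (\<lambda>u. \<phi> u * u)"
proof -
  obtain c g1 g2 where g: "mono_kernel g1" "mono_kernel g2" "0 \<le> c" and \<phi>: "\<phi> = (\<lambda>u. c * (g1 u - g2 u))"
    using assms by (auto simp: bv_kernel_def)
  have mk: "mono_kernel (\<lambda>u. (f u * (u + 1) + g u) / 3)" if f: "mono_kernel f" and g: "mono_kernel g" for f g
    unfolding mono_kernel_def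
  proof (intro conjI allI impI)
    fix u v :: real
    show "u \<notin> {- 1..1} \<Longrightarrow> (f u * (u + 1) + g u) / 3 = 0" using f g by (auto simp: mono_kernel_def)
    show "(f u * (u + 1) + g u) / 3 \<le> (f v * (v + 1) + g v) / 3" if "-1 \<le> u" "u \<le> v" "v \<le> 1"
    proof -
      have "f u * (u + 1) \<le> f v * (v + 1)" using f that by (intro mult_mono) (auto simp: mono_kernel_def)
      moreover have "g u \<le> g v" using g that by (auto simp: mono_kernel_def)
      ultimately show ?thesis by simp
    qed
    have "0 \<le> f u * (u + 1) \<and> f u * (u + 1) \<le> 2"
    proof (cases "u \<in> {-1..1}")
      case True
      then have "f u * (u + 1) \<le> 1 * 2" using f by (intro mult_mono) (auto simp: mono_kernel_def)
      then show ?thesis using f True by (auto simp: mono_kernel_def)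
    next
      case False then show ?thesis using f by (auto simp: mono_kernel_def)
    qed
    moreover have "0 \<le> g u \<and> g u \<le> 1" using g by (auto simp: mono_kernel_def)
    ultimately show "0 \<le> (f u * (u + 1) + g u) / 3" "(f u * (u + 1) + g u) / 3 \<le> 1" by auto
  qed
  show ?thesis
    unfolding bv_kernel_def
  proof (intro exI conjI)
    show "mono_kernel (\<lambda>u. (g1 u * (u + 1) + g2 u) / 3)" "mono_kernel (\<lambda>u. (g2 u * (u + 1) + g1 u) / 3)"
      using mk g by auto
    show "0 \<le> 3 * c" using g by simp
    show "(\<lambda>u. \<phi> u * u) = (\<lambda>u. 3 * c * ((g1 u * (u + 1) + g2 u) / 3 - (g2 u * (u + 1) + g1 u) / 3))"
      unfolding \<phi> by (auto simp: field_simps)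
  qed
qed

lemma bv_kernel_times_power: "bv_kernel \<phi> \<Longrightarrow> bv_kernel (\<lambda>u. \<phi> u * u ^ p)"
proof (induction p)
  case (Suc p)
  then show ?case using bv_kernel_times_id[of "\<lambda>u. \<phi> u * u ^ p"] by (simp add: mult_ac)
qed simp

text \<open>Jordan decomposition: with the variation function \<open>V\<close>, both \<open>V + K\<close> and \<open>V - K\<close> are monotone.\<close>

lemma bounded_variation_imp_bv_kernel:
  assumes bv: "bounded_variation_on K (-1) 1" and zero: "\<And>u. u \<notin> {-1..1} \<Longrightarrow> K u = 0"
  shows "bv_kernel K"
proof -
  define chain where "chain u N x \<longleftrightarrow> (\<forall>k\<le>N. x k \<in> {-1..u}) \<and> (\<forall>k<N. x k \<le> x (Suc k))"
    for u :: real and N :: nat and x :: "nat \<Rightarrow> real"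
  define var where "var N x = (\<Sum>k<N. \<bar>K (x (Suc k)) - K (x k)\<bar>)" for N and x :: "nat \<Rightarrow> real"
  obtain B where B: "\<And>N x. chain 1 N x \<Longrightarrow> var N x \<le> B"
    using bv unfolding bounded_variation_on_def chain_def var_def by blast
  have chain_mono: "chain v N x" if "chain u N x" "u \<le> v" for u v N x
    using that unfolding chain_def by force
  define S where "S u = {var N x | N x. chain u N x}" for u
  define V where "V u = Sup (S u)" for u
  have S_ne: "S u \<noteq> {}" if "-1 \<le> u" for u
  proof -
    have "chain u 0 (\<lambda>_. -1)" using that by (auto simp: chain_def)
    then show ?thesis unfolding S_def by blast
  qed
  have S_bdd: "bdd_above (S u)" if "u \<le> 1" for u
    using B chain_mono[OF _ that] unfolding S_def by (intro bdd_aboveI[of _ B]) auto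
  have V_le: "var N x \<le> V u" if "chain u N x" "u \<le> 1" for u N x
    unfolding V_def using that S_bdd[OF that(2)] by (intro cSup_upper) (auto simp: S_def)
  have V0: "0 \<le> V u" if "-1 \<le> u" "u \<le> 1" for u
    using V_le[of u 0 "\<lambda>_. -1"] that by (auto simp: chain_def var_def)
  have V_B: "V u \<le> B" if "-1 \<le> u" "u \<le> 1" for u
    unfolding V_def using S_ne[OF that(1)] B chain_mono[OF _ that(2)] by (intro cSup_least) (auto simp: S_def)
  have incr: "V u + \<bar>K v - K u\<bar> \<le> V v" if uv: "-1 \<le> u" "u \<le> v" "v \<le> 1" for u v
  proof -
    have "s \<le> V v - \<bar>K v - K u\<bar>" if sS: "s \<in> S u" for s
    proof -
      obtain N x where s: "s = var N x" and ch: "chain u N x" using sS unfolding S_def by blast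
      \<comment> \<open>The chain up to \<open>u\<close> is extended by the points \<open>u\<close>
        and \<open>v\<close>. The jump from \<open>x N\<close> to \<open>u\<close> only adds to the
        variation, and the last jump contributes \<open>\<bar>K v - K u\<bar>\<close>.\<close>
      define x' where "x' k = (if k \<le> N then x k else if k = Suc N then u else v)" for k
      have "chain v (Suc (Suc N)) x'"
        using ch uv unfolding chain_def x'_def by (auto simp: le_Suc_eq less_Suc_eq)
      then have "var (Suc (Suc N)) x' \<le> V v" by (rule V_le) (use uv in auto)
      moreover have "var (Suc (Suc N)) x' = var N x + \<bar>K u - K (x N)\<bar> + \<bar>K v - K u\<bar>"
        unfolding var_def x'_def by simp
      ultimately show ?thesis unfolding s by linarith
    qed
    then have "V u \<le> V v - \<bar>K v - K u\<bar>" unfolding V_def[of u] using S_ne[OF uv(1)] by (intro cSup_least)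
    then show ?thesis by linarith
  qed
  have B0: "0 \<le> B" using V0[of 1] V_B[of 1] by simp
  define b where "b = \<bar>K (-1)\<bar>"
  \<comment> \<open>With \<open>V u \<le> B\<close> and \<open>\<bar>K u\<bar> \<le> b + B\<close>,
    the shifted sum \<open>V u + s * K u + b + B\<close> lies between 0 and
    \<open>3 * B + 2 * b\<close>; the 1 makes the divisor positive.\<close>
  define c where "c = 3 * B + 2 * b + 1"
  have K_bd: "\<bar>K u\<bar> \<le> b + B" if "-1 \<le> u" "u \<le> 1" for u
    using incr[of "-1" u] V0[of "-1"] V_B[of u] that unfolding b_def by linarith
  define g where "g s u = (if u \<in> {-1..1} then (V u + s * K u + b + B) / c else 0)" for s u
  have c: "0 < c" using B0 unfolding c_def b_def by simp
  have g: "mono_kernel (g s)" if s: "s = 1 \<or> s = -1" for s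
    unfolding mono_kernel_def
  proof (intro conjI allI impI)
    fix u v :: real
    show "u \<notin> {- 1..1} \<Longrightarrow> g s u = 0" by (auto simp: g_def)
    show "g s u \<le> g s v" if "-1 \<le> u" "u \<le> v" "v \<le> 1"
      using incr[OF that] s that c unfolding g_def by (auto intro!: divide_right_mono simp: abs_le_iff)
    have r: "0 \<le> V u + s * K u + b + B" "V u + s * K u + b + B \<le> c" if "-1 \<le> u" "u \<le> 1"
      using V0[OF that] K_bd[OF that] V_B[OF that] s unfolding c_def by (auto simp: abs_le_iff b_def)
    then show "0 \<le> g s u" "g s u \<le> 1" using c unfolding g_def by (auto simp: divide_le_eq)
  qed
  have "K = (\<lambda>u. (c / 2) * (g 1 u - g (-1) u))"
  proof
    fix u show "K u = (c / 2) * (g 1 u - g (-1) u)"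
      using zero[of u] c by (cases "u \<in> {-1..1}") (auto simp: g_def field_simps)
  qed
  then show ?thesis unfolding bv_kernel_def using g[of 1] g[of "-1"] c
    by (intro exI[of _ "c / 2"] exI[of _ "g 1"] exI[of _ "g (-1)"]) auto
qed

subsection \<open>Least squares and quadratic forms\<close>

text \<open>Along the line \<open>r - \<epsilon> * d\<close> the criterion is a quadratic in
  \<epsilon> that is minimal at 0, so its linear coefficient vanishes. \<open>A\<close> stands for a
  weighted average over the sample; linearity and a nonnegative quadratic coefficient
  suffice.\<close>

lemma normal_equation:
  fixes A :: "('e \<Rightarrow> real) \<Rightarrow> real"
  assumes add: "\<And>f g. A (\<lambda>e. f e + g e) = A f + A g" and scale: "\<And>c f. A (\<lambda>e. c * f e) = c * A f"
    and pos: "0 \<le> A (\<lambda>e. w e * (d e)\<^sup>2)"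
    and least: "\<And>\<epsilon>. A (\<lambda>e. w e * (r e)\<^sup>2) \<le> A (\<lambda>e. w e * (r e - \<epsilon> * d e)\<^sup>2)"
  shows "A (\<lambda>e. w e * r e * d e) = 0"
proof (rule ccontr)
  let ?S = "A (\<lambda>e. w e * r e * d e)" and ?Q = "A (\<lambda>e. w e * (d e)\<^sup>2)"
  assume S: "?S \<noteq> 0"
  \<comment> \<open>The exact minimiser would divide by \<open>?Q\<close>, which may be 0. With
    \<open>?Q + 1\<close> the criterion still drops by
    \<open>\<epsilon>\<^sup>2 * (?Q + 2)\<close>.\<close>
  define \<epsilon> where "\<epsilon> = ?S / (?Q + 1)"
  have "A (\<lambda>e. w e * (r e - \<epsilon> * d e)\<^sup>2)
      = A (\<lambda>e. (w e * (r e)\<^sup>2 + (- 2 * \<epsilon>) * (w e * r e * d e)) + \<epsilon>\<^sup>2 * (w e * (d e)\<^sup>2))"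
    by (intro arg_cong[of _ _ A] ext) (simp add: power2_eq_square algebra_simps)
  also have "\<dots> = A (\<lambda>e. w e * (r e)\<^sup>2) + (- 2 * \<epsilon>) * ?S + \<epsilon>\<^sup>2 * ?Q"
    unfolding add scale ..
  finally have "0 \<le> (- 2 * \<epsilon>) * ?S + \<epsilon>\<^sup>2 * ?Q" using least[of \<epsilon>] by linarith
  moreover have "e * s = e\<^sup>2 * (q + 1)" if "e = s / (q + 1)" "0 \<le> q" for e s q :: real
    using that by (simp add: power2_eq_square)
  from this[OF \<epsilon>_def pos] have "\<epsilon> * ?S = \<epsilon>\<^sup>2 * (?Q + 1)" .
  moreover have "0 < \<epsilon>\<^sup>2" "0 \<le> \<epsilon>\<^sup>2 * ?Q" using S pos unfolding \<epsilon>_def by auto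
  ultimately show False by (simp add: algebra_simps)
qed

text \<open>With \<open>d\<close> the fit of the coefficient errors, orthogonality of the fitted
  residuals \<open>q\<close> to \<open>d\<close> gives \<open>A (w r d) = A (w d^2)\<close>. The
  left side is at most \<open>R\<close> times the sum of the absolute coefficient errors, the right
  side at least \<open>lam\<close> times the sum of their squares; comparing the two norms of three
  coefficients costs the factor 3. The predicate \<open>P\<close> describes the values of the third
  coefficient over which the minimum is taken.\<close>

lemma least_squares_error:
  fixes A :: "('e \<Rightarrow> real) \<Rightarrow> real" and x1 x2 :: "'e \<Rightarrow> real"
  assumes add: "\<And>f g. A (\<lambda>e. f e + g e) = A f + A g" and scale: "\<And>c f. A (\<lambda>e. c * f e) = c * A f"
    and least: "\<And>c0 c1 c2. P c2 \<Longrightarrow> A (\<lambda>e. w e * (z e - a0 - a1 * x1 e - a2 * x2 e)\<^sup>2)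
                     \<le> A (\<lambda>e. w e * (z e - c0 - c1 * x1 e - c2 * x2 e)\<^sup>2)"
    and P: "\<And>\<epsilon>. P (a2 + \<epsilon> * (a2 - b2))"
    and lower: "lam * ((a0 - b0)\<^sup>2 + (a1 - b1)\<^sup>2 + (a2 - b2)\<^sup>2)
          \<le> A (\<lambda>e. w e * ((a0 - b0) + (a1 - b1) * x1 e + (a2 - b2) * x2 e)\<^sup>2)" and lam: "0 < lam"
    and R0: "\<bar>A (\<lambda>e. w e * (z e - b0 - b1 * x1 e - b2 * x2 e))\<bar> \<le> R"
    and R1: "\<bar>A (\<lambda>e. w e * (z e - b0 - b1 * x1 e - b2 * x2 e) * x1 e)\<bar> \<le> R"
    and R2: "\<bar>A (\<lambda>e. w e * (z e - b0 - b1 * x1 e - b2 * x2 e) * x2 e)\<bar> \<le> R"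
  shows "\<bar>a0 - b0\<bar> \<le> 3 * R / lam"
proof -
  define r where "r e = z e - b0 - b1 * x1 e - b2 * x2 e" for e
  define d where "d e = (a0 - b0) + (a1 - b1) * x1 e + (a2 - b2) * x2 e" for e
  define q where "q e = z e - a0 - a1 * x1 e - a2 * x2 e" for e
  have rq: "r e = q e + d e" for e unfolding r_def q_def d_def by (simp add: algebra_simps)
  have pos: "0 \<le> A (\<lambda>e. w e * (d e)\<^sup>2)"
  proof -
    have "0 \<le> lam * ((a0 - b0)\<^sup>2 + (a1 - b1)\<^sup>2 + (a2 - b2)\<^sup>2)" using lam by simp
    then show ?thesis using lower unfolding d_def by linarith
  qed
  have "A (\<lambda>e. w e * q e * d e) = 0"
  proof (rule normal_equation[OF add scale pos])
    fix \<epsilon>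
    have "A (\<lambda>e. w e * (q e)\<^sup>2) \<le> A (\<lambda>e. w e * (z e - (a0 + \<epsilon> * (a0 - b0)) - (a1 + \<epsilon> * (a1 - b1)) * x1 e - (a2 + \<epsilon> * (a2 - b2)) * x2 e)\<^sup>2)"
      unfolding q_def by (rule least[OF P])
    also have "\<dots> = A (\<lambda>e. w e * (q e - \<epsilon> * d e)\<^sup>2)"
      unfolding q_def d_def by (intro arg_cong[of _ _ A] ext arg_cong2[of _ _ _ _ "(*)"] arg_cong2[of _ _ _ _ power] refl)
        (simp add: algebra_simps)
    finally show "A (\<lambda>e. w e * (q e)\<^sup>2) \<le> A (\<lambda>e. w e * (q e - \<epsilon> * d e)\<^sup>2)" .
  qed
  moreover have "A (\<lambda>e. w e * r e * d e) = A (\<lambda>e. w e * q e * d e + w e * (d e)\<^sup>2)"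
    unfolding rq by (intro arg_cong[of _ _ A] ext) (simp add: power2_eq_square algebra_simps)
  ultimately have eq: "A (\<lambda>e. w e * r e * d e) = A (\<lambda>e. w e * (d e)\<^sup>2)" unfolding add by simp
  let ?s = "\<bar>a0 - b0\<bar> + \<bar>a1 - b1\<bar> + \<bar>a2 - b2\<bar>"
  have "A (\<lambda>e. w e * r e * d e) = A (\<lambda>e. ((a0 - b0) * (w e * r e) + (a1 - b1) * (w e * r e * x1 e)) + (a2 - b2) * (w e * r e * x2 e))"
    unfolding d_def by (intro arg_cong[of _ _ A] ext) (simp add: algebra_simps)
  also have "\<dots> = (a0 - b0) * A (\<lambda>e. w e * r e) + (a1 - b1) * A (\<lambda>e. w e * r e * x1 e) + (a2 - b2) * A (\<lambda>e. w e * r e * x2 e)"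
    unfolding add scale ..
  also have "\<dots> \<le> \<bar>a0 - b0\<bar> * R + \<bar>a1 - b1\<bar> * R + \<bar>a2 - b2\<bar> * R"
  proof -
    have "x * y \<le> \<bar>x\<bar> * R" if "\<bar>y\<bar> \<le> R" for x y :: real
      using mult_left_mono[OF that, of "\<bar>x\<bar>"] abs_ge_self[of "x * y"] by (simp add: abs_mult)
    then show ?thesis using R0 R1 R2 unfolding r_def by (intro add_mono) auto
  qed
  finally have up: "A (\<lambda>e. w e * (d e)\<^sup>2) \<le> ?s * R" unfolding eq by (simp add: algebra_simps)
  have cs: "?s\<^sup>2 \<le> 3 * ((a0 - b0)\<^sup>2 + (a1 - b1)\<^sup>2 + (a2 - b2)\<^sup>2)"
  proof -
    have "(x + y + z)\<^sup>2 \<le> 3 * (x\<^sup>2 + y\<^sup>2 + z\<^sup>2)" for x y z :: real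
      using zero_le_power2[of "x - y"] zero_le_power2[of "x - z"] zero_le_power2[of "y - z"]
      by (simp add: power2_eq_square algebra_simps)
    from this[of "\<bar>a0 - b0\<bar>" "\<bar>a1 - b1\<bar>" "\<bar>a2 - b2\<bar>"] show ?thesis by simp
  qed
  have "lam / 3 * ?s\<^sup>2 \<le> lam * ((a0 - b0)\<^sup>2 + (a1 - b1)\<^sup>2 + (a2 - b2)\<^sup>2)"
    using mult_left_mono[OF cs, of "lam / 3"] lam by simp
  also have "\<dots> \<le> ?s * R" using lower up unfolding d_def by linarith
  finally have *: "?s * (lam / 3 * ?s) \<le> ?s * R" by (simp add: power2_eq_square mult_ac)
  have "lam / 3 * ?s \<le> R"
  proof (cases "?s = 0")
    case True
    have "lam / 3 * ?s = 0" unfolding True by simp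
    moreover have "0 \<le> R" using R0 by linarith
    ultimately show ?thesis by linarith
  next
    case False
    then have "0 < ?s" by linarith
    then show ?thesis using * mult_le_cancel_left_pos by blast
  qed
  then have "?s \<le> 3 * R / lam" using lam by (simp add: field_simps)
  then show ?thesis by linarith
qed

text \<open>Up to the mass \<open>\<sigma>0 * \<tau>0\<close> the form is a second moment under a
  product of two normalised laws with means \<open>k1\<close>, \<open>k2\<close> and variances
  \<open>v1\<close>, \<open>v2'\<close>; completing the square turns it into
  \<open>A\<^sup>2 + c1\<^sup>2 * v1 + c2\<^sup>2 * v2'\<close>. The alternative
  \<open>c2 = 0\<close> admits a degenerate second coordinate, as in the univariate fit.\<close>

lemma moment_form_lower:
  fixes c0 c1 c2 :: real
  assumes s: "0 < s" "s \<le> \<sigma>0" "s \<le> \<tau>0" and k: "\<bar>\<sigma>1\<bar> \<le> \<sigma>0" "\<bar>\<tau>1\<bar> \<le> \<tau>0"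
    and v: "0 < v" "v * \<sigma>0\<^sup>2 \<le> \<sigma>2 * \<sigma>0 - \<sigma>1\<^sup>2" and v2: "c2 = 0 \<or> v * \<tau>0\<^sup>2 \<le> \<tau>2 * \<tau>0 - \<tau>1\<^sup>2"
  shows "s\<^sup>2 / (2 + 5 / v) * (c0\<^sup>2 + c1\<^sup>2 + c2\<^sup>2) \<le>
     c0\<^sup>2 * (\<sigma>0 * \<tau>0) + c1\<^sup>2 * (\<sigma>2 * \<tau>0) + c2\<^sup>2 * (\<sigma>0 * \<tau>2)
      + 2 * c0 * c1 * (\<sigma>1 * \<tau>0) + 2 * c0 * c2 * (\<sigma>0 * \<tau>1) + 2 * c1 * c2 * (\<sigma>1 * \<tau>1)" (is "_ \<le> ?Q")
proof -
  have pos: "0 < \<sigma>0" "0 < \<tau>0" using s by auto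
  define k1 k2 A where "k1 = \<sigma>1 / \<sigma>0" and "k2 = \<tau>1 / \<tau>0" and "A = c0 + c1 * k1 + c2 * k2"
  define v1 v2' where "v1 = \<sigma>2 / \<sigma>0 - k1\<^sup>2" and "v2' = \<tau>2 / \<tau>0 - k2\<^sup>2"
  have eqs: "\<sigma>1 = k1 * \<sigma>0" "\<tau>1 = k2 * \<tau>0" "\<sigma>2 = (v1 + k1\<^sup>2) * \<sigma>0" "\<tau>2 = (v2' + k2\<^sup>2) * \<tau>0"
    using pos unfolding k1_def k2_def v1_def v2'_def by auto
  have "\<sigma>2 * \<sigma>0 - \<sigma>1\<^sup>2 = v1 * \<sigma>0\<^sup>2" "\<tau>2 * \<tau>0 - \<tau>1\<^sup>2 = v2' * \<tau>0\<^sup>2"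
    unfolding eqs by (simp_all add: power2_eq_square algebra_simps)
  then have v1: "v \<le> v1" and v2'': "c2 = 0 \<or> v \<le> v2'" using v(2) v2 pos by auto
  have k': "\<bar>k1\<bar> \<le> 1" "\<bar>k2\<bar> \<le> 1" using k pos unfolding k1_def k2_def by auto
  have Q: "?Q = \<sigma>0 * \<tau>0 * (A\<^sup>2 + c1\<^sup>2 * v1 + c2\<^sup>2 * v2')"
    unfolding eqs A_def by (simp add: power2_eq_square algebra_simps)
  have low: "A\<^sup>2 + v * (c1\<^sup>2 + c2\<^sup>2) \<le> A\<^sup>2 + c1\<^sup>2 * v1 + c2\<^sup>2 * v2'"
    using mult_left_mono[OF v1, of "c1\<^sup>2"] v2'' mult_left_mono[of v v2' "c2\<^sup>2"] by (auto simp: algebra_simps)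
  \<comment> \<open>Recovers \<open>c0\<close> from \<open>A\<close>, using that the means are at
    most 1 in modulus. Adding \<open>c1\<^sup>2 + c2\<^sup>2\<close> turns the 4 into the 5 of the
    constant \<open>2 + 5 / v\<close>.\<close>
  have c0: "c0\<^sup>2 \<le> 2 * A\<^sup>2 + 4 * (c1\<^sup>2 + c2\<^sup>2)"
  proof -
    have 1: "(x - y - z)\<^sup>2 \<le> 2 * x\<^sup>2 + 4 * (y\<^sup>2 + z\<^sup>2)" for x y z :: real
    proof -
      have "2 * x\<^sup>2 + 4 * (y\<^sup>2 + z\<^sup>2) - (x - y - z)\<^sup>2 = (x + y + z)\<^sup>2 + 2 * (y - z)\<^sup>2"
        by (simp add: power2_eq_square algebra_simps)
      then show ?thesis using zero_le_power2[of "x + y + z"] zero_le_power2[of "y - z"] by linarith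
    qed
    have 2: "(c * k)\<^sup>2 \<le> c\<^sup>2" if "\<bar>k\<bar> \<le> 1" for c k :: real
    proof -
      have "k\<^sup>2 \<le> 1" using that by (simp add: abs_square_le_1)
      then show ?thesis by (simp add: power_mult_distrib mult_left_le)
    qed
    have "c0 = A - c1 * k1 - c2 * k2" unfolding A_def by simp
    then have "c0\<^sup>2 \<le> 2 * A\<^sup>2 + 4 * ((c1 * k1)\<^sup>2 + (c2 * k2)\<^sup>2)" using 1 by simp
    also have "\<dots> \<le> 2 * A\<^sup>2 + 4 * (c1\<^sup>2 + c2\<^sup>2)"
      using 2 k' by (intro add_left_mono mult_left_mono add_mono) auto
    finally show ?thesis .
  qed
  have "c0\<^sup>2 + c1\<^sup>2 + c2\<^sup>2 \<le> 2 * A\<^sup>2 + 5 * (c1\<^sup>2 + c2\<^sup>2)" using c0 by simp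
  also have "\<dots> \<le> (2 + 5 / v) * (A\<^sup>2 + v * (c1\<^sup>2 + c2\<^sup>2))"
  proof -
    have "(2 + 5 / v) * (A\<^sup>2 + v * (c1\<^sup>2 + c2\<^sup>2)) = 2 * A\<^sup>2 + 5 * (c1\<^sup>2 + c2\<^sup>2) + (5 / v * A\<^sup>2 + 2 * v * (c1\<^sup>2 + c2\<^sup>2))"
      using v by (simp add: field_simps)
    moreover have "0 \<le> 5 / v * A\<^sup>2 + 2 * v * (c1\<^sup>2 + c2\<^sup>2)" using v by simp
    ultimately show ?thesis by linarith
  qed
  finally have "(c0\<^sup>2 + c1\<^sup>2 + c2\<^sup>2) / (2 + 5 / v) \<le> A\<^sup>2 + v * (c1\<^sup>2 + c2\<^sup>2)"
    using v by (simp add: divide_le_eq add_pos_pos mult.commute)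
  then have main: "(c0\<^sup>2 + c1\<^sup>2 + c2\<^sup>2) / (2 + 5 / v) \<le> A\<^sup>2 + c1\<^sup>2 * v1 + c2\<^sup>2 * v2'" using low by linarith
  have "s\<^sup>2 \<le> \<sigma>0 * \<tau>0" unfolding power2_eq_square using s by (intro mult_mono) auto
  then have "s\<^sup>2 * ((c0\<^sup>2 + c1\<^sup>2 + c2\<^sup>2) / (2 + 5 / v)) \<le> \<sigma>0 * \<tau>0 * (A\<^sup>2 + c1\<^sup>2 * v1 + c2\<^sup>2 * v2')"
    using main v pos by (intro mult_mono) (auto intro!: divide_nonneg_nonneg add_nonneg_nonneg)
  then show ?thesis unfolding Q by simp
qed

text \<open>Replacing the six moments by their empirical versions changes the form by at most \<eta>
  times the sum of the absolute monomials, and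
  \<open>\<bar>2 * x * y\<bar> \<le> x\<^sup>2 + y\<^sup>2\<close> bounds that sum by three times
  the squared norm.\<close>

lemma empirical_form_lower:
  fixes c0 c1 c2 :: real
  assumes add: "\<And>f g. A (\<lambda>e. f e + g e) = A f + A g" and scale: "\<And>c f. A (\<lambda>e. c * f e) = c * (A f :: real)"
    and lower: "l * (c0\<^sup>2 + c1\<^sup>2 + c2\<^sup>2) \<le> c0\<^sup>2 * m00 + c1\<^sup>2 * m20 + c2\<^sup>2 * m02 + 2 * c0 * c1 * m10 + 2 * c0 * c2 * m01 + 2 * c1 * c2 * m11"
    and close: "\<bar>A (\<lambda>e. w e) - m00\<bar> \<le> \<eta>" "\<bar>A (\<lambda>e. w e * (x1 e)\<^sup>2) - m20\<bar> \<le> \<eta>" "\<bar>A (\<lambda>e. w e * (x2 e)\<^sup>2) - m02\<bar> \<le> \<eta>"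
      "\<bar>A (\<lambda>e. w e * x1 e) - m10\<bar> \<le> \<eta>" "\<bar>A (\<lambda>e. w e * x2 e) - m01\<bar> \<le> \<eta>" "\<bar>A (\<lambda>e. w e * (x1 e * x2 e)) - m11\<bar> \<le> \<eta>"
  shows "(l - 3 * \<eta>) * (c0\<^sup>2 + c1\<^sup>2 + c2\<^sup>2) \<le> A (\<lambda>e. w e * (c0 + c1 * x1 e + c2 * x2 e)\<^sup>2)"
proof -
  have "A (\<lambda>e. w e * (c0 + c1 * x1 e + c2 * x2 e)\<^sup>2) = A (\<lambda>e. c0\<^sup>2 * w e + c1\<^sup>2 * (w e * (x1 e)\<^sup>2) + c2\<^sup>2 * (w e * (x2 e)\<^sup>2)
      + 2 * c0 * c1 * (w e * x1 e) + 2 * c0 * c2 * (w e * x2 e) + 2 * c1 * c2 * (w e * (x1 e * x2 e)))"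
    by (intro arg_cong[of _ _ A] ext) (simp add: power2_eq_square algebra_simps)
  also have "\<dots> = c0\<^sup>2 * A w + c1\<^sup>2 * A (\<lambda>e. w e * (x1 e)\<^sup>2) + c2\<^sup>2 * A (\<lambda>e. w e * (x2 e)\<^sup>2)
      + 2 * c0 * c1 * A (\<lambda>e. w e * x1 e) + 2 * c0 * c2 * A (\<lambda>e. w e * x2 e) + 2 * c1 * c2 * A (\<lambda>e. w e * (x1 e * x2 e))"
    unfolding add scale ..
  finally have eq: "A (\<lambda>e. w e * (c0 + c1 * x1 e + c2 * x2 e)\<^sup>2) = \<dots>" .
  have *: "c * m - \<bar>c\<bar> * \<eta> \<le> c * B" if "\<bar>B - m\<bar> \<le> \<eta>" for c B m :: real
  proof -
    have "\<bar>c\<bar> * \<bar>B - m\<bar> \<le> \<bar>c\<bar> * \<eta>" using that by (intro mult_left_mono) auto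
    then have "- (\<bar>c\<bar> * \<eta>) \<le> c * (B - m)" by (simp add: abs_mult[symmetric] abs_le_iff)
    then show ?thesis by (simp add: algebra_simps)
  qed
  have "c0\<^sup>2 * m00 + c1\<^sup>2 * m20 + c2\<^sup>2 * m02 + 2 * c0 * c1 * m10 + 2 * c0 * c2 * m01 + 2 * c1 * c2 * m11
     - (c0\<^sup>2 + c1\<^sup>2 + c2\<^sup>2 + \<bar>2 * c0 * c1\<bar> + \<bar>2 * c0 * c2\<bar> + \<bar>2 * c1 * c2\<bar>) * \<eta> \<le> A (\<lambda>e. w e * (c0 + c1 * x1 e + c2 * x2 e)\<^sup>2)"
    unfolding eq using *[OF close(1), of "c0\<^sup>2"] *[OF close(2), of "c1\<^sup>2"] *[OF close(3), of "c2\<^sup>2"]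
      *[OF close(4), of "2 * c0 * c1"] *[OF close(5), of "2 * c0 * c2"] *[OF close(6), of "2 * c1 * c2"]
    by (simp only: abs_power2 distrib_right)
  moreover have "c0\<^sup>2 + c1\<^sup>2 + c2\<^sup>2 + \<bar>2 * c0 * c1\<bar> + \<bar>2 * c0 * c2\<bar> + \<bar>2 * c1 * c2\<bar> \<le> 3 * (c0\<^sup>2 + c1\<^sup>2 + c2\<^sup>2)"
  proof -
    have "\<bar>2 * x * y\<bar> \<le> x\<^sup>2 + y\<^sup>2" for x y :: real
      using zero_le_power2[of "x - y"] zero_le_power2[of "x + y"] by (simp add: abs_le_iff power2_eq_square algebra_simps)
    note * = this
    have "a + b + c + x + y + z \<le> 3 * (a + b + c)" if "x \<le> a + b" "y \<le> a + c" "z \<le> b + c" for a b c x y z :: real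
      using that by (simp add: algebra_simps)
    then show ?thesis using * by blast
  qed
  then have "(c0\<^sup>2 + c1\<^sup>2 + c2\<^sup>2 + \<bar>2 * c0 * c1\<bar> + \<bar>2 * c0 * c2\<bar> + \<bar>2 * c1 * c2\<bar>) * \<eta> \<le> 3 * (c0\<^sup>2 + c1\<^sup>2 + c2\<^sup>2) * \<eta>"
    using close(1) by (intro mult_right_mono) auto
  ultimately show ?thesis using lower by (simp add: algebra_simps)
qed

subsection \<open>Uniform deviations of kernel sums\<close>

text \<open>Rounding the infimum down and the supremum up to the grid gives the outer range, one
  step inward from each end the inner one. Points of the inner range lie strictly between infimum
  and supremum, so the argument is indifferent to which end points belong to
  \<open>I\<close>.\<close>

lemma interval_sandwich:
  fixes c h \<delta> :: real
  assumes I: "is_interval I" "I \<subseteq> {-1..1}" and h: "0 < h" and \<delta>: "0 < \<delta>"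
  shows "\<exists>p q :: int. \<delta> * (real_of_int q - real_of_int p) \<le> 2 * h + 2 * \<delta> \<and>
     \<bar>\<delta> * real_of_int p\<bar> \<le> \<bar>c\<bar> + h + \<delta> \<and> \<bar>\<delta> * real_of_int q\<bar> \<le> \<bar>c\<bar> + h + \<delta> \<and>
     (\<forall>x. \<delta> * real_of_int (p + 1) \<le> x \<and> x \<le> \<delta> * real_of_int (q - 1) \<longrightarrow> (x - c) / h \<in> I) \<and>
     (\<forall>x. (x - c) / h \<in> I \<longrightarrow> \<delta> * real_of_int p \<le> x \<and> x \<le> \<delta> * real_of_int q)"
proof (cases "I = {}")
  case True
  \<comment> \<open>For the empty interval both ends are chosen equal: the range from
    \<open>p + 1\<close> to \<open>p - 1\<close> contains no point.\<close>
  define p where "p = \<lfloor>c / \<delta>\<rfloor>"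
  have "real_of_int p \<le> c / \<delta>" "c / \<delta> < real_of_int p + 1" by (auto simp: p_def)
  then have "\<delta> * real_of_int p \<le> c" "c < \<delta> * real_of_int p + \<delta>" using \<delta> by (auto simp: field_simps)
  then have "\<bar>\<delta> * real_of_int p\<bar> \<le> \<bar>c\<bar> + h + \<delta>" using h \<delta> by linarith
  moreover have "\<not> (\<delta> * real_of_int (p + 1) \<le> x \<and> x \<le> \<delta> * real_of_int (p - 1))" for x
    using \<delta> by (auto simp: algebra_simps)
  ultimately show ?thesis using True h \<delta> by (intro exI[of _ p]) auto
next
  case False
  define S where "S = (\<lambda>u. c + h * u) ` I"
  have S_ne: "S \<noteq> {}" using False by (simp add: S_def)
  have S_iff: "x \<in> S \<longleftrightarrow> (x - c) / h \<in> I" for x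
  proof
    assume "(x - c) / h \<in> I"
    then have "c + h * ((x - c) / h) \<in> S" unfolding S_def by blast
    then show "x \<in> S" using h by simp
  qed (use h in \<open>auto simp: S_def\<close>)
  have S_bd: "c - h \<le> x \<and> x \<le> c + h" if "x \<in> S" for x
  proof -
    have "-1 \<le> (x - c) / h" "(x - c) / h \<le> 1" using that I(2) unfolding S_iff by auto
    then show ?thesis using h by (simp add: field_simps)
  qed
  have bdd: "bdd_above S" "bdd_below S" using S_bd by (auto intro!: bdd_aboveI[of _ "c + h"] bdd_belowI[of _ "c - h"])
  define x1 x2 where "x1 = Inf S" and "x2 = Sup S"
  have x12: "c - h \<le> x1" "x2 \<le> c + h"
    unfolding x1_def x2_def using S_bd S_ne by (auto intro!: cInf_greatest cSup_least)
  have x12': "x1 \<le> x" "x \<le> x2" if "x \<in> S" for x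
    unfolding x1_def x2_def using that bdd by (auto intro: cInf_lower cSup_upper)
  then have x1x2: "x1 \<le> x2" using S_ne by (meson all_not_in_conv order_trans)
  have inside: "x \<in> S" if x: "x1 < x" "x < x2" for x
  proof -
    obtain u where u: "u \<in> S" "u < x" using x(1) S_ne bdd unfolding x1_def by (meson cInf_lessD)
    obtain v where v: "v \<in> S" "x < v" using x(2) S_ne unfolding x2_def by (meson less_cSupD)
    have "(u - c) / h \<le> (x - c) / h" "(x - c) / h \<le> (v - c) / h"
      using u v h by (auto intro!: divide_right_mono)
    then show ?thesis using I(1) u v unfolding is_interval_1 S_iff by blast
  qed
  define p where "p = \<lfloor>x1 / \<delta>\<rfloor>"
  define q where "q = \<lceil>x2 / \<delta>\<rceil>"
  have "real_of_int p \<le> x1 / \<delta>" "x1 / \<delta> < real_of_int p + 1" by (auto simp: p_def)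
  then have p: "\<delta> * real_of_int p \<le> x1" "x1 < \<delta> * real_of_int p + \<delta>" using \<delta> by (auto simp: field_simps)
  have "x2 / \<delta> \<le> real_of_int q" "real_of_int q - 1 < x2 / \<delta>" unfolding q_def by linarith+
  then have q: "x2 \<le> \<delta> * real_of_int q" "\<delta> * real_of_int q - \<delta> < x2" using \<delta> by (auto simp: field_simps)
  have 1: "\<delta> * (real_of_int q - real_of_int p) \<le> 2 * h + 2 * \<delta>"
    using p q x12 by (simp add: algebra_simps)
  have 2: "\<bar>\<delta> * real_of_int p\<bar> \<le> \<bar>c\<bar> + h + \<delta>" "\<bar>\<delta> * real_of_int q\<bar> \<le> \<bar>c\<bar> + h + \<delta>"
    using p q x12 x1x2 \<delta> by linarith+
  have 3: "(x - c) / h \<in> I" if "\<delta> * real_of_int (p + 1) \<le> x" "x \<le> \<delta> * real_of_int (q - 1)" for x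
    using that p q inside[of x] unfolding S_iff[symmetric] by (simp add: algebra_simps)
  have 4: "\<delta> * real_of_int p \<le> x \<and> x \<le> \<delta> * real_of_int q" if "(x - c) / h \<in> I" for x
    using x12'[of x] that p q unfolding S_iff[symmetric] by linarith
  show ?thesis using 1 2 3 4 by blast
qed

text \<open>
  Common form of the univariate and bivariate kernel sums: on the curve \<open>i\<close> the nonnegative weights
  \<open>Z i j k\<close> sit at the points \<open>(T i j, T i k)\<close>. The univariate sums use the diagonal pairs \<open>j = k\<close>.
\<close>

locale pair_array = prob_space M for M :: "'w measure" +
  fixes G :: "nat \<Rightarrow> 'w measure" and E :: "nat \<Rightarrow> nat \<Rightarrow> (nat \<times> nat) set" and wt :: "nat \<Rightarrow> nat \<Rightarrow> real"
    and T :: "nat \<Rightarrow> nat \<Rightarrow> 'w \<Rightarrow> real" and a b :: real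
  assumes indep_G: "indep_sets (\<lambda>i. sets (G i)) UNIV" and space_G: "space (G i) = space M"
    and fin_E: "finite (E n i)" and wt_nonneg: "0 \<le> wt n i"
    and T_meas: "T i j \<in> borel_measurable (G i)"
begin

definition curve_sum where
  "curve_sum Z n i F \<omega> = wt n i * (\<Sum>(j, k)\<in>E n i. Z i j k \<omega> * F (T i j \<omega>) (T i k \<omega>))"
  for Z :: "nat \<Rightarrow> nat \<Rightarrow> nat \<Rightarrow> 'w \<Rightarrow> real" and F :: "real \<Rightarrow> real \<Rightarrow> real"

definition dev where
  "dev Z n F \<omega> = (\<Sum>i<n. curve_sum Z n i F \<omega> - expectation (curve_sum Z n i F)) / real n"
  for Z :: "nat \<Rightarrow> nat \<Rightarrow> nat \<Rightarrow> 'w \<Rightarrow> real" and F :: "real \<Rightarrow> real \<Rightarrow> real"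

lemma sub_G: "f \<in> borel_measurable (G i) \<Longrightarrow> f \<in> borel_measurable M" for f :: "'w \<Rightarrow> real"
proof -
  assume f: "f \<in> borel_measurable (G i)"
  have "sets (G i) \<subseteq> events" using indep_G by (simp add: indep_sets_def)
  then show ?thesis using f space_G[of i] by (auto simp: measurable_def)
qed

lemma T_meas_M[measurable]: "T i j \<in> borel_measurable M"
  by (rule sub_G[OF T_meas])

end

text \<open>Nonnegative weights make \<open>curve_sum\<close> monotone in \<open>F\<close>, which
  the sandwiching by boxes needs. Signed weights are split into positive and negative parts
  later.\<close>

locale weighted_array = pair_array +
  fixes Z :: "nat \<Rightarrow> nat \<Rightarrow> nat \<Rightarrow> 'a \<Rightarrow> real"
  assumes Z_meas: "Z i j k \<in> borel_measurable (G i)" and Z_nonneg: "0 \<le> Z i j k \<omega>"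
    and Z_int: "integrable M (Z i j k)"
begin

lemma Z_meas_M[measurable]: "Z i j k \<in> borel_measurable M"
  by (rule sub_G[OF Z_meas])

definition bdd_fun :: "(real \<Rightarrow> real \<Rightarrow> real) \<Rightarrow> bool" where
  "bdd_fun F \<longleftrightarrow> (\<lambda>(x, y). F x y) \<in> borel_measurable borel \<and> (\<exists>B. \<forall>x y. \<bar>F x y\<bar> \<le> B)"

lemma summand_int:
  assumes "bdd_fun F" shows "integrable M (\<lambda>\<omega>. Z i j k \<omega> * F (T i j \<omega>) (T i k \<omega>))"
proof -
  obtain B where B: "\<And>x y. \<bar>F x y\<bar> \<le> B" and [measurable]: "(\<lambda>(x, y). F x y) \<in> borel_measurable borel"
    using assms by (auto simp: bdd_fun_def)
  have [measurable]: "(\<lambda>(x, y). F x y) \<in> borel_measurable (borel \<Otimes>\<^sub>M borel)" by (simp add: borel_prod)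
  show ?thesis
  proof (rule Bochner_Integration.integrable_bound)
    show "integrable M (\<lambda>\<omega>. B * Z i j k \<omega>)" using Z_int by auto
    show "AE \<omega> in M. norm (Z i j k \<omega> * F (T i j \<omega>) (T i k \<omega>)) \<le> norm (B * Z i j k \<omega>)"
    proof (rule AE_I2)
      fix \<omega>
      have "\<bar>F (T i j \<omega>) (T i k \<omega>)\<bar> \<le> \<bar>B\<bar>" using B abs_ge_self order_trans by blast
      then show "norm (Z i j k \<omega> * F (T i j \<omega>) (T i k \<omega>)) \<le> norm (B * Z i j k \<omega>)"
        using mult_right_mono[of "\<bar>F (T i j \<omega>) (T i k \<omega>)\<bar>" "\<bar>B\<bar>" "\<bar>Z i j k \<omega>\<bar>"] by (simp add: abs_mult mult.commute)
    qed
  qed measurable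
qed

lemma curve_sum_int: "bdd_fun F \<Longrightarrow> integrable M (curve_sum Z n i F)"
  unfolding curve_sum_def by (auto intro!: integrable_mult_right Bochner_Integration.integrable_sum summand_int)

lemma curve_sum_add: "curve_sum Z n i (\<lambda>x y. F x y + H x y) \<omega> = curve_sum Z n i F \<omega> + curve_sum Z n i H \<omega>"
  unfolding curve_sum_def by (simp add: sum.distrib[symmetric] distrib_left[symmetric] case_prod_beta)

lemma curve_sum_scale: "curve_sum Z n i (\<lambda>x y. c * F x y) \<omega> = c * curve_sum Z n i F \<omega>"
  unfolding curve_sum_def by (simp add: sum_distrib_left case_prod_beta mult_ac)

lemma curve_sum_mono:
  assumes "\<And>x y. F x y \<le> H x y" shows "curve_sum Z n i F \<omega> \<le> curve_sum Z n i H \<omega>"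
  unfolding curve_sum_def using assms wt_nonneg Z_nonneg
  by (auto intro!: mult_left_mono sum_mono)

lemma curve_sum_nonneg: "(\<And>x y. 0 \<le> F x y) \<Longrightarrow> 0 \<le> curve_sum Z n i F \<omega>"
  unfolding curve_sum_def using wt_nonneg Z_nonneg by (auto intro!: mult_nonneg_nonneg sum_nonneg)

lemma dev_add:
  assumes "bdd_fun F" "bdd_fun H" shows "dev Z n (\<lambda>x y. F x y + H x y) \<omega> = dev Z n F \<omega> + dev Z n H \<omega>"
proof -
  have "expectation (curve_sum Z n i (\<lambda>x y. F x y + H x y)) = expectation (curve_sum Z n i F) + expectation (curve_sum Z n i H)" for i
    using curve_sum_int[OF assms(1)] curve_sum_int[OF assms(2)] unfolding curve_sum_add by simp
  then show ?thesis unfolding dev_def curve_sum_add by (simp add: sum.distrib sum_subtractf add_divide_distrib diff_divide_distrib)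
qed

lemma dev_scale: "dev Z n (\<lambda>x y. c * F x y) \<omega> = c * dev Z n F \<omega>"
proof -
  have "expectation (curve_sum Z n i (\<lambda>x y. c * F x y)) = c * expectation (curve_sum Z n i F)" for i
    unfolding curve_sum_scale by simp
  then show ?thesis unfolding dev_def curve_sum_scale by (simp add: right_diff_distrib[symmetric] sum_distrib_left[symmetric])
qed

text \<open>A crude bound whose constant depends on the outcome and the sample size. It serves to
  pass from step functions to kernels, where the sup-norm error \<open>e\<close> tends to 0 with
  everything else fixed.\<close>

lemma dev_bound:
  assumes F: "bdd_fun F" and e: "\<And>x y. \<bar>F x y\<bar> \<le> e"
  shows "\<bar>dev Z n F \<omega>\<bar> \<le> ((\<Sum>i<n. curve_sum Z n i (\<lambda>_ _. 1) \<omega> + expectation (curve_sum Z n i (\<lambda>_ _. 1))) / real n) * e"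
proof -
  have one: "bdd_fun (\<lambda>_ _. c)" for c by (auto simp: bdd_fun_def)
  have c: "curve_sum Z n i (\<lambda>_ _. c) \<omega> = c * curve_sum Z n i (\<lambda>_ _. 1) \<omega>" for i c \<omega>
    using curve_sum_scale[of n i c "\<lambda>_ _. 1"] by simp
  have le: "\<bar>curve_sum Z n i F \<omega>\<bar> \<le> e * curve_sum Z n i (\<lambda>_ _. 1) \<omega>" for i \<omega>
    using curve_sum_mono[of F "\<lambda>_ _. e" n i \<omega>] curve_sum_mono[of "\<lambda>_ _. - e" F n i \<omega>] e
    unfolding c[of _ e] c[of _ "-e"] by (auto simp: abs_le_iff minus_le_iff)
  have le': "\<bar>expectation (curve_sum Z n i F)\<bar> \<le> e * expectation (curve_sum Z n i (\<lambda>_ _. 1))" for i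
  proof -
    have "\<bar>expectation (curve_sum Z n i F)\<bar> \<le> expectation (\<lambda>\<omega>. \<bar>curve_sum Z n i F \<omega>\<bar>)"
      by (rule integral_abs_bound)
    also have "\<dots> \<le> expectation (\<lambda>\<omega>. e * curve_sum Z n i (\<lambda>_ _. 1) \<omega>)"
      using curve_sum_int[OF F] curve_sum_int[OF one] le by (intro integral_mono) auto
    finally show ?thesis by simp
  qed
  have "\<bar>\<Sum>i<n. curve_sum Z n i F \<omega> - expectation (curve_sum Z n i F)\<bar>
      \<le> (\<Sum>i<n. \<bar>curve_sum Z n i F \<omega> - expectation (curve_sum Z n i F)\<bar>)" by (rule sum_abs)
  also have "\<dots> \<le> (\<Sum>i<n. e * (curve_sum Z n i (\<lambda>_ _. 1) \<omega> + expectation (curve_sum Z n i (\<lambda>_ _. 1))))"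
  proof (rule sum_mono)
    fix i show "\<bar>curve_sum Z n i F \<omega> - expectation (curve_sum Z n i F)\<bar> \<le> e * (curve_sum Z n i (\<lambda>_ _. 1) \<omega> + expectation (curve_sum Z n i (\<lambda>_ _. 1)))"
      using le[of i \<omega>] le'[of i] by (simp add: distrib_left)
  qed
  finally show ?thesis unfolding dev_def by (simp add: abs_divide sum_distrib_left[symmetric] mult.commute divide_right_mono)
qed

text \<open>For \<open>q < p\<close> the box is empty, so intervals shorter than the mesh, whose
  inner range is empty, need no separate treatment.\<close>

definition grid_box :: "real \<Rightarrow> int \<times> int \<times> int \<times> int \<Rightarrow> real \<Rightarrow> real \<Rightarrow> real" where
  "grid_box \<delta> = (\<lambda>(p, q, p', q') x y. indicator {\<delta> * real_of_int p .. \<delta> * real_of_int q} x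
     * indicator {\<delta> * real_of_int p' .. \<delta> * real_of_int q'} y)"

lemma bdd_fun_product:
  assumes "bounded_borel f" "bounded_borel g" shows "bdd_fun (\<lambda>x y. f x * g y)"
proof -
  obtain B C where B: "\<And>u. \<bar>f u\<bar> \<le> B" and C: "\<And>u. \<bar>g u\<bar> \<le> C"
    and [measurable]: "f \<in> borel_measurable borel" "g \<in> borel_measurable borel"
    using assms by (auto simp: bounded_borel_def)
  have "\<bar>f x * g y\<bar> \<le> B * C" for x y
    unfolding abs_mult using B[of x] C[of y] by (intro mult_mono) auto
  moreover have "(\<lambda>(x, y). f x * g y) \<in> borel_measurable (borel \<Otimes>\<^sub>M borel)" by measurable
  ultimately show ?thesis unfolding bdd_fun_def borel_prod by blast
qed

lemma bdd_fun_grid_box: "bdd_fun (grid_box \<delta> \<theta>)"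
  unfolding grid_box_def by (cases \<theta>) (auto intro!: bdd_fun_product bounded_borel_indicator)

lemma bounded_borel_rescale:
  assumes "bounded_borel f" shows "bounded_borel (\<lambda>x. f ((x - c) / h))"
proof -
  obtain B where "\<And>u. \<bar>f u\<bar> \<le> B" and [measurable]: "f \<in> borel_measurable borel"
    using assms by (auto simp: bounded_borel_def)
  then show ?thesis unfolding bounded_borel_def by (intro conjI exI[of _ B]) auto
qed

text \<open>
  Control on boxes of a grid of mesh \<open>1 / n\<^sup>2\<close> suffices: every product of intervals lies between two
  such boxes whose expected masses differ by a multiple of the mesh.
\<close>

lemma dev_interval_le:
  assumes h: "0 < h" "h \<le> 1" and \<delta>: "0 < \<delta>" "\<delta> \<le> h"
    and s: "s \<in> {a..b}" and t: "t \<in> {a..b}"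
    and I: "is_interval I" "I \<subseteq> {-1..1}" and J: "is_interval J" "J \<subseteq> {-1..1}"
    and n: "0 < n"
    and grid: "\<And>p q p' q'. \<delta> * (real_of_int q - real_of_int p) \<le> 4 * h \<Longrightarrow> \<delta> * (real_of_int q' - real_of_int p') \<le> 4 * h \<Longrightarrow>
       (\<forall>r\<in>{p, q, p', q'}. \<bar>\<delta> * real_of_int r\<bar> \<le> \<bar>a\<bar> + \<bar>b\<bar> + 3) \<Longrightarrow> \<bar>dev Z n (grid_box \<delta> (p, q, p', q')) \<omega>\<bar> \<le> \<epsilon>"
    and strip: "\<And>c. (\<Sum>i<n. expectation (curve_sum Z n i (\<lambda>x y. indicator {c .. c + \<delta>} x))) \<le> real n * (C * \<delta>)"
      "\<And>c. (\<Sum>i<n. expectation (curve_sum Z n i (\<lambda>x y. indicator {c .. c + \<delta>} y))) \<le> real n * (C * \<delta>)"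
  shows "\<bar>dev Z n (\<lambda>x y. indicator I ((x - s) / h) * indicator J ((y - t) / h)) \<omega>\<bar> \<le> \<epsilon> + 4 * C * \<delta>"
proof -
  let ?r = real_of_int
  obtain p q where p: "\<delta> * (?r q - ?r p) \<le> 2 * h + 2 * \<delta>" "\<bar>\<delta> * ?r p\<bar> \<le> \<bar>s\<bar> + h + \<delta>" "\<bar>\<delta> * ?r q\<bar> \<le> \<bar>s\<bar> + h + \<delta>"
      "\<And>x. \<delta> * ?r (p + 1) \<le> x \<Longrightarrow> x \<le> \<delta> * ?r (q - 1) \<Longrightarrow> (x - s) / h \<in> I"
      "\<And>x. (x - s) / h \<in> I \<Longrightarrow> \<delta> * ?r p \<le> x \<and> x \<le> \<delta> * ?r q"
    using interval_sandwich[OF I h(1) \<delta>(1), of s] by blast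
  obtain p' q' where p': "\<delta> * (?r q' - ?r p') \<le> 2 * h + 2 * \<delta>" "\<bar>\<delta> * ?r p'\<bar> \<le> \<bar>t\<bar> + h + \<delta>" "\<bar>\<delta> * ?r q'\<bar> \<le> \<bar>t\<bar> + h + \<delta>"
      "\<And>x. \<delta> * ?r (p' + 1) \<le> x \<Longrightarrow> x \<le> \<delta> * ?r (q' - 1) \<Longrightarrow> (x - t) / h \<in> J"
      "\<And>x. (x - t) / h \<in> J \<Longrightarrow> \<delta> * ?r p' \<le> x \<and> x \<le> \<delta> * ?r q'"
    using interval_sandwich[OF J h(1) \<delta>(1), of t] by blast
  let ?F = "\<lambda>x y. indicator I ((x - s) / h) * indicator J ((y - t) / h) :: real"
  let ?U = "grid_box \<delta> (p, q, p', q')" and ?L = "grid_box \<delta> (p + 1, q - 1, p' + 1, q' - 1)"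
  let ?S1 = "\<lambda>r x y. indicator {\<delta> * ?r r .. \<delta> * ?r r + \<delta>} x :: real" and ?S2 = "\<lambda>r x y. indicator {\<delta> * ?r r .. \<delta> * ?r r + \<delta>} y :: real"
  let ?S = "\<lambda>x y. (?S1 p x y + ?S1 (q - 1) x y) + (?S2 p' x y + ?S2 (q' - 1) x y)"
  have bF: "bdd_fun ?F"
    using bdd_fun_product[OF bounded_borel_rescale bounded_borel_rescale, OF bounded_borel_indicator bounded_borel_indicator]
      real_interval_borel_measurable[OF I(1)] real_interval_borel_measurable[OF J(1)] by blast
  have one: "bounded_borel (\<lambda>_. 1)" by (auto simp: bounded_borel_def)
  have bS1: "bdd_fun (?S1 r)" and bS2: "bdd_fun (?S2 r)" for r
    using bdd_fun_product[OF bounded_borel_indicator one, of "{\<delta> * ?r r .. \<delta> * ?r r + \<delta>}"]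
      bdd_fun_product[OF one bounded_borel_indicator, of "{\<delta> * ?r r .. \<delta> * ?r r + \<delta>}"] by simp_all
  have LF: "?L x y \<le> ?F x y" for x y
    using p(4)[of x] p'(4)[of y] unfolding grid_box_def by (auto simp: indicator_def)
  have FU: "?F x y \<le> ?U x y" for x y
    using p(5)[of x] p'(5)[of y] unfolding grid_box_def by (auto simp: indicator_def)
  \<comment> \<open>A point of the outer box outside the inner one lies in one of four strips of
    width \<delta>, one along each side.\<close>
  have UL: "?U x y \<le> ?L x y + ?S x y" for x y
    unfolding grid_box_def by (auto simp: indicator_def algebra_simps)
  \<comment> \<open>Outer corners lie within \<open>\<bar>a\<bar> + \<bar>b\<bar> + 2\<close> of 0,
    inner ones one mesh further at most; this explains the 3 in \<open>grid\<close>. The side length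
    \<open>2 * h + 2 * \<delta>\<close> is at most \<open>4 * h\<close> because
    \<open>\<delta> \<le> h\<close>.\<close>
  have rng: "\<bar>s\<bar> + h + \<delta> \<le> \<bar>a\<bar> + \<bar>b\<bar> + 2" "\<bar>t\<bar> + h + \<delta> \<le> \<bar>a\<bar> + \<bar>b\<bar> + 2" using s t h \<delta> by auto
  have r1: "\<bar>\<delta> * ?r (r + 1)\<bar> \<le> \<bar>\<delta> * ?r r\<bar> + \<delta>" "\<bar>\<delta> * ?r (r - 1)\<bar> \<le> \<bar>\<delta> * ?r r\<bar> + \<delta>" for r
    using \<delta> abs_triangle_ineq[of "\<delta> * ?r r" \<delta>] abs_triangle_ineq4[of "\<delta> * ?r r" \<delta>] by (simp_all add: algebra_simps)
  have dU: "\<bar>dev Z n ?U \<omega>\<bar> \<le> \<epsilon>"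
  proof (rule grid)
    show "\<delta> * (?r q - ?r p) \<le> 4 * h" "\<delta> * (?r q' - ?r p') \<le> 4 * h" using p(1) p'(1) \<delta> by linarith+
    have "x \<le> \<bar>a\<bar> + \<bar>b\<bar> + 3" if "x \<le> w" "w \<le> \<bar>a\<bar> + \<bar>b\<bar> + 2" for x w :: real
      using that by linarith
    then show "\<forall>r\<in>{p, q, p', q'}. \<bar>\<delta> * ?r r\<bar> \<le> \<bar>a\<bar> + \<bar>b\<bar> + 3"
      using p(2,3) p'(2,3) rng by blast
  qed
  have dL: "\<bar>dev Z n ?L \<omega>\<bar> \<le> \<epsilon>"
  proof (rule grid)
    have "\<delta> * (?r (q - 1) - ?r (p + 1)) \<le> \<delta> * (?r q - ?r p)" "\<delta> * (?r (q' - 1) - ?r (p' + 1)) \<le> \<delta> * (?r q' - ?r p')"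
      using \<delta> by (auto intro!: mult_left_mono)
    then show "\<delta> * (?r (q - 1) - ?r (p + 1)) \<le> 4 * h" "\<delta> * (?r (q' - 1) - ?r (p' + 1)) \<le> 4 * h"
      using p(1) p'(1) \<delta> h by linarith+
    show "\<forall>r\<in>{p + 1, q - 1, p' + 1, q' - 1}. \<bar>\<delta> * ?r r\<bar> \<le> \<bar>a\<bar> + \<bar>b\<bar> + 3"
    proof -
      have hlp: "x \<le> \<bar>a\<bar> + \<bar>b\<bar> + 3" if "x \<le> y + \<delta>" "y \<le> w" "w \<le> \<bar>a\<bar> + \<bar>b\<bar> + 2" for x y w :: real
        using that \<delta> h by linarith
      show ?thesis
        using hlp[OF r1(1) p(2) rng(1)] hlp[OF r1(2) p(3) rng(1)] hlp[OF r1(1) p'(2) rng(2)] hlp[OF r1(2) p'(3) rng(2)]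
        by blast
    qed
  qed
  let ?e = "\<lambda>F. \<Sum>i<n. expectation (curve_sum Z n i F)" and ?c = "\<lambda>F. \<Sum>i<n. curve_sum Z n i F \<omega>"
  have e_mono: "?e F \<le> ?e H" if "bdd_fun F" "bdd_fun H" "\<And>x y. F x y \<le> H x y" for F H
    using that by (intro sum_mono integral_mono curve_sum_int curve_sum_mono)
  have c_mono: "?c F \<le> ?c H" if "\<And>x y. F x y \<le> H x y" for F H
    using that by (intro sum_mono curve_sum_mono)
  have bdd_fun_add: "bdd_fun (\<lambda>x y. F x y + H x y)" if F: "bdd_fun F" and H: "bdd_fun H" for F H
  proof -
    obtain B C where "\<And>x y. \<bar>F x y\<bar> \<le> B" "\<And>x y. \<bar>H x y\<bar> \<le> C" using F H by (auto simp: bdd_fun_def)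
    then have "\<forall>x y. \<bar>F x y + H x y\<bar> \<le> B + C" by (meson abs_triangle_ineq add_mono order_trans)
    moreover have "(\<lambda>(x, y). F x y + H x y) \<in> borel_measurable borel"
      using F H borel_measurable_add[of "\<lambda>(x, y). F x y" borel "\<lambda>(x, y). H x y"] by (simp add: bdd_fun_def case_prod_beta')
    ultimately show ?thesis unfolding bdd_fun_def by blast
  qed
  have e_add: "?e (\<lambda>x y. F x y + H x y) = ?e F + ?e H" if "bdd_fun F" "bdd_fun H" for F H
    using curve_sum_int[OF that(1)] curve_sum_int[OF that(2)] unfolding curve_sum_add by (simp add: sum.distrib)
  have "?e ?U \<le> ?e (\<lambda>x y. ?L x y + ?S x y)"
    by (intro e_mono bdd_fun_add bdd_fun_grid_box bS1 bS2 UL)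
  also have "\<dots> = ?e ?L + ((?e (?S1 p) + ?e (?S1 (q - 1))) + (?e (?S2 p') + ?e (?S2 (q' - 1))))"
    by (simp only: e_add bdd_fun_add bdd_fun_grid_box bS1 bS2)
  also have "\<dots> \<le> ?e ?L + real n * (4 * C * \<delta>)"
    using strip(1)[of "\<delta> * ?r p"] strip(1)[of "\<delta> * ?r (q - 1)"] strip(2)[of "\<delta> * ?r p'"] strip(2)[of "\<delta> * ?r (q' - 1)"]
    by (simp add: algebra_simps)
  finally have eUL: "?e ?U - ?e ?L \<le> real n * (4 * C * \<delta>)" by simp
  have eLF: "?e ?L \<le> ?e ?F" and eFU: "?e ?F \<le> ?e ?U" by (intro e_mono bF bdd_fun_grid_box LF FU)+
  have cLF: "?c ?L \<le> ?c ?F" and cFU: "?c ?F \<le> ?c ?U" by (intro c_mono LF FU)+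
  have dv: "dev Z n F \<omega> = (?c F - ?e F) / real n" for F unfolding dev_def by (simp add: sum_subtractf)
  have "dev Z n ?F \<omega> \<le> (?c ?U - ?e ?U + real n * (4 * C * \<delta>)) / real n"
    unfolding dv using eUL eLF cFU by (intro divide_right_mono) auto
  also have "\<dots> = dev Z n ?U \<omega> + 4 * C * \<delta>" unfolding dv using n by (simp add: add_divide_distrib)
  finally have up: "dev Z n ?F \<omega> \<le> \<epsilon> + 4 * C * \<delta>" using dU by linarith
  have "(?c ?L - ?e ?L - real n * (4 * C * \<delta>)) / real n \<le> dev Z n ?F \<omega>"
    unfolding dv using eUL eFU cLF by (intro divide_right_mono) auto
  moreover have "(?c ?L - ?e ?L - real n * (4 * C * \<delta>)) / real n = dev Z n ?L \<omega> - 4 * C * \<delta>"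
    unfolding dv using n by (simp add: diff_divide_distrib)
  ultimately show ?thesis using up dL by linarith
qed

text \<open>The bound for finite classes is applied to the boxes of the grid. \<open>strip\<close>
  turns the gap between outer and inner box into a multiple of the mesh, \<open>mesh\<close> puts
  that multiple below the stochastic rate, and \<open>h_ge\<close> keeps the mesh finer than the
  window.\<close>

lemma AE_dev_intervals:
  fixes V :: "nat \<Rightarrow> 'a \<Rightarrow> real" and \<beta> h :: "nat \<Rightarrow> real"
  assumes V_meas: "\<And>i. V i \<in> borel_measurable (G i)"
    and dom: "AE \<omega> in M. \<forall>n. \<forall>i<n. curve_sum Z n i (\<lambda>_ _. 1) \<omega> powr l \<le> V i \<omega>"
    and V_int: "\<And>i. integrable M (V i)" and V_mean: "\<And>i. expectation (V i) \<le> v"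
    and V_avg: "AE \<omega> in M. \<exists>B. \<forall>n. (\<Sum>i<n. V i \<omega>) \<le> B * real n"
    and sq_int: "\<And>n i. i < n \<Longrightarrow> integrable M (\<lambda>\<omega>. (curve_sum Z n i (\<lambda>_ _. 1) \<omega>)\<^sup>2)"
    and second: "\<And>n c d c' d'. 0 < n \<Longrightarrow> c \<le> d \<Longrightarrow> d - c \<le> 4 * h n \<Longrightarrow> c' \<le> d' \<Longrightarrow> d' - c' \<le> 4 * h n \<Longrightarrow>
       (\<Sum>i<n. expectation (\<lambda>\<omega>. (curve_sum Z n i (\<lambda>x y. indicator {c..d} x * indicator {c'..d'} y) \<omega>)\<^sup>2)) \<le> C * real n * \<beta> n"
    and strip: "\<And>n c d. 0 < n \<Longrightarrow> 0 < d \<Longrightarrow> (\<Sum>i<n. expectation (curve_sum Z n i (\<lambda>x y. indicator {c .. c + d} x))) \<le> real n * (C' * d)"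
      "\<And>n c d. 0 < n \<Longrightarrow> 0 < d \<Longrightarrow> (\<Sum>i<n. expectation (curve_sum Z n i (\<lambda>x y. indicator {c .. c + d} y))) \<le> real n * (C' * d)"
    and C: "0 \<le> C" and h_pos: "\<And>n. 0 < h n" and h_lim: "h \<longlonglongrightarrow> 0"
    and h_ge: "\<forall>\<^sub>F n in sequentially. 1 / (real n)\<^sup>2 \<le> h n"
    and \<beta>_pos: "\<forall>\<^sub>F n in sequentially. 0 < \<beta> n"
    and l: "2 < l" and rate: "(\<lambda>n. inverse (\<beta> n) * (ln (real n) / real n) powr (1 - 2 / l)) \<longlonglongrightarrow> 0"
    and mesh: "\<forall>\<^sub>F n in sequentially. 1 / (real n)\<^sup>2 \<le> sqrt (\<beta> n * (ln (real n) / real n))"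
  shows "AE \<omega> in M. \<exists>B. \<forall>\<^sub>F n in sequentially. \<forall>s\<in>{a..b}. \<forall>t\<in>{a..b}. \<forall>I J.
     is_interval I \<longrightarrow> I \<subseteq> {-1..1} \<longrightarrow> is_interval J \<longrightarrow> J \<subseteq> {-1..1} \<longrightarrow>
     \<bar>dev Z n (\<lambda>x y. indicator I ((x - s) / h n) * indicator J ((y - t) / h n)) \<omega>\<bar> \<le> B * sqrt (\<beta> n * (ln (real n) / real n))"
proof -
  \<comment> \<open>Corner coordinates are bounded by \<open>N\<close>, so at mesh
    \<open>1 / n ^ 2\<close> their indices are at most \<open>N * n ^ 2\<close> in modulus and the
    number of boxes grows no faster than \<open>n ^ 8\<close>.\<close>
  define N where "N = nat \<lceil>\<bar>a\<bar> + \<bar>b\<bar> + 3\<rceil>"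
  have N: "\<bar>a\<bar> + \<bar>b\<bar> + 3 \<le> real N" unfolding N_def by linarith
  define \<delta> where "\<delta> n = 1 / (real n)\<^sup>2" for n :: nat
  define rng where "rng n = {- int (N * n ^ 2) .. int (N * n ^ 2)}" for n :: nat
  \<comment> \<open>The class is empty for \<open>n = 0\<close> because the cardinality bound
    vanishes there: \<open>0 ^ 8 = 0\<close>.\<close>
  define \<Theta> where "\<Theta> n = (if n = 0 then {} else {(p, q, p', q'). p \<in> rng n \<and> q \<in> rng n \<and> p' \<in> rng n \<and> q' \<in> rng n \<and>
     \<delta> n * (real_of_int q - real_of_int p) \<le> 4 * h n \<and> \<delta> n * (real_of_int q' - real_of_int p') \<le> 4 * h n})" for n
  have sub: "\<Theta> n \<subseteq> rng n \<times> rng n \<times> rng n \<times> rng n" for n unfolding \<Theta>_def by auto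
  have fin: "finite (\<Theta> n)" for n by (rule finite_subset[OF sub]) (auto simp: rng_def)
  have card: "real (card (\<Theta> n)) \<le> (3 * real N) ^ 4 * real n ^ 8" for n
  proof (cases "n = 0")
    case False
    have "card (\<Theta> n) \<le> card (rng n \<times> rng n \<times> rng n \<times> rng n)" by (rule card_mono[OF _ sub]) (auto simp: rng_def)
    also have "\<dots> = (card (rng n)) ^ 4" by (simp add: card_cartesian_product power4_eq_xxxx mult_ac)
    also have "card (rng n) = 2 * (N * n ^ 2) + 1" unfolding rng_def by (simp add: nat_eq_iff)
    also have "2 * (N * n ^ 2) + 1 \<le> 3 * N * n ^ 2"
    proof -
      have "0 < N" using N by (cases "N = 0") auto
      then have "1 \<le> N * n ^ 2" using False by simp
      then show ?thesis by linarith
    qed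
    finally have "card (\<Theta> n) \<le> (3 * N * n ^ 2) ^ 4" by (simp add: power_mono)
    then have "real (card (\<Theta> n)) \<le> real ((3 * N * n ^ 2) ^ 4)" by (rule of_nat_mono)
    then show ?thesis by (simp add: power_mult_distrib power_mult[symmetric])
  qed (simp add: \<Theta>_def)
  let ?D = "\<lambda>n i \<theta>. curve_sum Z n i (grid_box (\<delta> n) \<theta>)"
  have grid_box01: "0 \<le> grid_box d \<theta> x y \<and> grid_box d \<theta> x y \<le> 1" for d \<theta> x y
    unfolding grid_box_def by (cases \<theta>) (auto simp: indicator_def)
  have D0: "0 \<le> ?D n i \<theta> \<omega>" for n i \<theta> \<omega> by (intro curve_sum_nonneg) (use grid_box01 in auto)
  have D1: "?D n i \<theta> \<omega> \<le> curve_sum Z n i (\<lambda>_ _. 1) \<omega>" for n i \<theta> \<omega>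
    by (intro curve_sum_mono) (use grid_box01 in auto)
  have D_meas: "?D n i \<theta> \<in> borel_measurable (G i)" for n i \<theta>
  proof -
    have [measurable]: "(\<lambda>(x, y). grid_box (\<delta> n) \<theta> x y) \<in> borel_measurable (borel \<Otimes>\<^sub>M borel)"
      using bdd_fun_grid_box by (simp add: bdd_fun_def borel_prod)
    note [measurable] = Z_meas T_meas
    show ?thesis unfolding curve_sum_def case_prod_beta
      by (intro borel_measurable_times borel_measurable_sum borel_measurable_const) measurable
  qed
  have D_int: "integrable M (\<lambda>\<omega>. (?D n i \<theta> \<omega>)\<^sup>2)" if "i < n" for n i \<theta>
  proof (rule Bochner_Integration.integrable_bound[OF sq_int[OF that]])
    show "(\<lambda>\<omega>. (?D n i \<theta> \<omega>)\<^sup>2) \<in> borel_measurable M" using sub_G[OF D_meas] by measurable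
    show "AE \<omega> in M. norm ((?D n i \<theta> \<omega>)\<^sup>2) \<le> norm ((curve_sum Z n i (\<lambda>_ _. 1) \<omega>)\<^sup>2)"
      using power_mono[OF D1 D0, of n i \<theta> _ 2] by (intro AE_I2) auto
  qed
  have D_second: "(\<Sum>i<n. expectation (\<lambda>\<omega>. (?D n i \<theta> \<omega>)\<^sup>2)) \<le> C * real n * \<beta> n"
    if n: "0 < n" and b: "0 < \<beta> n" and th: "\<theta> \<in> \<Theta> n" for n \<theta>
  proof -
    obtain p q p' q' where \<theta>: "\<theta> = (p, q, p', q')" by (cases \<theta>) auto
    show ?thesis
    proof (cases "p \<le> q \<and> p' \<le> q'")
      case True
      have "\<delta> n * real_of_int p \<le> \<delta> n * real_of_int q" "\<delta> n * real_of_int p' \<le> \<delta> n * real_of_int q'"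
        using True by (auto intro!: mult_left_mono divide_right_mono simp: \<delta>_def)
      moreover have "\<delta> n * real_of_int q - \<delta> n * real_of_int p \<le> 4 * h n" "\<delta> n * real_of_int q' - \<delta> n * real_of_int p' \<le> 4 * h n"
        using th n unfolding \<theta> \<Theta>_def by (auto simp: right_diff_distrib)
      ultimately show ?thesis unfolding \<theta> grid_box_def by (simp add: second[OF n])
    next
      case False
      have "grid_box (\<delta> n) \<theta> = (\<lambda>_ _. 0)"
      proof (intro ext)
        have "0 < \<delta> n" using n by (simp add: \<delta>_def)
        then have "\<not> \<delta> n * real_of_int p \<le> \<delta> n * real_of_int q \<or> \<not> \<delta> n * real_of_int p' \<le> \<delta> n * real_of_int q'"
          using False by auto
        then show "grid_box (\<delta> n) \<theta> x y = 0" for x y unfolding \<theta> grid_box_def by (auto simp: indicator_def)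
      qed
      then have "?D n i \<theta> \<omega> = 0" for i \<omega> by (simp add: curve_sum_def)
      then show ?thesis using C b by simp
    qed
  qed
  have dom': "AE \<omega> in M. \<forall>n. \<forall>i<n. \<forall>\<theta>\<in>\<Theta> n. ?D n i \<theta> \<omega> powr l \<le> V i \<omega>"
    using dom
  proof eventually_elim
    case (elim \<omega>)
    show ?case
    proof (intro allI impI ballI)
      fix n i :: nat and \<theta> assume "i < n"
      have "?D n i \<theta> \<omega> powr l \<le> curve_sum Z n i (\<lambda>_ _. 1) \<omega> powr l" using l by (intro powr_mono2 D0 D1) auto
      then show "?D n i \<theta> \<omega> powr l \<le> V i \<omega>" using elim \<open>i < n\<close> order_trans by blast
    qed
  qed
  have "AE \<omega> in M. \<exists>B. \<forall>\<^sub>F n in sequentially. \<forall>\<theta>\<in>\<Theta> n. \<bar>dev Z n (grid_box (\<delta> n) \<theta>) \<omega>\<bar> \<le> B * sqrt (\<beta> n * (ln (real n) / real n))"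
    unfolding dev_def
  proof (rule AE_deviation_finite_classes[OF indep_G space_G D_meas V_meas D0 dom' V_int V_mean V_avg fin card])
    show "\<forall>\<^sub>F n in sequentially. \<forall>\<theta>\<in>\<Theta> n. (\<Sum>i<n. expectation (\<lambda>\<omega>. (?D n i \<theta> \<omega>)\<^sup>2)) \<le> C * real n * \<beta> n"
      using \<beta>_pos eventually_gt_at_top[of 0] by eventually_elim (use D_second in auto)
  qed (use D_int \<beta>_pos l rate in auto)
  then show ?thesis
  proof eventually_elim
    case (elim \<omega>)
    then obtain B where B: "\<forall>\<^sub>F n in sequentially. \<forall>\<theta>\<in>\<Theta> n. \<bar>dev Z n (grid_box (\<delta> n) \<theta>) \<omega>\<bar> \<le> B * sqrt (\<beta> n * (ln (real n) / real n))" by auto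
    have h1: "\<forall>\<^sub>F n in sequentially. h n < 1" using order_tendstoD(2)[OF h_lim, of 1] by simp
    have "\<forall>\<^sub>F n in sequentially. \<forall>s\<in>{a..b}. \<forall>t\<in>{a..b}. \<forall>I J.
       is_interval I \<longrightarrow> I \<subseteq> {-1..1} \<longrightarrow> is_interval J \<longrightarrow> J \<subseteq> {-1..1} \<longrightarrow>
       \<bar>dev Z n (\<lambda>x y. indicator I ((x - s) / h n) * indicator J ((y - t) / h n)) \<omega>\<bar>
         \<le> (B + 4 * \<bar>C'\<bar>) * sqrt (\<beta> n * (ln (real n) / real n))"
      using B h1 h_ge mesh eventually_gt_at_top[of 0]
    proof eventually_elim
      fix n :: nat
      assume Bn: "\<forall>\<theta>\<in>\<Theta> n. \<bar>dev Z n (grid_box (\<delta> n) \<theta>) \<omega>\<bar> \<le> B * sqrt (\<beta> n * (ln (real n) / real n))" (is "\<forall>\<theta>\<in>_. _ \<le> B * ?a")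
        and hn: "h n < 1" "1 / (real n)\<^sup>2 \<le> h n" and ms: "1 / (real n)\<^sup>2 \<le> sqrt (\<beta> n * (ln (real n) / real n))" and n: "0 < n"
      have d: "0 < \<delta> n" "\<delta> n \<le> h n" "\<delta> n \<le> ?a" using n hn ms by (auto simp: \<delta>_def)
      show "\<forall>s\<in>{a..b}. \<forall>t\<in>{a..b}. \<forall>I J.
         is_interval I \<longrightarrow> I \<subseteq> {-1..1} \<longrightarrow> is_interval J \<longrightarrow> J \<subseteq> {-1..1} \<longrightarrow>
         \<bar>dev Z n (\<lambda>x y. indicator I ((x - s) / h n) * indicator J ((y - t) / h n)) \<omega>\<bar> \<le> (B + 4 * \<bar>C'\<bar>) * ?a"
      proof (intro ballI allI impI)
        fix s t :: real and I J :: "real set"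
        assume st: "s \<in> {a..b}" "t \<in> {a..b}" and IJ: "is_interval I" "I \<subseteq> {-1..1}" "is_interval J" "J \<subseteq> {-1..1}"
        have "\<bar>dev Z n (\<lambda>x y. indicator I ((x - s) / h n) * indicator J ((y - t) / h n)) \<omega>\<bar> \<le> B * ?a + 4 * C' * \<delta> n"
        proof (rule dev_interval_le[OF h_pos _ d(1,2) st IJ n _ strip[OF n d(1)]])
          show "h n \<le> 1" using hn by simp
          fix p q p' q' :: int
          assume len: "\<delta> n * (real_of_int q - real_of_int p) \<le> 4 * h n" "\<delta> n * (real_of_int q' - real_of_int p') \<le> 4 * h n"
            and bd: "\<forall>r\<in>{p, q, p', q'}. \<bar>\<delta> n * real_of_int r\<bar> \<le> \<bar>a\<bar> + \<bar>b\<bar> + 3"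
          have "r \<in> rng n" if "r \<in> {p, q, p', q'}" for r
          proof -
            have "\<bar>\<delta> n * real_of_int r\<bar> \<le> real N" using bd that N order_trans by blast
            then have "\<bar>real_of_int r\<bar> \<le> real N * (real n)\<^sup>2" using n by (simp add: \<delta>_def abs_mult field_simps)
            then have "real_of_int \<bar>r\<bar> \<le> real_of_int (int (N * n ^ 2))" by simp
            then have "\<bar>r\<bar> \<le> int (N * n ^ 2)" by (simp only: of_int_le_iff)
            then show ?thesis unfolding rng_def by auto
          qed
          then have "(p, q, p', q') \<in> \<Theta> n" using len n unfolding \<Theta>_def by auto
          then show "\<bar>dev Z n (grid_box (\<delta> n) (p, q, p', q')) \<omega>\<bar> \<le> B * ?a" using Bn by blast
        qed
        also have "\<dots> \<le> B * ?a + 4 * \<bar>C'\<bar> * ?a"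
        proof -
          have "4 * C' * \<delta> n \<le> 4 * \<bar>C'\<bar> * \<delta> n" using d(1) by (intro mult_right_mono) auto
          also have "\<dots> \<le> 4 * \<bar>C'\<bar> * ?a" using d(3) by (intro mult_left_mono) auto
          finally show ?thesis by simp
        qed
        finally show "\<bar>dev Z n (\<lambda>x y. indicator I ((x - s) / h n) * indicator J ((y - t) / h n)) \<omega>\<bar> \<le> (B + 4 * \<bar>C'\<bar>) * ?a"
          by (simp add: distrib_right)
      qed
    qed
    then show ?case by blast
  qed
qed

text \<open>Two passes of the layer argument: first in \<open>x\<close> with an interval kept in
  \<open>y\<close>, then in \<open>y\<close> with the monotone kernel \<open>g1\<close> already in
  place. Neither pass enlarges \<epsilon>.\<close>

lemma dev_mono_kernels_le:
  assumes ints: "\<And>I J. is_interval I \<Longrightarrow> I \<subseteq> {-1..1} \<Longrightarrow> is_interval J \<Longrightarrow> J \<subseteq> {-1..1} \<Longrightarrow>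
       \<bar>dev Z n (\<lambda>x y. indicator I ((x - s) / h) * indicator J ((y - t) / h)) \<omega>\<bar> \<le> \<epsilon>"
    and g: "mono_kernel g1" "mono_kernel g2"
  shows "\<bar>dev Z n (\<lambda>x y. g1 ((x - s) / h) * g2 ((y - t) / h)) \<omega>\<bar> \<le> \<epsilon>"
proof -
  define K where "K = (\<Sum>i<n. curve_sum Z n i (\<lambda>_ _. 1) \<omega> + expectation (curve_sum Z n i (\<lambda>_ _. 1))) / real n"
  let ?P = "\<lambda>f k x y. f ((x - s) / h) * k ((y - t) / h) :: real"
  have bdd: "bdd_fun (?P f k)" if "bounded_borel f" "bounded_borel k" for f k
    using bdd_fun_product[OF bounded_borel_rescale[OF that(1)] bounded_borel_rescale[OF that(2)]] .
  have addL: "dev Z n (?P (\<lambda>u. f u + g u) k) \<omega> = dev Z n (?P f k) \<omega> + dev Z n (?P g k) \<omega>"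
    if "bounded_borel f" "bounded_borel g" "bounded_borel k" for f g k
    using dev_add[OF bdd[OF that(1,3)] bdd[OF that(2,3)], of n \<omega>] by (simp add: distrib_right)
  have addR: "dev Z n (?P k (\<lambda>u. f u + g u)) \<omega> = dev Z n (?P k f) \<omega> + dev Z n (?P k g) \<omega>"
    if "bounded_borel f" "bounded_borel g" "bounded_borel k" for f g k
    using dev_add[OF bdd[OF that(3,1)] bdd[OF that(3,2)], of n \<omega>] by (simp add: distrib_left)
  have scL: "dev Z n (?P (\<lambda>u. c * f u) k) \<omega> = c * dev Z n (?P f k) \<omega>" for c f k
    using dev_scale[of n c "?P f k" \<omega>] by (simp add: mult_ac)
  have scR: "dev Z n (?P k (\<lambda>u. c * f u)) \<omega> = c * dev Z n (?P k f) \<omega>" for c f k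
    using dev_scale[of n c "?P k f" \<omega>] by (simp add: mult_ac)
  have bd: "\<bar>dev Z n (?P f k) \<omega>\<bar> \<le> K * e" if "bounded_borel f" "bounded_borel k" "\<And>u v. \<bar>f u * k v\<bar> \<le> e" for f k e
    unfolding K_def by (rule dev_bound[OF bdd[OF that(1,2)]]) (rule that(3))
  have le1: "\<bar>f u * k v\<bar> \<le> e" if "\<bar>f u\<bar> \<le> e" "\<bar>k v\<bar> \<le> 1" for f k :: "real \<Rightarrow> real" and u v e
    using mult_mono[OF that] order_trans[OF abs_ge_zero that(1)] by (simp add: abs_mult)
  have one: "\<bar>dev Z n (?P g1 (indicator J)) \<omega>\<bar> \<le> \<epsilon>" if J: "is_interval J" "J \<subseteq> {-1..1}" for J
  proof (rule mono_kernel_functional_le[where C = K and D = "\<lambda>f. dev Z n (?P f (indicator J)) \<omega>"])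
    have bJ: "bounded_borel (indicator J)" by (intro bounded_borel_indicator real_interval_borel_measurable J)
    show "dev Z n (?P (\<lambda>u. f u + g u) (indicator J)) \<omega> = dev Z n (?P f (indicator J)) \<omega> + dev Z n (?P g (indicator J)) \<omega>"
      if "bounded_borel f" "bounded_borel g" for f g by (rule addL[OF that bJ])
    show "\<bar>dev Z n (?P f (indicator J)) \<omega>\<bar> \<le> K * e" if "bounded_borel f" "\<And>u. \<bar>f u\<bar> \<le> e" for f e
    proof (rule bd[OF that(1) bJ])
      fix u v show "\<bar>f u * indicator J v\<bar> \<le> e"
        using le1[of f u e "indicator J" v] that(2) by (simp add: indicator_def)
    qed
  qed (use scL ints[OF _ _ J] g in auto)
  show ?thesis
  proof (rule mono_kernel_functional_le[where C = K and D = "\<lambda>f. dev Z n (?P g1 f) \<omega>"])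
    have b1: "bounded_borel g1" by (rule mono_kernel_bounded_borel[OF g(1)])
    show "dev Z n (?P g1 (\<lambda>u. f u + g u)) \<omega> = dev Z n (?P g1 f) \<omega> + dev Z n (?P g1 g) \<omega>"
      if "bounded_borel f" "bounded_borel g" for f g by (rule addR[OF that b1])
    show "\<bar>dev Z n (?P g1 f) \<omega>\<bar> \<le> K * e" if "bounded_borel f" "\<And>u. \<bar>f u\<bar> \<le> e" for f e
    proof (rule bd[OF b1 that(1)])
      fix u v show "\<bar>g1 u * f v\<bar> \<le> e"
        using le1[of f v e g1 u] that(2) g(1) by (simp add: mult.commute mono_kernel_def)
    qed
  qed (use scR one g in auto)
qed

text \<open>The product of two Jordan forms consists of four products of monotone kernels, which
  gives \<open>4 * (c * d)\<close>. This constant is chosen before sample size, centre, bandwidth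
  and outcome, so uniformity in all of them is kept.\<close>

lemma dev_bv_kernels_le:
  assumes "bv_kernel \<phi>" "bv_kernel \<psi>"
  shows "\<exists>C\<ge>0. \<forall>n s t h \<omega> \<epsilon>. (\<forall>I J. is_interval I \<longrightarrow> I \<subseteq> {-1..1} \<longrightarrow> is_interval J \<longrightarrow> J \<subseteq> {-1..1} \<longrightarrow>
       \<bar>dev Z n (\<lambda>x y. indicator I ((x - s) / h) * indicator J ((y - t) / h)) \<omega>\<bar> \<le> \<epsilon>) \<longrightarrow>
     \<bar>dev Z n (\<lambda>x y. \<phi> ((x - s) / h) * \<psi> ((y - t) / h)) \<omega>\<bar> \<le> C * \<epsilon>"
proof -
  obtain c g1 g2 where g: "mono_kernel g1" "mono_kernel g2" "0 \<le> c" and \<phi>: "\<phi> = (\<lambda>u. c * (g1 u - g2 u))"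
    using assms(1) by (auto simp: bv_kernel_def)
  obtain d k1 k2 where k: "mono_kernel k1" "mono_kernel k2" "0 \<le> d" and \<psi>: "\<psi> = (\<lambda>u. d * (k1 u - k2 u))"
    using assms(2) by (auto simp: bv_kernel_def)
  show ?thesis
  proof (intro exI[of _ "4 * (c * d)"] conjI allI impI)
    show "0 \<le> 4 * (c * d)" using g k by simp
    fix n s t h \<omega> \<epsilon>
    assume *: "\<forall>I J. is_interval I \<longrightarrow> I \<subseteq> {-1..1} \<longrightarrow> is_interval J \<longrightarrow> J \<subseteq> {-1..1} \<longrightarrow>
       \<bar>dev Z n (\<lambda>x y. indicator I ((x - s) / h) * indicator J ((y - t) / h)) \<omega>\<bar> \<le> \<epsilon>"
    let ?P = "\<lambda>f k x y. f ((x - s) / h) * k ((y - t) / h) :: real"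
    have le: "\<bar>dev Z n (?P f f') \<omega>\<bar> \<le> \<epsilon>" if "mono_kernel f" "mono_kernel f'" for f f'
      by (rule dev_mono_kernels_le[OF _ that]) (use * in blast)
    have bd: "bdd_fun (?P f f')" if "mono_kernel f" "mono_kernel f'" for f f'
      using bdd_fun_product[OF bounded_borel_rescale bounded_borel_rescale] mono_kernel_bounded_borel that by blast
    have bds: "bdd_fun (\<lambda>x y. (- 1) * ?P f f' x y)" if "mono_kernel f" "mono_kernel f'" for f f'
      using bdd_fun_product[OF bounded_borel_scale[OF bounded_borel_rescale] bounded_borel_rescale, of f f' "-1"]
        mono_kernel_bounded_borel that by (simp add: mult.assoc)
    have ba: "bdd_fun (\<lambda>x y. ?P f k x y + (- 1) * ?P f k' x y)" if "mono_kernel f" "mono_kernel k" "mono_kernel k'" for f k k'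
    proof -
      have "bounded_borel (\<lambda>u. k u + (- 1) * k' u)"
        by (intro bounded_borel_add bounded_borel_scale mono_kernel_bounded_borel that)
      from bdd_fun_product[OF bounded_borel_rescale bounded_borel_rescale, OF mono_kernel_bounded_borel[OF that(1)] this]
      show ?thesis by (simp add: algebra_simps)
    qed
    have ba': "bdd_fun (\<lambda>x y. (- 1) * (?P f k x y + (- 1) * ?P f k' x y))" if "mono_kernel f" "mono_kernel k" "mono_kernel k'" for f k k'
      using ba[OF that(1,3,2)] by (simp add: algebra_simps)
    have "dev Z n (?P \<phi> \<psi>) \<omega> = dev Z n (\<lambda>x y. (c * d) * ((?P g1 k1 x y + (- 1) * ?P g1 k2 x y) + (- 1) * (?P g2 k1 x y + (- 1) * ?P g2 k2 x y))) \<omega>"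
      unfolding \<phi> \<psi> by (intro arg_cong[of _ _ "\<lambda>F. dev Z n F \<omega>"] ext) (simp add: algebra_simps)
    also have "\<dots> = (c * d) * ((dev Z n (?P g1 k1) \<omega> + (- 1) * dev Z n (?P g1 k2) \<omega>) + (- 1) * (dev Z n (?P g2 k1) \<omega> + (- 1) * dev Z n (?P g2 k2) \<omega>))"
      by (simp only: dev_scale dev_add bd bds ba ba' g k)
    finally have "\<bar>dev Z n (?P \<phi> \<psi>) \<omega>\<bar> = (c * d) * \<bar>(dev Z n (?P g1 k1) \<omega> + (- 1) * dev Z n (?P g1 k2) \<omega>) + (- 1) * (dev Z n (?P g2 k1) \<omega> + (- 1) * dev Z n (?P g2 k2) \<omega>)\<bar>"
      using g(3) k(3) by (simp only: abs_mult abs_of_nonneg)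
    also have "\<dots> \<le> (c * d) * (4 * \<epsilon>)"
      using le[OF g(1) k(1)] le[OF g(1) k(2)] le[OF g(2) k(1)] le[OF g(2) k(2)] g(3) k(3)
      by (intro mult_left_mono) auto
    finally show "\<bar>dev Z n (?P \<phi> \<psi>) \<omega>\<bar> \<le> 4 * (c * d) * \<epsilon>" by (simp add: mult_ac)
  qed
qed

end

subsection \<open>The sampling model\<close>

text \<open>Rectangles determine the product of two sigma-finite measures, and on rectangles the
  formula is independence of the two sigma-algebras. The targets may have different types, as for
  the outcome of a path paired with observation times.\<close>

lemma (in prob_space) indep_set_vars:
  assumes indep: "indep_set (sets A) (sets B)" and sp: "space A = space M" "space B = space M"
    and f: "f \<in> measurable A S" and g: "g \<in> measurable B N"
  shows "distr M (S \<Otimes>\<^sub>M N) (\<lambda>\<omega>. (f \<omega>, g \<omega>)) = distr M S f \<Otimes>\<^sub>M distr M N g"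
proof -
  have ev: "sets A \<subseteq> events" "sets B \<subseteq> events" using indep unfolding indep_sets2_eq by auto
  have fM[measurable]: "f \<in> measurable M S" using f ev sp by (auto simp: measurable_def)
  have gM[measurable]: "g \<in> measurable M N" using g ev sp by (auto simp: measurable_def)
  interpret S: prob_space "distr M S f" by (rule prob_space_distr) measurable
  interpret N: prob_space "distr M N g" by (rule prob_space_distr) measurable
  show ?thesis
  proof (rule pair_measure_eqI[symmetric])
    show "sigma_finite_measure (distr M S f)" "sigma_finite_measure (distr M N g)" by unfold_locales
    show "sets (distr M S f \<Otimes>\<^sub>M distr M N g) = sets (distr M (S \<Otimes>\<^sub>M N) (\<lambda>\<omega>. (f \<omega>, g \<omega>)))"
      by (simp cong: sets_pair_measure_cong)
    fix C D assume "C \<in> sets (distr M S f)" "D \<in> sets (distr M N g)"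
    then have [measurable]: "C \<in> sets S" "D \<in> sets N" by auto
    have "f -` C \<inter> space M \<in> sets A" "g -` D \<inter> space M \<in> sets B"
      using measurable_sets[OF f, of C] measurable_sets[OF g, of D] sp by auto
    then have "prob ((f -` C \<inter> space M) \<inter> (g -` D \<inter> space M)) = prob (f -` C \<inter> space M) * prob (g -` D \<inter> space M)"
      using indep unfolding indep_sets2_eq by blast
    moreover have "(\<lambda>\<omega>. (f \<omega>, g \<omega>)) -` (C \<times> D) \<inter> space M = (f -` C \<inter> space M) \<inter> (g -` D \<inter> space M)" by auto
    ultimately show "emeasure (distr M S f) C * emeasure (distr M N g) D = emeasure (distr M (S \<Otimes>\<^sub>M N) (\<lambda>\<omega>. (f \<omega>, g \<omega>))) (C \<times> D)"
      by (simp add: emeasure_distr emeasure_eq_measure ennreal_mult)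
  qed
qed

lemma (in prob_space) indep_set_integral:
  fixes f g :: "'a \<Rightarrow> real"
  assumes indep: "indep_set (sets A) (sets B)" and sp: "space A = space M" "space B = space M"
    and f: "f \<in> borel_measurable A" and g: "g \<in> borel_measurable B"
    and int: "integrable M f" "integrable M g"
  shows "integrable M (\<lambda>\<omega>. f \<omega> * g \<omega>)" "expectation (\<lambda>\<omega>. f \<omega> * g \<omega>) = expectation f * expectation g"
proof -
  have "indep_var borel f borel g"
    unfolding indep_var_distribution_eq using indep_set_vars[OF indep sp f g] int by auto
  then show "integrable M (\<lambda>\<omega>. f \<omega> * g \<omega>)" "expectation (\<lambda>\<omega>. f \<omega> * g \<omega>) = expectation f * expectation g"
    using indep_var_integrable indep_var_lebesgue_integral int by blast+
qed

locale fda_model = prob_space M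
  for M :: "'w measure" +
  fixes a b \<sigma> :: real and P :: "'p measure" and X :: "real \<Rightarrow> 'p \<Rightarrow> real" and \<xi> :: "nat \<Rightarrow> 'w \<Rightarrow> 'p"
    and T U :: "nat \<Rightarrow> nat \<Rightarrow> 'w \<Rightarrow> real" and f\<^sub>T :: "real \<Rightarrow> real" and m\<^sub>T M\<^sub>T :: real
  assumes ab: "a < b" and process: "second_order_process a b P X"
    and model: "sampling_model a b M P \<xi> T U f\<^sub>T \<sigma>"
    and m\<^sub>T: "0 < m\<^sub>T" and f\<^sub>T_bounds: "\<And>t. t \<in> {a..b} \<Longrightarrow> m\<^sub>T \<le> f\<^sub>T t \<and> f\<^sub>T t \<le> M\<^sub>T"
begin

lemma M\<^sub>T: "0 < M\<^sub>T" using m\<^sub>T f\<^sub>T_bounds[of a] ab by auto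

sublocale P: prob_space P
  using process by (simp add: second_order_process_def)

lemma \<xi>_meas[measurable]: "\<xi> i \<in> measurable M P" and distr_\<xi>: "distr M P (\<xi> i) = P"
  using model by (auto simp: sampling_model_def)

lemma T_range: "\<omega> \<in> space M \<Longrightarrow> a \<le> T i j \<omega> \<and> T i j \<omega> \<le> b"
  and T_distributed: "distributed M lborel (T i j) (\<lambda>t. ennreal (f\<^sub>T t * indicator {a..b} t))"
  using model by (auto simp: sampling_model_def)

lemma T_borel[measurable]: "T i j \<in> borel_measurable M"
  using distributed_measurable[OF T_distributed[of i j]] by simp

lemma U_borel[measurable]: "U i j \<in> borel_measurable M"
  and U_distr: "distr M borel (U i j) = distr M borel (U 0 0)"
  and U_mean: "expectation (U i j) = 0" and U_sq: "integrable M (\<lambda>\<omega>. (U i j \<omega>)\<^sup>2)"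
  using model unfolding sampling_model_def by blast+

definition I_ab where "I_ab = restrict_space borel {a..b}"

lemma space_I_ab: "space I_ab = {a..b}" by (simp add: I_ab_def space_restrict_space)

lemma X_meas: "(\<lambda>(t, p). X t p) \<in> borel_measurable (I_ab \<Otimes>\<^sub>M P)"
  using process by (simp add: second_order_process_def I_ab_def)

text \<open>A set of sources encoded as a measure space on the outcomes of \<open>M\<close>, so that
  dependence on these sources alone becomes a \<open>measurable\<close> statement.\<close>

definition sources :: "source set \<Rightarrow> 'w measure" where
  "sources A = sigma (space M) (\<Union>s\<in>A. source_events M P \<xi> T U s)"

lemma indep_sources: "indep_sets (source_events M P \<xi> T U) UNIV"
  using model by (simp add: sampling_model_def)

lemma source_events_Pow: "source_events M P \<xi> T U s \<subseteq> Pow (space M)"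
proof -
  have "source_events M P \<xi> T U s \<subseteq> events" using indep_sources by (simp add: indep_sets_def)
  then show ?thesis using sets.sets_into_space by blast
qed

lemma space_sources[simp]: "space (sources A) = space M" by (simp add: sources_def space_measure_of_conv)

lemma sets_sources: "sets (sources A) = sigma_sets (space M) (\<Union>s\<in>A. source_events M P \<xi> T U s)"
  unfolding sources_def using source_events_Pow by (intro sets_measure_of) auto

lemma Int_stable_source_events: "Int_stable (source_events M P \<xi> T U s)"
  by (cases s) (auto simp: Int_stable_def)

text \<open>Grouping principle: the events of each single source form an intersection-stable system,
  so independence of the sources extends to the sigma-algebras generated by disjoint groups.\<close>

lemma indep_sources_family:
  assumes "disjoint_family_on A J" shows "indep_sets (\<lambda>j. sets (sources (A j))) J"
  unfolding sets_sources
  by (intro indep_sets_collect_sigma Int_stable_source_events assms indep_sets_mono_index[OF _ indep_sources]) auto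

lemma indep_sources_pair:
  assumes "A \<inter> B = {}" shows "indep_set (sets (sources A)) (sets (sources B))"
proof -
  have "indep_sets (\<lambda>j. sets (sources (case_bool A B j))) UNIV"
    using assms by (intro indep_sources_family) (auto simp: disjoint_family_on_def split: bool.split)
  then show ?thesis unfolding indep_set_def by (rule indep_sets_mono_sets) (auto split: bool.split)
qed

lemma sets_sources_mono: "A \<subseteq> B \<Longrightarrow> sets (sources A) \<subseteq> sets (sources B)"
  unfolding sets_sources by (intro sigma_sets_subseteq) auto

lemma sources_mono: "A \<subseteq> B \<Longrightarrow> f \<in> measurable (sources A) N \<Longrightarrow> f \<in> measurable (sources B) N"
  using sets_sources_mono[of A B] by (auto simp: measurable_def)

lemma sources_sub: "f \<in> measurable (sources A) N \<Longrightarrow> f \<in> measurable M N"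
proof -
  assume f: "f \<in> measurable (sources A) N"
  have "sets (sources A) \<subseteq> events" using indep_sources_pair[of A "{}"] by (simp add: indep_sets2_eq)
  then show ?thesis using f by (auto simp: measurable_def)
qed

lemma measurable_sources:
  assumes s: "s \<in> A" and f: "f \<in> space M \<rightarrow> space N"
    and ev: "source_events M P \<xi> T U s = sets (vimage_algebra (space M) f N)"
  shows "f \<in> measurable (sources A) N"
proof (rule measurableI)
  show "f x \<in> space N" if "x \<in> space (sources A)" for x using f that by auto
  fix B assume "B \<in> sets N"
  then have "f -` B \<inter> space M \<in> source_events M P \<xi> T U s" unfolding ev by (rule in_vimage_algebra)
  then show "f -` B \<inter> space (sources A) \<in> sets (sources A)"
    unfolding sets_sources using s by (auto intro: sigma_sets.Basic)
qed

lemma \<xi>_sources: "Curve i \<in> A \<Longrightarrow> \<xi> i \<in> measurable (sources A) P"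
  using measurable_space[OF \<xi>_meas] by (auto intro!: measurable_sources)

lemma T_sources: "Time i j \<in> A \<Longrightarrow> T i j \<in> borel_measurable (sources A)"
  by (auto intro!: measurable_sources)

lemma U_sources: "Error i j \<in> A \<Longrightarrow> U i j \<in> borel_measurable (sources A)"
  by (auto intro!: measurable_sources)

lemma T_I_ab: "Time i j \<in> A \<Longrightarrow> T i j \<in> measurable (sources A) I_ab"
  unfolding I_ab_def using T_range T_sources by (auto intro!: measurable_restrict_space2)

lemma X_at_T: "Time i j \<in> A \<Longrightarrow> Curve i \<in> A \<Longrightarrow> (\<lambda>\<omega>. X (T i j \<omega>) (\<xi> i \<omega>)) \<in> borel_measurable (sources A)"
  using measurable_compose[OF measurable_Pair[OF T_I_ab \<xi>_sources] X_meas] by simp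

definition curve_sources :: "nat \<Rightarrow> source set" where
  "curve_sources i = {Curve i} \<union> range (Time i) \<union> range (Error i)"

text \<open>Everything on curve \<open>i\<close> except its observation times. An observation
  involves the curve at a random time and so mixes both kinds of source; its dominating variables
  live here and are therefore independent of the times.\<close>

definition amplitude_sources :: "nat \<Rightarrow> source set" where
  "amplitude_sources i = {Curve i} \<union> range (Error i)"

definition time_sources :: "nat \<Rightarrow> source set" where
  "time_sources i = range (Time i)"

lemma indep_curves: "indep_sets (\<lambda>i. sets (sources (curve_sources i))) UNIV"
  by (intro indep_sources_family) (auto simp: disjoint_family_on_def curve_sources_def)

lemma indep_amplitude_time: "indep_set (sets (sources (amplitude_sources i))) (sets (sources (time_sources i)))"
  by (intro indep_sources_pair) (auto simp: amplitude_sources_def time_sources_def)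

lemma source_subsets: "amplitude_sources i \<subseteq> curve_sources i" "time_sources i \<subseteq> curve_sources i"
  by (auto simp: amplitude_sources_def time_sources_def curve_sources_def)

lemma indep_T: "indep_vars (\<lambda>_. borel) (T i) UNIV"
  by (rule indep_vars_of_subalgebras[OF indep_sources_family[of "\<lambda>j. {Time i j}"]])
    (auto simp: disjoint_family_on_def intro!: T_sources)

lemma indep_U: "indep_vars (\<lambda>_. borel) (U i) UNIV"
  by (rule indep_vars_of_subalgebras[OF indep_sources_family[of "\<lambda>j. {Error i j}"]])
    (auto simp: disjoint_family_on_def intro!: U_sources)

lemma T_expectation:
  assumes [measurable]: "g \<in> borel_measurable borel"
  shows "expectation (\<lambda>\<omega>. g (T i j \<omega>)) = (\<integral>x. f\<^sub>T x * indicator {a..b} x * g x \<partial>lborel)"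
proof -
  have "0 \<le> f\<^sub>T x * indicator {a..b} x" for x
    using f\<^sub>T_bounds[of x] m\<^sub>T by (auto simp: indicator_def)
  then show ?thesis using distributed_integral[OF T_distributed, of g i j] by simp
qed

lemma f\<^sub>T_meas[measurable]: "(\<lambda>t. f\<^sub>T t * indicator {a..b} t) \<in> borel_measurable borel"
proof -
  have "(\<lambda>t. enn2real (ennreal (f\<^sub>T t * indicator {a..b} t))) \<in> borel_measurable lborel"
    using distributed_borel_measurable[OF T_distributed[of 0 0]] by measurable
  moreover have "enn2real (ennreal (f\<^sub>T t * indicator {a..b} t)) = f\<^sub>T t * indicator {a..b} t" for t
    using f\<^sub>T_bounds[of t] m\<^sub>T by (auto simp: indicator_def)
  ultimately show ?thesis by simp
qed

lemma T_prob_le: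
  assumes "c \<le> d" shows "expectation (\<lambda>\<omega>. indicator {c..d} (T i j \<omega>)) \<le> M\<^sub>T * (d - c)"
proof -
  have int: "integrable lborel (\<lambda>x. M\<^sub>T * indicator {c..d} x)"
    by (intro integrable_mult_right integrable_real_indicator) (auto simp: emeasure_lborel_Icc_eq)
  have le: "f\<^sub>T x * indicator {a..b} x * indicator {c..d} x \<le> M\<^sub>T * indicator {c..d} x \<and>
      0 \<le> f\<^sub>T x * indicator {a..b} x * indicator {c..d} x" for x :: real
    using f\<^sub>T_bounds[of x] m\<^sub>T M\<^sub>T by (auto simp: indicator_def)
  have le': "\<bar>f\<^sub>T x * indicator {a..b} x * indicator {c..d} x\<bar> \<le> \<bar>M\<^sub>T * indicator {c..d} x\<bar>" for x :: real
    using le[of x] by linarith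
  have "expectation (\<lambda>\<omega>. indicator {c..d} (T i j \<omega>)) = (\<integral>x. f\<^sub>T x * indicator {a..b} x * indicator {c..d} x \<partial>lborel)"
    by (rule T_expectation) measurable
  also have "\<dots> \<le> (\<integral>x. M\<^sub>T * indicator {c..d} x \<partial>lborel)"
    using le le' by (intro integral_mono Bochner_Integration.integrable_bound[OF int]) auto
  also have "\<dots> = M\<^sub>T * (d - c)" using assms by simp
  finally show ?thesis .
qed

text \<open>\<open>L\<close> is a set of indices, so the times are distinct and independent and
  every factor is at most \<open>q\<close>. Coincidences among indices thus show up only in the
  cardinality of \<open>L\<close>.\<close>

lemma T_prod_le:
  assumes fin: "finite L" and A: "\<And>l. l \<in> L \<Longrightarrow> \<exists>c d. A l = {c..d} \<and> c \<le> d \<and> M\<^sub>T * (d - c) \<le> q"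
  shows "expectation (\<lambda>\<omega>. \<Prod>l\<in>L. indicat_real (A l) (T i l \<omega>)) \<le> q ^ card L"
proof -
  have [measurable]: "A l \<in> sets borel" if "l \<in> L" for l using A[OF that] by auto
  have ind: "indep_vars (\<lambda>_. borel) (\<lambda>l \<omega>. indicat_real (A l) (T i l \<omega>) :: real) L"
    by (rule indep_vars_compose2[OF indep_vars_subset[OF indep_T], where Y = "\<lambda>l. indicat_real (A l)"]) auto
  have int: "integrable M (\<lambda>\<omega>. indicat_real (A l) (T i l \<omega>) :: real)" if "l \<in> L" for l
    using that by (intro integrable_const_bound[where B = 1]) (auto simp: indicator_def)
  have "expectation (\<lambda>\<omega>. \<Prod>l\<in>L. indicat_real (A l) (T i l \<omega>)) = (\<Prod>l\<in>L. expectation (\<lambda>\<omega>. indicat_real (A l) (T i l \<omega>)))"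
    by (rule indep_vars_lebesgue_integral[OF fin ind int])
  also have "\<dots> \<le> (\<Prod>l\<in>L. q)"
  proof (rule prod_mono)
    fix l assume l: "l \<in> L"
    obtain c d where "A l = {c..d}" "c \<le> d" "M\<^sub>T * (d - c) \<le> q" using A[OF l] by auto
    then show "0 \<le> expectation (\<lambda>\<omega>. indicat_real (A l) (T i l \<omega>)) \<and> expectation (\<lambda>\<omega>. indicat_real (A l) (T i l \<omega>)) \<le> q"
      using T_prob_le[of c d i l] by (auto intro!: integral_nonneg_AE)
  qed
  finally show ?thesis by simp
qed

text \<open>Fubini for the joint law of the two times and the path outcome, which is a product
  because they come from disjoint sources. Joint measurability of the process makes the integrand
  measurable, and \<open>j = k\<close> is allowed because only the pair of times against the curve
  matters.\<close>

lemma integrate_out_curve: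
  fixes g :: "real \<Rightarrow> real \<Rightarrow> 'p \<Rightarrow> real"
  assumes g: "(\<lambda>((s, t), p). g s t p) \<in> borel_measurable ((I_ab \<Otimes>\<^sub>M I_ab) \<Otimes>\<^sub>M P)"
    and int: "integrable M (\<lambda>\<omega>. g (T i j \<omega>) (T i k \<omega>) (\<xi> i \<omega>))"
  shows "expectation (\<lambda>\<omega>. g (T i j \<omega>) (T i k \<omega>) (\<xi> i \<omega>)) = expectation (\<lambda>\<omega>. \<integral>p. g (T i j \<omega>) (T i k \<omega>) p \<partial>P)"
proof -
  let ?S = "I_ab \<Otimes>\<^sub>M I_ab" and ?T = "\<lambda>\<omega>. (T i j \<omega>, T i k \<omega>)"
  have T: "?T \<in> measurable (sources (time_sources i)) ?S"
    by (intro measurable_Pair T_I_ab) (auto simp: time_sources_def)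
  have TM[measurable]: "?T \<in> measurable M ?S" by (rule sources_sub[OF T])
  have d: "distr M (?S \<Otimes>\<^sub>M P) (\<lambda>\<omega>. (?T \<omega>, \<xi> i \<omega>)) = distr M ?S ?T \<Otimes>\<^sub>M P"
    using indep_set_vars[OF indep_sources_pair[of "time_sources i" "{Curve i}"] _ _ T \<xi>_sources[of i "{Curve i}"]]
    by (auto simp: time_sources_def distr_\<xi>)
  interpret D: prob_space "distr M ?S ?T" by (rule prob_space_distr) measurable
  have sf: "sigma_finite_measure P" by unfold_locales
  interpret pair_sigma_finite "distr M ?S ?T" P ..
  let ?g = "\<lambda>((s, t), p). g s t p"
  have gm: "?g \<in> borel_measurable (distr M ?S ?T \<Otimes>\<^sub>M P)" using g by simp
  have intd: "integrable (distr M ?S ?T \<Otimes>\<^sub>M P) ?g"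
    unfolding d[symmetric] using int g by (subst integrable_distr_eq) auto
  have "expectation (\<lambda>\<omega>. g (T i j \<omega>) (T i k \<omega>) (\<xi> i \<omega>)) = (\<integral>z. ?g z \<partial>(distr M (?S \<Otimes>\<^sub>M P) (\<lambda>\<omega>. (?T \<omega>, \<xi> i \<omega>))))"
    using g by (subst integral_distr) auto
  also have "\<dots> = (\<integral>st. \<integral>p. ?g (st, p) \<partial>P \<partial>distr M ?S ?T)"
    unfolding d by (rule integral_fst'[OF intd, symmetric])
  also have "\<dots> = expectation (\<lambda>\<omega>. \<integral>p. ?g (?T \<omega>, p) \<partial>P)"
  proof (rule integral_distr[OF TM])
    show "(\<lambda>st. \<integral>p. ?g (st, p) \<partial>P) \<in> borel_measurable ?S"
      using sigma_finite_measure.borel_measurable_lebesgue_integral[OF sf, of "\<lambda>st p. case st of (s, t) \<Rightarrow> g s t p" ?S] g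
      by (simp add: case_prod_beta')
  qed
  finally show ?thesis by simp
qed

end

section \<open>Amplitudes on one curve and their envelopes\<close>

lemma powr_sum3_le:
  fixes x y z p :: real
  assumes "0 \<le> x" "0 \<le> y" "0 \<le> z" "0 \<le> p"
  shows "(x + y + z) powr p \<le> 3 powr p * (x powr p + y powr p + z powr p)"
proof -
  define w where "w = max x (max y z)"
  have w: "0 \<le> w" "x + y + z \<le> 3 * w" using assms by (auto simp: w_def)
  have "(x + y + z) powr p \<le> (3 * w) powr p" using assms w by (intro powr_mono2) auto
  also have "\<dots> = 3 powr p * w powr p" using w by (simp add: powr_mult)
  also have "w powr p \<le> x powr p + y powr p + z powr p"
  proof -
    have "0 \<le> x powr p" "0 \<le> y powr p" "0 \<le> z powr p" by auto
    then show ?thesis unfolding w_def max_def by auto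
  qed
  finally show ?thesis by simp
qed

text \<open>\<open>p\<close> is the common moment order of the errors and of the curve supremum: the
  exponent of \<open>condC5\<close> for the mean, and twice the exponent of \<open>condC6\<close>
  for pair products.\<close>

locale fda_moment = fda_model +
  fixes p :: real
  assumes p: "2 < p" and sup_moment: "finite_sup_moment a b P X p"
    and U_moment: "\<And>i j. integrable M (\<lambda>\<omega>. \<bar>U i j \<omega>\<bar> powr p)"
begin

definition esup_pow where "esup_pow \<omega> = (SUP t\<in>{a..b}. ennreal (\<bar>X t \<omega>\<bar> powr p))"

text \<open>\<open>enn2real\<close> sends an infinite supremum to 0, so domination by
  \<open>sup_pow\<close> can hold almost everywhere only.\<close>

definition sup_pow where "sup_pow \<omega> = enn2real (esup_pow \<omega>)"

lemma esup_pow_meas[measurable]: "esup_pow \<in> borel_measurable P"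
  and esup_pow_integral: "(\<integral>\<^sup>+ \<omega>. esup_pow \<omega> \<partial>P) < \<infinity>"
  using sup_moment unfolding esup_pow_def finite_sup_moment_def by blast+

lemma sup_pow_nonneg: "0 \<le> sup_pow \<omega>" by (simp add: sup_pow_def)

lemma sup_pow_meas[measurable]: "sup_pow \<in> borel_measurable P"
  unfolding sup_pow_def by measurable

lemma sup_pow_finite: "AE \<omega> in P. esup_pow \<omega> < \<infinity>"
  using nn_integral_noteq_infinite[of esup_pow P] esup_pow_integral by (simp add: less_top)

lemma sup_pow_int: "integrable P sup_pow"
proof (rule integrableI_nonneg)
  have "(\<integral>\<^sup>+ \<omega>. ennreal (sup_pow \<omega>) \<partial>P) = (\<integral>\<^sup>+ \<omega>. esup_pow \<omega> \<partial>P)"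
    using sup_pow_finite by (intro nn_integral_cong_AE) (auto elim!: eventually_mono simp: sup_pow_def)
  then show "(\<integral>\<^sup>+ \<omega>. ennreal (sup_pow \<omega>) \<partial>P) < \<infinity>" using esup_pow_integral by simp
qed (auto simp: sup_pow_nonneg)

lemma X_powr_le_sup_pow: "AE \<omega> in P. \<forall>t\<in>{a..b}. \<bar>X t \<omega>\<bar> powr p \<le> sup_pow \<omega>"
  using sup_pow_finite
proof eventually_elim
  case (elim \<omega>)
  show ?case
  proof
    fix t assume "t \<in> {a..b}"
    then have "ennreal (\<bar>X t \<omega>\<bar> powr p) \<le> esup_pow \<omega>" unfolding esup_pow_def by (intro SUP_upper)
    then have "enn2real (ennreal (\<bar>X t \<omega>\<bar> powr p)) \<le> sup_pow \<omega>"
      unfolding sup_pow_def using elim by (intro enn2real_mono) auto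
    then show "\<bar>X t \<omega>\<bar> powr p \<le> sup_pow \<omega>" by simp
  qed
qed

definition curve_bound where "curve_bound \<omega> = sup_pow \<omega> powr (1 / p)"

lemma curve_bound_nonneg: "0 \<le> curve_bound \<omega>" by (simp add: curve_bound_def)

lemma curve_bound_meas[measurable]: "curve_bound \<in> borel_measurable P"
  unfolding curve_bound_def by measurable

lemma curve_bound_powr: "curve_bound \<omega> powr p = sup_pow \<omega>"
  using p sup_pow_nonneg by (simp add: curve_bound_def powr_powr)

lemma X_le_curve_bound: "AE \<omega> in P. \<forall>t\<in>{a..b}. \<bar>X t \<omega>\<bar> \<le> curve_bound \<omega>"
  using X_powr_le_sup_pow
proof eventually_elim
  case (elim \<omega>)
  show ?case
  proof
    fix t assume t: "t \<in> {a..b}"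
    have "(\<bar>X t \<omega>\<bar> powr p) powr (1 / p) \<le> sup_pow \<omega> powr (1 / p)"
      using elim t p by (intro powr_mono2) auto
    then show "\<bar>X t \<omega>\<bar> \<le> curve_bound \<omega>" using p by (simp add: powr_powr curve_bound_def)
  qed
qed

lemma power2_le_powr: "0 \<le> x \<Longrightarrow> x\<^sup>2 \<le> 1 + x powr p" for x :: real
proof (cases "x \<le> 1")
  case False
  then have "x powr 2 \<le> x powr p" using p by (intro powr_mono) auto
  then show ?thesis using False by (simp add: powr_numeral)
next
  case True
  moreover assume "0 \<le> x"
  ultimately have "x\<^sup>2 \<le> 1" by (simp add: abs_square_le_1)
  then show ?thesis using powr_ge_zero[of x p] by linarith
qed

lemma curve_bound_sq_int: "integrable P (\<lambda>\<omega>. (curve_bound \<omega>)\<^sup>2)"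
proof (rule Bochner_Integration.integrable_bound)
  show "integrable P (\<lambda>\<omega>. 1 + sup_pow \<omega>)" using sup_pow_int by auto
  show "AE \<omega> in P. norm ((curve_bound \<omega>)\<^sup>2) \<le> norm (1 + sup_pow \<omega>)"
    using power2_le_powr[OF curve_bound_nonneg] sup_pow_nonneg by (intro AE_I2) (auto simp: curve_bound_powr)
qed measurable

lemma curve_bound_int: "integrable P curve_bound"
  by (rule P.integrable_of_square[OF _ curve_bound_sq_int]) measurable

text \<open>The two integrals bound the mean function and the second moment function. The summand 1
  gives \<open>1 \<le> amp i j \<omega>\<close>, so that the constant weight 1 of the design sums is
  dominated too, and \<open>offset \<le> offset * offset\<close>, which is used for pair
  products.\<close>

definition offset where "offset = 1 + (\<integral>\<omega>. curve_bound \<omega> \<partial>P) + (\<integral>\<omega>. (curve_bound \<omega>)\<^sup>2 \<partial>P)"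

lemma offset_ge: "1 \<le> offset" "(\<integral>\<omega>. curve_bound \<omega> \<partial>P) \<le> offset" "(\<integral>\<omega>. (curve_bound \<omega>)\<^sup>2 \<partial>P) \<le> offset"
proof -
  have "0 \<le> (\<integral>\<omega>. curve_bound \<omega> \<partial>P)" "0 \<le> (\<integral>\<omega>. (curve_bound \<omega>)\<^sup>2 \<partial>P)"
    by (auto intro!: integral_nonneg_AE simp: curve_bound_nonneg)
  then show "1 \<le> offset" "(\<integral>\<omega>. curve_bound \<omega> \<partial>P) \<le> offset" "(\<integral>\<omega>. (curve_bound \<omega>)\<^sup>2 \<partial>P) \<le> offset"
    unfolding offset_def by linarith+
qed

text \<open>The offset makes \<open>amp i j\<close> and \<open>amp i j * amp i k\<close> dominate the centred observations and their products.\<close>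

definition amp where "amp i j \<omega> = curve_bound (\<xi> i \<omega>) + \<bar>U i j \<omega>\<bar> + offset"

lemma amp_meas: "amp i j \<in> borel_measurable (sources (amplitude_sources i))"
proof -
  have [measurable]: "\<xi> i \<in> measurable (sources (amplitude_sources i)) P"
    "U i j \<in> borel_measurable (sources (amplitude_sources i))"
    by (auto intro!: \<xi>_sources U_sources simp: amplitude_sources_def)
  show ?thesis unfolding amp_def by measurable
qed

lemma amp_borel[measurable]: "amp i j \<in> borel_measurable M"
  by (rule sources_sub[OF amp_meas])

lemma amp_ge: "1 \<le> amp i j \<omega>"
  using offset_ge(1) curve_bound_nonneg[of "\<xi> i \<omega>"] unfolding amp_def by linarith

lemma \<xi>_integral: "expectation (\<lambda>\<omega>. g (\<xi> i \<omega>)) = (\<integral>q. g q \<partial>P)" and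
  \<xi>_integrable: "integrable M (\<lambda>\<omega>. g (\<xi> i \<omega>)) \<longleftrightarrow> integrable P g"
  if "g \<in> borel_measurable P" for g :: "'b \<Rightarrow> real"
  using integral_distr[OF \<xi>_meas[of i], of g] integrable_distr_eq[OF \<xi>_meas[of i], of g] that by (simp_all add: distr_\<xi>)

lemma U_integral: "expectation (\<lambda>\<omega>. g (U i j \<omega>)) = expectation (\<lambda>\<omega>. g (U 0 0 \<omega>))"
  if "g \<in> borel_measurable borel" for g :: "real \<Rightarrow> real"
  using integral_distr[OF U_borel[of i j], of g] integral_distr[OF U_borel[of 0 0], of g] that by (simp add: U_distr[of i j])

definition amp_moment where
  "amp_moment = 3 powr p * ((\<integral>q. sup_pow q \<partial>P) + expectation (\<lambda>\<omega>. \<bar>U 0 0 \<omega>\<bar> powr p) + offset powr p)"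

lemma amp_powr_int: "integrable M (\<lambda>\<omega>. amp i j \<omega> powr p)"
  and amp_powr_le: "expectation (\<lambda>\<omega>. amp i j \<omega> powr p) \<le> amp_moment"
proof -
  let ?B = "\<lambda>\<omega>. 3 powr p * (sup_pow (\<xi> i \<omega>) + \<bar>U i j \<omega>\<bar> powr p + offset powr p)"
  have le: "amp i j \<omega> powr p \<le> ?B \<omega>" for \<omega>
    using powr_sum3_le[of "curve_bound (\<xi> i \<omega>)" "\<bar>U i j \<omega>\<bar>" offset p] p offset_ge(1) curve_bound_nonneg
    unfolding amp_def by (simp add: curve_bound_powr)
  have int: "integrable M (\<lambda>\<omega>. sup_pow (\<xi> i \<omega>))" using \<xi>_integrable sup_pow_int by simp
  have intB: "integrable M ?B" using int U_moment by auto
  show int_amp: "integrable M (\<lambda>\<omega>. amp i j \<omega> powr p)"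
  proof (rule Bochner_Integration.integrable_bound[OF intB])
    show "AE \<omega> in M. norm (amp i j \<omega> powr p) \<le> norm (?B \<omega>)"
      using le abs_ge_self order_trans by (intro AE_I2) (simp, blast)
  qed measurable
  have "expectation (\<lambda>\<omega>. amp i j \<omega> powr p) \<le> expectation ?B"
    using int_amp intB le by (intro integral_mono) auto
  also have "\<dots> = amp_moment"
    unfolding amp_moment_def using int U_moment U_integral[of "\<lambda>u. \<bar>u\<bar> powr p" i j] \<xi>_integral[of sup_pow i]
    by (simp add: prob_space)
  finally show "expectation (\<lambda>\<omega>. amp i j \<omega> powr p) \<le> amp_moment" .
qed

lemma amp_power_int: "integrable M (\<lambda>\<omega>. amp i j \<omega> ^ q)"
  and amp_power_le: "expectation (\<lambda>\<omega>. amp i j \<omega> ^ q) \<le> amp_moment" if q: "real q \<le> p"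
proof -
  have le: "amp i j \<omega> ^ q \<le> amp i j \<omega> powr p" for \<omega>
  proof -
    have "amp i j \<omega> powr real q \<le> amp i j \<omega> powr p" using amp_ge q by (intro powr_mono) auto
    then show ?thesis using amp_ge[of i j \<omega>] by (simp add: powr_realpow)
  qed
  have pos: "0 \<le> amp i j \<omega>" for \<omega> using amp_ge[of i j \<omega>] by linarith
  show int: "integrable M (\<lambda>\<omega>. amp i j \<omega> ^ q)"
    by (rule Bochner_Integration.integrable_bound[OF amp_powr_int[of i j]]) (use le pos in \<open>auto simp: abs_of_nonneg\<close>)
  have "expectation (\<lambda>\<omega>. amp i j \<omega> ^ q) \<le> expectation (\<lambda>\<omega>. amp i j \<omega> powr p)"
    using int amp_powr_int le by (intro integral_mono) auto
  then show "expectation (\<lambda>\<omega>. amp i j \<omega> ^ q) \<le> amp_moment" using amp_powr_le[of i j] by linarith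
qed

definition U_half_moment where "U_half_moment = (\<integral>x. \<bar>x\<bar> powr (p / 2) \<partial>distr M borel (U 0 0))"

text \<open>The curve bound and the offset are constant along a curve, so only the errors call for a
  mean envelope; \<open>3 powr p\<close> is the price of splitting the \<open>p\<close>-th power of
  three summands.\<close>

definition amp_env where
  "amp_env i \<omega> = 3 powr p * (sup_pow (\<xi> i \<omega>) + mean_envelope p U_half_moment (\<lambda>j. U i j \<omega>) + offset powr p)"

lemma U_row_env:
  shows "integrable M (\<lambda>\<omega>. mean_envelope p U_half_moment (\<lambda>j. U i j \<omega>))"
    and "AE \<omega> in M. \<forall>m>0. ((\<Sum>j<m. \<bar>U i j \<omega>\<bar>) / real m) powr p \<le> mean_envelope p U_half_moment (\<lambda>j. U i j \<omega>)"
  using mean_envelope_bounds[OF indep_U U_distr _ U_moment U_half_moment_def, of i] p by auto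

text \<open>The envelope is a function of the whole infinite row of errors, so the rows themselves
  must be identically distributed. Independence and equal marginals make each row law the same
  product measure.\<close>

lemma U_row_law:
  "distr M (Pi\<^sub>M UNIV (\<lambda>_. borel)) (\<lambda>\<omega> j. U i j \<omega>) = distr M (Pi\<^sub>M UNIV (\<lambda>_. borel)) (\<lambda>\<omega> j. U 0 j \<omega>)"
proof -
  have "distr M (Pi\<^sub>M UNIV (\<lambda>_. borel)) (\<lambda>\<omega> j. U i j \<omega>) = Pi\<^sub>M UNIV (\<lambda>_. distr M borel (U 0 0))" for i
    using indep_vars_iff_distr_eq_PiM[of UNIV "U i" "\<lambda>_. borel"] indep_U[of i] U_distr[of i] by (simp add: restrict_def)
  then show ?thesis by simp
qed

lemma U_row_meas: "(\<lambda>\<omega> j. U i j \<omega>) \<in> measurable (sources (amplitude_sources i)) (Pi\<^sub>M UNIV (\<lambda>_. borel))"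
  by (intro measurable_PiM_single') (auto intro!: U_sources simp: amplitude_sources_def)

lemma env_meas: "(\<lambda>\<omega>. mean_envelope p U_half_moment (\<lambda>j. U i j \<omega>)) \<in> borel_measurable (sources (amplitude_sources i))"
  by (rule measurable_compose[OF U_row_meas measurable_mean_envelope])

lemma sup_pow_\<xi>_meas: "(\<lambda>\<omega>. sup_pow (\<xi> i \<omega>)) \<in> borel_measurable (sources (amplitude_sources i))"
  by (rule measurable_compose[OF \<xi>_sources sup_pow_meas]) (simp add: amplitude_sources_def)

lemma amp_env_meas: "amp_env i \<in> borel_measurable (sources (curve_sources i))"
  unfolding amp_env_def using sources_mono[OF source_subsets(1) env_meas] sources_mono[OF source_subsets(1) sup_pow_\<xi>_meas]
  by measurable

lemma amp_env_int: "integrable M (amp_env i)"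
  unfolding amp_env_def using U_row_env(1)[of i] \<xi>_integrable[of sup_pow i] sup_pow_int by auto

lemma env_integral: "expectation (\<lambda>\<omega>. mean_envelope p U_half_moment (\<lambda>j. U i j \<omega>)) = expectation (\<lambda>\<omega>. mean_envelope p U_half_moment (\<lambda>j. U 0 j \<omega>))"
  using integral_distr[OF sources_sub[OF U_row_meas[of i]] measurable_mean_envelope[of p U_half_moment]]
    integral_distr[OF sources_sub[OF U_row_meas[of 0]] measurable_mean_envelope[of p U_half_moment]] U_row_law[of i] by simp

lemma amp_env_mean: "expectation (amp_env i) = expectation (amp_env 0)"
  unfolding amp_env_def using U_row_env(1) \<xi>_integrable[of sup_pow] sup_pow_int \<xi>_integral[of sup_pow] env_integral[of i]
  by (simp add: prob_space)

text \<open>Curve suprema and error envelopes form two independent, identically distributed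
  sequences, averaged separately; this uses the law of each sequence and not their joint
  law.\<close>

lemma amp_env_avg: "AE \<omega> in M. \<exists>B. \<forall>n. (\<Sum>i<n. amp_env i \<omega>) \<le> B * real n"
proof -
  have ind: "indep_vars (\<lambda>_. borel) V UNIV" if "\<And>i. V i \<in> borel_measurable (sources (amplitude_sources i))" for V :: "nat \<Rightarrow> 'a \<Rightarrow> real"
    by (rule indep_vars_of_subalgebras[OF indep_sources_family[of amplitude_sources]])
      (use that in \<open>auto simp: disjoint_family_on_def amplitude_sources_def\<close>)
  have 1: "AE \<omega> in M. \<exists>B. \<forall>n. (\<Sum>i<n. sup_pow (\<xi> i \<omega>)) \<le> B * real n"
  proof (rule AE_bounded_averages[OF ind[OF sup_pow_\<xi>_meas]])
    show "distr M borel (\<lambda>\<omega>. sup_pow (\<xi> i \<omega>)) = distr M borel (\<lambda>\<omega>. sup_pow (\<xi> 0 \<omega>))" for i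
      using distr_distr[OF sup_pow_meas \<xi>_meas[of i]] distr_distr[OF sup_pow_meas \<xi>_meas[of 0]]
      by (simp add: distr_\<xi> comp_def)
    show "integrable M (\<lambda>\<omega>. sup_pow (\<xi> 0 \<omega>))" using \<xi>_integrable sup_pow_int by simp
  qed (rule sup_pow_nonneg)
  have 2: "AE \<omega> in M. \<exists>B. \<forall>n. (\<Sum>i<n. mean_envelope p U_half_moment (\<lambda>j. U i j \<omega>)) \<le> B * real n"
  proof (rule AE_bounded_averages[OF ind[OF env_meas]])
    show "distr M borel (\<lambda>\<omega>. mean_envelope p U_half_moment (\<lambda>j. U i j \<omega>)) = distr M borel (\<lambda>\<omega>. mean_envelope p U_half_moment (\<lambda>j. U 0 j \<omega>))" for i
      using distr_distr[OF measurable_mean_envelope[of p U_half_moment] sources_sub[OF U_row_meas[of i]]]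
        distr_distr[OF measurable_mean_envelope[of p U_half_moment] sources_sub[OF U_row_meas[of 0]]] U_row_law[of i]
      by (simp add: comp_def)
  qed (auto simp: mean_envelope_nonneg U_row_env)
  from 1 2 show ?thesis
  proof eventually_elim
    case (elim \<omega>)
    then obtain B1 B2 where "\<And>n. (\<Sum>i<n. sup_pow (\<xi> i \<omega>)) \<le> B1 * real n"
      "\<And>n. (\<Sum>i<n. mean_envelope p U_half_moment (\<lambda>j. U i j \<omega>)) \<le> B2 * real n" by blast
    then have "(\<Sum>i<n. sup_pow (\<xi> i \<omega>)) + (\<Sum>i<n. mean_envelope p U_half_moment (\<lambda>j. U i j \<omega>)) + real n * offset powr p
        \<le> B1 * real n + B2 * real n + real n * offset powr p" for n
      by (intro add_mono) auto
    then have "3 powr p * ((\<Sum>i<n. sup_pow (\<xi> i \<omega>)) + (\<Sum>i<n. mean_envelope p U_half_moment (\<lambda>j. U i j \<omega>)) + real n * offset powr p)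
        \<le> 3 powr p * (B1 * real n + B2 * real n + real n * offset powr p)" for n
      by (intro mult_left_mono) auto
    then have "(\<Sum>i<n. amp_env i \<omega>) \<le> (3 powr p * (B1 + B2 + offset powr p)) * real n" for n
      unfolding amp_env_def sum_distrib_left[symmetric] by (simp add: sum.distrib algebra_simps)
    then show ?case by blast
  qed
qed

lemma amp_mean_powr_le: "AE \<omega> in M. \<forall>i. \<forall>m>0. ((\<Sum>j<m. amp i j \<omega>) / real m) powr p \<le> amp_env i \<omega>"
proof -
  have "AE \<omega> in M. \<forall>i. \<forall>m>0. ((\<Sum>j<m. \<bar>U i j \<omega>\<bar>) / real m) powr p \<le> mean_envelope p U_half_moment (\<lambda>j. U i j \<omega>)"
    using U_row_env(2) by (simp add: AE_all_countable)
  then show ?thesis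
  proof eventually_elim
    case (elim \<omega>)
    show ?case
    proof (intro allI impI)
      fix i m :: nat assume m: "0 < m"
      have eq: "(\<Sum>j<m. amp i j \<omega>) / real m = curve_bound (\<xi> i \<omega>) + (\<Sum>j<m. \<bar>U i j \<omega>\<bar>) / real m + offset"
        unfolding amp_def using m by (simp add: sum.distrib field_simps)
      have "((\<Sum>j<m. amp i j \<omega>) / real m) powr p
          \<le> 3 powr p * (curve_bound (\<xi> i \<omega>) powr p + ((\<Sum>j<m. \<bar>U i j \<omega>\<bar>) / real m) powr p + offset powr p)"
        unfolding eq using p offset_ge(1) by (intro powr_sum3_le) (auto simp: curve_bound_nonneg sum_nonneg)
      also have "\<dots> \<le> amp_env i \<omega>"
        unfolding amp_env_def curve_bound_powr using elim m by (intro mult_left_mono add_mono) auto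
      finally show "((\<Sum>j<m. amp i j \<omega>) / real m) powr p \<le> amp_env i \<omega>" .
    qed
  qed
qed

lemma X_le_curve_bound_\<xi>: "AE \<omega> in M. \<forall>i. \<forall>t\<in>{a..b}. \<bar>X t (\<xi> i \<omega>)\<bar> \<le> curve_bound (\<xi> i \<omega>)"
  unfolding AE_all_countable
proof
  fix i
  have "AE q in distr M P (\<xi> i). \<forall>t\<in>{a..b}. \<bar>X t q\<bar> \<le> curve_bound q" unfolding distr_\<xi> by (rule X_le_curve_bound)
  then show "AE \<omega> in M. \<forall>t\<in>{a..b}. \<bar>X t (\<xi> i \<omega>)\<bar> \<le> curve_bound (\<xi> i \<omega>)" by (rule AE_distrD[OF \<xi>_meas])
qed

lemma amplitude_time_product:
  fixes f g :: "'a \<Rightarrow> real"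
  assumes "f \<in> borel_measurable (sources (amplitude_sources i))" "g \<in> borel_measurable (sources (time_sources i))"
    and "integrable M f" "integrable M g"
  shows "integrable M (\<lambda>\<omega>. f \<omega> * g \<omega>)" "expectation (\<lambda>\<omega>. f \<omega> * g \<omega>) = expectation f * expectation g"
  using indep_set_integral[OF indep_amplitude_time[of i] _ _ assms] by auto

end

text \<open>\<open>Z\<close> depends on the times through the curve, so second moments of its sums
  do not separate. Its majorant \<open>Kd\<close> is a function of curve and errors and hence
  independent of the times; the moments of the dominating sums factor into \<kappa> and window
  probabilities. By \<open>wt_sum\<close> each curve contributes a genuine average.\<close>

locale dominated_array = fda_moment +
  fixes E :: "nat \<Rightarrow> nat \<Rightarrow> (nat \<times> nat) set" and wt :: "nat \<Rightarrow> nat \<Rightarrow> real"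
    and Z Kd :: "nat \<Rightarrow> nat \<Rightarrow> nat \<Rightarrow> 'a \<Rightarrow> real" and \<kappa> :: real
  assumes fin_E: "finite (E n i)" and wt_nonneg: "0 \<le> wt n i" and wt_sum: "i < n \<Longrightarrow> wt n i * real (card (E n i)) = 1"
    and Z_meas: "Z i j k \<in> borel_measurable (sources (curve_sources i))" and Z_nonneg: "0 \<le> Z i j k \<omega>"
    and Z_le: "AE \<omega> in M. \<forall>i j k. Z i j k \<omega> \<le> Kd i j k \<omega>"
    and Kd_meas: "Kd i j k \<in> borel_measurable (sources (amplitude_sources i))" and Kd_nonneg: "0 \<le> Kd i j k \<omega>"
    and Kd_sq: "integrable M (\<lambda>\<omega>. (Kd i j k \<omega>)\<^sup>2)" and Kd_le: "expectation (\<lambda>\<omega>. (Kd i j k \<omega>)\<^sup>2) \<le> \<kappa>"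
begin

lemma Kd_borel[measurable]: "Kd i j k \<in> borel_measurable M"
  by (rule sources_sub[OF Kd_meas])

lemma Kd_int: "integrable M (Kd i j k)"
  by (rule integrable_of_square[OF _ Kd_sq]) measurable

lemma Kd_prod_int: "integrable M (\<lambda>\<omega>. Kd i j k \<omega> * Kd i j' k' \<omega>)"
  and Kd_prod_le: "expectation (\<lambda>\<omega>. Kd i j k \<omega> * Kd i j' k' \<omega>) \<le> \<kappa>"
proof -
  let ?B = "\<lambda>\<omega>. ((Kd i j k \<omega>)\<^sup>2 + (Kd i j' k' \<omega>)\<^sup>2) / 2"
  have le: "Kd i j k \<omega> * Kd i j' k' \<omega> \<le> ?B \<omega>" for \<omega>
    using sum_squares_bound[of "Kd i j k \<omega>" "Kd i j' k' \<omega>"] by simp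
  have intB: "integrable M ?B" using Kd_sq by auto
  show int: "integrable M (\<lambda>\<omega>. Kd i j k \<omega> * Kd i j' k' \<omega>)"
    by (rule Bochner_Integration.integrable_bound[OF intB]) (use le Kd_nonneg in \<open>auto simp: abs_mult abs_of_nonneg\<close>)
  have "expectation (\<lambda>\<omega>. Kd i j k \<omega> * Kd i j' k' \<omega>) \<le> expectation ?B"
    using int intB le by (intro integral_mono) auto
  also have "\<dots> \<le> \<kappa>" using Kd_sq Kd_le[of i j k] Kd_le[of i j' k'] by simp
  finally show "expectation (\<lambda>\<omega>. Kd i j k \<omega> * Kd i j' k' \<omega>) \<le> \<kappa>" .
qed

lemma Kd_mean_le: "expectation (Kd i j k) \<le> (1 + \<kappa>) / 2"
proof -
  have "expectation (Kd i j k) \<le> expectation (\<lambda>\<omega>. (1 + (Kd i j k \<omega>)\<^sup>2) / 2)"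
  proof (rule integral_mono[OF Kd_int])
    show "integrable M (\<lambda>\<omega>. (1 + (Kd i j k \<omega>)\<^sup>2) / 2)" using Kd_sq by auto
    show "Kd i j k \<omega> \<le> (1 + (Kd i j k \<omega>)\<^sup>2) / 2" for \<omega> using sum_squares_bound[of 1 "Kd i j k \<omega>"] by simp
  qed
  also have "\<dots> \<le> (1 + \<kappa>) / 2" using Kd_sq[of i j k] Kd_le[of i j k] by (simp add: prob_space)
  finally show ?thesis .
qed

lemma \<kappa>_nonneg: "0 \<le> \<kappa>"
proof -
  have "0 \<le> expectation (\<lambda>\<omega>. (Kd 0 0 0 \<omega>)\<^sup>2)" by (intro integral_nonneg_AE AE_I2) simp
  then show ?thesis using Kd_le[of 0 0 0] by linarith
qed

lemma Z_borel: "Z i j k \<in> borel_measurable M"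
  by (rule sources_sub[OF Z_meas])

lemma Z_int': "integrable M (Z i j k)"
proof (rule Bochner_Integration.integrable_bound[OF Kd_int Z_borel])
  show "AE \<omega> in M. norm (Z i j k \<omega>) \<le> norm (Kd i j k \<omega>)"
    using Z_le by eventually_elim (use Z_nonneg Kd_nonneg in \<open>auto simp: abs_of_nonneg\<close>)
qed

sublocale weighted_array M "\<lambda>i. sources (curve_sources i)" E wt T a b Z
proof unfold_locales
  show "T i j \<in> borel_measurable (sources (curve_sources i))" for i j
    by (rule T_sources) (simp add: curve_sources_def)
qed (use indep_curves fin_E wt_nonneg Z_meas Z_nonneg Z_int' in auto)

definition dom_sum where
  "dom_sum n i F \<omega> = wt n i * (\<Sum>(j, k)\<in>E n i. Kd i j k \<omega> * F (T i j \<omega>) (T i k \<omega>))" for F :: "real \<Rightarrow> real \<Rightarrow> real"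

lemma curve_sum_le_dom:
  assumes "\<And>x y. 0 \<le> F x y" "\<forall>i j k. Z i j k \<omega> \<le> Kd i j k \<omega>"
  shows "curve_sum Z n i F \<omega> \<le> dom_sum n i F \<omega>"
  unfolding curve_sum_def dom_sum_def using assms wt_nonneg
  by (auto intro!: mult_left_mono sum_mono mult_right_mono)

lemma time_fun_meas:
  assumes "(\<lambda>(x, y). F x y) \<in> borel_measurable (borel \<Otimes>\<^sub>M borel)"
  shows "(\<lambda>\<omega>. F (T i j \<omega>) (T i k \<omega>) :: real) \<in> borel_measurable (sources (time_sources i))"
proof -
  have "(\<lambda>\<omega>. (T i j \<omega>, T i k \<omega>)) \<in> measurable (sources (time_sources i)) (borel \<Otimes>\<^sub>M borel)"
    by (intro measurable_Pair T_sources) (auto simp: time_sources_def)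
  from measurable_compose[OF this assms] show ?thesis by simp
qed

context
  fixes F :: "real \<Rightarrow> real \<Rightarrow> real"
  assumes F_meas: "(\<lambda>(x, y). F x y) \<in> borel_measurable (borel \<Otimes>\<^sub>M borel)"
    and F01: "\<And>x y. 0 \<le> F x y \<and> F x y \<le> 1"
begin

lemma time_fun_int: "integrable M (\<lambda>\<omega>. F (T i j \<omega>) (T i k \<omega>))"
  and time_fun_prod_int: "integrable M (\<lambda>\<omega>. F (T i j \<omega>) (T i k \<omega>) * F (T i j' \<omega>) (T i k' \<omega>))"
proof -
  note [measurable] = sources_sub[OF time_fun_meas[OF F_meas]]
  show "integrable M (\<lambda>\<omega>. F (T i j \<omega>) (T i k \<omega>))"
    using F01 by (intro integrable_const_bound[where B = 1]) auto
  have "\<bar>F x y * F x' y'\<bar> \<le> 1" for x y x' y'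
    using mult_mono[of "F x y" 1 "F x' y'" 1] F01 by (auto simp: abs_mult abs_of_nonneg)
  then show "integrable M (\<lambda>\<omega>. F (T i j \<omega>) (T i k \<omega>) * F (T i j' \<omega>) (T i k' \<omega>))"
    by (intro integrable_const_bound[where B = 1]) auto
qed

lemma dom_sum_int: "integrable M (dom_sum n i F)"
  unfolding dom_sum_def
  by (auto intro!: integrable_mult_right Bochner_Integration.integrable_sum amplitude_time_product(1)[OF Kd_meas time_fun_meas[OF F_meas] Kd_int time_fun_int])

text \<open>After domination each summand is a mean amplitude times a probability. The mean is at
  most \<open>(1 + \<kappa>) / 2\<close> because \<open>x \<le> (1 + x\<^sup>2) / 2\<close>, and
  averaging over the pairs preserves the bound.\<close>

lemma expectation_curve_sum_le:
  assumes q: "\<And>j k. (j, k) \<in> E n i \<Longrightarrow> expectation (\<lambda>\<omega>. F (T i j \<omega>) (T i k \<omega>)) \<le> q" and i: "i < n" and q0: "0 \<le> q"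
  shows "expectation (curve_sum Z n i F) \<le> (1 + \<kappa>) / 2 * q"
proof -
  have bF: "bdd_fun F" unfolding bdd_fun_def using F_meas F01 by (auto simp: borel_prod abs_of_nonneg intro!: exI[of _ 1])
  have "expectation (curve_sum Z n i F) \<le> expectation (dom_sum n i F)"
  proof (rule integral_mono_AE[OF curve_sum_int[OF bF] dom_sum_int])
    show "AE \<omega> in M. curve_sum Z n i F \<omega> \<le> dom_sum n i F \<omega>"
      using Z_le by eventually_elim (rule curve_sum_le_dom, use F01 in auto)
  qed
  also have "\<dots> = wt n i * (\<Sum>(j, k)\<in>E n i. expectation (Kd i j k) * expectation (\<lambda>\<omega>. F (T i j \<omega>) (T i k \<omega>)))"
    unfolding dom_sum_def using amplitude_time_product[OF Kd_meas time_fun_meas[OF F_meas] Kd_int time_fun_int]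
    by (simp add: case_prod_beta)
  also have "\<dots> \<le> wt n i * (\<Sum>(j, k)\<in>E n i. (1 + \<kappa>) / 2 * q)"
  proof (intro mult_left_mono sum_mono wt_nonneg, clarify)
    fix j k assume "(j, k) \<in> E n i"
    then show "expectation (Kd i j k) * expectation (\<lambda>\<omega>. F (T i j \<omega>) (T i k \<omega>)) \<le> (1 + \<kappa>) / 2 * q"
      using q Kd_mean_le \<kappa>_nonneg q0 F01 by (intro mult_mono) (auto intro!: integral_nonneg_AE)
  qed
  also have "\<dots> = (wt n i * real (card (E n i))) * ((1 + \<kappa>) / 2 * q)" by (simp add: case_prod_beta)
  also have "\<dots> = (1 + \<kappa>) / 2 * q" using wt_sum[OF i] by simp
  finally show ?thesis .
qed

lemma dom_sum_sq:
  "(dom_sum n i F \<omega>)\<^sup>2 = (wt n i)\<^sup>2 * (\<Sum>(j, k)\<in>E n i. \<Sum>(j', k')\<in>E n i. (Kd i j k \<omega> * Kd i j' k' \<omega>) * (F (T i j \<omega>) (T i k \<omega>) * F (T i j' \<omega>) (T i k' \<omega>)))"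
  unfolding dom_sum_def power_mult_distrib power2_eq_square[of "sum _ _"] sum_product
  by (simp add: case_prod_beta mult_ac)

lemma dom_sum_sq_summand:
  shows "integrable M (\<lambda>\<omega>. (Kd i j k \<omega> * Kd i j' k' \<omega>) * (F (T i j \<omega>) (T i k \<omega>) * F (T i j' \<omega>) (T i k' \<omega>)))"
    and "expectation (\<lambda>\<omega>. (Kd i j k \<omega> * Kd i j' k' \<omega>) * (F (T i j \<omega>) (T i k \<omega>) * F (T i j' \<omega>) (T i k' \<omega>)))
      = expectation (\<lambda>\<omega>. Kd i j k \<omega> * Kd i j' k' \<omega>) * expectation (\<lambda>\<omega>. F (T i j \<omega>) (T i k \<omega>) * F (T i j' \<omega>) (T i k' \<omega>))"
  using amplitude_time_product[OF borel_measurable_times[OF Kd_meas Kd_meas] borel_measurable_times[OF time_fun_meas[OF F_meas] time_fun_meas[OF F_meas]] Kd_prod_int time_fun_prod_int]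
  by auto

lemma dom_sum_sq_int: "integrable M (\<lambda>\<omega>. (dom_sum n i F \<omega>)\<^sup>2)"
  unfolding dom_sum_sq case_prod_beta
  by (intro integrable_mult_right Bochner_Integration.integrable_sum dom_sum_sq_summand(1))

text \<open>The square of the dominating sum is a double sum over pairs of pairs. Independence of
  amplitudes and times factors each term, and the product of two amplitudes has mean at most
  \<kappa>; what remains is the probability that up to four times fall into the window.\<close>

lemma curve_sum_sq_int: "integrable M (\<lambda>\<omega>. (curve_sum Z n i F \<omega>)\<^sup>2)"
  and expectation_curve_sum_sq_le: "expectation (\<lambda>\<omega>. (curve_sum Z n i F \<omega>)\<^sup>2) \<le> \<kappa> * (wt n i)\<^sup>2 *
     (\<Sum>(j, k)\<in>E n i. \<Sum>(j', k')\<in>E n i. expectation (\<lambda>\<omega>. F (T i j \<omega>) (T i k \<omega>) * F (T i j' \<omega>) (T i k' \<omega>)))"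
proof -
  have bF: "bdd_fun F" unfolding bdd_fun_def using F_meas F01 by (auto simp: borel_prod abs_of_nonneg intro!: exI[of _ 1])
  have le: "AE \<omega> in M. (curve_sum Z n i F \<omega>)\<^sup>2 \<le> (dom_sum n i F \<omega>)\<^sup>2"
    using Z_le
  proof eventually_elim
    case (elim \<omega>)
    show ?case using F01 elim by (intro power_mono curve_sum_le_dom curve_sum_nonneg) auto
  qed
  show int: "integrable M (\<lambda>\<omega>. (curve_sum Z n i F \<omega>)\<^sup>2)"
  proof (rule Bochner_Integration.integrable_bound[OF dom_sum_sq_int])
    show "(\<lambda>\<omega>. (curve_sum Z n i F \<omega>)\<^sup>2) \<in> borel_measurable M"
      using borel_measurable_integrable[OF curve_sum_int[OF bF]] by measurable
    show "AE \<omega> in M. norm ((curve_sum Z n i F \<omega>)\<^sup>2) \<le> norm ((dom_sum n i F \<omega>)\<^sup>2)" using le by simp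
  qed
  have "expectation (\<lambda>\<omega>. (curve_sum Z n i F \<omega>)\<^sup>2) \<le> expectation (\<lambda>\<omega>. (dom_sum n i F \<omega>)\<^sup>2)"
    by (rule integral_mono_AE[OF int dom_sum_sq_int le])
  also have "\<dots> = (wt n i)\<^sup>2 * (\<Sum>(j, k)\<in>E n i. \<Sum>(j', k')\<in>E n i.
      expectation (\<lambda>\<omega>. Kd i j k \<omega> * Kd i j' k' \<omega>) * expectation (\<lambda>\<omega>. F (T i j \<omega>) (T i k \<omega>) * F (T i j' \<omega>) (T i k' \<omega>)))"
    unfolding dom_sum_sq using dom_sum_sq_summand by (simp add: case_prod_beta)
  also have "\<dots> \<le> (wt n i)\<^sup>2 * (\<Sum>(j, k)\<in>E n i. \<Sum>(j', k')\<in>E n i.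
      \<kappa> * expectation (\<lambda>\<omega>. F (T i j \<omega>) (T i k \<omega>) * F (T i j' \<omega>) (T i k' \<omega>)))"
    unfolding case_prod_beta
    by (intro mult_left_mono sum_mono mult_right_mono Kd_prod_le integral_nonneg_AE AE_I2 mult_nonneg_nonneg) (use F01 in auto)
  also have "\<dots> = \<kappa> * (wt n i)\<^sup>2 * (\<Sum>(j, k)\<in>E n i. \<Sum>(j', k')\<in>E n i. expectation (\<lambda>\<omega>. F (T i j \<omega>) (T i k \<omega>) * F (T i j' \<omega>) (T i k' \<omega>)))"
    by (simp add: case_prod_beta sum_distrib_left[symmetric])
  finally show "expectation (\<lambda>\<omega>. (curve_sum Z n i F \<omega>)\<^sup>2) \<le> \<dots>" .
qed

end

text \<open>The envelope is \<open>cV * amp_env i\<close>, the same for every sample size. The input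
  left open is \<open>count\<close>, the combinatorial bound on window probabilities of two pairs.
  \<open>l\<close> may differ from \<open>p\<close>, since for pair products the envelope has twice
  the order.\<close>

lemma AE_dev_dominated:
  fixes \<beta> h :: "nat \<Rightarrow> real"
  assumes cV: "0 \<le> cV" and dom: "AE \<omega> in M. \<forall>n. \<forall>i<n. dom_sum n i (\<lambda>_ _. 1) \<omega> powr l \<le> cV * amp_env i \<omega>"
    and count: "\<And>n c d c' d'. 0 < n \<Longrightarrow> c \<le> d \<Longrightarrow> d - c \<le> 4 * h n \<Longrightarrow> c' \<le> d' \<Longrightarrow> d' - c' \<le> 4 * h n \<Longrightarrow>
       (\<Sum>i<n. (wt n i)\<^sup>2 * (\<Sum>(j, k)\<in>E n i. \<Sum>(j', k')\<in>E n i. expectation (\<lambda>\<omega>.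
          (indicat_real {c..d} (T i j \<omega>) * indicat_real {c'..d'} (T i k \<omega>)) *
          (indicat_real {c..d} (T i j' \<omega>) * indicat_real {c'..d'} (T i k' \<omega>))))) \<le> C * real n * \<beta> n"
    and C: "0 \<le> C" and h_pos: "\<And>n. 0 < h n" and h_lim: "h \<longlonglongrightarrow> 0"
    and h_ge: "\<forall>\<^sub>F n in sequentially. 1 / (real n)\<^sup>2 \<le> h n"
    and \<beta>_pos: "\<forall>\<^sub>F n in sequentially. 0 < \<beta> n"
    and l: "2 < l" and rate: "(\<lambda>n. inverse (\<beta> n) * (ln (real n) / real n) powr (1 - 2 / l)) \<longlonglongrightarrow> 0"
    and mesh: "\<forall>\<^sub>F n in sequentially. 1 / (real n)\<^sup>2 \<le> sqrt (\<beta> n * (ln (real n) / real n))"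
  shows "AE \<omega> in M. \<exists>B. \<forall>\<^sub>F n in sequentially. \<forall>s\<in>{a..b}. \<forall>t\<in>{a..b}. \<forall>I J.
     is_interval I \<longrightarrow> I \<subseteq> {-1..1} \<longrightarrow> is_interval J \<longrightarrow> J \<subseteq> {-1..1} \<longrightarrow>
     \<bar>dev Z n (\<lambda>x y. indicator I ((x - s) / h n) * indicator J ((y - t) / h n)) \<omega>\<bar> \<le> B * sqrt (\<beta> n * (ln (real n) / real n))"
proof (rule AE_dev_intervals[where V = "\<lambda>i \<omega>. cV * amp_env i \<omega>" and l = l and v = "cV * expectation (amp_env 0)" and C = "\<kappa> * C" and C' = "(1 + \<kappa>) / 2 * M\<^sub>T", OF _ _ _ _ _ _ _ _ _ _ h_pos h_lim h_ge \<beta>_pos l rate mesh])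
  show "(\<lambda>\<omega>. cV * amp_env i \<omega>) \<in> borel_measurable (sources (curve_sources i))" for i
    using amp_env_meas by simp
  show "AE \<omega> in M. \<forall>n. \<forall>i<n. curve_sum Z n i (\<lambda>_ _. 1) \<omega> powr l \<le> cV * amp_env i \<omega>"
    using dom Z_le
  proof eventually_elim
    case (elim \<omega>)
    show ?case
    proof (intro allI impI)
      fix n i :: nat assume "i < n"
      have "curve_sum Z n i (\<lambda>_ _. 1) \<omega> powr l \<le> dom_sum n i (\<lambda>_ _. 1) \<omega> powr l"
        using elim l by (intro powr_mono2 curve_sum_le_dom curve_sum_nonneg) auto
      then show "curve_sum Z n i (\<lambda>_ _. 1) \<omega> powr l \<le> cV * amp_env i \<omega>" using elim \<open>i < n\<close> order_trans by blast
    qed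
  qed
  show "integrable M (\<lambda>\<omega>. cV * amp_env i \<omega>)" for i using amp_env_int by auto
  show "expectation (\<lambda>\<omega>. cV * amp_env i \<omega>) \<le> cV * expectation (amp_env 0)" for i using amp_env_mean[of i] by simp
  show "AE \<omega> in M. \<exists>B. \<forall>n. (\<Sum>i<n. cV * amp_env i \<omega>) \<le> B * real n"
    using amp_env_avg
  proof eventually_elim
    case (elim \<omega>)
    then obtain B where "\<And>n. (\<Sum>i<n. amp_env i \<omega>) \<le> B * real n" by auto
    then have "cV * (\<Sum>i<n. amp_env i \<omega>) \<le> cV * (B * real n)" for n using cV by (intro mult_left_mono) auto
    then show ?case by (intro exI[of _ "cV * B"]) (simp add: sum_distrib_left mult_ac)
  qed
  have one: "(\<lambda>(x, y). 1 :: real) \<in> borel_measurable (borel \<Otimes>\<^sub>M borel)" by simp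
  show "integrable M (\<lambda>\<omega>. (curve_sum Z n i (\<lambda>_ _. 1) \<omega>)\<^sup>2)" for n i
    by (rule curve_sum_sq_int[OF one]) auto
  show "0 \<le> \<kappa> * C" using \<kappa>_nonneg C by simp
  fix n :: nat assume n: "0 < n"
  show "(\<Sum>i<n. expectation (\<lambda>\<omega>. (curve_sum Z n i (\<lambda>x y. indicator {c..d} x * indicator {c'..d'} y) \<omega>)\<^sup>2)) \<le> \<kappa> * C * real n * \<beta> n"
    if "c \<le> d" "d - c \<le> 4 * h n" "c' \<le> d'" "d' - c' \<le> 4 * h n" for c d c' d'
  proof -
    let ?F = "\<lambda>x y. indicat_real {c..d} x * indicat_real {c'..d'} y"
    have m: "(\<lambda>(x, y). ?F x y) \<in> borel_measurable (borel \<Otimes>\<^sub>M borel)" by measurable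
    have "(\<Sum>i<n. expectation (\<lambda>\<omega>. (curve_sum Z n i ?F \<omega>)\<^sup>2)) \<le> (\<Sum>i<n. \<kappa> * (wt n i)\<^sup>2 *
       (\<Sum>(j, k)\<in>E n i. \<Sum>(j', k')\<in>E n i. expectation (\<lambda>\<omega>. ?F (T i j \<omega>) (T i k \<omega>) * ?F (T i j' \<omega>) (T i k' \<omega>))))"
      by (intro sum_mono expectation_curve_sum_sq_le m) (auto simp: indicator_def)
    also have "\<dots> = \<kappa> * (\<Sum>i<n. (wt n i)\<^sup>2 * (\<Sum>(j, k)\<in>E n i. \<Sum>(j', k')\<in>E n i. expectation (\<lambda>\<omega>. ?F (T i j \<omega>) (T i k \<omega>) * ?F (T i j' \<omega>) (T i k' \<omega>))))"
      by (simp only: sum_distrib_left mult.assoc)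
    also have "\<dots> \<le> \<kappa> * (C * real n * \<beta> n)"
      by (rule mult_left_mono[OF count[OF n that] \<kappa>_nonneg])
    finally show ?thesis by (simp only: mult.assoc)
  qed
  fix c d :: real assume d: "0 < d"
  \<comment> \<open>A strip of width \<open>d\<close> has probability at most
    \<open>M\<^sub>T * d\<close> in either coordinate, whence the strip constant
    \<open>(1 + \<kappa>) / 2 * M\<^sub>T\<close>.\<close>
  have q: "expectation (\<lambda>\<omega>. indicat_real {c..c + d} (T i j \<omega>)) \<le> M\<^sub>T * d" for i j
    using T_prob_le[of c "c + d" i j] d by simp
  have m1: "(\<lambda>(x, y). indicat_real {c..c + d} x) \<in> borel_measurable (borel \<Otimes>\<^sub>M borel)"
    and m2: "(\<lambda>(x, y). indicat_real {c..c + d} y) \<in> borel_measurable (borel \<Otimes>\<^sub>M (borel :: real measure))"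
    by measurable
  have "0 \<le> M\<^sub>T * d" using M\<^sub>T d by simp
  have e1: "expectation (curve_sum Z n i (\<lambda>x y. indicator {c..c + d} x)) \<le> (1 + \<kappa>) / 2 * (M\<^sub>T * d)" if "i < n" for i
    by (rule expectation_curve_sum_le[OF m1 _ q that \<open>0 \<le> M\<^sub>T * d\<close>]) (auto simp: indicator_def)
  have e2: "expectation (curve_sum Z n i (\<lambda>x y. indicator {c..c + d} y)) \<le> (1 + \<kappa>) / 2 * (M\<^sub>T * d)" if "i < n" for i
    by (rule expectation_curve_sum_le[OF m2 _ q that \<open>0 \<le> M\<^sub>T * d\<close>]) (auto simp: indicator_def)
  have "(\<Sum>i<n. expectation (curve_sum Z n i (\<lambda>x y. indicator {c..c + d} x))) \<le> (\<Sum>i<n. (1 + \<kappa>) / 2 * (M\<^sub>T * d))"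
    "(\<Sum>i<n. expectation (curve_sum Z n i (\<lambda>x y. indicator {c..c + d} y))) \<le> (\<Sum>i<n. (1 + \<kappa>) / 2 * (M\<^sub>T * d))"
    by (rule sum_mono, rule e1, simp) (rule sum_mono, rule e2, simp)
  then show "(\<Sum>i<n. expectation (curve_sum Z n i (\<lambda>x y. indicator {c..c + d} x))) \<le> real n * ((1 + \<kappa>) / 2 * M\<^sub>T * d)"
    "(\<Sum>i<n. expectation (curve_sum Z n i (\<lambda>x y. indicator {c..c + d} y))) \<le> real n * ((1 + \<kappa>) / 2 * M\<^sub>T * d)"
    by (simp_all add: mult_ac)
qed

end

text \<open>Weights, counts and rates are fixed while \<open>Z\<close> stays free: the same bounds
  serve the constant weight 1, for the design, and the centred observations, for the noise.\<close>

locale signed_array = fda_moment +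
  fixes E :: "nat \<Rightarrow> nat \<Rightarrow> (nat \<times> nat) set" and wt :: "nat \<Rightarrow> nat \<Rightarrow> real"
    and Kd :: "nat \<Rightarrow> nat \<Rightarrow> nat \<Rightarrow> 'a \<Rightarrow> real" and \<kappa> cV C l :: real and \<beta> h :: "nat \<Rightarrow> real"
  assumes fin_E: "finite (E n i)" and wt_nonneg: "0 \<le> wt n i" and wt_sum: "i < n \<Longrightarrow> wt n i * real (card (E n i)) = 1"
    and Kd_meas: "Kd i j k \<in> borel_measurable (sources (amplitude_sources i))" and Kd_nonneg: "0 \<le> Kd i j k \<omega>"
    and Kd_sq: "integrable M (\<lambda>\<omega>. (Kd i j k \<omega>)\<^sup>2)" and Kd_le: "expectation (\<lambda>\<omega>. (Kd i j k \<omega>)\<^sup>2) \<le> \<kappa>"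
    and cV: "0 \<le> cV" and dom: "AE \<omega> in M. \<forall>n. \<forall>i<n. (wt n i * (\<Sum>(j, k)\<in>E n i. Kd i j k \<omega>)) powr l \<le> cV * amp_env i \<omega>"
    and count: "\<And>n c d c' d'. 0 < n \<Longrightarrow> c \<le> d \<Longrightarrow> d - c \<le> 4 * h n \<Longrightarrow> c' \<le> d' \<Longrightarrow> d' - c' \<le> 4 * h n \<Longrightarrow>
       (\<Sum>i<n. (wt n i)\<^sup>2 * (\<Sum>(j, k)\<in>E n i. \<Sum>(j', k')\<in>E n i. expectation (\<lambda>\<omega>.
          (indicat_real {c..d} (T i j \<omega>) * indicat_real {c'..d'} (T i k \<omega>)) *
          (indicat_real {c..d} (T i j' \<omega>) * indicat_real {c'..d'} (T i k' \<omega>))))) \<le> C * real n * \<beta> n"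
    and C: "0 \<le> C" and h_pos: "\<And>n. 0 < h n" and h_lim: "h \<longlonglongrightarrow> 0"
    and h_ge: "\<forall>\<^sub>F n in sequentially. 1 / (real n)\<^sup>2 \<le> h n"
    and \<beta>_pos: "\<forall>\<^sub>F n in sequentially. 0 < \<beta> n"
    and l: "2 < l" and rate: "(\<lambda>n. inverse (\<beta> n) * (ln (real n) / real n) powr (1 - 2 / l)) \<longlonglongrightarrow> 0"
    and mesh: "\<forall>\<^sub>F n in sequentially. 1 / (real n)\<^sup>2 \<le> sqrt (\<beta> n * (ln (real n) / real n))"
begin

definition kernel_avg where
  "kernel_avg Z n F \<omega> = (\<Sum>i<n. wt n i * (\<Sum>(j, k)\<in>E n i. Z i j k \<omega> * F (T i j \<omega>) (T i k \<omega>))) / real n"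
  for Z :: "nat \<Rightarrow> nat \<Rightarrow> nat \<Rightarrow> 'a \<Rightarrow> real" and F :: "real \<Rightarrow> real \<Rightarrow> real"

definition kernel_mean where
  "kernel_mean Z n F = (\<Sum>i<n. wt n i * (\<Sum>(j, k)\<in>E n i. expectation (\<lambda>\<omega>. Z i j k \<omega> * F (T i j \<omega>) (T i k \<omega>)))) / real n"
  for Z :: "nat \<Rightarrow> nat \<Rightarrow> nat \<Rightarrow> 'a \<Rightarrow> real" and F :: "real \<Rightarrow> real \<Rightarrow> real"

definition rate_fun where "rate_fun n = sqrt (\<beta> n * (ln (real n) / real n))"

text \<open>From intervals to kernels of bounded variation, for nonnegative weights. The
  integrability conclusion allows expectations to be subtracted when a signed weight is
  split.\<close>

lemma AE_kernel_avg_nonneg: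
  assumes Z_meas: "\<And>i j k. Z i j k \<in> borel_measurable (sources (curve_sources i))" and Z_nonneg: "\<And>i j k \<omega>. 0 \<le> Z i j k \<omega>"
    and Z_le: "AE \<omega> in M. \<forall>i j k. Z i j k \<omega> \<le> Kd i j k \<omega>"
    and bv: "bv_kernel \<phi>" "bv_kernel \<psi>"
  shows "AE \<omega> in M. \<exists>B. \<forall>\<^sub>F n in sequentially. \<forall>s\<in>{a..b}. \<forall>t\<in>{a..b}.
     \<bar>kernel_avg Z n (\<lambda>x y. \<phi> ((x - s) / h n) * \<psi> ((y - t) / h n)) \<omega> - kernel_mean Z n (\<lambda>x y. \<phi> ((x - s) / h n) * \<psi> ((y - t) / h n))\<bar>
       \<le> B * rate_fun n"
    and "\<And>s t n i j k. integrable M (\<lambda>\<omega>. Z i j k \<omega> * (\<phi> ((T i j \<omega> - s) / h n) * \<psi> ((T i k \<omega> - t) / h n)))"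
proof -
  interpret dominated_array M a b \<sigma> P X \<xi> T U f\<^sub>T m\<^sub>T M\<^sub>T p E wt Z Kd \<kappa>
    by unfold_locales (use fin_E wt_nonneg wt_sum Z_meas Z_nonneg Z_le Kd_meas Kd_nonneg Kd_sq Kd_le in auto)
  have bF: "bdd_fun (\<lambda>x y. \<phi> ((x - s) / h n) * \<psi> ((y - t) / h n))" for s t n
    by (rule bdd_fun_product[OF bounded_borel_rescale[OF bv_kernel_bounded_borel[OF bv(1)]] bounded_borel_rescale[OF bv_kernel_bounded_borel[OF bv(2)]]])
  show "integrable M (\<lambda>\<omega>. Z i j k \<omega> * (\<phi> ((T i j \<omega> - s) / h n) * \<psi> ((T i k \<omega> - t) / h n)))" for s t n i j k
    by (rule summand_int[OF bF])
  have dev_eq: "dev Z n F \<omega> = kernel_avg Z n F \<omega> - kernel_mean Z n F" if F: "bdd_fun F" for n F \<omega>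
  proof -
    have e: "expectation (curve_sum Z n i F) = wt n i * (\<Sum>(j, k)\<in>E n i. expectation (\<lambda>\<omega>. Z i j k \<omega> * F (T i j \<omega>) (T i k \<omega>)))" for i
      unfolding curve_sum_def using summand_int[OF F] by (simp add: case_prod_beta)
    show ?thesis
      unfolding dev_def e sum_subtractf diff_divide_distrib kernel_avg_def kernel_mean_def curve_sum_def ..
  qed
  have dom': "AE \<omega> in M. \<forall>n. \<forall>i<n. dom_sum n i (\<lambda>_ _. 1) \<omega> powr l \<le> cV * amp_env i \<omega>"
    using dom by (simp add: dom_sum_def)
  have AEd: "AE \<omega> in M. \<exists>B. \<forall>\<^sub>F n in sequentially. \<forall>s\<in>{a..b}. \<forall>t\<in>{a..b}. \<forall>I J.
     is_interval I \<longrightarrow> I \<subseteq> {-1..1} \<longrightarrow> is_interval J \<longrightarrow> J \<subseteq> {-1..1} \<longrightarrow>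
     \<bar>dev Z n (\<lambda>x y. indicator I ((x - s) / h n) * indicator J ((y - t) / h n)) \<omega>\<bar> \<le> B * sqrt (\<beta> n * (ln (real n) / real n))"
    by (rule AE_dev_dominated[OF cV dom' _ C h_pos h_lim h_ge \<beta>_pos l rate mesh]) (rule count)
  obtain D where D: "0 \<le> D" "\<And>n s t h \<omega> \<epsilon>. (\<And>I J. is_interval I \<Longrightarrow> I \<subseteq> {-1..1} \<Longrightarrow> is_interval J \<Longrightarrow> J \<subseteq> {-1..1} \<Longrightarrow>
       \<bar>dev Z n (\<lambda>x y. indicator I ((x - s) / h) * indicator J ((y - t) / h)) \<omega>\<bar> \<le> \<epsilon>) \<Longrightarrow>
     \<bar>dev Z n (\<lambda>x y. \<phi> ((x - s) / h) * \<psi> ((y - t) / h)) \<omega>\<bar> \<le> D * \<epsilon>"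
    using dev_bv_kernels_le[OF bv] by blast
  show "AE \<omega> in M. \<exists>B. \<forall>\<^sub>F n in sequentially. \<forall>s\<in>{a..b}. \<forall>t\<in>{a..b}.
     \<bar>kernel_avg Z n (\<lambda>x y. \<phi> ((x - s) / h n) * \<psi> ((y - t) / h n)) \<omega> - kernel_mean Z n (\<lambda>x y. \<phi> ((x - s) / h n) * \<psi> ((y - t) / h n))\<bar>
       \<le> B * rate_fun n"
    using AEd
  proof eventually_elim
    case (elim \<omega>)
    then obtain B where B: "\<forall>\<^sub>F n in sequentially. \<forall>s\<in>{a..b}. \<forall>t\<in>{a..b}. \<forall>I J.
       is_interval I \<longrightarrow> I \<subseteq> {-1..1} \<longrightarrow> is_interval J \<longrightarrow> J \<subseteq> {-1..1} \<longrightarrow>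
       \<bar>dev Z n (\<lambda>x y. indicator I ((x - s) / h n) * indicator J ((y - t) / h n)) \<omega>\<bar> \<le> B * sqrt (\<beta> n * (ln (real n) / real n))" by blast
    show ?case
    proof (intro exI[of _ "D * B"])
      show "\<forall>\<^sub>F n in sequentially. \<forall>s\<in>{a..b}. \<forall>t\<in>{a..b}.
        \<bar>kernel_avg Z n (\<lambda>x y. \<phi> ((x - s) / h n) * \<psi> ((y - t) / h n)) \<omega> - kernel_mean Z n (\<lambda>x y. \<phi> ((x - s) / h n) * \<psi> ((y - t) / h n))\<bar>
         \<le> D * B * rate_fun n"
        using B
      proof eventually_elim
        case (elim n)
        show ?case
        proof (intro ballI)
          fix s t assume "s \<in> {a..b}" "t \<in> {a..b}"
          then have "\<bar>dev Z n (\<lambda>x y. \<phi> ((x - s) / h n) * \<psi> ((y - t) / h n)) \<omega>\<bar> \<le> D * (B * sqrt (\<beta> n * (ln (real n) / real n)))"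
            using elim by (intro D(2)) blast
          then show "\<bar>kernel_avg Z n (\<lambda>x y. \<phi> ((x - s) / h n) * \<psi> ((y - t) / h n)) \<omega> - kernel_mean Z n (\<lambda>x y. \<phi> ((x - s) / h n) * \<psi> ((y - t) / h n))\<bar>
             \<le> D * B * rate_fun n"
            unfolding dev_eq[OF bF] rate_fun_def by (simp add: mult.assoc)
        qed
      qed
    qed
  qed
qed

text \<open>Positive and negative parts are nonnegative, measurable and dominated by the same
  \<open>Kd\<close>. Averages and means are linear in \<open>Z\<close>, so the two bounds
  add.\<close>

lemma AE_kernel_avg:
  assumes Z_meas: "\<And>i j k. Z i j k \<in> borel_measurable (sources (curve_sources i))"
    and Z_le: "AE \<omega> in M. \<forall>i j k. \<bar>Z i j k \<omega>\<bar> \<le> Kd i j k \<omega>"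
    and bv: "bv_kernel \<phi>" "bv_kernel \<psi>"
  shows "AE \<omega> in M. \<exists>B. \<forall>\<^sub>F n in sequentially. \<forall>s\<in>{a..b}. \<forall>t\<in>{a..b}.
     \<bar>kernel_avg Z n (\<lambda>x y. \<phi> ((x - s) / h n) * \<psi> ((y - t) / h n)) \<omega> - kernel_mean Z n (\<lambda>x y. \<phi> ((x - s) / h n) * \<psi> ((y - t) / h n))\<bar>
       \<le> B * rate_fun n"
proof -
  let ?p = "\<lambda>i j k \<omega>. max 0 (Z i j k \<omega>)" and ?n = "\<lambda>i j k \<omega>. max 0 (- Z i j k \<omega>)"
  have Z: "Z i j k \<omega> * c = ?p i j k \<omega> * c - ?n i j k \<omega> * c" for i j k \<omega> c by (cases "0 \<le> Z i j k \<omega>") auto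
  have meas: "?p i j k \<in> borel_measurable (sources (curve_sources i))" "?n i j k \<in> borel_measurable (sources (curve_sources i))" for i j k
    using Z_meas[of i j k] by measurable
  have lep: "AE \<omega> in M. \<forall>i j k. ?p i j k \<omega> \<le> Kd i j k \<omega>" and len: "AE \<omega> in M. \<forall>i j k. ?n i j k \<omega> \<le> Kd i j k \<omega>"
    using Z_le by (eventually_elim, use Kd_nonneg in \<open>auto simp: abs_le_iff minus_le_iff\<close>)+
  note P = AE_kernel_avg_nonneg[OF meas(1) _ lep bv] and N = AE_kernel_avg_nonneg[OF meas(2) _ len bv]
  let ?F = "\<lambda>n s t x y. \<phi> ((x - s) / h n) * \<psi> ((y - t) / h n)"
  have avg: "kernel_avg Z n F \<omega> = kernel_avg ?p n F \<omega> - kernel_avg ?n n F \<omega>" for n F \<omega>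
    unfolding kernel_avg_def diff_divide_distrib[symmetric] sum_subtractf[symmetric] right_diff_distrib[symmetric] case_prod_beta
      Z[symmetric] ..
  have "expectation (\<lambda>\<omega>. Z i j k \<omega> * ?F n s t (T i j \<omega>) (T i k \<omega>)) = expectation (\<lambda>\<omega>. ?p i j k \<omega> * ?F n s t (T i j \<omega>) (T i k \<omega>))
      - expectation (\<lambda>\<omega>. ?n i j k \<omega> * ?F n s t (T i j \<omega>) (T i k \<omega>))" for i j k n s t
    unfolding Bochner_Integration.integral_diff[OF P(2) N(2), simplified, symmetric] Z ..
  then have mean: "kernel_mean Z n (?F n s t) = kernel_mean ?p n (?F n s t) - kernel_mean ?n n (?F n s t)" for n s t
    unfolding kernel_mean_def diff_divide_distrib[symmetric] sum_subtractf[symmetric] right_diff_distrib[symmetric] case_prod_beta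
    by simp
  have "AE \<omega> in M. \<exists>B. \<forall>\<^sub>F n in sequentially. \<forall>s\<in>{a..b}. \<forall>t\<in>{a..b}.
     \<bar>kernel_avg ?p n (?F n s t) \<omega> - kernel_mean ?p n (?F n s t)\<bar> \<le> B * rate_fun n" by (rule P(1)) auto
  moreover have "AE \<omega> in M. \<exists>B. \<forall>\<^sub>F n in sequentially. \<forall>s\<in>{a..b}. \<forall>t\<in>{a..b}.
     \<bar>kernel_avg ?n n (?F n s t) \<omega> - kernel_mean ?n n (?F n s t)\<bar> \<le> B * rate_fun n" by (rule N(1)) auto
  ultimately show ?thesis
  proof eventually_elim
    case (elim \<omega>)
    then obtain B1 B2 where "\<forall>\<^sub>F n in sequentially. \<forall>s\<in>{a..b}. \<forall>t\<in>{a..b}. \<bar>kernel_avg ?p n (?F n s t) \<omega> - kernel_mean ?p n (?F n s t)\<bar> \<le> B1 * rate_fun n"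
      "\<forall>\<^sub>F n in sequentially. \<forall>s\<in>{a..b}. \<forall>t\<in>{a..b}. \<bar>kernel_avg ?n n (?F n s t) \<omega> - kernel_mean ?n n (?F n s t)\<bar> \<le> B2 * rate_fun n"
      by blast
    then have "\<forall>\<^sub>F n in sequentially. \<forall>s\<in>{a..b}. \<forall>t\<in>{a..b}. \<bar>kernel_avg Z n (?F n s t) \<omega> - kernel_mean Z n (?F n s t)\<bar> \<le> (B1 + B2) * rate_fun n"
    proof eventually_elim
      case (elim n)
      show ?case
      proof (intro ballI)
        fix s t assume "s \<in> {a..b}" "t \<in> {a..b}"
        then have "\<bar>kernel_avg ?p n (?F n s t) \<omega> - kernel_mean ?p n (?F n s t)\<bar> \<le> B1 * rate_fun n"
          "\<bar>kernel_avg ?n n (?F n s t) \<omega> - kernel_mean ?n n (?F n s t)\<bar> \<le> B2 * rate_fun n" using elim by blast+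
        then show "\<bar>kernel_avg Z n (?F n s t) \<omega> - kernel_mean Z n (?F n s t)\<bar> \<le> (B1 + B2) * rate_fun n"
          unfolding avg mean distrib_right by linarith
      qed
    qed
    then show ?case by blast
  qed
qed

end

subsection \<open>Rates and counting of pairs\<close>

text \<open>The reciprocal of \<open>gam\<close>, the form in which it enters all rates; it lies
  between 0 and 1, and with it the rates become polynomials in the bandwidth.\<close>

definition inv_avg :: "(nat \<Rightarrow> nat \<Rightarrow> nat) \<Rightarrow> nat \<Rightarrow> nat \<Rightarrow> real" where
  "inv_avg m n k = (\<Sum>i<n. 1 / real (m n i) ^ k) / real n"

lemma inverse_gam: "1 / gam m n k = inv_avg m n k" "1 / (x * gam m n k) = inv_avg m n k / x"
  unfolding gam_def inv_avg_def by (simp_all add: field_simps)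

lemma inv_avg_bounds:
  assumes "\<And>n i. i < n \<Longrightarrow> 2 \<le> m n i"
  shows "0 \<le> inv_avg m n k" "inv_avg m n k \<le> 1"
proof -
  have le: "1 / real (m n i) ^ k \<le> 1" if "i < n" for i using assms[OF that] by (simp add: divide_le_eq)
  have "(\<Sum>i<n. 1 / real (m n i) ^ k) \<le> (\<Sum>i<n. 1)" using le by (intro sum_mono) auto
  then show "inv_avg m n k \<le> 1" unfolding inv_avg_def by (simp add: divide_le_eq)
  show "0 \<le> inv_avg m n k" unfolding inv_avg_def by (intro divide_nonneg_nonneg sum_nonneg) auto
qed

text \<open>
  The moment condition in abstract form: \<open>k\<close> is the normalisation (\<open>h\<close> or \<open>h\<^sup>2\<close>) and
  \<open>sqrt (\<beta> \<rho>) / k\<close> the stochastic rate.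
\<close>

lemma rate_facts:
  fixes \<beta> k :: "nat \<Rightarrow> real"
  assumes \<beta>: "\<And>n. 0 < \<beta> n" and k: "\<And>n. 0 < k n" and le: "\<forall>\<^sub>F n in sequentially. \<beta> n \<le> B * k n"
    and l: "2 < l" and rate: "(\<lambda>n. inverse (\<beta> n) * (ln (real n) / real n) powr (1 - 2 / l)) \<longlonglongrightarrow> 0"
  shows "\<forall>\<^sub>F n in sequentially. 1 / (real n)\<^sup>2 \<le> k n"
    and "\<forall>\<^sub>F n in sequentially. 1 / (real n)\<^sup>2 \<le> sqrt (\<beta> n * (ln (real n) / real n))"
    and "(\<lambda>n. sqrt (\<beta> n * (ln (real n) / real n)) / k n) \<longlonglongrightarrow> 0"
proof -
  define \<rho> where "\<rho> n = ln (real n) / real n" for n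
  have \<rho>_lim: "\<rho> \<longlonglongrightarrow> 0" unfolding \<rho>_def by real_asymp
  have big: "\<forall>\<^sub>F n in sequentially. 3 \<le> n \<and> 1 / real n \<le> \<rho> n \<and> 0 < \<rho> n \<and> \<rho> n < 1"
    using eventually_ge_at_top[of 3] order_tendstoD(2)[OF \<rho>_lim, of 1, simplified]
  proof eventually_elim
    case (elim n)
    have "exp 1 \<le> real n" using exp_le elim by linarith
    then have "1 \<le> ln (real n)" using elim by (simp add: ln_ge_iff)
    then show ?case using elim unfolding \<rho>_def by (auto intro: divide_right_mono)
  qed
  \<comment> \<open>For \<rho> below 1 the power \<open>\<rho> powr (1 - 2 / l)\<close> is at least
    \<rho>, so the moment condition implies this weaker limit. All three conclusions rest on
    it.\<close>
  have ratio: "(\<lambda>n. \<rho> n / \<beta> n) \<longlonglongrightarrow> 0"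
  proof (rule tendsto_sandwich[OF _ _ tendsto_const rate])
    show "\<forall>\<^sub>F n in sequentially. 0 \<le> \<rho> n / \<beta> n"
      using big by eventually_elim (use \<beta> less_imp_le in \<open>auto intro!: divide_nonneg_pos\<close>)
    show "\<forall>\<^sub>F n in sequentially. \<rho> n / \<beta> n \<le> inverse (\<beta> n) * (ln (real n) / real n) powr (1 - 2 / l)"
      using big
    proof eventually_elim
      case (elim n)
      then have pos: "0 < \<rho> n" by simp
      have "\<rho> n powr 1 \<le> \<rho> n powr (1 - 2 / l)" using pos elim l by (intro powr_mono') auto
      then have "\<rho> n \<le> \<rho> n powr (1 - 2 / l)" using pos by simp
      then have "\<rho> n \<le> (ln (real n) / real n) powr (1 - 2 / l)" by (simp only: \<rho>_def)
      then have "inverse (\<beta> n) * \<rho> n \<le> inverse (\<beta> n) * (ln (real n) / real n) powr (1 - 2 / l)"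
        using \<beta>[of n] by (intro mult_left_mono) auto
      then show ?case by (simp add: divide_inverse mult.commute)
    qed
  qed
  define B' where "B' = \<bar>B\<bar> + 1"
  have B': "0 < B'" "1 \<le> B'" "B \<le> B'" by (auto simp: B'_def)
  have small: "\<forall>\<^sub>F n in sequentially. \<rho> n / \<beta> n < 1 / B'"
    using order_tendstoD(2)[OF ratio, of "1 / B'"] B' by simp
  have le': "\<forall>\<^sub>F n in sequentially. \<beta> n \<le> B' * k n"
    using le by eventually_elim (use k B' mult_right_mono[of B B' "k _"] less_imp_le order_trans in blast)
  have sq: "1 / (real n)\<^sup>2 \<le> 1 / real n" if "3 \<le> n" for n :: nat
  proof -
    have "real n * 1 \<le> real n * real n" using that by (intro mult_left_mono) auto
    then show ?thesis using that by (intro divide_left_mono) (auto simp: power2_eq_square)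
  qed
  show "\<forall>\<^sub>F n in sequentially. 1 / (real n)\<^sup>2 \<le> k n"
    using big small le'
  proof eventually_elim
    case (elim n)
    then have "B' * \<rho> n \<le> \<beta> n" using \<beta>[of n] B' by (simp add: field_simps)
    also have "\<dots> \<le> B' * k n" using elim by simp
    finally have "\<rho> n \<le> k n" using B' by simp
    then show ?case using sq[of n] elim by linarith
  qed
  show "\<forall>\<^sub>F n in sequentially. 1 / (real n)\<^sup>2 \<le> sqrt (\<beta> n * (ln (real n) / real n))"
    using big small
  proof eventually_elim
    case (elim n)
    have r: "0 \<le> \<rho> n" using elim by (smt (verit) divide_nonneg_nonneg of_nat_0_le_iff)
    have "B' * \<rho> n \<le> \<beta> n" using elim \<beta>[of n] B' by (simp add: field_simps)
    moreover have "1 * \<rho> n \<le> B' * \<rho> n" using B' r by (intro mult_right_mono) auto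
    ultimately have "\<rho> n \<le> \<beta> n" by linarith
    then have "\<rho> n * \<rho> n \<le> \<beta> n * \<rho> n" using r by (intro mult_right_mono)
    then have "\<rho> n \<le> sqrt (\<beta> n * \<rho> n)" using r by (simp add: real_le_rsqrt power2_eq_square)
    then show ?case using sq[of n] elim unfolding \<rho>_def by linarith
  qed
  show "(\<lambda>n. sqrt (\<beta> n * (ln (real n) / real n)) / k n) \<longlonglongrightarrow> 0"
  proof (rule tendsto_sandwich[OF _ _ tendsto_const])
    show "(\<lambda>n. B' * sqrt (\<rho> n / \<beta> n)) \<longlonglongrightarrow> 0"
      using tendsto_mult[OF tendsto_const[of B'] tendsto_real_sqrt[OF ratio]] by simp
    show "\<forall>\<^sub>F n in sequentially. 0 \<le> sqrt (\<beta> n * (ln (real n) / real n)) / k n"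
      using big
    proof eventually_elim
      case (elim n)
      have "0 \<le> ln (real n) / real n" using elim by (auto intro!: divide_nonneg_nonneg ln_ge_zero)
      then have "0 \<le> \<beta> n * (ln (real n) / real n)" using \<beta>[of n] by (intro mult_nonneg_nonneg) auto
      then show ?case using k[of n] by (intro divide_nonneg_nonneg real_sqrt_ge_zero) auto
    qed
    show "\<forall>\<^sub>F n in sequentially. sqrt (\<beta> n * (ln (real n) / real n)) / k n \<le> B' * sqrt (\<rho> n / \<beta> n)"
      using big le'
    proof eventually_elim
      case (elim n)
      have r: "0 \<le> \<rho> n" using elim by (smt (verit) divide_nonneg_nonneg of_nat_0_le_iff)
      \<comment> \<open>Pulling \<beta> out of the root shows the quotient as \<beta> / k, which is
        bounded, times the vanishing factor \<open>sqrt (\<rho> n / \<beta> n)\<close>.\<close>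
      have "\<beta> n * \<rho> n = (\<beta> n)\<^sup>2 * (\<rho> n / \<beta> n)" using \<beta>[of n] by (simp add: power2_eq_square field_simps)
      then have "sqrt (\<beta> n * \<rho> n) = \<beta> n * sqrt (\<rho> n / \<beta> n)"
        using \<beta>[of n] by (simp only: real_sqrt_mult real_sqrt_abs abs_of_pos)
      also have "\<dots> \<le> B' * k n * sqrt (\<rho> n / \<beta> n)"
        using elim r \<beta>[of n] by (intro mult_right_mono) auto
      finally show ?case using k[of n] unfolding \<rho>_def by (simp add: divide_le_eq mult_ac)
    qed
  qed
qed

section \<open>Coincidences among pairs of points on one curve\<close>

definition pairs_diag :: "nat \<Rightarrow> (nat \<times> nat) set" where
  "pairs_diag m = (\<lambda>j. (j, j)) ` {..<m}"

definition pairs_off :: "nat \<Rightarrow> (nat \<times> nat) set" where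
  "pairs_off m = Sigma {..<m} (\<lambda>j. {..<m} - {j})"

lemma finite_pairs[simp]: "finite (pairs_diag m)" "finite (pairs_off m)"
  by (auto simp: pairs_diag_def pairs_off_def)

lemma sum_pairs_diag: "(\<Sum>(j, k)\<in>pairs_diag m. g j k) = (\<Sum>j<m. g j j)" for g :: "nat \<Rightarrow> nat \<Rightarrow> real"
  unfolding pairs_diag_def by (subst sum.reindex) (auto simp: inj_on_def)

lemma sum_pairs_off: "(\<Sum>(j, k)\<in>pairs_off m. g j k) = (\<Sum>j<m. \<Sum>k\<in>{..<m} - {j}. g j k)" for g :: "nat \<Rightarrow> nat \<Rightarrow> real"
  unfolding pairs_off_def by (rule sum.Sigma[symmetric]) auto

lemma card_pairs_diag: "card (pairs_diag m) = m"
  unfolding pairs_diag_def by (subst card_image) (auto simp: inj_on_def)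

lemma card_pairs_off: "real (card (pairs_off m)) = real m * (real m - 1)"
proof -
  have "card (pairs_off m) = (\<Sum>j<m. m - 1)" unfolding pairs_off_def by (subst card_SigmaI) auto
  then show ?thesis by (cases m) (auto simp: algebra_simps)
qed

text \<open>The constraints by the first interval on the distinct indices among \<open>j\<close>,
  \<open>j'\<close> give \<open>q ^ card {j, j'}\<close>. The form with \<open>of_bool\<close> can
  be summed over \<open>j'\<close> at once and holds for every nonnegative \<open>q\<close>, also
  above 1.\<close>

lemma (in fda_model) two_boxes_le_diag:
  assumes q: "M\<^sub>T * (d - c) \<le> q" and cd: "c \<le> d" and q0: "0 \<le> q"
  shows "expectation (\<lambda>\<omega>. (indicat_real {c..d} (T i j \<omega>) * indicat_real {c'..d'} (T i j \<omega>)) *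
          (indicat_real {c..d} (T i j' \<omega>) * indicat_real {c'..d'} (T i j' \<omega>))) \<le> q * (q + of_bool (j' = j))"
proof -
  let ?L = "{j, j'}"
  have "expectation (\<lambda>\<omega>. (indicat_real {c..d} (T i j \<omega>) * indicat_real {c'..d'} (T i j \<omega>)) *
          (indicat_real {c..d} (T i j' \<omega>) * indicat_real {c'..d'} (T i j' \<omega>)))
      \<le> expectation (\<lambda>\<omega>. \<Prod>l\<in>?L. indicat_real {c..d} (T i l \<omega>))"
  proof (intro integral_mono)
    show "integrable M (\<lambda>\<omega>. (indicat_real {c..d} (T i j \<omega>) * indicat_real {c'..d'} (T i j \<omega>)) *
          (indicat_real {c..d} (T i j' \<omega>) * indicat_real {c'..d'} (T i j' \<omega>)))"
      by (intro integrable_const_bound[where B = 1]) (auto simp: indicator_def)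
    have "\<bar>\<Prod>l\<in>?L. indicat_real {c..d} (T i l \<omega>)\<bar> \<le> 1" for \<omega>
      unfolding abs_prod by (intro prod_le_1) (auto simp: indicator_def)
    moreover have "(\<lambda>\<omega>. \<Prod>l\<in>?L. indicat_real {c..d} (T i l \<omega>)) \<in> borel_measurable M" by measurable
    ultimately show "integrable M (\<lambda>\<omega>. \<Prod>l\<in>?L. indicat_real {c..d} (T i l \<omega>))"
      by (intro integrable_const_bound[where B = 1]) auto
    show "(indicat_real {c..d} (T i j \<omega>) * indicat_real {c'..d'} (T i j \<omega>)) *
          (indicat_real {c..d} (T i j' \<omega>) * indicat_real {c'..d'} (T i j' \<omega>)) \<le> (\<Prod>l\<in>?L. indicat_real {c..d} (T i l \<omega>))" for \<omega>
      by (cases "j = j'") (auto simp: indicator_def)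
  qed
  also have "\<dots> \<le> q ^ card ?L" by (rule T_prod_le) (use q cd in auto)
  also have "\<dots> \<le> q * (q + of_bool (j' = j))" using q0 mult_nonneg_nonneg[OF q0 q0] by (auto simp: power2_eq_square card_insert_if distrib_left)
  finally show ?thesis .
qed

text \<open>Two off-diagonal pairs have two, three or four distinct indices, and each distinct index
  costs a factor \<open>q\<close>. The bound is a product in \<open>j'\<close> and
  \<open>k'\<close>, so that the sum over the second pair factorises.\<close>

lemma (in fda_model) two_boxes_le_off:
  assumes q: "M\<^sub>T * (d - c) \<le> q" "M\<^sub>T * (d' - c') \<le> q" and cd: "c \<le> d" "c' \<le> d'" and q0: "0 \<le> q"
    and jk: "j \<noteq> k" "j' \<noteq> k'"
  shows "expectation (\<lambda>\<omega>. (indicat_real {c..d} (T i j \<omega>) * indicat_real {c'..d'} (T i k \<omega>)) *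
          (indicat_real {c..d} (T i j' \<omega>) * indicat_real {c'..d'} (T i k' \<omega>)))
     \<le> q\<^sup>2 * ((q + of_bool (j' \<in> {j, k})) * (q + of_bool (k' \<in> {j, k})))"
proof -
  define L where "L = {j, k} \<union> ({j', k'} - {j, k})"
  \<comment> \<open>One interval per distinct index: \<open>j\<close> and \<open>k\<close> keep
    those of the first pair, a new \<open>j'\<close> or \<open>k'\<close> that of its own position.
    A crossing such as \<open>j' = k\<close> imposes two constraints, and keeping one of them only
    enlarges the probability.\<close>
  define A where "A l = (if l = j \<or> (l = j' \<and> l \<noteq> k) then {c..d} else {c'..d'})" for l
  have fin: "finite L" unfolding L_def by auto
  have [measurable]: "A l \<in> sets borel" for l unfolding A_def by auto
  have "expectation (\<lambda>\<omega>. (indicat_real {c..d} (T i j \<omega>) * indicat_real {c'..d'} (T i k \<omega>)) *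
          (indicat_real {c..d} (T i j' \<omega>) * indicat_real {c'..d'} (T i k' \<omega>)))
      \<le> expectation (\<lambda>\<omega>. \<Prod>l\<in>L. indicat_real (A l) (T i l \<omega>))"
  proof (intro integral_mono)
    fix \<omega>
    show "(indicat_real {c..d} (T i j \<omega>) * indicat_real {c'..d'} (T i k \<omega>)) *
          (indicat_real {c..d} (T i j' \<omega>) * indicat_real {c'..d'} (T i k' \<omega>)) \<le> (\<Prod>l\<in>L. indicat_real (A l) (T i l \<omega>))"
    proof (cases "T i j \<omega> \<in> {c..d} \<and> T i k \<omega> \<in> {c'..d'} \<and> T i j' \<omega> \<in> {c..d} \<and> T i k' \<omega> \<in> {c'..d'}")
      case True
      then have "T i l \<omega> \<in> A l" if "l \<in> L" for l using that jk unfolding L_def A_def by auto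
      then have "(\<Prod>l\<in>L. indicat_real (A l) (T i l \<omega>)) = 1" by simp
      then show ?thesis by (simp add: indicator_def)
    next
      case False
      then have z: "(indicat_real {c..d} (T i j \<omega>) * indicat_real {c'..d'} (T i k \<omega>)) *
          (indicat_real {c..d} (T i j' \<omega>) * indicat_real {c'..d'} (T i k' \<omega>)) = 0" by (auto simp: indicator_def)
      show ?thesis unfolding z by (intro prod_nonneg) simp
    qed
  next
    show "integrable M (\<lambda>\<omega>. (indicat_real {c..d} (T i j \<omega>) * indicat_real {c'..d'} (T i k \<omega>)) *
          (indicat_real {c..d} (T i j' \<omega>) * indicat_real {c'..d'} (T i k' \<omega>)))"
      by (intro integrable_const_bound[where B = 1]) (auto simp: indicator_def)
    have "\<bar>\<Prod>l\<in>L. indicat_real (A l) (T i l \<omega>)\<bar> \<le> 1" for \<omega>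
      unfolding abs_prod by (intro prod_le_1) (auto simp: indicator_def)
    moreover have "(\<lambda>\<omega>. \<Prod>l\<in>L. indicat_real (A l) (T i l \<omega>)) \<in> borel_measurable M" by measurable
    ultimately show "integrable M (\<lambda>\<omega>. \<Prod>l\<in>L. indicat_real (A l) (T i l \<omega>))"
      by (intro integrable_const_bound[where B = 1]) auto
  qed
  also have "\<dots> \<le> q ^ card L"
  proof (rule T_prod_le[OF fin])
    show "\<exists>c d. A l = {c..d} \<and> c \<le> d \<and> M\<^sub>T * (d - c) \<le> q" for l
      unfolding A_def using q cd by auto
  qed
  also have "q ^ card L = q\<^sup>2 * (q ^ of_bool (j' \<notin> {j, k}) * q ^ of_bool (k' \<notin> {j, k}))"
  proof -
    have "card L = card {j, k} + card ({j', k'} - {j, k})" unfolding L_def by (rule card_Un_disjoint) auto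
    also have "card {j, k} = 2" using jk by simp
    also have "card ({j', k'} - {j, k}) = of_bool (j' \<notin> {j, k}) + of_bool (k' \<notin> {j, k})"
      using jk by (auto simp: insert_Diff_if)
    finally show ?thesis by (simp only: power_add)
  qed
  also have "\<dots> \<le> q\<^sup>2 * ((q + of_bool (j' \<in> {j, k})) * (q + of_bool (k' \<in> {j, k})))"
    using q0 by (intro mult_left_mono mult_mono) (auto intro!: mult_nonneg_nonneg)
  finally show ?thesis .
qed

text \<open>Among the squared number of combinations only the \<open>m\<close> coinciding ones lose
  a factor \<open>q\<close>, which after normalisation leaves \<open>q / real m\<close>. With
  \<open>q\<close> proportional to the bandwidth, averaging over curves produces the two terms of
  \<open>beta1\<close>.\<close>

lemma (in fda_model) count_diag:
  assumes q: "M\<^sub>T * (d - c) \<le> q" and cd: "c \<le> d" and q0: "0 \<le> q" and m: "0 < m"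
  shows "(1 / real m)\<^sup>2 * (\<Sum>(j, k)\<in>pairs_diag m. \<Sum>(j', k')\<in>pairs_diag m. expectation (\<lambda>\<omega>.
          (indicat_real {c..d} (T i j \<omega>) * indicat_real {c'..d'} (T i k \<omega>)) *
          (indicat_real {c..d} (T i j' \<omega>) * indicat_real {c'..d'} (T i k' \<omega>)))) \<le> q\<^sup>2 + q / real m"
proof -
  have "(\<Sum>(j, k)\<in>pairs_diag m. \<Sum>(j', k')\<in>pairs_diag m. expectation (\<lambda>\<omega>.
          (indicat_real {c..d} (T i j \<omega>) * indicat_real {c'..d'} (T i k \<omega>)) *
          (indicat_real {c..d} (T i j' \<omega>) * indicat_real {c'..d'} (T i k' \<omega>))))
      \<le> (\<Sum>j<m. \<Sum>j'<m. q * (q + of_bool (j' = j)))"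
    unfolding sum_pairs_diag by (intro sum_mono two_boxes_le_diag q cd q0)
  also have "\<dots> = real m * (q * (real m * q + 1))"
    by (simp add: sum_distrib_left[symmetric] sum.distrib of_bool_def)
  finally have "(1 / real m)\<^sup>2 * (\<Sum>(j, k)\<in>pairs_diag m. \<Sum>(j', k')\<in>pairs_diag m. expectation (\<lambda>\<omega>.
          (indicat_real {c..d} (T i j \<omega>) * indicat_real {c'..d'} (T i k \<omega>)) *
          (indicat_real {c..d} (T i j' \<omega>) * indicat_real {c'..d'} (T i k' \<omega>))))
      \<le> (1 / real m)\<^sup>2 * (real m * (q * (real m * q + 1)))" by (rule mult_left_mono) simp
  also have "\<dots> = q\<^sup>2 + q / real m" using m by (simp add: power2_eq_square field_simps)
  finally show ?thesis .
qed

text \<open>For a fixed first pair the second pair is enlarged to all of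
  \<open>{..<m} \<times> {..<m}\<close>, where the sum is the square of
  \<open>real m * q + 2\<close>: two of the \<open>m\<close> indices can coincide. The mixed term of
  that square is absorbed by \<open>(x + 2)^2 \<le> 2 x^2 + 8\<close>, so no term of order
  \<open>q ^ 3\<close> remains.\<close>

lemma (in fda_model) count_off:
  assumes q: "M\<^sub>T * (d - c) \<le> q" "M\<^sub>T * (d' - c') \<le> q" and cd: "c \<le> d" "c' \<le> d'" and q0: "0 \<le> q" and m: "2 \<le> m"
  shows "(1 / (real m * (real m - 1)))\<^sup>2 * (\<Sum>(j, k)\<in>pairs_off m. \<Sum>(j', k')\<in>pairs_off m. expectation (\<lambda>\<omega>.
          (indicat_real {c..d} (T i j \<omega>) * indicat_real {c'..d'} (T i k \<omega>)) *
          (indicat_real {c..d} (T i j' \<omega>) * indicat_real {c'..d'} (T i k' \<omega>)))) \<le> 4 * q ^ 4 + 16 * q\<^sup>2 / (real m)\<^sup>2"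
proof -
  let ?e = "\<lambda>j k j' k'. expectation (\<lambda>\<omega>.
          (indicat_real {c..d} (T i j \<omega>) * indicat_real {c'..d'} (T i k \<omega>)) *
          (indicat_real {c..d} (T i j' \<omega>) * indicat_real {c'..d'} (T i k' \<omega>)))"
  define N where "N = real m * (real m - 1)"
  have inner: "(\<Sum>(j', k')\<in>pairs_off m. ?e j k j' k') \<le> q\<^sup>2 * (real m * q + 2)\<^sup>2" if jk: "(j, k) \<in> pairs_off m" for j k
  proof -
    have ne: "j \<noteq> k" "j < m" "k < m" using jk by (auto simp: pairs_off_def)
    let ?b = "\<lambda>j'. q + of_bool (j' \<in> {j, k})"
    have "(\<Sum>(j', k')\<in>pairs_off m. ?e j k j' k') \<le> (\<Sum>(j', k')\<in>pairs_off m. q\<^sup>2 * (?b j' * ?b k'))"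
    proof (intro sum_mono, clarify)
      fix j' k' assume "(j', k') \<in> pairs_off m"
      then have "j' \<noteq> k'" by (auto simp: pairs_off_def)
      then show "?e j k j' k' \<le> q\<^sup>2 * (?b j' * ?b k')" by (rule two_boxes_le_off[OF q cd q0 ne(1)])
    qed
    also have "\<dots> \<le> (\<Sum>(j', k')\<in>{..<m} \<times> {..<m}. q\<^sup>2 * (?b j' * ?b k'))"
      using q0 by (intro sum_mono2) (auto simp: pairs_off_def)
    also have "\<dots> = q\<^sup>2 * ((\<Sum>j'<m. ?b j') * (\<Sum>k'<m. ?b k'))"
      by (simp only: sum.cartesian_product[symmetric] sum_distrib_left[symmetric] sum_product)
    also have "(\<Sum>j'<m. ?b j') = real m * q + 2"
    proof -
      have "(\<Sum>j'<m. of_bool (j' \<in> {j, k}) :: real) = real (card {j, k})"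
        using ne by (subst sum.mono_neutral_cong_right[of _ "{j, k}" _ "\<lambda>_. 1"]) auto
      then show ?thesis using ne(1) by (simp add: sum.distrib)
    qed
    finally show ?thesis by (simp add: power2_eq_square)
  qed
  have "(\<Sum>(j, k)\<in>pairs_off m. \<Sum>(j', k')\<in>pairs_off m. ?e j k j' k') \<le> (\<Sum>(j, k)\<in>pairs_off m. q\<^sup>2 * (real m * q + 2)\<^sup>2)"
    by (intro sum_mono, clarify) (rule inner)
  also have "\<dots> = N * (q\<^sup>2 * (real m * q + 2)\<^sup>2)" by (simp add: case_prod_beta card_pairs_off N_def)
  finally have "(1 / N)\<^sup>2 * (\<Sum>(j, k)\<in>pairs_off m. \<Sum>(j', k')\<in>pairs_off m. ?e j k j' k') \<le> (1 / N)\<^sup>2 * (N * (q\<^sup>2 * (real m * q + 2)\<^sup>2))"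
    by (rule mult_left_mono) simp
  also have "\<dots> = (1 / N) * (q\<^sup>2 * (real m * q + 2)\<^sup>2)"
    using m by (simp add: N_def power2_eq_square)
  \<comment> \<open>\<open>m \<ge> 2\<close> makes the number of off-diagonal pairs at least half of
    the square of \<open>m\<close>.\<close>
  also have "\<dots> \<le> (2 / (real m)\<^sup>2) * (q\<^sup>2 * (2 * (real m)\<^sup>2 * q\<^sup>2 + 8))"
  proof (rule mult_mono)
    have "(real m)\<^sup>2 / 2 \<le> N"
    proof -
      have "real m * 2 \<le> real m * real m" using m by (intro mult_left_mono) auto
      then show ?thesis unfolding N_def by (simp add: power2_eq_square algebra_simps)
    qed
    moreover have "0 < (real m)\<^sup>2 / 2" "0 < N" using m by (simp_all add: N_def)
    ultimately have "1 / N \<le> 1 / ((real m)\<^sup>2 / 2)" by (intro divide_left_mono mult_pos_pos) auto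
    then show "1 / N \<le> 2 / (real m)\<^sup>2" by simp
    have "(real m * q + 2)\<^sup>2 \<le> 2 * (real m)\<^sup>2 * q\<^sup>2 + 8"
      using zero_le_power2[of "real m * q - 2"] by (simp add: power2_eq_square algebra_simps)
    then show "q\<^sup>2 * (real m * q + 2)\<^sup>2 \<le> q\<^sup>2 * (2 * (real m)\<^sup>2 * q\<^sup>2 + 8)" by (rule mult_left_mono) simp
  qed auto
  also have "\<dots> = 4 * q ^ 4 + 16 * q\<^sup>2 / (real m)\<^sup>2"
    using m by (simp add: field_simps power2_eq_square power4_eq_xxxx)
  finally show ?thesis unfolding N_def .
qed

subsection \<open>Centred observations\<close>

context fda_model
begin

abbreviation \<mu> where "\<mu> \<equiv> mean_fun P X"

definition second_moment where "second_moment s t = (\<integral>q. X s q * X t q \<partial>P)"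

lemma X_random: "t \<in> {a..b} \<Longrightarrow> X t \<in> borel_measurable P"
  using measurable_compose[OF measurable_Pair1'[of t I_ab P] X_meas] by (simp add: space_I_ab)

lemma X_sq_int: "t \<in> {a..b} \<Longrightarrow> integrable P (\<lambda>q. (X t q)\<^sup>2)"
  using process by (simp add: second_order_process_def)

lemma X_int: "t \<in> {a..b} \<Longrightarrow> integrable P (X t)"
  by (rule P.integrable_of_square[OF X_random X_sq_int])

lemma X_prod_int:
  assumes st: "s \<in> {a..b}" "t \<in> {a..b}" shows "integrable P (\<lambda>q. X s q * X t q)"
proof (rule Bochner_Integration.integrable_bound)
  show "integrable P (\<lambda>q. ((X s q)\<^sup>2 + (X t q)\<^sup>2) / 2)" using X_sq_int st by auto
  show "(\<lambda>q. X s q * X t q) \<in> borel_measurable P" using X_random st by auto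
  have "\<bar>x * y\<bar> \<le> (x\<^sup>2 + y\<^sup>2) / 2" for x y :: real
    using sum_squares_bound[of "\<bar>x\<bar>" "\<bar>y\<bar>"] by (simp add: abs_mult)
  then have "norm (x * y) \<le> norm ((x\<^sup>2 + y\<^sup>2) / 2)" for x y :: real
    by (metis real_norm_def abs_ge_self order_trans)
  then show "AE q in P. norm (X s q * X t q) \<le> norm (((X s q)\<^sup>2 + (X t q)\<^sup>2) / 2)"
    by (intro AE_I2)
qed

lemma cov_fun_eq:
  assumes st: "s \<in> {a..b}" "t \<in> {a..b}" shows "cov_fun P X s t = second_moment s t - \<mu> s * \<mu> t"
proof -
  have "cov_fun P X s t = (\<integral>q. X s q * X t q - \<mu> t * X s q - \<mu> s * X t q + \<mu> s * \<mu> t \<partial>P)"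
    unfolding cov_fun_def by (intro Bochner_Integration.integral_cong) (auto simp: algebra_simps)
  also have "\<dots> = second_moment s t - \<mu> t * \<mu> s - \<mu> s * \<mu> t + \<mu> s * \<mu> t"
    unfolding second_moment_def mean_fun_def using X_prod_int[OF st] X_int[OF st(1)] X_int[OF st(2)] by (simp add: P.prob_space)
  finally show ?thesis by simp
qed

lemma I_ab_borel: "(\<lambda>x. x) \<in> measurable I_ab borel"
  by (simp add: I_ab_def measurable_restrict_space1)

lemma \<mu>_meas: "\<mu> \<in> borel_measurable I_ab"
  unfolding mean_fun_def by (rule P.borel_measurable_lebesgue_integral[OF X_meas])

lemma X_fst_meas: "(\<lambda>z. X (fst (fst z)) (snd z)) \<in> borel_measurable ((I_ab \<Otimes>\<^sub>M I_ab) \<Otimes>\<^sub>M P)"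
  and X_snd_meas: "(\<lambda>z. X (snd (fst z)) (snd z)) \<in> borel_measurable ((I_ab \<Otimes>\<^sub>M I_ab) \<Otimes>\<^sub>M P)"
proof -
  have 1: "(\<lambda>z. (fst (fst z), snd z)) \<in> measurable ((I_ab \<Otimes>\<^sub>M I_ab) \<Otimes>\<^sub>M P) (I_ab \<Otimes>\<^sub>M P)" by measurable
  have 2: "(\<lambda>z. (snd (fst z), snd z)) \<in> measurable ((I_ab \<Otimes>\<^sub>M I_ab) \<Otimes>\<^sub>M P) (I_ab \<Otimes>\<^sub>M P)" by measurable
  show "(\<lambda>z. X (fst (fst z)) (snd z)) \<in> borel_measurable ((I_ab \<Otimes>\<^sub>M I_ab) \<Otimes>\<^sub>M P)"
    "(\<lambda>z. X (snd (fst z)) (snd z)) \<in> borel_measurable ((I_ab \<Otimes>\<^sub>M I_ab) \<Otimes>\<^sub>M P)"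
    using measurable_compose[OF 1 X_meas] measurable_compose[OF 2 X_meas] by simp_all
qed

lemma second_moment_meas: "(\<lambda>(s, t). second_moment s t) \<in> borel_measurable (I_ab \<Otimes>\<^sub>M I_ab)"
proof -
  have "(\<lambda>z. X (fst (fst z)) (snd z) * X (snd (fst z)) (snd z)) \<in> borel_measurable ((I_ab \<Otimes>\<^sub>M I_ab) \<Otimes>\<^sub>M P)"
    by (intro borel_measurable_times X_fst_meas X_snd_meas)
  then have "(\<lambda>(st, q). X (fst st) q * X (snd st) q) \<in> borel_measurable ((I_ab \<Otimes>\<^sub>M I_ab) \<Otimes>\<^sub>M P)"
    by (simp add: case_prod_beta')
  from P.borel_measurable_lebesgue_integral[OF this] show ?thesis
    by (simp add: second_moment_def case_prod_beta')
qed

definition Y where "Y i j \<omega> = X (T i j \<omega>) (\<xi> i \<omega>) + U i j \<omega>"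

lemma obs_eq: "obs X \<xi> T U i j \<omega> = Y i j \<omega>"
  by (simp add: obs_def realization_def Y_def)

text \<open>Centring at the conditional mean given the times, not at the value at the target point,
  keeps the noise exactly of mean 0 against every kernel; smoothness enters through the bias alone.
  The same holds for \<open>eps2\<close>.\<close>

definition eps1 where "eps1 i j \<omega> = Y i j \<omega> - \<mu> (T i j \<omega>)"

definition eps2 where "eps2 i j k \<omega> = Y i j \<omega> * Y i k \<omega> - second_moment (T i j \<omega>) (T i k \<omega>)"

lemma T_range': "\<omega> \<in> space M \<Longrightarrow> T i j \<omega> \<in> {a..b}" using T_range by auto

lemma Y_meas: "Curve i \<in> A \<Longrightarrow> Time i j \<in> A \<Longrightarrow> Error i j \<in> A \<Longrightarrow> Y i j \<in> borel_measurable (sources A)"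
  unfolding Y_def by (intro borel_measurable_add X_at_T U_sources)

lemma \<mu>_T_meas: "Time i j \<in> A \<Longrightarrow> (\<lambda>\<omega>. \<mu> (T i j \<omega>)) \<in> borel_measurable (sources A)"
  by (rule measurable_compose[OF T_I_ab \<mu>_meas])

lemma second_moment_T_meas: "Time i j \<in> A \<Longrightarrow> Time i k \<in> A \<Longrightarrow> (\<lambda>\<omega>. second_moment (T i j \<omega>) (T i k \<omega>)) \<in> borel_measurable (sources A)"
  using measurable_compose[OF measurable_Pair[OF T_I_ab T_I_ab] second_moment_meas, of i j A i k] by simp

lemma eps1_meas: "eps1 i j \<in> borel_measurable (sources (curve_sources i))"
  unfolding eps1_def by (intro borel_measurable_diff Y_meas \<mu>_T_meas) (auto simp: curve_sources_def)

lemma eps2_meas: "eps2 i j k \<in> borel_measurable (sources (curve_sources i))"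
  unfolding eps2_def by (intro borel_measurable_diff borel_measurable_times Y_meas second_moment_T_meas) (auto simp: curve_sources_def)

end

context fda_moment
begin

lemma \<mu>_le_offset: "t \<in> {a..b} \<Longrightarrow> \<bar>\<mu> t\<bar> \<le> offset"
proof -
  assume t: "t \<in> {a..b}"
  have "\<bar>\<mu> t\<bar> \<le> (\<integral>q. \<bar>X t q\<bar> \<partial>P)" unfolding mean_fun_def by (rule integral_abs_bound)
  also have "\<dots> \<le> (\<integral>q. curve_bound q \<partial>P)"
    using X_le_curve_bound t X_int[OF t] curve_bound_int by (intro integral_mono_AE) auto
  finally show ?thesis using offset_ge(2) by linarith
qed

lemma second_moment_le_offset:
  assumes st: "s \<in> {a..b}" "t \<in> {a..b}" shows "\<bar>second_moment s t\<bar> \<le> offset"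
proof -
  have "\<bar>second_moment s t\<bar> \<le> (\<integral>q. \<bar>X s q * X t q\<bar> \<partial>P)" unfolding second_moment_def by (rule integral_abs_bound)
  also have "\<dots> \<le> (\<integral>q. (curve_bound q)\<^sup>2 \<partial>P)"
  proof (rule integral_mono_AE)
    show "AE q in P. \<bar>X s q * X t q\<bar> \<le> (curve_bound q)\<^sup>2"
      using X_le_curve_bound
    proof eventually_elim
      case (elim q)
      then show ?case using st mult_mono[of "\<bar>X s q\<bar>" "curve_bound q" "\<bar>X t q\<bar>" "curve_bound q"] curve_bound_nonneg[of q]
        by (simp add: abs_mult power2_eq_square)
    qed
  qed (use X_prod_int[OF st] curve_bound_sq_int in auto)
  finally show ?thesis using offset_ge(3) by linarith
qed

lemma eps1_le: "AE \<omega> in M. \<forall>i j. \<bar>eps1 i j \<omega>\<bar> \<le> amp i j \<omega>"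
  using X_le_curve_bound_\<xi> AE_space
proof eventually_elim
  case (elim \<omega>)
  show ?case
  proof (intro allI)
    fix i j
    have T: "T i j \<omega> \<in> {a..b}" using elim T_range' by blast
    have "\<bar>X (T i j \<omega>) (\<xi> i \<omega>)\<bar> \<le> curve_bound (\<xi> i \<omega>)" using elim T by blast
    then show "\<bar>eps1 i j \<omega>\<bar> \<le> amp i j \<omega>"
      using \<mu>_le_offset[OF T] unfolding eps1_def Y_def amp_def by linarith
  qed
qed

text \<open>The product of amplitudes expands into the product of the two observation bounds,
  nonnegative mixed terms and \<open>offset * offset\<close>; the last dominates
  \<open>offset\<close> and thus the second moment function.\<close>

lemma eps2_le: "AE \<omega> in M. \<forall>i j k. \<bar>eps2 i j k \<omega>\<bar> \<le> amp i j \<omega> * amp i k \<omega>"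
  using X_le_curve_bound_\<xi> AE_space
proof eventually_elim
  case (elim \<omega>)
  show ?case
  proof (intro allI)
    fix i j k
    have T: "T i j \<omega> \<in> {a..b}" "T i k \<omega> \<in> {a..b}" using elim T_range' by blast+
    let ?x = "curve_bound (\<xi> i \<omega>) + \<bar>U i j \<omega>\<bar>" and ?y = "curve_bound (\<xi> i \<omega>) + \<bar>U i k \<omega>\<bar>"
    have Y: "\<bar>Y i j \<omega>\<bar> \<le> curve_bound (\<xi> i \<omega>) + \<bar>U i j \<omega>\<bar>" if "T i j \<omega> \<in> {a..b}" for j
    proof -
      have "\<bar>X (T i j \<omega>) (\<xi> i \<omega>)\<bar> \<le> curve_bound (\<xi> i \<omega>)" using elim that by blast
      then show "\<bar>Y i j \<omega>\<bar> \<le> curve_bound (\<xi> i \<omega>) + \<bar>U i j \<omega>\<bar>" unfolding Y_def by linarith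
    qed
    have xy: "0 \<le> ?x" "0 \<le> ?y" using curve_bound_nonneg by auto
    have "\<bar>Y i j \<omega> * Y i k \<omega>\<bar> \<le> ?x * ?y"
      unfolding abs_mult using Y[OF T(1)] Y[OF T(2)] xy by (intro mult_mono) auto
    moreover have "offset \<le> offset * offset" using offset_ge(1) mult_left_mono[of 1 offset offset] by simp
    moreover have "0 \<le> ?x * offset + offset * ?y" using xy offset_ge(1) curve_bound_nonneg[of "\<xi> i \<omega>"] by (intro add_nonneg_nonneg mult_nonneg_nonneg) auto
    moreover have "amp i j \<omega> * amp i k \<omega> = ?x * ?y + (?x * offset + offset * ?y) + offset * offset"
      unfolding amp_def by (simp add: algebra_simps)
    ultimately show "\<bar>eps2 i j k \<omega>\<bar> \<le> amp i j \<omega> * amp i k \<omega>"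
      using second_moment_le_offset[OF T] unfolding eps2_def by linarith
  qed
qed

lemma XT_meas[measurable]: "(\<lambda>\<omega>. X (T i j \<omega>) (\<xi> i \<omega>)) \<in> borel_measurable M"
  using sources_sub[OF X_at_T[of i j UNIV]] by simp

lemma curve_bound_\<xi>_int: "integrable M (\<lambda>\<omega>. curve_bound (\<xi> i \<omega>))" "integrable M (\<lambda>\<omega>. (curve_bound (\<xi> i \<omega>))\<^sup>2)"
  using \<xi>_integrable[of curve_bound i] \<xi>_integrable[of "\<lambda>q. (curve_bound q)\<^sup>2" i] curve_bound_int curve_bound_sq_int by simp_all

lemma XT_int: "integrable M (\<lambda>\<omega>. X (T i j \<omega>) (\<xi> i \<omega>))"
proof (rule Bochner_Integration.integrable_bound[OF curve_bound_\<xi>_int(1)])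
  show "AE \<omega> in M. norm (X (T i j \<omega>) (\<xi> i \<omega>)) \<le> norm (curve_bound (\<xi> i \<omega>))"
    using X_le_curve_bound_\<xi> AE_space by eventually_elim (use T_range' curve_bound_nonneg in auto)
qed measurable

lemma XT_prod_int: "integrable M (\<lambda>\<omega>. X (T i j \<omega>) (\<xi> i \<omega>) * X (T i k \<omega>) (\<xi> i \<omega>))"
proof (rule Bochner_Integration.integrable_bound[OF curve_bound_\<xi>_int(2)])
  show "AE \<omega> in M. norm (X (T i j \<omega>) (\<xi> i \<omega>) * X (T i k \<omega>) (\<xi> i \<omega>)) \<le> norm ((curve_bound (\<xi> i \<omega>))\<^sup>2)"
    using X_le_curve_bound_\<xi> AE_space
  proof eventually_elim
    case (elim \<omega>)
    have "\<bar>X (T i j \<omega>) (\<xi> i \<omega>)\<bar> \<le> curve_bound (\<xi> i \<omega>)" "\<bar>X (T i k \<omega>) (\<xi> i \<omega>)\<bar> \<le> curve_bound (\<xi> i \<omega>)"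
      using elim T_range' by blast+
    then show ?case using mult_mono[of "\<bar>X (T i j \<omega>) (\<xi> i \<omega>)\<bar>" "curve_bound (\<xi> i \<omega>)" "\<bar>X (T i k \<omega>) (\<xi> i \<omega>)\<bar>" "curve_bound (\<xi> i \<omega>)"]
        curve_bound_nonneg[of "\<xi> i \<omega>"] by (auto simp: abs_mult power2_eq_square)
  qed
qed measurable

lemma bounded_mult_int:
  fixes f g :: "'a \<Rightarrow> real"
  assumes "integrable M f" "g \<in> borel_measurable M" "\<And>\<omega>. \<bar>g \<omega>\<bar> \<le> B"
  shows "integrable M (\<lambda>\<omega>. f \<omega> * g \<omega>)"
proof (rule Bochner_Integration.integrable_bound)
  show "integrable M (\<lambda>\<omega>. B * \<bar>f \<omega>\<bar>)" using assms(1) by auto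
  show "(\<lambda>\<omega>. f \<omega> * g \<omega>) \<in> borel_measurable M" using assms by auto
  have "\<bar>f \<omega>\<bar> * \<bar>g \<omega>\<bar> \<le> \<bar>f \<omega>\<bar> * B" for \<omega> using assms(3) by (intro mult_left_mono) auto
  then show "AE \<omega> in M. norm (f \<omega> * g \<omega>) \<le> norm (B * \<bar>f \<omega>\<bar>)"
    by (intro AE_I2) (simp add: abs_mult, metis abs_ge_self abs_mult abs_of_nonneg abs_ge_zero mult.commute order_trans mult_right_mono)
qed

context
  fixes F :: "real \<Rightarrow> real \<Rightarrow> real" and B :: real
  assumes F_meas: "(\<lambda>(x, y). F x y) \<in> borel_measurable (borel \<Otimes>\<^sub>M borel)" and F_bd: "\<And>x y. \<bar>F x y\<bar> \<le> B"
begin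

lemma F_T_meas: "Time i j \<in> A \<Longrightarrow> Time i k \<in> A \<Longrightarrow> (\<lambda>\<omega>. F (T i j \<omega>) (T i k \<omega>)) \<in> borel_measurable (sources A)"
  using measurable_compose[OF measurable_Pair[OF T_sources T_sources] F_meas, of i j A i k] by simp

lemma F_T_M: "(\<lambda>\<omega>. F (T i j \<omega>) (T i k \<omega>)) \<in> borel_measurable M"
  using sources_sub[OF F_T_meas[of i j UNIV k]] by simp

lemma F_pair_meas: "(\<lambda>z. F (fst (fst z)) (snd (fst z))) \<in> borel_measurable ((I_ab \<Otimes>\<^sub>M I_ab) \<Otimes>\<^sub>M P)"
proof -
  have "(\<lambda>z. (fst (fst z), snd (fst z))) \<in> measurable ((I_ab \<Otimes>\<^sub>M I_ab) \<Otimes>\<^sub>M P) (borel \<Otimes>\<^sub>M borel)"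
    by (intro measurable_Pair measurable_compose[OF _ I_ab_borel]) measurable
  from measurable_compose[OF this F_meas] show ?thesis by (simp add: case_prod_beta')
qed

lemma XT_F_expectation:
  "expectation (\<lambda>\<omega>. X (T i j \<omega>) (\<xi> i \<omega>) * F (T i j \<omega>) (T i k \<omega>)) = expectation (\<lambda>\<omega>. \<mu> (T i j \<omega>) * F (T i j \<omega>) (T i k \<omega>))"
proof -
  have "expectation (\<lambda>\<omega>. X (T i j \<omega>) (\<xi> i \<omega>) * F (T i j \<omega>) (T i k \<omega>))
      = expectation (\<lambda>\<omega>. \<integral>q. X (T i j \<omega>) q * F (T i j \<omega>) (T i k \<omega>) \<partial>P)"
    using integrate_out_curve[of "\<lambda>s t q. X s q * F s t" i j k] borel_measurable_times[OF X_fst_meas F_pair_meas]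
      bounded_mult_int[OF XT_int F_T_M F_bd] by (simp add: case_prod_beta')
  then show ?thesis by (simp add: mean_fun_def)
qed

lemma XT_prod_F_expectation:
  "expectation (\<lambda>\<omega>. (X (T i j \<omega>) (\<xi> i \<omega>) * X (T i k \<omega>) (\<xi> i \<omega>)) * F (T i j \<omega>) (T i k \<omega>))
     = expectation (\<lambda>\<omega>. second_moment (T i j \<omega>) (T i k \<omega>) * F (T i j \<omega>) (T i k \<omega>))"
proof -
  have "expectation (\<lambda>\<omega>. (X (T i j \<omega>) (\<xi> i \<omega>) * X (T i k \<omega>) (\<xi> i \<omega>)) * F (T i j \<omega>) (T i k \<omega>))
      = expectation (\<lambda>\<omega>. \<integral>q. (X (T i j \<omega>) q * X (T i k \<omega>) q) * F (T i j \<omega>) (T i k \<omega>) \<partial>P)"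
    using integrate_out_curve[of "\<lambda>s t q. (X s q * X t q) * F s t" i j k]
      borel_measurable_times[OF borel_measurable_times[OF X_fst_meas X_snd_meas] F_pair_meas]
      bounded_mult_int[OF XT_prod_int F_T_M F_bd] by (simp add: case_prod_beta')
  then show ?thesis by (simp add: second_moment_def)
qed

text \<open>Whatever does not involve \<open>Error i k\<close> is independent of
  \<open>U i k\<close>, whose mean is 0. With \<open>A\<close> the complement of that single source,
  \<open>g\<close> may involve the curve, all times and all other errors.\<close>

lemma U_indep_zero:
  assumes g: "g \<in> borel_measurable (sources A)" and int: "integrable M g" and A: "Error i k \<notin> A"
  shows "integrable M (\<lambda>\<omega>. U i k \<omega> * g \<omega>)" "expectation (\<lambda>\<omega>. U i k \<omega> * g \<omega>) = 0"
proof -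
  have "indep_set (sets (sources {Error i k})) (sets (sources A))" using A by (intro indep_sources_pair) auto
  note * = indep_set_integral[OF this _ _ U_sources g integrable_of_square[OF U_borel U_sq] int]
  show "integrable M (\<lambda>\<omega>. U i k \<omega> * g \<omega>)" "expectation (\<lambda>\<omega>. U i k \<omega> * g \<omega>) = 0"
    using * by (simp_all add: U_mean)
qed

lemma eps1_F_expectation: "expectation (\<lambda>\<omega>. eps1 i j \<omega> * F (T i j \<omega>) (T i k \<omega>)) = 0"
proof -
  let ?F = "\<lambda>\<omega>. F (T i j \<omega>) (T i k \<omega>)"
  have intF: "integrable M ?F" using F_bd F_T_M by (intro integrable_const_bound[where B = B]) auto
  have 1: "integrable M (\<lambda>\<omega>. X (T i j \<omega>) (\<xi> i \<omega>) * ?F \<omega>)" by (rule bounded_mult_int[OF XT_int F_T_M F_bd])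
  note U = U_indep_zero[OF F_T_meas[of i j "{Time i j, Time i k}" k] intF, of i j]
  have 2: "integrable M (\<lambda>\<omega>. \<mu> (T i j \<omega>) * ?F \<omega>)"
  proof (rule bounded_mult_int[OF _ F_T_M F_bd])
    show "integrable M (\<lambda>\<omega>. \<mu> (T i j \<omega>))"
      using sources_sub[OF \<mu>_T_meas[of i j UNIV]] \<mu>_le_offset T_range'
      by (intro integrable_const_bound[where B = offset]) auto
  qed
  have "expectation (\<lambda>\<omega>. eps1 i j \<omega> * ?F \<omega>) = expectation (\<lambda>\<omega>. X (T i j \<omega>) (\<xi> i \<omega>) * ?F \<omega> + U i j \<omega> * ?F \<omega> - \<mu> (T i j \<omega>) * ?F \<omega>)"
    unfolding eps1_def Y_def by (simp add: algebra_simps)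
  also have "\<dots> = 0" using 1 2 U XT_F_expectation by simp
  finally show ?thesis .
qed

text \<open>Multiplying out leaves the curve product, which integrates to
  \<open>second_moment\<close> at the times, and three terms with an error factor. These vanish
  because \<open>j \<noteq> k\<close> makes one error independent of everything else in the term; on
  the diagonal the squared error would leave a contribution of
  \<open>\<sigma>\<^sup>2\<close>.\<close>

lemma eps2_F_expectation:
  assumes jk: "j \<noteq> k" shows "expectation (\<lambda>\<omega>. eps2 i j k \<omega> * F (T i j \<omega>) (T i k \<omega>)) = 0"
proof -
  let ?F = "\<lambda>\<omega>. F (T i j \<omega>) (T i k \<omega>)" and ?X = "\<lambda>j \<omega>. X (T i j \<omega>) (\<xi> i \<omega>)"
  have intF: "integrable M ?F" using F_bd F_T_M by (intro integrable_const_bound[where B = B]) auto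
  have 1: "integrable M (\<lambda>\<omega>. (?X j \<omega> * ?X k \<omega>) * ?F \<omega>)" by (rule bounded_mult_int[OF XT_prod_int F_T_M F_bd])
  have Ak: "Time i j \<in> - {Error i k}" "Time i k \<in> - {Error i k}" "Curve i \<in> - {Error i k}" "Error i j \<in> - {Error i k}" using jk by auto
  have Aj: "Time i j \<in> - {Error i j}" "Time i k \<in> - {Error i j}" "Curve i \<in> - {Error i j}" by auto
  have iX: "integrable M (\<lambda>\<omega>. ?X l \<omega> * ?F \<omega>)" for l by (rule bounded_mult_int[OF XT_int F_T_M F_bd])
  note U1 = U_indep_zero[OF borel_measurable_times[OF X_at_T[OF Ak(1,3)] F_T_meas[OF Ak(1,2)]] iX[of j], of i k]
  note U2 = U_indep_zero[OF borel_measurable_times[OF X_at_T[OF Aj(2,3)] F_T_meas[OF Aj(1,2)]] iX[of k], of i j]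
  note U3' = U_indep_zero[OF F_T_meas[OF Aj(1,2)] intF, of i j]
  note U3 = U_indep_zero[OF borel_measurable_times[OF U_sources[OF Ak(4)] F_T_meas[OF Ak(1,2)]], of i k]
  have 2: "integrable M (\<lambda>\<omega>. second_moment (T i j \<omega>) (T i k \<omega>) * ?F \<omega>)"
  proof (rule bounded_mult_int[OF _ F_T_M F_bd])
    show "integrable M (\<lambda>\<omega>. second_moment (T i j \<omega>) (T i k \<omega>))"
      using sources_sub[OF second_moment_T_meas[of i j UNIV k]] second_moment_le_offset T_range'
      by (intro integrable_const_bound[where B = offset]) auto
  qed
  have "expectation (\<lambda>\<omega>. eps2 i j k \<omega> * ?F \<omega>) = expectation (\<lambda>\<omega>. ((((?X j \<omega> * ?X k \<omega>) * ?F \<omega> + U i k \<omega> * (?X j \<omega> * ?F \<omega>))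
      + U i j \<omega> * (?X k \<omega> * ?F \<omega>)) + U i k \<omega> * (U i j \<omega> * ?F \<omega>)) - second_moment (T i j \<omega>) (T i k \<omega>) * ?F \<omega>)"
    unfolding eps2_def Y_def by (intro Bochner_Integration.integral_cong) (auto simp: algebra_simps)
  also have "\<dots> = 0" using 1 2 U1 U2 U3 U3' XT_prod_F_expectation by simp
  finally show ?thesis .
qed

end

end

subsection \<open>Kernel moments of the design\<close>

lemma kernel_integrable_times:
  assumes K: "condC2 K" and g: "g \<in> borel_measurable borel" and bd: "\<And>u. u \<in> {-1..1} \<Longrightarrow> \<bar>g u\<bar> \<le> (B :: real)"
  shows "integrable lborel (\<lambda>u. K u * g u)"
proof (rule Bochner_Integration.integrable_bound)
  have int: "integrable lborel K" and K0: "\<And>u. 0 \<le> K u" and Kz: "\<And>u. u \<notin> {-1..1} \<Longrightarrow> K u = 0"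
    using K by (auto simp: condC2_def)
  show "integrable lborel (\<lambda>u. B * K u)" using int by auto
  show "(\<lambda>u. K u * g u) \<in> borel_measurable lborel" using int g by auto
  have "norm (K u * g u) \<le> norm (B * K u)" for u
  proof (cases "u \<in> {-1..1}")
    case True
    then have "K u * \<bar>g u\<bar> \<le> K u * B" using bd K0 by (intro mult_left_mono) auto
    then show ?thesis using K0[of u] abs_ge_self[of "B * K u"] by (simp add: abs_mult mult.commute)
  qed (simp add: Kz)
  then show "AE u in lborel. norm (K u * g u) \<le> norm (B * K u)" by (intro AE_I2)
qed

text \<open>By symmetry half of the mass lies on \<open>[0, 1]\<close>. Restricted to it, the kernel
  is a density and not a point mass, so its second moment about any centre is bounded below
  uniformly.\<close>

lemma half_kernel_variance:
  assumes K: "condC2 K"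
  shows "(\<integral>u. K u * indicator {0..1} u \<partial>lborel) = 1 / 2"
    and "\<exists>v>0. \<forall>c. v \<le> (\<integral>u. K u * ((u - c)\<^sup>2 * indicator {0..1} u) \<partial>lborel)"
proof -
  have int: "integrable lborel K" and K0: "\<And>u. 0 \<le> K u" and Kz: "\<And>u. u \<notin> {-1..1} \<Longrightarrow> K u = 0"
    and sym: "\<And>u. K (- u) = K u" and tot: "(\<integral>u. K u \<partial>lborel) = 1"
    using K by (auto simp: condC2_def)
  have i1: "integrable lborel (\<lambda>u. K u * indicator {0..1} u)" "integrable lborel (\<lambda>u. K u * indicator {-1..0} u)"
    by (auto intro!: kernel_integrable_times[OF K, of _ 1] simp: indicator_def)
  have "(\<integral>u. K u * indicator {-1..0} u \<partial>lborel) = (\<integral>u. K u * indicator {0..1} u \<partial>lborel)"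
    using lborel_integral_real_affine[of "-1" "\<lambda>u. K u * indicator {-1..0} u" 0]
    by (simp add: sym) (intro Bochner_Integration.integral_cong, auto simp: indicator_def)
  moreover have "(\<integral>u. K u \<partial>lborel) = (\<integral>u. K u * indicator {-1..0} u + K u * indicator {0..1} u \<partial>lborel)"
  proof (rule integral_cong_AE)
    show "AE u in lborel. K u = K u * indicator {-1..0} u + K u * indicator {0..1} u"
      using AE_lborel_singleton[of 0] by eventually_elim (use Kz in \<open>auto simp: indicator_def\<close>)
  qed (use int in auto)
  ultimately show half: "(\<integral>u. K u * indicator {0..1} u \<partial>lborel) = 1 / 2"
    using i1 tot by simp
  have intp: "integrable lborel (\<lambda>u. K u * (u ^ p * indicator {0..1} u))" for p :: nat
  proof (rule kernel_integrable_times[OF K, of _ 1])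
    show "\<bar>u ^ p * indicator {0..1} u\<bar> \<le> 1" for u :: real
      by (auto simp: indicator_def power_le_one)
  qed measurable
  define k where "k p = (\<integral>u. K u * (u ^ p * indicator {0..1} u) \<partial>lborel)" for p :: nat
  have k0: "k 0 = 1 / 2" using half by (simp add: k_def)
  have quad: "(\<integral>u. K u * ((u - c)\<^sup>2 * indicator {0..1} u) \<partial>lborel) = k 2 - 2 * c * k 1 + c\<^sup>2 / 2" for c
  proof -
    have "(\<integral>u. K u * ((u - c)\<^sup>2 * indicator {0..1} u) \<partial>lborel) =
      (\<integral>u. K u * (u ^ 2 * indicator {0..1} u) - 2 * c * (K u * (u ^ 1 * indicator {0..1} u)) + c\<^sup>2 * (K u * (u ^ 0 * indicator {0..1} u)) \<partial>lborel)"
      by (intro Bochner_Integration.integral_cong) (auto simp: power2_eq_square algebra_simps)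
    also have "\<dots> = k 2 - 2 * c * k 1 + c\<^sup>2 * k 0"
      unfolding k_def using intp[of 2] intp[of 1] intp[of 0] by simp
    finally show ?thesis by (simp add: k0)
  qed
  \<comment> \<open>The minimum of the quadratic in \<open>c\<close>, attained at
    \<open>c = 2 * k 1\<close> because the half kernel has mass \<open>1 / 2\<close>.\<close>
  define v where "v = k 2 - 2 * (2 * k 1) * k 1 + (2 * k 1)\<^sup>2 / 2"
  have min: "v \<le> k 2 - 2 * c * k 1 + c\<^sup>2 / 2" for c
    unfolding v_def using zero_le_power2[of "c - 2 * k 1"] by (simp add: power2_eq_square algebra_simps)
  have int_c: "integrable lborel (\<lambda>u. K u * ((u - c)\<^sup>2 * indicator {0..1} u))" for c
  proof (rule kernel_integrable_times[OF K, of _ "(1 + \<bar>c\<bar>)\<^sup>2"])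
    show "\<bar>(u - c)\<^sup>2 * indicator {0..1} u\<bar> \<le> (1 + \<bar>c\<bar>)\<^sup>2" if "u \<in> {-1..1}" for u :: real
    proof -
      have "\<bar>u - c\<bar> \<le> 1 + \<bar>c\<bar>" using that by auto
      then have "(u - c)\<^sup>2 \<le> (1 + \<bar>c\<bar>)\<^sup>2" using power_mono[of "\<bar>u - c\<bar>" "1 + \<bar>c\<bar>" 2] by simp
      then show ?thesis by (auto simp: indicator_def)
    qed
  qed measurable
  \<comment> \<open>A vanishing minimum would force \<open>K\<close> to be 0 almost everywhere on
    \<open>[0, 1]\<close>, since the single point \<open>2 * k 1\<close> is a null set; this
    contradicts the mass \<open>1 / 2\<close>.\<close>
  have "v \<noteq> 0"
  proof
    assume "v = 0"
    then have "(\<integral>u. K u * ((u - 2 * k 1)\<^sup>2 * indicator {0..1} u) \<partial>lborel) = 0" using quad[of "2 * k 1"] by (simp add: v_def)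
    then have "AE u in lborel. K u * ((u - 2 * k 1)\<^sup>2 * indicator {0..1} u) = 0"
      using integral_nonneg_eq_0_iff_AE[OF int_c] K0 by auto
    then have "AE u in lborel. K u * indicator {0..1} u = 0"
      using AE_lborel_singleton[of "2 * k 1"] by eventually_elim auto
    then have "(\<integral>u. K u * indicator {0..1} u \<partial>lborel) = (\<integral>u. 0 \<partial>(lborel :: real measure))"
      using i1 by (intro integral_cong_AE) auto
    then show False using half by simp
  qed
  moreover have "0 \<le> v"
  proof -
    have "0 \<le> (\<integral>u. K u * ((u - 2 * k 1)\<^sup>2 * indicator {0..1} u) \<partial>lborel)" using K0 by (intro integral_nonneg_AE) auto
    then show ?thesis using quad[of "2 * k 1"] by (simp add: v_def)
  qed
  ultimately show "\<exists>v>0. \<forall>c. v \<le> (\<integral>u. K u * ((u - c)\<^sup>2 * indicator {0..1} u) \<partial>lborel)"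
    unfolding quad using min by (intro exI[of _ v]) auto
qed

context fda_model
begin

definition moment where
  "moment \<phi> h t = (\<integral>u. \<phi> u * (f\<^sub>T (t + h * u) * indicator {a..b} (t + h * u)) \<partial>lborel)" for \<phi> :: "real \<Rightarrow> real"

lemma f\<^sub>T_abs: "0 \<le> f\<^sub>T x * indicator {a..b} x" "f\<^sub>T x * indicator {a..b} x \<le> M\<^sub>T" "\<bar>f\<^sub>T x * indicator {a..b} x\<bar> \<le> M\<^sub>T"
  using f\<^sub>T_bounds[of x] m\<^sub>T M\<^sub>T by (auto simp: indicator_def)

lemma kernel_T_expectation:
  assumes [measurable]: "\<phi> \<in> borel_measurable borel" and h: "0 < h"
  shows "expectation (\<lambda>\<omega>. \<phi> ((T i j \<omega> - t) / h)) = h * moment \<phi> h t"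
proof -
  have "expectation (\<lambda>\<omega>. \<phi> ((T i j \<omega> - t) / h)) = (\<integral>x. f\<^sub>T x * indicator {a..b} x * \<phi> ((x - t) / h) \<partial>lborel)"
    by (rule T_expectation) measurable
  also have "\<dots> = h * (\<integral>u. f\<^sub>T (t + h * u) * indicator {a..b} (t + h * u) * \<phi> u \<partial>lborel)"
    using lborel_integral_real_affine[of h "\<lambda>x. f\<^sub>T x * indicator {a..b} x * \<phi> ((x - t) / h)" t] h by simp
  finally show ?thesis unfolding moment_def by (simp add: mult.commute)
qed

lemma kernel_T_prod_expectation:
  assumes \<phi>: "\<phi> \<in> borel_measurable borel" "\<And>u. \<bar>\<phi> u\<bar> \<le> B" and \<psi>: "\<psi> \<in> borel_measurable borel" "\<And>u. \<bar>\<psi> u\<bar> \<le> B'"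
    and h: "0 < h" and jk: "j \<noteq> k"
  shows "expectation (\<lambda>\<omega>. \<phi> ((T i j \<omega> - s) / h) * \<psi> ((T i k \<omega> - t) / h)) = h\<^sup>2 * (moment \<phi> h s * moment \<psi> h t)"
proof -
  have m: "(\<lambda>\<omega>. \<phi> ((T i j \<omega> - s) / h)) \<in> borel_measurable (sources {Time i j})"
    "(\<lambda>\<omega>. \<psi> ((T i k \<omega> - t) / h)) \<in> borel_measurable (sources {Time i k})"
    using \<phi>(1) \<psi>(1) T_sources[of i j "{Time i j}"] T_sources[of i k "{Time i k}"] by measurable
  have int: "integrable M (\<lambda>\<omega>. \<phi> ((T i j \<omega> - s) / h))" "integrable M (\<lambda>\<omega>. \<psi> ((T i k \<omega> - t) / h))"
    using integrable_const_bound[OF _ sources_sub[OF m(1)], of B] integrable_const_bound[OF _ sources_sub[OF m(2)], of B'] \<phi>(2) \<psi>(2)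
    by auto
  have "indep_set (sets (sources {Time i j})) (sets (sources {Time i k}))" using jk by (intro indep_sources_pair) auto
  from indep_set_integral(2)[OF this _ _ m int] show ?thesis
    using kernel_T_expectation[OF \<phi>(1) h] kernel_T_expectation[OF \<psi>(1) h] by (simp add: power2_eq_square)
qed

text \<open>
  For \<open>h \<le> (b - a) / 2\<close> one of the half windows \<open>[t, t + h]\<close>, \<open>[t - h, t]\<close> lies inside \<open>[a, b]\<close>;
  this keeps the design nondegenerate up to the boundary.
\<close>

lemma kernel_moments_nondegenerate:
  assumes K: "condC2 K"
  defines "S \<equiv> \<lambda>p. moment (\<lambda>u. K u * u ^ p)"
  shows "\<exists>s v. 0 < s \<and> s \<le> 1 \<and> 0 < v \<and> (\<forall>h t. 0 < h \<longrightarrow> h \<le> (b - a) / 2 \<longrightarrow> t \<in> {a..b} \<longrightarrow>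
     s \<le> S 0 h t \<and> \<bar>S 1 h t\<bar> \<le> S 0 h t \<and> v * (S 0 h t)\<^sup>2 \<le> S 2 h t * S 0 h t - (S 1 h t)\<^sup>2 \<and> S 0 h t \<le> M\<^sub>T)"
proof -
  have K0: "\<And>u. 0 \<le> K u" and Kz: "\<And>u. u \<notin> {-1..1} \<Longrightarrow> K u = 0" and intK: "integrable lborel K"
    and sym: "\<And>u. K (- u) = K u" and tot: "(\<integral>u. K u \<partial>lborel) = 1"
    using K by (auto simp: condC2_def)
  obtain v where v: "0 < v" "\<And>c. v \<le> (\<integral>u. K u * ((u - c)\<^sup>2 * indicator {0..1} u) \<partial>lborel)"
    using half_kernel_variance(2)[OF K] by blast
  have reflect: "(\<integral>u. K u * (g (- u) * indicator {-1..0} u) \<partial>lborel) = (\<integral>u. K u * (g u * indicator {0..1} u) \<partial>lborel)" for g :: "real \<Rightarrow> real"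
    using lborel_integral_real_affine[of "-1" "\<lambda>u. K u * (g (- u) * indicator {-1..0} u)" 0]
    by (simp add: sym) (intro Bochner_Integration.integral_cong, auto simp: indicator_def)
  define s where "s = min (m\<^sub>T / 2) 1"
  \<comment> \<open>The variance bound below is linear in \<open>S 0\<close>; as \<open>S 0\<close>
    is at most \<open>M\<^sub>T\<close>, it implies the quadratic form with this constant.\<close>
  define w where "w = m\<^sub>T * v / M\<^sub>T"
  have main: "s \<le> S 0 h t \<and> \<bar>S 1 h t\<bar> \<le> S 0 h t \<and> w * (S 0 h t)\<^sup>2 \<le> S 2 h t * S 0 h t - (S 1 h t)\<^sup>2 \<and> S 0 h t \<le> M\<^sub>T"
    if h: "0 < h" "h \<le> (b - a) / 2" and t: "t \<in> {a..b}" for h t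
  proof -
    let ?f = "\<lambda>u. f\<^sub>T (t + h * u) * indicator {a..b} (t + h * u)"
    have fm[measurable]: "?f \<in> borel_measurable borel" by (rule measurable_compose[OF _ f\<^sub>T_meas]) measurable
    have int: "integrable lborel (\<lambda>u. K u * (g u * ?f u))" if gm[measurable]: "g \<in> borel_measurable borel" and gb: "\<And>u. u \<in> {-1..1} \<Longrightarrow> \<bar>g u\<bar> \<le> B" for g :: "real \<Rightarrow> real" and B
    proof (rule kernel_integrable_times[OF K, of _ "B * M\<^sub>T"])
      show "\<bar>g u * ?f u\<bar> \<le> B * M\<^sub>T" if "u \<in> {-1..1}" for u
        unfolding abs_mult[of "g u"] using gb[OF that] f\<^sub>T_abs(3) by (intro mult_mono) auto
    qed measurable
    have S_eq: "S p h t = (\<integral>u. K u * (u ^ p * ?f u) \<partial>lborel)" for p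
      unfolding S_def moment_def by (simp add: mult.assoc)
    have intp: "integrable lborel (\<lambda>u. K u * (u ^ p * ?f u))" for p
      by (rule int[of "\<lambda>u. u ^ p" 1]) (auto simp: power_abs abs_le_iff intro!: power_le_one)
    have inside: "(\<forall>u\<in>{0..1}. t + h * u \<in> {a..b}) \<or> (\<forall>u\<in>{-1..0}. t + h * u \<in> {a..b})"
    proof (cases "t + h \<le> b")
      case True
      have "t + h * u \<in> {a..b}" if "u \<in> {0..1}" for u
      proof -
        have "0 \<le> h * u" "h * u \<le> h * 1" using h that by (auto intro: mult_left_mono)
        then show ?thesis using True t by auto
      qed
      then show ?thesis by blast
    next
      case False
      have "t + h * u \<in> {a..b}" if "u \<in> {-1..0}" for u
      proof -
        have "h * u \<le> 0" "h * (-1) \<le> h * u" using h that mult_left_mono[of "-1" u h] by (auto intro: mult_nonneg_nonpos)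
        then show ?thesis using False t h by auto
      qed
      then show ?thesis by blast
    qed
    \<comment> \<open>On whichever half window lies inside, the density is at least
      \<open>m\<^sub>T\<close>. The choice of half depends on \<open>t\<close>, so \<open>c\<close>
      is required to serve both.\<close>
    have lower: "m\<^sub>T * c \<le> (\<integral>u. K u * (g u * ?f u) \<partial>lborel)"
      if gm[measurable]: "g \<in> borel_measurable borel" and gb: "\<And>u. u \<in> {-1..1} \<Longrightarrow> \<bar>g u\<bar> \<le> B" and g0: "\<And>u. 0 \<le> g u"
        and c1: "c \<le> (\<integral>u. K u * (g u * indicator {0..1} u) \<partial>lborel)" and c2: "c \<le> (\<integral>u. K u * (g u * indicator {-1..0} u) \<partial>lborel)"
      for g :: "real \<Rightarrow> real" and B c
    proof -
      have low: "m\<^sub>T * (\<integral>u. K u * (g u * indicator A u) \<partial>lborel) \<le> (\<integral>u. K u * (g u * ?f u) \<partial>lborel)"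
        if A: "\<forall>u\<in>A. t + h * u \<in> {a..b}" "A \<in> sets borel" for A
      proof -
        note [measurable] = A(2)
        have iA: "integrable lborel (\<lambda>u. K u * (g u * indicator A u))"
          by (rule kernel_integrable_times[OF K, of _ B]) (use gb in \<open>auto simp: indicator_def intro: order_trans[OF abs_ge_zero]\<close>)
        have "(\<integral>u. m\<^sub>T * (K u * (g u * indicator A u)) \<partial>lborel) \<le> (\<integral>u. K u * (g u * ?f u) \<partial>lborel)"
        proof (rule integral_mono)
          show "m\<^sub>T * (K u * (g u * indicator A u)) \<le> K u * (g u * ?f u)" for u
          proof (cases "u \<in> A")
            case True
            then have "m\<^sub>T \<le> ?f u" using A(1) f\<^sub>T_bounds by auto
            then have "K u * (g u * m\<^sub>T) \<le> K u * (g u * ?f u)" using K0 g0 by (intro mult_left_mono) auto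
            then show ?thesis using True by (simp add: mult_ac)
          next
            case False
            then show ?thesis using K0 g0 f\<^sub>T_abs(1) by simp
          qed
        qed (use iA int[OF gm gb] in auto)
        then show ?thesis by simp
      qed
      from inside show ?thesis
      proof
        assume "\<forall>u\<in>{0..1}. t + h * u \<in> {a..b}"
        from low[OF this] have "m\<^sub>T * (\<integral>u. K u * (g u * indicator {0..1} u) \<partial>lborel) \<le> (\<integral>u. K u * (g u * ?f u) \<partial>lborel)" by simp
        moreover have "m\<^sub>T * c \<le> m\<^sub>T * (\<integral>u. K u * (g u * indicator {0..1} u) \<partial>lborel)" using c1 m\<^sub>T by simp
        ultimately show ?thesis by linarith
      next
        assume "\<forall>u\<in>{-1..0}. t + h * u \<in> {a..b}"
        from low[OF this] have "m\<^sub>T * (\<integral>u. K u * (g u * indicator {-1..0} u) \<partial>lborel) \<le> (\<integral>u. K u * (g u * ?f u) \<partial>lborel)" by simp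
        moreover have "m\<^sub>T * c \<le> m\<^sub>T * (\<integral>u. K u * (g u * indicator {-1..0} u) \<partial>lborel)" using c2 m\<^sub>T by simp
        ultimately show ?thesis by linarith
      qed
    qed
    have S0: "m\<^sub>T * (1 / 2) \<le> S 0 h t"
      unfolding S_eq using lower[of "\<lambda>_. 1" 1 "1 / 2"] half_kernel_variance(1)[OF K] reflect[of "\<lambda>_. 1"] by simp
    have S0_le: "S 0 h t \<le> M\<^sub>T"
    proof -
      have "S 0 h t \<le> (\<integral>u. M\<^sub>T * K u \<partial>lborel)"
        unfolding S_eq
      proof (rule integral_mono)
        show "K u * (u ^ 0 * ?f u) \<le> M\<^sub>T * K u" for u
          using mult_left_mono[OF f\<^sub>T_abs(2)[of "t + h * u"] K0[of u]] by (simp add: mult.commute[of "M\<^sub>T"])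
      qed (use intp[of 0] intK in auto)
      then show ?thesis using tot by simp
    qed
    have S1: "\<bar>S 1 h t\<bar> \<le> S 0 h t"
    proof -
      have "\<bar>S 1 h t\<bar> \<le> (\<integral>u. \<bar>K u * (u ^ 1 * ?f u)\<bar> \<partial>lborel)" unfolding S_eq by (rule integral_abs_bound)
      also have "\<dots> \<le> S 0 h t"
        unfolding S_eq
      proof (rule integral_mono)
        show "\<bar>K u * (u ^ 1 * ?f u)\<bar> \<le> K u * (u ^ 0 * ?f u)" for u
        proof (cases "u \<in> {-1..1}")
          case True
          then have "\<bar>u\<bar> * ?f u \<le> 1 * ?f u" using f\<^sub>T_abs(1) by (intro mult_right_mono) auto
          then have "K u * (\<bar>u\<bar> * ?f u) \<le> K u * (1 * ?f u)" using K0 by (rule mult_left_mono)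
          moreover have "\<bar>K u * (u ^ 1 * ?f u)\<bar> = K u * (\<bar>u\<bar> * ?f u)"
            by (simp only: abs_mult[of "K u"] abs_mult[of u] abs_of_nonneg[OF K0] abs_of_nonneg[OF f\<^sub>T_abs(1)] power_one_right)
          ultimately show ?thesis by simp
        qed (simp add: Kz)
      qed (use intp[of 0] intp[of 1] in auto)
      finally show ?thesis .
    qed
    have pos: "0 < S 0 h t" using S0 m\<^sub>T by linarith
    have var: "m\<^sub>T * v \<le> S 2 h t - (S 1 h t)\<^sup>2 / S 0 h t"
    proof -
      \<comment> \<open>The weighted mean of \<open>u\<close>; centring there turns the second
        moment into \<open>S 2 - (S 1)\<^sup>2 / S 0\<close>.\<close>
      define c where "c = S 1 h t / S 0 h t"
      have "m\<^sub>T * v \<le> (\<integral>u. K u * ((u - c)\<^sup>2 * ?f u) \<partial>lborel)"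
      proof (rule lower[of _ "(1 + \<bar>c\<bar>)\<^sup>2"])
        show "\<bar>(u - c)\<^sup>2\<bar> \<le> (1 + \<bar>c\<bar>)\<^sup>2" if "u \<in> {-1..1}" for u :: real
        proof -
          have "\<bar>u - c\<bar> \<le> 1 + \<bar>c\<bar>" using that by auto
          then show ?thesis using power_mono[of "\<bar>u - c\<bar>" "1 + \<bar>c\<bar>" 2] by simp
        qed
        show "v \<le> (\<integral>u. K u * ((u - c)\<^sup>2 * indicator {0..1} u) \<partial>lborel)" by (rule v(2))
        \<comment> \<open>Reflection maps the left half kernel with centre \<open>c\<close> to the
          right one with centre \<open>- c\<close>. The bound \<open>v\<close> is uniform in the
          centre, so it covers both halves.\<close>
        have "(\<integral>u. K u * ((u - c)\<^sup>2 * indicator {-1..0} u) \<partial>lborel) = (\<integral>u. K u * ((u - (- c))\<^sup>2 * indicator {0..1} u) \<partial>lborel)"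
          using reflect[of "\<lambda>u. (u - (- c))\<^sup>2"] power2_minus[of "_ - c"] by (simp add: power2_commute)
        then show "v \<le> (\<integral>u. K u * ((u - c)\<^sup>2 * indicator {-1..0} u) \<partial>lborel)" using v(2)[of "- c"] by simp
      qed auto
      also have "\<dots> = (\<integral>u. K u * (u ^ 2 * ?f u) - 2 * c * (K u * (u ^ 1 * ?f u)) + c\<^sup>2 * (K u * (u ^ 0 * ?f u)) \<partial>lborel)"
        by (intro Bochner_Integration.integral_cong) (auto simp: power2_eq_square algebra_simps)
      also have "\<dots> = S 2 h t - 2 * c * S 1 h t + c\<^sup>2 * S 0 h t"
        unfolding S_eq using intp[of 2] intp[of 1] intp[of 0] by simp
      also have "\<dots> = S 2 h t - (S 1 h t)\<^sup>2 / S 0 h t"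
        unfolding c_def using pos by (simp add: power2_eq_square field_simps)
      finally show ?thesis .
    qed
    have "w * (S 0 h t)\<^sup>2 = (m\<^sub>T * v) * S 0 h t * (S 0 h t / M\<^sub>T)"
      unfolding w_def by (simp add: power2_eq_square)
    also have "\<dots> \<le> (m\<^sub>T * v) * S 0 h t * 1"
      using S0_le M\<^sub>T m\<^sub>T v(1) pos by (intro mult_left_mono) auto
    also have "\<dots> \<le> (S 2 h t - (S 1 h t)\<^sup>2 / S 0 h t) * S 0 h t"
      using var pos by simp
    also have "\<dots> = S 2 h t * S 0 h t - (S 1 h t)\<^sup>2" using pos by (simp add: field_simps)
    finally have "w * (S 0 h t)\<^sup>2 \<le> S 2 h t * S 0 h t - (S 1 h t)\<^sup>2" .
    then show ?thesis using S0 S1 S0_le unfolding s_def by auto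
  qed
  have "0 < s" "s \<le> 1" "0 < w" using m\<^sub>T M\<^sub>T v(1) unfolding s_def w_def by auto
  then show ?thesis using main by blast
qed

end

subsection \<open>Convergence rates\<close>

text \<open>\<open>L = s\<^sup>2 / (2 + 5 / v)\<close> bounds the expected design form below. Entry
  errors of at most \<open>L / 6\<close> cost at most \<open>L / 2\<close>, so the empirical form
  keeps \<open>L / 2\<close> and the least squares bound \<open>3 * R / (L / 2)\<close> is the
  stated one.\<close>

lemma local_linear_error:
  fixes A :: "('e \<Rightarrow> real) \<Rightarrow> real" and x1 x2 :: "'e \<Rightarrow> real"
  assumes add: "\<And>f g. A (\<lambda>e. f e + g e) = A f + A g" and scale: "\<And>c f. A (\<lambda>e. c * f e) = c * A f"
    and least: "\<And>c0 c1 c2. Q c2 \<Longrightarrow> A (\<lambda>e. w e * (z e - a0 - a1 * x1 e - a2 * x2 e)\<^sup>2)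
                     \<le> A (\<lambda>e. w e * (z e - c0 - c1 * x1 e - c2 * x2 e)\<^sup>2)"
    and Q: "\<And>\<epsilon>. Q (a2 + \<epsilon> * (a2 - b2))"
    and s: "0 < s" "s \<le> \<sigma>0" "s \<le> \<tau>0" and k: "\<bar>\<sigma>1\<bar> \<le> \<sigma>0" "\<bar>\<tau>1\<bar> \<le> \<tau>0"
    and v: "0 < v" "v * \<sigma>0\<^sup>2 \<le> \<sigma>2 * \<sigma>0 - \<sigma>1\<^sup>2" and v2: "a2 - b2 = 0 \<or> v * \<tau>0\<^sup>2 \<le> \<tau>2 * \<tau>0 - \<tau>1\<^sup>2"
    and close: "\<bar>A (\<lambda>e. w e) - \<sigma>0 * \<tau>0\<bar> \<le> \<eta>" "\<bar>A (\<lambda>e. w e * (x1 e)\<^sup>2) - \<sigma>2 * \<tau>0\<bar> \<le> \<eta>" "\<bar>A (\<lambda>e. w e * (x2 e)\<^sup>2) - \<sigma>0 * \<tau>2\<bar> \<le> \<eta>"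
      "\<bar>A (\<lambda>e. w e * x1 e) - \<sigma>1 * \<tau>0\<bar> \<le> \<eta>" "\<bar>A (\<lambda>e. w e * x2 e) - \<sigma>0 * \<tau>1\<bar> \<le> \<eta>" "\<bar>A (\<lambda>e. w e * (x1 e * x2 e)) - \<sigma>1 * \<tau>1\<bar> \<le> \<eta>"
    and \<eta>: "6 * \<eta> \<le> s\<^sup>2 / (2 + 5 / v)"
    and R0: "\<bar>A (\<lambda>e. w e * (z e - b0 - b1 * x1 e - b2 * x2 e))\<bar> \<le> R"
    and R1: "\<bar>A (\<lambda>e. w e * (z e - b0 - b1 * x1 e - b2 * x2 e) * x1 e)\<bar> \<le> R"
    and R2: "\<bar>A (\<lambda>e. w e * (z e - b0 - b1 * x1 e - b2 * x2 e) * x2 e)\<bar> \<le> R"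
  shows "\<bar>a0 - b0\<bar> \<le> 6 * R / (s\<^sup>2 / (2 + 5 / v))"
proof -
  define L where "L = s\<^sup>2 / (2 + 5 / v)"
  have L: "0 < L" unfolding L_def using s v by (simp add: add_pos_pos)
  let ?n = "(a0 - b0)\<^sup>2 + (a1 - b1)\<^sup>2 + (a2 - b2)\<^sup>2"
  have "L / 2 * ?n \<le> (L - 3 * \<eta>) * ?n"
    using \<eta> unfolding L_def[symmetric] by (intro mult_right_mono) auto
  also have "\<dots> \<le> A (\<lambda>e. w e * ((a0 - b0) + (a1 - b1) * x1 e + (a2 - b2) * x2 e)\<^sup>2)"
    by (rule empirical_form_lower[OF add scale moment_form_lower[OF s k v v2, folded L_def] close])
  finally have lower: "L / 2 * ?n \<le> A (\<lambda>e. w e * ((a0 - b0) + (a1 - b1) * x1 e + (a2 - b2) * x2 e)\<^sup>2)" .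
  have "\<bar>a0 - b0\<bar> \<le> 3 * R / (L / 2)"
  proof (rule least_squares_error[where P = Q and A = A, OF add scale _ Q lower _ R0 R1 R2])
    show "0 < L / 2" using L by simp
  qed (rule least)
  then show ?thesis unfolding L_def[symmetric] by simp
qed

lemma (in signed_array) rate_fun_nonneg: "\<forall>\<^sub>F n in sequentially. 0 \<le> rate_fun n"
  using \<beta>_pos eventually_ge_at_top[of 1]
proof eventually_elim
  case (elim n)
  then have "0 \<le> \<beta> n * (ln (real n) / real n)" by (intro mult_nonneg_nonneg divide_nonneg_nonneg) auto
  then show ?case unfolding rate_fun_def by simp
qed

text \<open>Design entries and normal equations involve several kernels \<open>K u * u ^ q\<close>
  at once; over a finite family the sum of the absolute constants serves as one constant for
  all.\<close>

lemma (in signed_array) AE_kernel_avg_family: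
  assumes Z_meas: "\<And>i j k. Z i j k \<in> borel_measurable (sources (curve_sources i))"
    and Z_le: "AE \<omega> in M. \<forall>i j k. \<bar>Z i j k \<omega>\<bar> \<le> Kd i j k \<omega>"
    and fin: "finite \<Phi>" "finite \<Psi>" and bv: "\<And>\<phi>. \<phi> \<in> \<Phi> \<Longrightarrow> bv_kernel \<phi>" "\<And>\<psi>. \<psi> \<in> \<Psi> \<Longrightarrow> bv_kernel \<psi>"
  shows "AE \<omega> in M. \<exists>B\<ge>0. \<forall>\<^sub>F n in sequentially. \<forall>\<phi>\<in>\<Phi>. \<forall>\<psi>\<in>\<Psi>. \<forall>s\<in>{a..b}. \<forall>t\<in>{a..b}.
     \<bar>kernel_avg Z n (\<lambda>x y. \<phi> ((x - s) / h n) * \<psi> ((y - t) / h n)) \<omega> - kernel_mean Z n (\<lambda>x y. \<phi> ((x - s) / h n) * \<psi> ((y - t) / h n))\<bar>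
       \<le> B * rate_fun n"
proof -
  let ?P = "\<lambda>\<omega> n \<phi> \<psi> B. \<forall>s\<in>{a..b}. \<forall>t\<in>{a..b}.
     \<bar>kernel_avg Z n (\<lambda>x y. \<phi> ((x - s) / h n) * \<psi> ((y - t) / h n)) \<omega> - kernel_mean Z n (\<lambda>x y. \<phi> ((x - s) / h n) * \<psi> ((y - t) / h n))\<bar> \<le> B * rate_fun n"
  have "AE \<omega> in M. \<forall>\<phi>\<in>\<Phi>. \<forall>\<psi>\<in>\<Psi>. \<exists>B. \<forall>\<^sub>F n in sequentially. ?P \<omega> n \<phi> \<psi> B"
    by (intro AE_finite_allI fin AE_kernel_avg Z_meas Z_le bv)
  then show ?thesis
  proof eventually_elim
    case (elim \<omega>)
    define B where "B \<phi> \<psi> = (SOME B. \<forall>\<^sub>F n in sequentially. ?P \<omega> n \<phi> \<psi> B)" for \<phi> \<psi>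
    have B: "\<forall>\<^sub>F n in sequentially. ?P \<omega> n \<phi> \<psi> (B \<phi> \<psi>)" if "\<phi> \<in> \<Phi>" "\<psi> \<in> \<Psi>" for \<phi> \<psi>
      unfolding B_def using elim that by (intro someI_ex[of "\<lambda>B. \<forall>\<^sub>F n in sequentially. ?P \<omega> n \<phi> \<psi> B"]) blast
    define C where "C = (\<Sum>\<phi>\<in>\<Phi>. \<Sum>\<psi>\<in>\<Psi>. \<bar>B \<phi> \<psi>\<bar>)"
    have C0: "0 \<le> C" unfolding C_def by (intro sum_nonneg) auto
    have BC: "B \<phi> \<psi> \<le> C" if "\<phi> \<in> \<Phi>" "\<psi> \<in> \<Psi>" for \<phi> \<psi>
    proof -
      have "\<bar>B \<phi> \<psi>\<bar> \<le> (\<Sum>\<psi>\<in>\<Psi>. \<bar>B \<phi> \<psi>\<bar>)" by (rule member_le_sum[OF that(2) _ fin(2)]) auto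
      also have "\<dots> \<le> C" unfolding C_def by (rule member_le_sum[OF that(1) _ fin(1)]) (auto intro: sum_nonneg)
      finally show ?thesis by simp
    qed
    have "\<forall>\<^sub>F n in sequentially. \<forall>\<phi>\<in>\<Phi>. \<forall>\<psi>\<in>\<Psi>. ?P \<omega> n \<phi> \<psi> (B \<phi> \<psi>)"
      by (rule eventually_ball_finite[OF fin(1)], rule ballI, rule eventually_ball_finite[OF fin(2)], rule ballI, rule B)
    then have "\<forall>\<^sub>F n in sequentially. \<forall>\<phi>\<in>\<Phi>. \<forall>\<psi>\<in>\<Psi>. ?P \<omega> n \<phi> \<psi> C"
      using rate_fun_nonneg
    proof eventually_elim
      case (elim n)
      show ?case
      proof (intro ballI)
        fix \<phi> \<psi> s t assume *: "\<phi> \<in> \<Phi>" "\<psi> \<in> \<Psi>" "s \<in> {a..b}" "t \<in> {a..b}"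
        have "B \<phi> \<psi> * rate_fun n \<le> C * rate_fun n" using BC[OF *(1,2)] elim by (intro mult_right_mono) auto
        then show "\<bar>kernel_avg Z n (\<lambda>x y. \<phi> ((x - s) / h n) * \<psi> ((y - t) / h n)) \<omega> - kernel_mean Z n (\<lambda>x y. \<phi> ((x - s) / h n) * \<psi> ((y - t) / h n))\<bar> \<le> C * rate_fun n"
          using elim * order_trans by blast
      qed
    qed
    then show ?case using C0 by blast
  qed
qed

definition beta1 :: "(nat \<Rightarrow> nat \<Rightarrow> nat) \<Rightarrow> (nat \<Rightarrow> real) \<Rightarrow> nat \<Rightarrow> real" where
  "beta1 m h n = (h n)\<^sup>2 + h n / gam m n 1"

text \<open>Two pairs on a curve can share no, one or two points. The number of distinct times is
  then four, three or two, each costing one factor of the bandwidth, with relative frequencies of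
  order 1, 1 / m and 1 / m^2; \<open>beta1\<close> is the analogue for two single points.\<close>

definition beta2 :: "(nat \<Rightarrow> nat \<Rightarrow> nat) \<Rightarrow> (nat \<Rightarrow> real) \<Rightarrow> nat \<Rightarrow> real" where
  "beta2 m h n = (h n) ^ 4 + (h n) ^ 3 / gam m n 1 + (h n)\<^sup>2 / gam m n 2"

lemma beta_eq: "beta1 m h n = (h n)\<^sup>2 + h n * inv_avg m n 1"
  "beta2 m h n = (h n) ^ 4 + (h n) ^ 3 * inv_avg m n 1 + (h n)\<^sup>2 * inv_avg m n 2"
  unfolding beta1_def beta2_def using inverse_gam(1)[of m n 1] inverse_gam(1)[of m n 2]
  by (simp_all add: divide_inverse)

lemma delta_eq:
  assumes "0 < h n"
  shows "sqrt (beta1 m h n * (ln (real n) / real n)) / h n = delta1 m n (h n)"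
    and "sqrt (beta2 m h n * (ln (real n) / real n)) / (h n)\<^sup>2 = delta2 m n (h n)"
proof -
  have "beta1 m h n * (ln (real n) / real n) = (h n)\<^sup>2 * ((1 + 1 / (h n * gam m n 1)) * ln (real n) / real n)"
  proof -
    define c where "c = ln (real n) / real n"
    have e: "x * ln (real n) / real n = x * c" for x by (simp add: c_def)
    show ?thesis unfolding beta_eq inverse_gam e c_def[symmetric] using assms by (simp add: field_simps power2_eq_square)
  qed
  then show "sqrt (beta1 m h n * (ln (real n) / real n)) / h n = delta1 m n (h n)"
    using assms unfolding delta1_def by (simp only: real_sqrt_mult real_sqrt_abs) simp
  have "beta2 m h n * (ln (real n) / real n) = ((h n)\<^sup>2)\<^sup>2 * ((1 + 1 / (h n * gam m n 1) + 1 / ((h n)\<^sup>2 * gam m n 2)) * ln (real n) / real n)"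
  proof -
    define c where "c = ln (real n) / real n"
    have e: "x * ln (real n) / real n = x * c" for x by (simp add: c_def)
    show ?thesis unfolding beta_eq inverse_gam e c_def[symmetric] using assms
      by (simp add: field_simps power2_eq_square power3_eq_cube power4_eq_xxxx)
  qed
  then show "sqrt (beta2 m h n * (ln (real n) / real n)) / (h n)\<^sup>2 = delta2 m n (h n)"
    using assms unfolding delta2_def by (simp only: real_sqrt_mult real_sqrt_abs) simp
qed

lemma beta_bounds:
  assumes m: "\<And>n i. i < n \<Longrightarrow> 2 \<le> m n i" and h: "\<And>n. 0 < h n" and lim: "h \<longlonglongrightarrow> 0"
  shows "0 < beta1 m h n" "0 < beta2 m h n"
    and "\<forall>\<^sub>F n in sequentially. beta1 m h n \<le> 2 * h n" "\<forall>\<^sub>F n in sequentially. beta2 m h n \<le> 3 * (h n)\<^sup>2"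
proof -
  have iv: "0 \<le> inv_avg m n k" "inv_avg m n k \<le> 1" for n k using inv_avg_bounds[of m n k] m by auto
  show "0 < beta1 m h n" "0 < beta2 m h n"
    unfolding beta_eq using h[of n] iv[of n 1] iv[of n 2]
    by (auto intro!: add_pos_nonneg mult_nonneg_nonneg)
  have h1: "\<forall>\<^sub>F n in sequentially. h n < 1" using order_tendstoD(2)[OF lim, of 1] by simp
  then show "\<forall>\<^sub>F n in sequentially. beta1 m h n \<le> 2 * h n"
  proof eventually_elim
    case (elim n)
    have "(h n)\<^sup>2 \<le> h n" using h[of n] elim by (simp add: power2_eq_square mult_left_le)
    moreover have "h n * inv_avg m n 1 \<le> h n" using h[of n] iv[of n 1] by (simp add: mult_left_le)
    ultimately show ?case unfolding beta_eq by linarith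
  qed
  from h1 show "\<forall>\<^sub>F n in sequentially. beta2 m h n \<le> 3 * (h n)\<^sup>2"
  proof eventually_elim
    case (elim n)
    have "(h n) ^ 4 \<le> (h n)\<^sup>2" "(h n) ^ 3 \<le> (h n)\<^sup>2" using h[of n] elim by (auto intro!: power_decreasing)
    moreover have "(h n) ^ 3 * inv_avg m n 1 \<le> (h n) ^ 3" "(h n)\<^sup>2 * inv_avg m n 2 \<le> (h n)\<^sup>2"
      using h[of n] iv[of n 1] iv[of n 2] by (auto simp: mult_left_le)
    ultimately show ?case unfolding beta_eq by linarith
  qed
qed

text \<open>The window probability is \<open>q = 4 * M\<^sub>T * h n\<close>, so
  \<open>q\<^sup>2\<close> and \<open>q\<close> account for the constants
  \<open>16 * M\<^sub>T\<^sup>2\<close> and \<open>4 * M\<^sub>T\<close>. The average amplitude is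
  dominated by the envelope itself, hence the factor 1.\<close>

lemma (in fda_moment) mean_array:
  assumes m: "\<And>n i. i < n \<Longrightarrow> 2 \<le> m n i" and h: "\<And>n. 0 < h n" and lim: "h \<longlonglongrightarrow> 0"
    and rate: "(\<lambda>n. inverse (beta1 m h n) * (ln (real n) / real n) powr (1 - 2 / p)) \<longlonglongrightarrow> 0"
  shows "signed_array M a b \<sigma> P X \<xi> T U f\<^sub>T m\<^sub>T M\<^sub>T p (\<lambda>n i. pairs_diag (m n i)) (\<lambda>n i. 1 / real (m n i))
     (\<lambda>i j k. amp i j) amp_moment 1 (16 * M\<^sub>T\<^sup>2 + 4 * M\<^sub>T) p (beta1 m h) h"
proof -
  have B: "\<And>n. 0 < beta1 m h n" "\<And>n. 0 < beta2 m h n" "\<forall>\<^sub>F n in sequentially. beta1 m h n \<le> 2 * h n"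
      "\<forall>\<^sub>F n in sequentially. beta2 m h n \<le> 3 * (h n)\<^sup>2"
    using beta_bounds[of m h, OF _ h lim] m by blast+
  note RF = rate_facts[OF B(1) h B(3) p rate]
  have m0: "0 < m n i" if "i < n" for n i using m[OF that] by simp
  have iv: "0 \<le> inv_avg m n k" "inv_avg m n k \<le> 1" for n k using inv_avg_bounds[of m n k] m by auto
  show ?thesis
  proof unfold_locales
    show "AE \<omega> in M. \<forall>n. \<forall>i<n. (1 / real (m n i) * (\<Sum>(j, k)\<in>pairs_diag (m n i). amp i j \<omega>)) powr p \<le> 1 * amp_env i \<omega>"
      using amp_mean_powr_le by eventually_elim (use m0 in \<open>simp add: sum_pairs_diag\<close>)
    show "(\<Sum>i<n. (1 / real (m n i))\<^sup>2 * (\<Sum>(j, k)\<in>pairs_diag (m n i). \<Sum>(j', k')\<in>pairs_diag (m n i). expectation (\<lambda>\<omega>.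
          (indicat_real {c..d} (T i j \<omega>) * indicat_real {c'..d'} (T i k \<omega>)) *
          (indicat_real {c..d} (T i j' \<omega>) * indicat_real {c'..d'} (T i k' \<omega>))))) \<le> (16 * M\<^sub>T\<^sup>2 + 4 * M\<^sub>T) * real n * beta1 m h n"
      if n: "0 < n" and cd: "c \<le> d" "d - c \<le> 4 * h n" for n c d c' d'
    proof -
      define q where "q = M\<^sub>T * (4 * h n)"
      have q: "M\<^sub>T * (d - c) \<le> q" "0 \<le> q" using cd M\<^sub>T h[of n] unfolding q_def by (auto intro: mult_left_mono)
      have "(\<Sum>i<n. (1 / real (m n i))\<^sup>2 * (\<Sum>(j, k)\<in>pairs_diag (m n i). \<Sum>(j', k')\<in>pairs_diag (m n i). expectation (\<lambda>\<omega>.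
          (indicat_real {c..d} (T i j \<omega>) * indicat_real {c'..d'} (T i k \<omega>)) *
          (indicat_real {c..d} (T i j' \<omega>) * indicat_real {c'..d'} (T i k' \<omega>))))) \<le> (\<Sum>i<n. q\<^sup>2 + q * (1 / real (m n i) ^ 1))"
        using count_diag[OF q(1) cd(1) q(2) m0] by (intro sum_mono) simp
      also have "\<dots> = real n * (q\<^sup>2 + q * inv_avg m n 1)"
        unfolding inv_avg_def sum.distrib sum_distrib_left[symmetric] using n by (simp add: field_simps)
      also have "q\<^sup>2 + q * inv_avg m n 1 \<le> (16 * M\<^sub>T\<^sup>2 + 4 * M\<^sub>T) * beta1 m h n"
      proof -
        have "(16 * M\<^sub>T\<^sup>2 + 4 * M\<^sub>T) * beta1 m h n = (q\<^sup>2 + q * inv_avg m n 1) + (16 * M\<^sub>T\<^sup>2 * (h n * inv_avg m n 1) + 4 * M\<^sub>T * (h n)\<^sup>2)"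
          unfolding beta_eq q_def by (simp add: power2_eq_square algebra_simps)
        moreover have "0 \<le> 16 * M\<^sub>T\<^sup>2 * (h n * inv_avg m n 1) + 4 * M\<^sub>T * (h n)\<^sup>2" using M\<^sub>T h[of n] iv by simp
        ultimately show ?thesis by linarith
      qed
      finally show ?thesis using n by (simp add: mult_ac)
    qed
    show "0 \<le> amp i j \<omega>" for i j \<omega> using amp_ge[of i j \<omega>] by linarith
    show "integrable M (\<lambda>\<omega>. (amp i j \<omega>)\<^sup>2)" "expectation (\<lambda>\<omega>. (amp i j \<omega>)\<^sup>2) \<le> amp_moment" for i j
      using amp_power_int[of 2] amp_power_le[of 2] p by auto
    show "0 \<le> 16 * M\<^sub>T\<^sup>2 + 4 * M\<^sub>T" using M\<^sub>T by simp
  qed (use amp_meas m0 h lim RF B p rate in \<open>auto simp: card_pairs_diag\<close>)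
qed

text \<open>Averages of amplitude products over off-diagonal pairs are at most twice the squared
  mean amplitude, which gives \<open>2 powr l\<close>; the \<open>l\<close>-th power of that square
  is the \<open>p\<close>-th power of the mean since \<open>p = 2 * l\<close>. With
  \<open>q = 4 * M\<^sub>T * h n\<close>, \<open>4 * q ^ 4\<close> and \<open>16 * q\<^sup>2\<close>
  yield the two numerical constants.\<close>

lemma (in fda_moment) cov_array:
  assumes m: "\<And>n i. i < n \<Longrightarrow> 2 \<le> m n i" and h: "\<And>n. 0 < h n" and lim: "h \<longlonglongrightarrow> 0" and l: "2 < l" and pl: "p = 2 * l"
    and rate: "(\<lambda>n. inverse (beta2 m h n) * (ln (real n) / real n) powr (1 - 2 / l)) \<longlonglongrightarrow> 0"
  shows "signed_array M a b \<sigma> P X \<xi> T U f\<^sub>T m\<^sub>T M\<^sub>T p (\<lambda>n i. pairs_off (m n i)) (\<lambda>n i. 1 / (real (m n i) * (real (m n i) - 1)))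
     (\<lambda>i j k \<omega>. amp i j \<omega> * amp i k \<omega>) amp_moment (2 powr l) (1024 * M\<^sub>T ^ 4 + 256 * M\<^sub>T\<^sup>2) l (beta2 m h) h"
proof -
  have B: "\<And>n. 0 < beta1 m h n" "\<And>n. 0 < beta2 m h n" "\<forall>\<^sub>F n in sequentially. beta1 m h n \<le> 2 * h n"
      "\<forall>\<^sub>F n in sequentially. beta2 m h n \<le> 3 * (h n)\<^sup>2"
    using beta_bounds[of m h, OF _ h lim] m by blast+
  have h2: "0 < (h n)\<^sup>2" for n using h[of n] by simp
  note RF = rate_facts[OF B(2) h2 B(4) l rate]
  have iv: "0 \<le> inv_avg m n k" "inv_avg m n k \<le> 1" for n k using inv_avg_bounds[of m n k] m by auto
  have amp0: "0 \<le> amp i j \<omega>" for i j \<omega> using amp_ge[of i j \<omega>] by linarith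
  show ?thesis
  proof unfold_locales
    show "AE \<omega> in M. \<forall>n. \<forall>i<n. (1 / (real (m n i) * (real (m n i) - 1)) * (\<Sum>(j, k)\<in>pairs_off (m n i). amp i j \<omega> * amp i k \<omega>)) powr l \<le> 2 powr l * amp_env i \<omega>"
      using amp_mean_powr_le
    proof eventually_elim
      case (elim \<omega>)
      show ?case
      proof (intro allI impI)
        fix n i :: nat assume i: "i < n"
        define r where "r = real (m n i)"
        have r: "2 \<le> r" using m[OF i] by (simp add: r_def)
        let ?S = "\<Sum>j<m n i. amp i j \<omega>"
        have "(\<Sum>(j, k)\<in>pairs_off (m n i). amp i j \<omega> * amp i k \<omega>) \<le> (\<Sum>(j, k)\<in>{..<m n i} \<times> {..<m n i}. amp i j \<omega> * amp i k \<omega>)"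
          using amp0 by (intro sum_mono2) (auto simp: pairs_off_def)
        also have "\<dots> = ?S\<^sup>2" by (simp add: power2_eq_square sum_product sum.cartesian_product)
        finally have s: "(\<Sum>(j, k)\<in>pairs_off (m n i). amp i j \<omega> * amp i k \<omega>) \<le> ?S\<^sup>2" .
        have "1 / (r * (r - 1)) \<le> 2 / r\<^sup>2"
        proof -
          have "r\<^sup>2 \<le> 2 * (r * (r - 1))" using r mult_left_mono[of 2 r r] by (simp add: power2_eq_square algebra_simps)
          then show ?thesis using r by (simp add: divide_simps mult_ac)
        qed
        then have "1 / (r * (r - 1)) * (\<Sum>(j, k)\<in>pairs_off (m n i). amp i j \<omega> * amp i k \<omega>) \<le> 2 / r\<^sup>2 * ?S\<^sup>2"
          using s r by (intro mult_mono) (auto intro!: sum_nonneg mult_nonneg_nonneg amp0)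
        also have "\<dots> = 2 * (?S / r)\<^sup>2" by (simp add: power_divide)
        finally have le: "1 / (r * (r - 1)) * (\<Sum>(j, k)\<in>pairs_off (m n i). amp i j \<omega> * amp i k \<omega>) \<le> 2 * (?S / r)\<^sup>2" .
        have "(1 / (r * (r - 1)) * (\<Sum>(j, k)\<in>pairs_off (m n i). amp i j \<omega> * amp i k \<omega>)) powr l \<le> (2 * (?S / r)\<^sup>2) powr l"
        proof (rule powr_mono2[OF _ _ le])
          have "0 \<le> (\<Sum>(j, k)\<in>pairs_off (m n i). amp i j \<omega> * amp i k \<omega>)" using amp0 by (intro sum_nonneg) auto
          then show "0 \<le> 1 / (r * (r - 1)) * (\<Sum>(j, k)\<in>pairs_off (m n i). amp i j \<omega> * amp i k \<omega>)"
            using r by (intro mult_nonneg_nonneg) auto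
        qed (use l in auto)
        also have "\<dots> = 2 powr l * (?S / r) powr p"
        proof -
          have S0: "0 \<le> ?S / r" using r by (auto intro!: divide_nonneg_nonneg sum_nonneg amp0)
          have "((?S / r)\<^sup>2) powr l = (?S / r) powr p"
          proof (cases "?S / r = 0")
            case False
            then have "(?S / r)\<^sup>2 = (?S / r) powr 2" using S0 by (simp add: powr_numeral)
            then show ?thesis by (simp only: powr_powr pl)
          qed (use p l in auto)
          then show ?thesis using S0 by (simp add: powr_mult)
        qed
        also have "\<dots> \<le> 2 powr l * amp_env i \<omega>"
          using elim m[OF i] unfolding r_def by (intro mult_left_mono) auto
        finally show "(1 / (real (m n i) * (real (m n i) - 1)) * (\<Sum>(j, k)\<in>pairs_off (m n i). amp i j \<omega> * amp i k \<omega>)) powr l \<le> 2 powr l * amp_env i \<omega>"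
          unfolding r_def .
      qed
    qed
    show "(\<Sum>i<n. (1 / (real (m n i) * (real (m n i) - 1)))\<^sup>2 * (\<Sum>(j, k)\<in>pairs_off (m n i). \<Sum>(j', k')\<in>pairs_off (m n i). expectation (\<lambda>\<omega>.
          (indicat_real {c..d} (T i j \<omega>) * indicat_real {c'..d'} (T i k \<omega>)) *
          (indicat_real {c..d} (T i j' \<omega>) * indicat_real {c'..d'} (T i k' \<omega>))))) \<le> (1024 * M\<^sub>T ^ 4 + 256 * M\<^sub>T\<^sup>2) * real n * beta2 m h n"
      if n: "0 < n" and cd: "c \<le> d" "d - c \<le> 4 * h n" "c' \<le> d'" "d' - c' \<le> 4 * h n" for n c d c' d'
    proof -
      define q where "q = M\<^sub>T * (4 * h n)"
      have q: "M\<^sub>T * (d - c) \<le> q" "M\<^sub>T * (d' - c') \<le> q" "0 \<le> q" using cd M\<^sub>T h[of n] unfolding q_def by (auto intro: mult_left_mono)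
      have "(\<Sum>i<n. (1 / (real (m n i) * (real (m n i) - 1)))\<^sup>2 * (\<Sum>(j, k)\<in>pairs_off (m n i). \<Sum>(j', k')\<in>pairs_off (m n i). expectation (\<lambda>\<omega>.
          (indicat_real {c..d} (T i j \<omega>) * indicat_real {c'..d'} (T i k \<omega>)) *
          (indicat_real {c..d} (T i j' \<omega>) * indicat_real {c'..d'} (T i k' \<omega>))))) \<le> (\<Sum>i<n. 4 * q ^ 4 + 16 * q\<^sup>2 * (1 / real (m n i) ^ 2))"
        using count_off[OF q(1,2) cd(1,3) q(3) m] by (intro sum_mono) simp
      also have "\<dots> = real n * (4 * q ^ 4 + 16 * q\<^sup>2 * inv_avg m n 2)"
        unfolding inv_avg_def sum.distrib sum_distrib_left[symmetric] using n by (simp add: field_simps)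
      also have "4 * q ^ 4 + 16 * q\<^sup>2 * inv_avg m n 2 \<le> (1024 * M\<^sub>T ^ 4 + 256 * M\<^sub>T\<^sup>2) * beta2 m h n"
      proof -
        have "(1024 * M\<^sub>T ^ 4 + 256 * M\<^sub>T\<^sup>2) * beta2 m h n = (4 * q ^ 4 + 16 * q\<^sup>2 * inv_avg m n 2)
          + (1024 * M\<^sub>T ^ 4 * ((h n) ^ 3 * inv_avg m n 1 + (h n)\<^sup>2 * inv_avg m n 2) + 256 * M\<^sub>T\<^sup>2 * ((h n) ^ 4 + (h n) ^ 3 * inv_avg m n 1))"
          unfolding beta_eq q_def by (simp add: power2_eq_square power4_eq_xxxx power3_eq_cube algebra_simps)
        moreover have "0 \<le> 1024 * M\<^sub>T ^ 4 * ((h n) ^ 3 * inv_avg m n 1 + (h n)\<^sup>2 * inv_avg m n 2) + 256 * M\<^sub>T\<^sup>2 * ((h n) ^ 4 + (h n) ^ 3 * inv_avg m n 1)"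
          using M\<^sub>T h[of n] iv by (intro add_nonneg_nonneg mult_nonneg_nonneg) auto
        ultimately show ?thesis by linarith
      qed
      finally show ?thesis using n by (simp add: mult_ac)
    qed
    show "0 \<le> amp i j \<omega> * amp i k \<omega>" for i j k \<omega> using amp0 by simp
    show "(\<lambda>\<omega>. amp i j \<omega> * amp i k \<omega>) \<in> borel_measurable (sources (amplitude_sources i))" for i j k
      using amp_meas by simp
    have pw: "integrable M (\<lambda>\<omega>. amp i j \<omega> ^ 4)" "expectation (\<lambda>\<omega>. amp i j \<omega> ^ 4) \<le> amp_moment" for i j
      using amp_power_int[of 4] amp_power_le[of 4] l pl by auto
    have sq: "(amp i j \<omega> * amp i k \<omega>)\<^sup>2 \<le> (amp i j \<omega> ^ 4 + amp i k \<omega> ^ 4) / 2" for i j k \<omega>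
      using sum_squares_bound[of "(amp i j \<omega>)\<^sup>2" "(amp i k \<omega>)\<^sup>2"] by (simp add: power_mult_distrib power_mult[symmetric])
    have intB: "integrable M (\<lambda>\<omega>. (amp i j \<omega> ^ 4 + amp i k \<omega> ^ 4) / 2)" for i j k using pw by auto
    show int: "integrable M (\<lambda>\<omega>. (amp i j \<omega> * amp i k \<omega>)\<^sup>2)" for i j k
    proof (rule Bochner_Integration.integrable_bound[OF intB[of i j k]])
      show "AE \<omega> in M. norm ((amp i j \<omega> * amp i k \<omega>)\<^sup>2) \<le> norm ((amp i j \<omega> ^ 4 + amp i k \<omega> ^ 4) / 2)"
        using order_trans[OF sq abs_ge_self] by (intro AE_I2) (simp only: real_norm_def abs_power2)
    qed measurable
    show "expectation (\<lambda>\<omega>. (amp i j \<omega> * amp i k \<omega>)\<^sup>2) \<le> amp_moment" for i j k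
    proof -
      have "expectation (\<lambda>\<omega>. (amp i j \<omega> * amp i k \<omega>)\<^sup>2) \<le> expectation (\<lambda>\<omega>. (amp i j \<omega> ^ 4 + amp i k \<omega> ^ 4) / 2)"
        by (rule integral_mono[OF int intB sq])
      also have "\<dots> \<le> amp_moment" using pw(1)[of i j] pw(1)[of i k] pw(2)[of i j] pw(2)[of i k] by simp
      finally show ?thesis .
    qed
    show "0 \<le> 1024 * M\<^sub>T ^ 4 + 256 * M\<^sub>T\<^sup>2" using M\<^sub>T by simp
    show "1 / (real (m n i) * (real (m n i) - 1)) * real (card (pairs_off (m n i))) = 1" if "i < n" for n i
      using m[OF that] by (simp add: card_pairs_off)
    show "0 \<le> 1 / (real (m n i) * (real (m n i) - 1))" for n i by (cases "m n i") auto
    show "\<forall>\<^sub>F n in sequentially. 1 / (real n)\<^sup>2 \<le> h n"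
      using RF(1) order_tendstoD(2)[OF lim, of 1, simplified]
    proof eventually_elim
      case (elim n)
      have "(h n)\<^sup>2 \<le> h n" using h[of n] elim by (simp add: power2_eq_square mult_left_le)
      then show ?case using elim by linarith
    qed
  qed (use h lim RF B l rate in auto)
qed

section \<open>Taylor expansions with one-sided derivatives at the boundary\<close>

lemma derivative_within_Lipschitz:
  fixes F F' :: "real \<Rightarrow> real"
  assumes d: "\<And>t. t \<in> {a..b} \<Longrightarrow> (F has_real_derivative F' t) (at t within {a..b})"
    and bd: "\<And>t. t \<in> {a..b} \<Longrightarrow> \<bar>F' t\<bar> \<le> C" and x: "x \<in> {a..b}" and y: "y \<in> {a..b}"
  shows "\<bar>F x - F y\<bar> \<le> C * \<bar>x - y\<bar>"
  using field_differentiable_bound[of "{a..b}" F F' C x y] assms by auto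

text \<open>The mean value inequality for \<open>F u - F' t * u\<close> on the segment from
  \<open>t\<close> to \<open>x\<close>: its derivative \<open>F' u - F' t\<close> is at most
  \<open>C * \<bar>x - t\<bar>\<close>. A Lipschitz derivative is enough, at the price of
  \<open>C\<close> in place of \<open>C / 2\<close>.\<close>

lemma Taylor_within:
  fixes F F' :: "real \<Rightarrow> real"
  assumes d: "\<And>t. t \<in> {a..b} \<Longrightarrow> (F has_real_derivative F' t) (at t within {a..b})"
    and lip: "\<And>x y. x \<in> {a..b} \<Longrightarrow> y \<in> {a..b} \<Longrightarrow> \<bar>F' x - F' y\<bar> \<le> C * \<bar>x - y\<bar>" and C: "0 \<le> C"
    and x: "x \<in> {a..b}" and t: "t \<in> {a..b}"
  shows "\<bar>F x - F t - F' t * (x - t)\<bar> \<le> C * (x - t)\<^sup>2"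
proof -
  let ?S = "closed_segment t x" and ?G = "\<lambda>u. F u - F' t * u"
  have sub: "?S \<subseteq> {a..b}" using x t by (auto simp: closed_segment_eq_real_ivl)
  have "norm (?G x - ?G t) \<le> (C * \<bar>x - t\<bar>) * norm (x - t)"
  proof (rule field_differentiable_bound[of ?S ?G "\<lambda>u. F' u - F' t"])
    fix u assume u: "u \<in> ?S"
    have "(F has_real_derivative F' u) (at u within ?S)"
      using d[of u] sub u by (intro DERIV_subset[OF _ sub]) auto
    then show "(?G has_real_derivative F' u - F' t) (at u within ?S)"
      by (auto intro!: derivative_eq_intros)
    have "\<bar>u - t\<bar> \<le> \<bar>x - t\<bar>" using u by (auto simp: closed_segment_eq_real_ivl split: if_splits)
    then have "C * \<bar>u - t\<bar> \<le> C * \<bar>x - t\<bar>" using C by (rule mult_left_mono)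
    then show "norm (F' u - F' t) \<le> C * \<bar>x - t\<bar>" using lip[of u t] sub u t by auto
  qed auto
  then show ?thesis by (simp add: algebra_simps power2_eq_square)
qed

text \<open>Moving one coordinate at a time, from \<open>(s, t)\<close> to \<open>(s, v)\<close> to
  \<open>(u, v)\<close>, uses partial derivatives only and no joint differentiability. The slope
  \<open>F1\<close> then appears at \<open>(s, v)\<close>, and the bounded mixed derivative
  \<open>F12\<close> brings it back to \<open>(s, t)\<close>. Each of the three errors is at most
  \<open>C * h\<^sup>2\<close>.\<close>

lemma Taylor2_within:
  fixes F F1 F2 F11 F12 F22 :: "real \<Rightarrow> real \<Rightarrow> real"
  assumes p: "has_partial1 a b F F1" "has_partial2 a b F F2" "has_partial1 a b F1 F11" "has_partial2 a b F1 F12" "has_partial2 a b F2 F22"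
    and bd: "\<And>s t. s \<in> {a..b} \<Longrightarrow> t \<in> {a..b} \<Longrightarrow> \<bar>F11 s t\<bar> \<le> C \<and> \<bar>F12 s t\<bar> \<le> C \<and> \<bar>F22 s t\<bar> \<le> C"
    and st: "s \<in> {a..b}" "t \<in> {a..b}" and uv: "u \<in> {a..b}" "v \<in> {a..b}" and h: "\<bar>u - s\<bar> \<le> h" "\<bar>v - t\<bar> \<le> h"
  shows "\<bar>F u v - F s t - F1 s t * (u - s) - F2 s t * (v - t)\<bar> \<le> 3 * C * h\<^sup>2"
proof -
  have C: "0 \<le> C" using bd[OF st] by auto
  have h0: "0 \<le> h" using h by auto
  have 1: "\<bar>F u v - F s v - F1 s v * (u - s)\<bar> \<le> C * (u - s)\<^sup>2"
  proof (rule Taylor_within[OF _ _ C uv(1) st(1)])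
    show "((\<lambda>u. F u v) has_real_derivative F1 x v) (at x within {a..b})" if "x \<in> {a..b}" for x
      using p(1) that uv by (auto simp: has_partial1_def)
    show "\<bar>F1 x v - F1 y v\<bar> \<le> C * \<bar>x - y\<bar>" if "x \<in> {a..b}" "y \<in> {a..b}" for x y
      by (rule derivative_within_Lipschitz[of a b "\<lambda>u. F1 u v" "\<lambda>u. F11 u v"]) (use p(3) bd uv that in \<open>auto simp: has_partial1_def\<close>)
  qed
  have 2: "\<bar>F s v - F s t - F2 s t * (v - t)\<bar> \<le> C * (v - t)\<^sup>2"
  proof (rule Taylor_within[OF _ _ C uv(2) st(2)])
    show "((\<lambda>v. F s v) has_real_derivative F2 s x) (at x within {a..b})" if "x \<in> {a..b}" for x
      using p(2) that st by (auto simp: has_partial2_def)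
    show "\<bar>F2 s x - F2 s y\<bar> \<le> C * \<bar>x - y\<bar>" if "x \<in> {a..b}" "y \<in> {a..b}" for x y
      by (rule derivative_within_Lipschitz[of a b "\<lambda>v. F2 s v" "\<lambda>v. F22 s v"]) (use p(5) bd st that in \<open>auto simp: has_partial2_def\<close>)
  qed
  have "\<bar>F1 s v - F1 s t\<bar> \<le> C * \<bar>v - t\<bar>"
    by (rule derivative_within_Lipschitz[of a b "\<lambda>v. F1 s v" "\<lambda>v. F12 s v"]) (use p(4) bd st uv in \<open>auto simp: has_partial2_def\<close>)
  also have "\<dots> \<le> C * h" using h C by (intro mult_left_mono)
  finally have "\<bar>(F1 s v - F1 s t) * (u - s)\<bar> \<le> (C * h) * h"
    unfolding abs_mult using h C h0 by (intro mult_mono) auto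
  then have 3: "\<bar>(F1 s v - F1 s t) * (u - s)\<bar> \<le> C * h\<^sup>2" by (simp add: power2_eq_square mult.assoc)
  have sq: "C * (u - s)\<^sup>2 \<le> C * h\<^sup>2" "C * (v - t)\<^sup>2 \<le> C * h\<^sup>2"
    using h h0 C by (auto intro!: mult_left_mono simp: abs_le_square_iff[symmetric])
  have "F u v - F s t - F1 s t * (u - s) - F2 s t * (v - t)
     = (F u v - F s v - F1 s v * (u - s)) + (F s v - F s t - F2 s t * (v - t)) + (F1 s v - F1 s t) * (u - s)"
    by (simp add: algebra_simps)
  then show ?thesis using 1 2 3 sq by linarith
qed

text \<open>The linear functional to which the least squares lemmas are applied. An index is a
  triple of curve and two points, so one functional serves both the diagonal and the off-diagonal
  sums.\<close>

definition pair_avg :: "(nat \<Rightarrow> real) \<Rightarrow> (nat \<Rightarrow> (nat \<times> nat) set) \<Rightarrow> nat \<Rightarrow> (nat \<times> nat \<times> nat \<Rightarrow> real) \<Rightarrow> real" where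
  "pair_avg wt E n f = (\<Sum>i<n. wt i * (\<Sum>(j, k)\<in>E i. f (i, j, k))) / real n"

lemma pair_avg_add: "pair_avg wt E n (\<lambda>e. f e + g e) = pair_avg wt E n f + pair_avg wt E n g"
  unfolding pair_avg_def by (simp add: sum.distrib distrib_left case_prod_beta add_divide_distrib)

lemma pair_avg_scale: "pair_avg wt E n (\<lambda>e. c * f e) = c * pair_avg wt E n f"
  unfolding pair_avg_def by (simp add: sum_distrib_left case_prod_beta mult_ac)

lemma pair_avg_abs_le:
  assumes wt: "\<And>i. 0 \<le> wt i" and le: "\<And>i j k. i < n \<Longrightarrow> (j, k) \<in> E i \<Longrightarrow> \<bar>f (i, j, k)\<bar> \<le> g (i, j, k)"
  shows "\<bar>pair_avg wt E n f\<bar> \<le> pair_avg wt E n g"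
proof -
  have "\<bar>\<Sum>i<n. wt i * (\<Sum>(j, k)\<in>E i. f (i, j, k))\<bar> \<le> (\<Sum>i<n. wt i * (\<Sum>(j, k)\<in>E i. g (i, j, k)))"
  proof (rule order_trans[OF sum_abs sum_mono])
    fix i assume i: "i \<in> {..<n}"
    have "\<bar>\<Sum>(j, k)\<in>E i. f (i, j, k)\<bar> \<le> (\<Sum>(j, k)\<in>E i. g (i, j, k))"
      by (rule order_trans[OF sum_abs sum_mono]) (use le i in auto)
    then show "\<bar>wt i * (\<Sum>(j, k)\<in>E i. f (i, j, k))\<bar> \<le> wt i * (\<Sum>(j, k)\<in>E i. g (i, j, k))"
      using wt[of i] by (simp add: abs_mult mult_left_mono)
  qed
  then show ?thesis unfolding pair_avg_def by (simp add: abs_divide divide_right_mono)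
qed

lemma condC2_facts:
  assumes "condC2 K"
  shows "\<And>u. 0 \<le> K u" "\<And>u. u \<notin> {-1..1} \<Longrightarrow> K u = 0" "\<And>p. bv_kernel (\<lambda>u. K u * u ^ p)"
proof -
  show "\<And>u. 0 \<le> K u" and z: "\<And>u. u \<notin> {-1..1} \<Longrightarrow> K u = 0" using assms unfolding condC2_def by blast+
  have "bounded_variation_on K (-1) 1" using assms unfolding condC2_def by blast
  then have "bv_kernel K" using z by (rule bounded_variation_imp_bv_kernel)
  then show "\<And>p. bv_kernel (\<lambda>u. K u * u ^ p)" by (rule bv_kernel_times_power)
qed

lemma mono_kernel_window: "mono_kernel (indicator {-1..1})"
  by (auto simp: mono_kernel_def indicator_def)

text \<open>\<open>w\<close> is a kernel weight that vanishes outside the window, so remainder and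
  rescaled coordinate are controlled only where it is nonzero.\<close>

lemma window_le:
  fixes x r C w :: real
  assumes w: "0 \<le> w" and r: "w \<noteq> 0 \<Longrightarrow> \<bar>r\<bar> \<le> C \<and> \<bar>x\<bar> \<le> 1"
  shows "\<bar>w * r * x\<bar> \<le> C * w" "\<bar>w * r\<bar> \<le> C * w"
proof -
  show *: "\<bar>w * r\<bar> \<le> C * w"
  proof (cases "w = 0")
    case False
    then have "w * \<bar>r\<bar> \<le> w * C" using w r by (intro mult_left_mono) auto
    then show ?thesis using w by (simp add: abs_mult mult.commute)
  qed simp
  show "\<bar>w * r * x\<bar> \<le> C * w"
  proof (cases "w = 0")
    case False
    then have "\<bar>w * r\<bar> * \<bar>x\<bar> \<le> \<bar>w * r\<bar> * 1" using r by (intro mult_left_mono) auto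
    then show ?thesis using * by (simp add: abs_mult)
  qed simp
qed

lemma delta_tendsto_0:
  assumes m: "\<And>n i. i < n \<Longrightarrow> 2 \<le> m n i" and h: "\<And>n. 0 < h n" and lim: "h \<longlonglongrightarrow> 0" and l: "2 < l"
  shows "(\<lambda>n. inverse (beta1 m h n) * (ln (real n) / real n) powr (1 - 2 / l)) \<longlonglongrightarrow> 0 \<Longrightarrow> (\<lambda>n. delta1 m n (h n)) \<longlonglongrightarrow> 0"
    and "(\<lambda>n. inverse (beta2 m h n) * (ln (real n) / real n) powr (1 - 2 / l)) \<longlonglongrightarrow> 0 \<Longrightarrow> (\<lambda>n. delta2 m n (h n)) \<longlonglongrightarrow> 0"
proof -
  have B: "\<And>n. 0 < beta1 m h n" "\<And>n. 0 < beta2 m h n" "\<forall>\<^sub>F n in sequentially. beta1 m h n \<le> 2 * h n"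
      "\<forall>\<^sub>F n in sequentially. beta2 m h n \<le> 3 * (h n)\<^sup>2"
    using beta_bounds[of m h, OF _ h lim] m by blast+
  have h2: "0 < (h n)\<^sup>2" for n using h[of n] by simp
  show "(\<lambda>n. delta1 m n (h n)) \<longlonglongrightarrow> 0"
    if "(\<lambda>n. inverse (beta1 m h n) * (ln (real n) / real n) powr (1 - 2 / l)) \<longlonglongrightarrow> 0"
    using rate_facts(3)[OF B(1) h B(3) l that] delta_eq(1)[of h _ m] h by simp
  show "(\<lambda>n. delta2 m n (h n)) \<longlonglongrightarrow> 0"
    if "(\<lambda>n. inverse (beta2 m h n) * (ln (real n) / real n) powr (1 - 2 / l)) \<longlonglongrightarrow> 0"
    using rate_facts(3)[OF B(2) h2 B(4) l that] delta_eq(2)[of h _ m] h by simp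
qed

section \<open>Uniform rate of the mean estimator\<close>

context fda_moment
begin

lemma mean_rate:
  assumes m: "\<And>n i. i < n \<Longrightarrow> 2 \<le> m n i" and h: "\<And>n. 0 < h n" and lim: "h \<longlonglongrightarrow> 0"
    and rate: "(\<lambda>n. inverse (beta1 m h n) * (ln (real n) / real n) powr (1 - 2 / p)) \<longlonglongrightarrow> 0"
    and K: "condC2 K" and C3: "condC3 a b \<mu>"
    and est: "\<And>n t \<omega>. t \<in> {a..b} \<Longrightarrow> \<omega> \<in> space M \<Longrightarrow>
       is_mean_estimate K (h n) n (m n) (\<lambda>i j. obs X \<xi> T U i j \<omega>) (\<lambda>i j. T i j \<omega>) t (mh n t \<omega>)"
  shows "AE \<omega> in M. \<exists>B\<ge>0. \<forall>\<^sub>F n in sequentially. \<forall>t\<in>{a..b}. \<bar>mh n t \<omega> - \<mu> t\<bar> \<le> B * ((h n)\<^sup>2 + delta1 m n (h n))"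
proof -
  let ?wt = "\<lambda>n i. 1 / real (m n i)" and ?E = "\<lambda>n i. pairs_diag (m n i)"
  interpret A: signed_array M a b \<sigma> P X \<xi> T U f\<^sub>T m\<^sub>T M\<^sub>T p ?E ?wt "\<lambda>i j k. amp i j" amp_moment 1 "16 * M\<^sub>T\<^sup>2 + 4 * M\<^sub>T" p "beta1 m h" h
    by (rule mean_array[OF m h lim rate])
  note KF = condC2_facts[OF K]
  define \<phi> where "\<phi> p u = K u * u ^ p" for p :: nat and u
  \<comment> \<open>On diagonal pairs both kernels see the same point; the indicator of the window
    is 1 wherever the first kernel is nonzero, so it changes nothing.\<close>
  define ind :: "real \<Rightarrow> real" where "ind = indicator {-1..1}"
  define S where "S p = moment (\<phi> p)" for p
  have S_def': "S = (\<lambda>p. moment (\<lambda>u. K u * u ^ p))" unfolding S_def \<phi>_def by simp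
  obtain s v where sv: "0 < s" "s \<le> 1" "0 < v" and nd: "\<And>h t. 0 < h \<Longrightarrow> h \<le> (b - a) / 2 \<Longrightarrow> t \<in> {a..b} \<Longrightarrow>
     s \<le> S 0 h t \<and> \<bar>S 1 h t\<bar> \<le> S 0 h t \<and> v * (S 0 h t)\<^sup>2 \<le> S 2 h t * S 0 h t - (S 1 h t)\<^sup>2 \<and> S 0 h t \<le> M\<^sub>T"
    using kernel_moments_nondegenerate[OF K] unfolding S_def' by blast
  define L where "L = s\<^sup>2 / (2 + 5 / v)"
  have L: "0 < L" "L \<le> 1"
  proof -
    have "0 < 5 / v" using sv by simp
    then have d: "1 < 2 + 5 / v" by linarith
    then have D0: "0 < 2 + 5 / v" by linarith
    then show "0 < L" unfolding L_def using sv by (intro divide_pos_pos zero_less_power)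
    have "s\<^sup>2 \<le> 1" using sv by (simp add: abs_square_le_1)
    then have "s\<^sup>2 \<le> 2 + 5 / v" using d by linarith
    then show "L \<le> 1" unfolding L_def using D0 by (subst divide_le_eq_1_pos)
  qed
  obtain \<mu>' \<mu>'' where \<mu>': "\<And>t. t \<in> {a..b} \<Longrightarrow> (\<mu> has_real_derivative \<mu>' t) (at t within {a..b})"
    and \<mu>'': "\<And>t. t \<in> {a..b} \<Longrightarrow> (\<mu>' has_real_derivative \<mu>'' t) (at t within {a..b})" and "bounded (\<mu>'' ` {a..b})"
    using C3 unfolding condC3_def by blast
  then obtain C where "\<forall>x\<in>\<mu>'' ` {a..b}. norm x \<le> C" unfolding bounded_iff by blast
  then have C: "\<bar>\<mu>'' t\<bar> \<le> C" if "t \<in> {a..b}" for t using that by simp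
  have C0: "0 \<le> C" using C[of a] ab by (auto intro: order_trans[OF abs_ge_zero])
  have Taylor: "\<bar>\<mu> x - \<mu> t - \<mu>' t * (x - t)\<bar> \<le> C * (x - t)\<^sup>2" if "x \<in> {a..b}" "t \<in> {a..b}" for x t
    by (rule Taylor_within[OF \<mu>' derivative_within_Lipschitz[OF \<mu>'' C] C0 that])
  let ?F = "\<lambda>n p s t x y. \<phi> p ((x - s) / h n) * ind ((y - t) / h n)"
  have bvs: "bv_kernel (\<phi> p)" "bv_kernel ind" for p
    using KF(3) mono_kernel_imp_bv[OF mono_kernel_window] unfolding \<phi>_def ind_def by auto
  have \<phi>ind: "\<phi> p u * ind u = \<phi> p u" for p u using KF(2)[of u] unfolding \<phi>_def ind_def by (auto simp: indicator_def)
  have fam: "AE \<omega> in M. \<exists>B\<ge>0. \<forall>\<^sub>F n in sequentially. \<forall>f\<in>\<phi> ` {0, 1, 2}. \<forall>g\<in>{ind}. \<forall>s\<in>{a..b}. \<forall>t\<in>{a..b}.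
     \<bar>A.kernel_avg Z n (\<lambda>x y. f ((x - s) / h n) * g ((y - t) / h n)) \<omega> - A.kernel_mean Z n (\<lambda>x y. f ((x - s) / h n) * g ((y - t) / h n))\<bar>
       \<le> B * A.rate_fun n"
    if "\<And>i j k. Z i j k \<in> borel_measurable (sources (curve_sources i))" "AE \<omega> in M. \<forall>i j k. \<bar>Z i j k \<omega>\<bar> \<le> amp i j \<omega>" for Z :: "nat \<Rightarrow> nat \<Rightarrow> nat \<Rightarrow> 'a \<Rightarrow> real"
    by (rule A.AE_kernel_avg_family) (use that bvs in auto)
  have fam1: "AE \<omega> in M. \<exists>B\<ge>0. \<forall>\<^sub>F n in sequentially. \<forall>f\<in>\<phi> ` {0, 1, 2}. \<forall>g\<in>{ind}. \<forall>s\<in>{a..b}. \<forall>t\<in>{a..b}.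
     \<bar>A.kernel_avg (\<lambda>_ _ _ _. 1) n (\<lambda>x y. f ((x - s) / h n) * g ((y - t) / h n)) \<omega> - A.kernel_mean (\<lambda>_ _ _ _. 1) n (\<lambda>x y. f ((x - s) / h n) * g ((y - t) / h n))\<bar>
       \<le> B * A.rate_fun n"
    by (rule fam) (use amp_ge in auto)
  have fam2: "AE \<omega> in M. \<exists>B\<ge>0. \<forall>\<^sub>F n in sequentially. \<forall>f\<in>\<phi> ` {0, 1, 2}. \<forall>g\<in>{ind}. \<forall>s\<in>{a..b}. \<forall>t\<in>{a..b}.
     \<bar>A.kernel_avg (\<lambda>i j k. eps1 i j) n (\<lambda>x y. f ((x - s) / h n) * g ((y - t) / h n)) \<omega> - A.kernel_mean (\<lambda>i j k. eps1 i j) n (\<lambda>x y. f ((x - s) / h n) * g ((y - t) / h n))\<bar>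
       \<le> B * A.rate_fun n"
    by (rule fam) (use eps1_meas eps1_le in auto)
  have mean1: "A.kernel_mean (\<lambda>_ _ _ _. 1) n (?F n q t t) = h n * S q (h n) t" if n: "0 < n" for n q t
  proof -
    have bm: "\<phi> q \<in> borel_measurable borel" using bv_kernel_bounded_borel[OF bvs(1)] by (simp add: bounded_borel_def)
    have "A.kernel_mean (\<lambda>_ _ _ _. 1) n (?F n q t t) = (\<Sum>i<n. ?wt n i * (\<Sum>j<m n i. h n * S q (h n) t)) / real n"
      unfolding A.kernel_mean_def sum_pairs_diag using kernel_T_expectation[OF bm h] by (simp add: \<phi>ind S_def)
    also have "\<dots> = (\<Sum>i<n. h n * S q (h n) t) / real n"
    proof (intro arg_cong2[of _ _ _ _ "(/)"] sum.cong refl)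
      fix i assume "i \<in> {..<n}"
      then show "?wt n i * (\<Sum>j<m n i. h n * S q (h n) t) = h n * S q (h n) t" using m[of i n] by simp
    qed
    also have "\<dots> = h n * S q (h n) t" using n by simp
    finally show ?thesis .
  qed
  have mean2: "A.kernel_mean (\<lambda>i j k. eps1 i j) n (?F n q t t) = 0" for n q t
  proof -
    obtain D where D: "\<And>u. \<bar>\<phi> q u\<bar> \<le> D" and bm[measurable]: "\<phi> q \<in> borel_measurable borel"
      using bv_kernel_bounded_borel[OF bvs(1)] by (auto simp: bounded_borel_def)
    have "(\<lambda>(x, y). \<phi> q ((x - t) / h n)) \<in> borel_measurable (borel \<Otimes>\<^sub>M (borel :: real measure))" by measurable
    from eps1_F_expectation[OF this D] show ?thesis
      unfolding A.kernel_mean_def sum_pairs_diag by (simp add: \<phi>ind)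
  qed
  have \<delta>: "A.rate_fun n / h n = delta1 m n (h n)" for n
    unfolding A.rate_fun_def using delta_eq(1)[of h n m] h by simp
  have \<delta>_lim: "(\<lambda>n. delta1 m n (h n)) \<longlonglongrightarrow> 0"
    using delta_tendsto_0(1)[OF _ h lim p rate] m by blast
  from fam1 fam2 AE_space show ?thesis
  proof eventually_elim
    case (elim \<omega>)
    then obtain B C' where B: "0 \<le> B" "\<forall>\<^sub>F n in sequentially. \<forall>f\<in>\<phi> ` {0, 1, 2}. \<forall>g\<in>{ind}. \<forall>s\<in>{a..b}. \<forall>t\<in>{a..b}.
        \<bar>A.kernel_avg (\<lambda>_ _ _ _. 1) n (\<lambda>x y. f ((x - s) / h n) * g ((y - t) / h n)) \<omega> - A.kernel_mean (\<lambda>_ _ _ _. 1) n (\<lambda>x y. f ((x - s) / h n) * g ((y - t) / h n))\<bar>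
         \<le> B * A.rate_fun n"
      and C': "0 \<le> C'" "\<forall>\<^sub>F n in sequentially. \<forall>f\<in>\<phi> ` {0, 1, 2}. \<forall>g\<in>{ind}. \<forall>s\<in>{a..b}. \<forall>t\<in>{a..b}.
        \<bar>A.kernel_avg (\<lambda>i j k. eps1 i j) n (\<lambda>x y. f ((x - s) / h n) * g ((y - t) / h n)) \<omega> - A.kernel_mean (\<lambda>i j k. eps1 i j) n (\<lambda>x y. f ((x - s) / h n) * g ((y - t) / h n))\<bar>
         \<le> C' * A.rate_fun n" by blast
    have \<omega>: "\<omega> \<in> space M" by fact
    \<comment> \<open>Eventually the stochastic error of the design entries is below a sixth of the
      eigenvalue bound \<open>L\<close>. The threshold depends on the outcome through
      \<open>B\<close>, but not on \<open>t\<close>.\<close>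
    have "(\<lambda>n. 6 * (B * delta1 m n (h n))) \<longlonglongrightarrow> 6 * (B * 0)" by (intro tendsto_mult tendsto_const \<delta>_lim)
    then have small: "\<forall>\<^sub>F n in sequentially. 6 * (B * delta1 m n (h n)) < L" using L by (intro order_tendstoD(2)) auto
    have hs: "\<forall>\<^sub>F n in sequentially. h n < (b - a) / 2" using order_tendstoD(2)[OF lim, of "(b - a) / 2"] ab by simp
    have "\<forall>\<^sub>F n in sequentially. \<forall>t\<in>{a..b}. \<bar>mh n t \<omega> - \<mu> t\<bar> \<le> (6 * (C' + C * (M\<^sub>T + 1)) / L) * ((h n)\<^sup>2 + delta1 m n (h n))"
      using B(2) C'(2) small hs A.rate_fun_nonneg eventually_gt_at_top[of 0]
    proof eventually_elim
      case (elim n)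
      show ?case
      proof
        fix t assume t: "t \<in> {a..b}"
        let ?d = "delta1 m n (h n)"
        have n: "0 < n" and hn: "h n \<le> (b - a) / 2" using elim by auto
        have d0: "0 \<le> ?d" unfolding \<delta>[symmetric] using elim h[of n] by (intro divide_nonneg_nonneg) auto
        note ND = nd[OF h hn t]
        let ?A = "pair_avg (?wt n) (?E n) n"
        define w where "w = (\<lambda>(i, j, k :: nat). kern_scale K (h n) (T i j \<omega> - t))"
        define z where "z = (\<lambda>(i, j, k :: nat). Y i j \<omega>)"
        define x where "x = (\<lambda>(i, j, k :: nat). (T i j \<omega> - t) / h n)"
        define r where "r = (\<lambda>(i, j, k :: nat). eps1 i j \<omega>)"
        have wx: "w e = \<phi> 0 (x e) / h n" "w e * x e = \<phi> 1 (x e) / h n" "w e * (x e)\<^sup>2 = \<phi> 2 (x e) / h n" for e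
          unfolding w_def x_def \<phi>_def kern_scale_def by (auto split: prod.splits)
        have avg: "?A (\<lambda>e. c e * (\<phi> q (x e) / h n)) = A.kernel_avg Z n (?F n q t t) \<omega> / h n"
          if "\<And>i j k. c (i, j, k) = Z i j k \<omega>" for c Z q
        proof -
          have "?A (\<lambda>e. c e * (\<phi> q (x e) / h n)) = ?A (\<lambda>e. (1 / h n) * (c e * \<phi> q (x e)))" by (simp add: mult_ac)
          also have "\<dots> = (1 / h n) * A.kernel_avg Z n (?F n q t t) \<omega>"
            unfolding pair_avg_scale unfolding pair_avg_def A.kernel_avg_def sum_pairs_diag x_def by (simp add: that \<phi>ind)
          finally show ?thesis by simp
        qed
        have close: "\<bar>?A (\<lambda>e. \<phi> q (x e) / h n) - S q (h n) t\<bar> \<le> B * ?d" if q: "q \<in> {0, 1, 2}" for q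
        proof -
          have "\<bar>A.kernel_avg (\<lambda>_ _ _ _. 1) n (?F n q t t) \<omega> - h n * S q (h n) t\<bar> \<le> B * A.rate_fun n"
            using elim(1) q t unfolding mean1[OF n, symmetric] by blast
          then have "\<bar>A.kernel_avg (\<lambda>_ _ _ _. 1) n (?F n q t t) \<omega> - h n * S q (h n) t\<bar> / h n \<le> B * A.rate_fun n / h n"
            using h[of n] by (intro divide_right_mono) auto
          moreover have "\<bar>A.kernel_avg (\<lambda>_ _ _ _. 1) n (?F n q t t) \<omega> - h n * S q (h n) t\<bar> / h n
              = \<bar>A.kernel_avg (\<lambda>_ _ _ _. 1) n (?F n q t t) \<omega> / h n - S q (h n) t\<bar>"
          proof -
            have "\<bar>y - h n * c\<bar> / h n = \<bar>(y - h n * c) / h n\<bar>" for y c by (simp only: abs_divide abs_of_pos[OF h])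
            moreover have "(y - h n * c) / h n = y / h n - c" for y c using h[of n] by (simp add: diff_divide_distrib)
            ultimately show ?thesis by simp
          qed
          ultimately show ?thesis
            using avg[of "\<lambda>_. 1" "\<lambda>_ _ _ _. 1" q] unfolding times_divide_eq_right[symmetric] \<delta> by simp
        qed
        have noise: "\<bar>?A (\<lambda>e. r e * (\<phi> q (x e) / h n))\<bar> \<le> C' * ?d" if q: "q \<in> {0, 1, 2}" for q
        proof -
          have "\<bar>A.kernel_avg (\<lambda>i j k. eps1 i j) n (?F n q t t) \<omega> - A.kernel_mean (\<lambda>i j k. eps1 i j) n (?F n q t t)\<bar> \<le> C' * A.rate_fun n"
            using elim(2) q t by blast
          then have "\<bar>A.kernel_avg (\<lambda>i j k. eps1 i j) n (?F n q t t) \<omega>\<bar> / h n \<le> C' * A.rate_fun n / h n"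
            using h[of n] unfolding mean2 by (intro divide_right_mono) auto
          then show ?thesis
            using avg[of r "\<lambda>i j k. eps1 i j" q] h[of n] unfolding times_divide_eq_right[symmetric] \<delta> r_def by (simp add: abs_divide)
        qed
        obtain a1 where "is_arg_min (mean_loss K (h n) n (m n) (\<lambda>i j. Y i j \<omega>) (\<lambda>i j. T i j \<omega>) t) (\<lambda>_. True) (mh n t \<omega>, a1)"
          using est[OF t \<omega>, of n] unfolding is_mean_estimate_def obs_eq by blast
        then have least: "mean_loss K (h n) n (m n) (\<lambda>i j. Y i j \<omega>) (\<lambda>i j. T i j \<omega>) t (mh n t \<omega>, a1)
            \<le> mean_loss K (h n) n (m n) (\<lambda>i j. Y i j \<omega>) (\<lambda>i j. T i j \<omega>) t c" for c
          unfolding is_arg_min_def by (meson linorder_not_le)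
        \<comment> \<open>In the rescaled coordinate \<open>x\<close> the slope becomes
          \<open>h n * c1\<close>. The design then has entries of order 1, and intercept and slope
          errors are measured on the same scale.\<close>
        have loss: "mean_loss K (h n) n (m n) (\<lambda>i j. Y i j \<omega>) (\<lambda>i j. T i j \<omega>) t (c0, c1) = ?A (\<lambda>e. w e * (z e - c0 - (h n * c1) * x e - c2 * 0)\<^sup>2)" for c0 c1 c2
          unfolding mean_loss_def pair_avg_def sum_pairs_diag w_def z_def x_def using h[of n] by (simp add: mult_ac)
        define bias where "bias = (\<lambda>(i, j, k :: nat). \<mu> (T i j \<omega>) - \<mu> t - \<mu>' t * (T i j \<omega> - t))"
        have resid: "z e - \<mu> t - (h n * \<mu>' t) * x e - 0 * 0 = r e + bias e" for e
          unfolding z_def x_def r_def bias_def eps1_def using h[of n] by (auto split: prod.splits)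
        have w0: "0 \<le> w e" and wz: "\<not> \<bar>x e\<bar> \<le> 1 \<Longrightarrow> w e = 0" for e
          unfolding wx(1) \<phi>_def using KF(1) KF(2)[of "x e"] h[of n] by (auto simp: abs_le_iff)
        have biasle: "\<bar>bias e\<bar> \<le> C * (h n)\<^sup>2" if "\<bar>x e\<bar> \<le> 1" for e
        proof -
          obtain i j k where e: "e = (i, j, k)" by (cases e)
          have "\<bar>T i j \<omega> - t\<bar> \<le> h n" using that h[of n] unfolding e x_def by (simp add: abs_divide)
          then have "(T i j \<omega> - t)\<^sup>2 \<le> (h n)\<^sup>2" using h[of n] by (simp add: abs_le_square_iff[symmetric])
          then have "C * (T i j \<omega> - t)\<^sup>2 \<le> C * (h n)\<^sup>2" using C0 by (rule mult_left_mono)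
          then show ?thesis using Taylor[OF T_range'[OF \<omega>] t, of i j] unfolding e bias_def by simp
        qed
        have wr: "w e \<noteq> 0 \<Longrightarrow> \<bar>bias e\<bar> \<le> C * (h n)\<^sup>2 \<and> \<bar>x e\<bar> \<le> 1" for e using biasle wz by blast
        \<comment> \<open>The total weight is within \<open>B * ?d\<close> of \<open>S 0\<close>,
          and \<open>B * ?d \<le> 1\<close> because \<open>6 * (B * ?d) < L\<close> and
          \<open>L \<le> 1\<close>.\<close>
        have Aw: "?A w \<le> M\<^sub>T + 1"
        proof -
          have "\<bar>?A w - S 0 (h n) t\<bar> \<le> B * ?d" using close[of 0] unfolding wx(1)[abs_def, symmetric] by (simp add: wx(1))
          moreover have "B * ?d \<le> 1" using elim(3) L by linarith
          ultimately show ?thesis using ND by linarith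
        qed
        have bias_avg: "\<bar>?A (\<lambda>e. w e * bias e * x e)\<bar> \<le> C * (M\<^sub>T + 1) * (h n)\<^sup>2" "\<bar>?A (\<lambda>e. w e * bias e)\<bar> \<le> C * (M\<^sub>T + 1) * (h n)\<^sup>2"
        proof -
          have "C * (h n)\<^sup>2 * ?A w \<le> C * (h n)\<^sup>2 * (M\<^sub>T + 1)" using Aw C0 by (intro mult_left_mono) auto
          moreover have "\<bar>?A (\<lambda>e. w e * bias e * x e)\<bar> \<le> ?A (\<lambda>e. C * (h n)\<^sup>2 * w e)" "\<bar>?A (\<lambda>e. w e * bias e)\<bar> \<le> ?A (\<lambda>e. C * (h n)\<^sup>2 * w e)"
            using window_le[OF w0 wr] by (auto intro!: pair_avg_abs_le)
          ultimately show "\<bar>?A (\<lambda>e. w e * bias e * x e)\<bar> \<le> C * (M\<^sub>T + 1) * (h n)\<^sup>2" "\<bar>?A (\<lambda>e. w e * bias e)\<bar> \<le> C * (M\<^sub>T + 1) * (h n)\<^sup>2"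
            unfolding pair_avg_scale by (simp_all add: mult_ac)
        qed
        define R where "R = C' * ?d + C * (M\<^sub>T + 1) * (h n)\<^sup>2"
        have R0: "\<bar>?A (\<lambda>e. w e * (z e - \<mu> t - (h n * \<mu>' t) * x e - 0 * 0))\<bar> \<le> R"
        proof -
          have "?A (\<lambda>e. w e * (r e + bias e)) = ?A (\<lambda>e. r e * (\<phi> 0 (x e) / h n)) + ?A (\<lambda>e. w e * bias e)"
            unfolding pair_avg_add[symmetric] wx(1)[symmetric] by (simp add: algebra_simps)
          then show ?thesis using noise[of 0] bias_avg(2) unfolding resid R_def by simp
        qed
        have R1: "\<bar>?A (\<lambda>e. w e * (z e - \<mu> t - (h n * \<mu>' t) * x e - 0 * 0) * x e)\<bar> \<le> R"
        proof -
          have "?A (\<lambda>e. w e * (r e + bias e) * x e) = ?A (\<lambda>e. r e * (\<phi> 1 (x e) / h n)) + ?A (\<lambda>e. w e * bias e * x e)"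
            unfolding pair_avg_add[symmetric] wx(2)[symmetric] by (simp add: algebra_simps)
          then show ?thesis using noise[of 1] bias_avg(1) unfolding resid R_def by simp
        qed
        have R00: "0 \<le> R" unfolding R_def using d0 C'(1) C0 M\<^sub>T by (intro add_nonneg_nonneg mult_nonneg_nonneg) auto
        have "?A (\<lambda>_. 0) = 0" unfolding pair_avg_def by simp
        have "\<bar>mh n t \<omega> - \<mu> t\<bar> \<le> 6 * R / (s\<^sup>2 / (2 + 5 / v))"
        \<comment> \<open>The univariate fit as a degenerate bivariate one: the second coordinate is
          0, with moments 1, 0, 0 and coefficient 0.\<close>
        proof (rule local_linear_error[where A = ?A and w = w and z = z and Q = "\<lambda>_. True" and ?x1.0 = x and ?x2.0 = "\<lambda>_. 0"
              and ?a1.0 = "h n * a1" and ?a2.0 = 0 and ?b1.0 = "h n * \<mu>' t" and ?b2.0 = 0 and s = s and v = v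
              and ?\<sigma>0.0 = "S 0 (h n) t" and ?\<sigma>1.0 = "S 1 (h n) t" and ?\<sigma>2.0 = "S 2 (h n) t" and ?\<tau>0.0 = 1 and ?\<tau>1.0 = 0 and ?\<tau>2.0 = 0
              and \<eta> = "B * ?d", OF pair_avg_add pair_avg_scale])
          show "?A (\<lambda>e. w e * (z e - mh n t \<omega> - h n * a1 * x e - 0 * 0)\<^sup>2) \<le> ?A (\<lambda>e. w e * (z e - c0 - c1 * x e - c2 * 0)\<^sup>2)" for c0 c1 c2
            using least[of "(c0, c1 / h n)"] h[of n] unfolding loss[of _ _ 0] by simp
          show "\<bar>?A (\<lambda>e. w e) - S 0 (h n) t * 1\<bar> \<le> B * ?d" "\<bar>?A (\<lambda>e. w e * (x e)\<^sup>2) - S 2 (h n) t * 1\<bar> \<le> B * ?d"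
            "\<bar>?A (\<lambda>e. w e * x e) - S 1 (h n) t * 1\<bar> \<le> B * ?d"
            using close[of 0] close[of 1] close[of 2] unfolding wx(2,3) unfolding wx(1) by simp_all
          show "6 * (B * ?d) \<le> s\<^sup>2 / (2 + 5 / v)" using elim(3) unfolding L_def by simp
        qed (use sv ND R0 R1 R00 d0 B(1) \<open>?A (\<lambda>_. 0) = 0\<close> in auto)
        also have "6 * R / (s\<^sup>2 / (2 + 5 / v)) \<le> (6 * (C' + C * (M\<^sub>T + 1)) / L) * ((h n)\<^sup>2 + ?d)"
        proof -
          have "R \<le> (C' + C * (M\<^sub>T + 1)) * ((h n)\<^sup>2 + ?d)"
          proof -
            have "(C' + C * (M\<^sub>T + 1)) * ((h n)\<^sup>2 + ?d) = R + (C' * (h n)\<^sup>2 + C * (M\<^sub>T + 1) * ?d)"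
              unfolding R_def by (simp add: algebra_simps)
            moreover have "0 \<le> C' * (h n)\<^sup>2 + C * (M\<^sub>T + 1) * ?d" using d0 C'(1) C0 M\<^sub>T by (intro add_nonneg_nonneg mult_nonneg_nonneg) auto
            ultimately show ?thesis by linarith
          qed
          then have "6 / L * R \<le> 6 / L * ((C' + C * (M\<^sub>T + 1)) * ((h n)\<^sup>2 + ?d))" using L by (intro mult_left_mono) auto
          then show ?thesis unfolding L_def[symmetric] by (simp only: times_divide_eq_left times_divide_eq_right mult.assoc)
        qed
        finally show "\<bar>mh n t \<omega> - \<mu> t\<bar> \<le> (6 * (C' + C * (M\<^sub>T + 1)) / L) * ((h n)\<^sup>2 + ?d)" .
      qed
    qed
    moreover have "0 \<le> 6 * (C' + C * (M\<^sub>T + 1)) / L" using C'(1) C0 M\<^sub>T L by (intro divide_nonneg_nonneg mult_nonneg_nonneg add_nonneg_nonneg) auto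
    ultimately show ?case by blast
  qed
qed

end

section \<open>Uniform rate of the product moment estimator\<close>

context fda_moment
begin

lemma cov_rate:
  assumes m: "\<And>n i. i < n \<Longrightarrow> 2 \<le> m n i" and h: "\<And>n. 0 < h n" and lim: "h \<longlonglongrightarrow> 0" and l: "2 < l" and pl: "p = 2 * l"
    and rate: "(\<lambda>n. inverse (beta2 m h n) * (ln (real n) / real n) powr (1 - 2 / l)) \<longlonglongrightarrow> 0"
    and K: "condC2 K" and C3: "condC3 a b \<mu>" and C4: "condC4 a b (cov_fun P X)"
    and est: "\<And>n s t \<omega>. s \<in> {a..b} \<Longrightarrow> t \<in> {a..b} \<Longrightarrow> \<omega> \<in> space M \<Longrightarrow>
       is_cov_estimate K (h n) n (m n) (\<lambda>i j. obs X \<xi> T U i j \<omega>) (\<lambda>i j. T i j \<omega>) s t (ch n s t \<omega>)"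
  shows "AE \<omega> in M. \<exists>B\<ge>0. \<forall>\<^sub>F n in sequentially. \<forall>s\<in>{a..b}. \<forall>t\<in>{a..b}.
     \<bar>ch n s t \<omega> - (cov_fun P X s t + \<mu> s * \<mu> t)\<bar> \<le> B * ((h n)\<^sup>2 + delta2 m n (h n))"
proof -
  let ?wt = "\<lambda>n i. 1 / (real (m n i) * (real (m n i) - 1))" and ?E = "\<lambda>n i. pairs_off (m n i)"
  interpret A: signed_array M a b \<sigma> P X \<xi> T U f\<^sub>T m\<^sub>T M\<^sub>T p ?E ?wt "\<lambda>i j k \<omega>. amp i j \<omega> * amp i k \<omega>" amp_moment "2 powr l"
      "1024 * M\<^sub>T ^ 4 + 256 * M\<^sub>T\<^sup>2" l "beta2 m h" h
    by (rule cov_array[OF m h lim l pl rate])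
  note KF = condC2_facts[OF K]
  define \<phi> where "\<phi> p u = K u * u ^ p" for p :: nat and u
  define S where "S p = moment (\<phi> p)" for p
  have S_def': "S = (\<lambda>p. moment (\<lambda>u. K u * u ^ p))" unfolding S_def \<phi>_def by simp
  obtain q v where qv: "0 < q" "q \<le> 1" "0 < v" and nd: "\<And>h t. 0 < h \<Longrightarrow> h \<le> (b - a) / 2 \<Longrightarrow> t \<in> {a..b} \<Longrightarrow>
     q \<le> S 0 h t \<and> \<bar>S 1 h t\<bar> \<le> S 0 h t \<and> v * (S 0 h t)\<^sup>2 \<le> S 2 h t * S 0 h t - (S 1 h t)\<^sup>2 \<and> S 0 h t \<le> M\<^sub>T"
    using kernel_moments_nondegenerate[OF K] unfolding S_def' by blast
  define L where "L = q\<^sup>2 / (2 + 5 / v)"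
  have L: "0 < L" "L \<le> 1"
  proof -
    have "0 < 5 / v" using qv by simp
    then have d: "1 < 2 + 5 / v" by linarith
    then have D0: "0 < 2 + 5 / v" by linarith
    then show "0 < L" unfolding L_def using qv by (intro divide_pos_pos zero_less_power)
    have "q\<^sup>2 \<le> 1" using qv by (simp add: abs_square_le_1)
    then have "q\<^sup>2 \<le> 2 + 5 / v" using d by linarith
    then show "L \<le> 1" unfolding L_def using D0 by (subst divide_le_eq_1_pos)
  qed
  \<comment> \<open>The target of \<open>ch\<close>, written through covariance and mean because the
    smoothness conditions are placed on these. On the square it equals \<open>second_moment\<close>,
    at which \<open>eps2\<close> is centred.\<close>
  define G where "G s t = cov_fun P X s t + \<mu> s * \<mu> t" for s t
  have G_eq: "G s t = second_moment s t" if "s \<in> {a..b}" "t \<in> {a..b}" for s t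
    unfolding G_def using cov_fun_eq[OF that] by simp
  obtain G1 G2 C where C0: "0 \<le> C" and Taylor: "\<And>s t u v h. s \<in> {a..b} \<Longrightarrow> t \<in> {a..b} \<Longrightarrow> u \<in> {a..b} \<Longrightarrow> v \<in> {a..b} \<Longrightarrow>
     \<bar>u - s\<bar> \<le> h \<Longrightarrow> \<bar>v - t\<bar> \<le> h \<Longrightarrow> \<bar>G u v - G s t - G1 s t * (u - s) - G2 s t * (v - t)\<bar> \<le> C * h\<^sup>2"
  proof -
    obtain \<mu>' \<mu>'' where \<mu>': "\<And>t. t \<in> {a..b} \<Longrightarrow> (\<mu> has_real_derivative \<mu>' t) (at t within {a..b})"
      and \<mu>'': "\<And>t. t \<in> {a..b} \<Longrightarrow> (\<mu>' has_real_derivative \<mu>'' t) (at t within {a..b})" and bd\<mu>: "bounded (\<mu>'' ` {a..b})"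
      using C3 unfolding condC3_def by blast
    obtain R1 R2 R11 R12 R21 R22 where R: "has_partial1 a b (cov_fun P X) R1" "has_partial2 a b (cov_fun P X) R2"
      "has_partial1 a b R1 R11" "has_partial2 a b R1 R12" "has_partial1 a b R2 R21" "has_partial2 a b R2 R22"
      and bdR: "\<And>D. D \<in> {R11, R12, R21, R22} \<Longrightarrow> bounded ((\<lambda>(s, t). D s t) ` ({a..b} \<times> {a..b}))"
      using C4 unfolding condC4_def by blast
    have bdR': "\<exists>c. \<forall>s\<in>{a..b}. \<forall>t\<in>{a..b}. \<bar>D s t\<bar> \<le> c" if "D \<in> {R11, R12, R21, R22}" for D
      using bdR[OF that] unfolding bounded_iff by (auto simp: split_beta)
    obtain c11 c12 c22 where c: "\<And>s t. s \<in> {a..b} \<Longrightarrow> t \<in> {a..b} \<Longrightarrow> \<bar>R11 s t\<bar> \<le> c11 \<and> \<bar>R12 s t\<bar> \<le> c12 \<and> \<bar>R22 s t\<bar> \<le> c22"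
      using bdR'[of R11] bdR'[of R12] bdR'[of R22] by blast
    \<comment> \<open>The condition bounds the second derivative only. The first is differentiable,
      hence continuous, and so bounded on the compact interval.\<close>
    have "continuous_on {a..b} \<mu>'" using \<mu>'' by (meson DERIV_continuous continuous_on_eq_continuous_within)
    then have "bounded (\<mu>' ` {a..b})" by (intro compact_imp_bounded compact_continuous_image) auto
    then obtain d1 where d1: "\<And>t. t \<in> {a..b} \<Longrightarrow> \<bar>\<mu>' t\<bar> \<le> d1" unfolding bounded_iff by (metis imageI real_norm_def)
    obtain d2 where d2: "\<And>t. t \<in> {a..b} \<Longrightarrow> \<bar>\<mu>'' t\<bar> \<le> d2" using bd\<mu> unfolding bounded_iff by (metis imageI real_norm_def)
    \<comment> \<open>Bounds for the second partial derivatives of the covariance plus those of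
      \<open>\<mu> s * \<mu> t\<close>: two first derivatives, or a second derivative times a value
      bounded by \<open>offset\<close>.\<close>
    define D where "D = c11 + c12 + c22 + d1 * d1 + d2 * offset"
    have nn: "0 \<le> c11" "0 \<le> c12" "0 \<le> c22" "0 \<le> d1" "0 \<le> d2" "0 \<le> offset"
      using c[of a a] d1[of a] d2[of a] ab offset_ge(1) by (auto intro: order_trans[OF abs_ge_zero])
    have mul: "\<bar>x * y\<bar> \<le> X * Y" if "\<bar>x\<bar> \<le> X" "\<bar>y\<bar> \<le> Y" for x y X Y :: real
      unfolding abs_mult using that by (intro mult_mono) auto
    have D0: "0 \<le> D" using nn unfolding D_def by (intro add_nonneg_nonneg mult_nonneg_nonneg)
    have "\<bar>G u v - G s t - (R1 s t + \<mu>' s * \<mu> t) * (u - s) - (R2 s t + \<mu> s * \<mu>' t) * (v - t)\<bar> \<le> 3 * D * h\<^sup>2"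
      if "s \<in> {a..b}" "t \<in> {a..b}" "u \<in> {a..b}" "v \<in> {a..b}" "\<bar>u - s\<bar> \<le> h" "\<bar>v - t\<bar> \<le> h" for s t u v h
    proof (rule Taylor2_within[of a b G "\<lambda>s t. R1 s t + \<mu>' s * \<mu> t" "\<lambda>s t. R2 s t + \<mu> s * \<mu>' t" "\<lambda>s t. R11 s t + \<mu>'' s * \<mu> t"
          "\<lambda>s t. R12 s t + \<mu>' s * \<mu>' t" "\<lambda>s t. R22 s t + \<mu> s * \<mu>'' t", OF _ _ _ _ _ _ that])
      show "has_partial1 a b G (\<lambda>s t. R1 s t + \<mu>' s * \<mu> t)"
        unfolding has_partial1_def G_def using R(1) \<mu>' by (auto simp: has_partial1_def intro!: derivative_eq_intros)
      show "has_partial2 a b G (\<lambda>s t. R2 s t + \<mu> s * \<mu>' t)"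
        unfolding has_partial2_def G_def using R(2) \<mu>' by (auto simp: has_partial2_def intro!: derivative_eq_intros)
      show "has_partial1 a b (\<lambda>s t. R1 s t + \<mu>' s * \<mu> t) (\<lambda>s t. R11 s t + \<mu>'' s * \<mu> t)"
        unfolding has_partial1_def using R(3) \<mu>'' by (auto simp: has_partial1_def intro!: derivative_eq_intros)
      show "has_partial2 a b (\<lambda>s t. R1 s t + \<mu>' s * \<mu> t) (\<lambda>s t. R12 s t + \<mu>' s * \<mu>' t)"
        unfolding has_partial2_def using R(4) \<mu>' by (auto simp: has_partial2_def intro!: derivative_eq_intros)
      show "has_partial2 a b (\<lambda>s t. R2 s t + \<mu> s * \<mu>' t) (\<lambda>s t. R22 s t + \<mu> s * \<mu>'' t)"
        unfolding has_partial2_def using R(6) \<mu>'' by (auto simp: has_partial2_def intro!: derivative_eq_intros)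
      fix s t assume st: "s \<in> {a..b}" "t \<in> {a..b}"
      have e: "\<bar>\<mu>'' s * \<mu> t\<bar> \<le> d2 * offset" "\<bar>\<mu>' s * \<mu>' t\<bar> \<le> d1 * d1" "\<bar>\<mu> s * \<mu>'' t\<bar> \<le> offset * d2"
        by (intro mul d1 d2 \<mu>_le_offset st)+
      have "0 \<le> d1 * d1" "0 \<le> d2 * offset" using nn by auto
      then show "\<bar>R11 s t + \<mu>'' s * \<mu> t\<bar> \<le> D \<and> \<bar>R12 s t + \<mu>' s * \<mu>' t\<bar> \<le> D \<and> \<bar>R22 s t + \<mu> s * \<mu>'' t\<bar> \<le> D"
        using c[OF st] e nn unfolding D_def mult.commute[of offset d2]
        by (auto intro: order_trans[OF abs_triangle_ineq])
    qed
    then show ?thesis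
      by (intro that[of "3 * D" "\<lambda>s t. R1 s t + \<mu>' s * \<mu> t" "\<lambda>s t. R2 s t + \<mu> s * \<mu>' t"]) (use D0 in auto)
  qed
  let ?F = "\<lambda>n p q s t x y. \<phi> p ((x - s) / h n) * \<phi> q ((y - t) / h n)"
  have bvs: "bv_kernel (\<phi> p)" for p using KF(3) unfolding \<phi>_def by auto
  have fam: "AE \<omega> in M. \<exists>B\<ge>0. \<forall>\<^sub>F n in sequentially. \<forall>f\<in>\<phi> ` {0, 1, 2}. \<forall>g\<in>\<phi> ` {0, 1, 2}. \<forall>s\<in>{a..b}. \<forall>t\<in>{a..b}.
     \<bar>A.kernel_avg Z n (\<lambda>x y. f ((x - s) / h n) * g ((y - t) / h n)) \<omega> - A.kernel_mean Z n (\<lambda>x y. f ((x - s) / h n) * g ((y - t) / h n))\<bar>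
       \<le> B * A.rate_fun n"
    if "\<And>i j k. Z i j k \<in> borel_measurable (sources (curve_sources i))" "AE \<omega> in M. \<forall>i j k. \<bar>Z i j k \<omega>\<bar> \<le> amp i j \<omega> * amp i k \<omega>"
    for Z :: "nat \<Rightarrow> nat \<Rightarrow> nat \<Rightarrow> 'a \<Rightarrow> real"
    by (rule A.AE_kernel_avg_family) (use that bvs in auto)
  have fam1: "AE \<omega> in M. \<exists>B\<ge>0. \<forall>\<^sub>F n in sequentially. \<forall>f\<in>\<phi> ` {0, 1, 2}. \<forall>g\<in>\<phi> ` {0, 1, 2}. \<forall>s\<in>{a..b}. \<forall>t\<in>{a..b}.
     \<bar>A.kernel_avg (\<lambda>_ _ _ _. 1) n (\<lambda>x y. f ((x - s) / h n) * g ((y - t) / h n)) \<omega> - A.kernel_mean (\<lambda>_ _ _ _. 1) n (\<lambda>x y. f ((x - s) / h n) * g ((y - t) / h n))\<bar>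
       \<le> B * A.rate_fun n"
  proof (rule fam)
    have "\<bar>1\<bar> \<le> amp i j \<omega> * amp i k \<omega>" for i j k \<omega>
      using mult_mono[OF amp_ge[of i j \<omega>] amp_ge[of i k \<omega>]] amp_ge[of i j \<omega>] by simp
    then show "AE \<omega> in M. \<forall>i j k. \<bar>1\<bar> \<le> amp i j \<omega> * amp i k \<omega>" by (intro AE_I2 allI)
  qed simp
  have fam2: "AE \<omega> in M. \<exists>B\<ge>0. \<forall>\<^sub>F n in sequentially. \<forall>f\<in>\<phi> ` {0, 1, 2}. \<forall>g\<in>\<phi> ` {0, 1, 2}. \<forall>s\<in>{a..b}. \<forall>t\<in>{a..b}.
     \<bar>A.kernel_avg eps2 n (\<lambda>x y. f ((x - s) / h n) * g ((y - t) / h n)) \<omega> - A.kernel_mean eps2 n (\<lambda>x y. f ((x - s) / h n) * g ((y - t) / h n))\<bar>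
       \<le> B * A.rate_fun n"
    by (rule fam) (use eps2_meas eps2_le in auto)
  have \<phi>_bd: "\<exists>D. \<forall>u. \<bar>\<phi> i u\<bar> \<le> D" and bm[measurable]: "\<phi> i \<in> borel_measurable borel" for i
    using bv_kernel_bounded_borel[OF bvs, of i] by (auto simp: bounded_borel_def)
  \<comment> \<open>Off the diagonal the two times are independent, so the expected design is a
    product of one-dimensional moments, which is the form that \<open>moment_form_lower\<close>
    treats.\<close>
  have mean1: "A.kernel_mean (\<lambda>_ _ _ _. 1) n (?F n i j s t) = (h n)\<^sup>2 * (S i (h n) s * S j (h n) t)" if n: "0 < n" for n i j s t
  proof -
    obtain D D' where D: "\<And>u. \<bar>\<phi> i u\<bar> \<le> D" "\<And>u. \<bar>\<phi> j u\<bar> \<le> D'" using \<phi>_bd by blast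
    let ?c = "(h n)\<^sup>2 * (S i (h n) s * S j (h n) t)"
    have ex: "expectation (\<lambda>\<omega>. 1 * ?F n i j s t (T r k \<omega>) (T r k' \<omega>)) = ?c" if "(k, k') \<in> pairs_off (m n r)" for r k k'
    proof -
      have "k \<noteq> k'" using that by (auto simp: pairs_off_def)
      from kernel_T_prod_expectation[OF bm D(1) bm D(2) h this] show ?thesis by (simp add: S_def)
    qed
    have "A.kernel_mean (\<lambda>_ _ _ _. 1) n (?F n i j s t) = (\<Sum>r<n. ?wt n r * (\<Sum>(k, k')\<in>?E n r. ?c)) / real n"
      unfolding A.kernel_mean_def
      by (intro arg_cong2[of _ _ _ _ "(/)"] sum.cong arg_cong2[of _ _ _ _ "(*)"] refl) (use ex in auto)
    also have "\<dots> = (\<Sum>r<n. ?c) / real n"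
    proof (intro arg_cong2[of _ _ _ _ "(/)"] sum.cong refl)
      fix r assume "r \<in> {..<n}"
      then show "?wt n r * (\<Sum>(k, k')\<in>?E n r. ?c) = ?c" using m[of r n] by (simp add: case_prod_beta card_pairs_off)
    qed
    also have "\<dots> = ?c" using n by simp
    finally show ?thesis .
  qed
  have mean2: "A.kernel_mean eps2 n (?F n i j s t) = 0" for n i j s t
  proof -
    obtain D D' where D: "\<And>u. \<bar>\<phi> i u\<bar> \<le> D" "\<And>u. \<bar>\<phi> j u\<bar> \<le> D'" using \<phi>_bd by blast
    have bd: "\<bar>?F n i j s t x y\<bar> \<le> D * D'" for x y
      unfolding abs_mult using D(1) D(2) order_trans[OF abs_ge_zero D(1)] by (intro mult_mono) auto
    have "(\<lambda>(x, y). ?F n i j s t x y) \<in> borel_measurable (borel \<Otimes>\<^sub>M borel)" by measurable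
    note ex = eps2_F_expectation[OF this bd]
    have "expectation (\<lambda>\<omega>. eps2 r k k' \<omega> * ?F n i j s t (T r k \<omega>) (T r k' \<omega>)) = 0" if "(k, k') \<in> pairs_off (m n r)" for r k k'
      by (rule ex) (use that in \<open>auto simp: pairs_off_def\<close>)
    then have "(\<Sum>(k, k')\<in>pairs_off (m n r). expectation (\<lambda>\<omega>. eps2 r k k' \<omega> * ?F n i j s t (T r k \<omega>) (T r k' \<omega>))) = 0" for r
      by (intro sum.neutral) auto
    then show ?thesis unfolding A.kernel_mean_def by simp
  qed
  have h2: "0 < (h n)\<^sup>2" for n using h[of n] by simp
  have \<delta>: "A.rate_fun n / (h n)\<^sup>2 = delta2 m n (h n)" for n
    unfolding A.rate_fun_def using delta_eq(2)[of h n m] h by simp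
  have \<delta>_lim: "(\<lambda>n. delta2 m n (h n)) \<longlonglongrightarrow> 0"
    using delta_tendsto_0(2)[OF _ h lim l rate] m by blast
  from fam1 fam2 AE_space show ?thesis
  proof eventually_elim
    case (elim \<omega>)
    then obtain B C' where B: "0 \<le> B" "\<forall>\<^sub>F n in sequentially. \<forall>f\<in>\<phi> ` {0, 1, 2}. \<forall>g\<in>\<phi> ` {0, 1, 2}. \<forall>s\<in>{a..b}. \<forall>t\<in>{a..b}.
        \<bar>A.kernel_avg (\<lambda>_ _ _ _. 1) n (\<lambda>x y. f ((x - s) / h n) * g ((y - t) / h n)) \<omega> - A.kernel_mean (\<lambda>_ _ _ _. 1) n (\<lambda>x y. f ((x - s) / h n) * g ((y - t) / h n))\<bar>
         \<le> B * A.rate_fun n"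
      and C': "0 \<le> C'" "\<forall>\<^sub>F n in sequentially. \<forall>f\<in>\<phi> ` {0, 1, 2}. \<forall>g\<in>\<phi> ` {0, 1, 2}. \<forall>s\<in>{a..b}. \<forall>t\<in>{a..b}.
        \<bar>A.kernel_avg eps2 n (\<lambda>x y. f ((x - s) / h n) * g ((y - t) / h n)) \<omega> - A.kernel_mean eps2 n (\<lambda>x y. f ((x - s) / h n) * g ((y - t) / h n))\<bar>
         \<le> C' * A.rate_fun n" by blast
    have \<omega>: "\<omega> \<in> space M" by fact
    have "(\<lambda>n. 6 * (B * delta2 m n (h n))) \<longlonglongrightarrow> 6 * (B * 0)" by (intro tendsto_mult tendsto_const \<delta>_lim)
    then have small: "\<forall>\<^sub>F n in sequentially. 6 * (B * delta2 m n (h n)) < L" using L by (intro order_tendstoD(2)) auto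
    have hs: "\<forall>\<^sub>F n in sequentially. h n < (b - a) / 2" using order_tendstoD(2)[OF lim, of "(b - a) / 2"] ab by simp
    \<comment> \<open>Bound for the total weight: the expected weight is a product of two factors of
      at most \<open>M\<^sub>T\<close>, and the 1 absorbs the stochastic error.\<close>
    define W where "W = M\<^sub>T\<^sup>2 + 1"
    have W0: "0 \<le> W" unfolding W_def by simp
    have "\<forall>\<^sub>F n in sequentially. \<forall>s\<in>{a..b}. \<forall>t\<in>{a..b}. \<bar>ch n s t \<omega> - G s t\<bar> \<le> (6 * (C' + C * W) / L) * ((h n)\<^sup>2 + delta2 m n (h n))"
      using B(2) C'(2) small hs A.rate_fun_nonneg eventually_gt_at_top[of 0]
    proof eventually_elim
      case (elim n)
      show ?case
      proof (intro ballI)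
        fix s t assume s: "s \<in> {a..b}" and t: "t \<in> {a..b}"
        let ?d = "delta2 m n (h n)"
        have n: "0 < n" and hn: "h n \<le> (b - a) / 2" using elim by auto
        have d0: "0 \<le> ?d" unfolding \<delta>[symmetric] using elim h2[of n] by (intro divide_nonneg_nonneg) auto
        note NDs = nd[OF h hn s] and NDt = nd[OF h hn t]
        let ?A = "pair_avg (?wt n) (?E n) n"
        define w where "w = (\<lambda>(i, j, k). kern_scale K (h n) (T i j \<omega> - s) * kern_scale K (h n) (T i k \<omega> - t))"
        define z where "z = (\<lambda>(i, j, k). Y i j \<omega> * Y i k \<omega>)"
        define x where "x = (\<lambda>(i, j, k :: nat). (T i j \<omega> - s) / h n)"
        define y where "y = (\<lambda>(i, j :: nat, k). (T i k \<omega> - t) / h n)"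
        define r where "r = (\<lambda>(i, j, k). eps2 i j k \<omega>)"
        have wx: "w e = \<phi> 0 (x e) * \<phi> 0 (y e) / (h n)\<^sup>2" "w e * x e = \<phi> 1 (x e) * \<phi> 0 (y e) / (h n)\<^sup>2"
          "w e * y e = \<phi> 0 (x e) * \<phi> 1 (y e) / (h n)\<^sup>2" "w e * (x e)\<^sup>2 = \<phi> 2 (x e) * \<phi> 0 (y e) / (h n)\<^sup>2"
          "w e * (y e)\<^sup>2 = \<phi> 0 (x e) * \<phi> 2 (y e) / (h n)\<^sup>2" "w e * (x e * y e) = \<phi> 1 (x e) * \<phi> 1 (y e) / (h n)\<^sup>2" for e
          unfolding w_def x_def y_def \<phi>_def kern_scale_def by (auto split: prod.splits simp: power2_eq_square mult_ac)
        have avg: "?A (\<lambda>e. c e * (\<phi> i (x e) * \<phi> j (y e) / (h n)\<^sup>2)) = A.kernel_avg Z n (?F n i j s t) \<omega> / (h n)\<^sup>2"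
          if "\<And>i j k. c (i, j, k) = Z i j k \<omega>" for c Z i j
        proof -
          have "?A (\<lambda>e. c e * (\<phi> i (x e) * \<phi> j (y e) / (h n)\<^sup>2)) = ?A (\<lambda>e. (1 / (h n)\<^sup>2) * (c e * (\<phi> i (x e) * \<phi> j (y e))))" by (simp add: mult_ac)
          also have "\<dots> = (1 / (h n)\<^sup>2) * A.kernel_avg Z n (?F n i j s t) \<omega>"
            unfolding pair_avg_scale unfolding pair_avg_def A.kernel_avg_def x_def y_def by (simp add: that)
          finally show ?thesis by simp
        qed
        have close: "\<bar>?A (\<lambda>e. \<phi> i (x e) * \<phi> j (y e) / (h n)\<^sup>2) - S i (h n) s * S j (h n) t\<bar> \<le> B * ?d"
          if ij: "i \<in> {0, 1, 2}" "j \<in> {0, 1, 2}" for i j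
        proof -
          let ?k = "A.kernel_avg (\<lambda>_ _ _ _. 1) n (?F n i j s t) \<omega>" and ?c = "S i (h n) s * S j (h n) t"
          have "\<bar>?k - (h n)\<^sup>2 * ?c\<bar> \<le> B * A.rate_fun n"
            using elim(1) ij s t unfolding mean1[OF n, symmetric] by blast
          then have "\<bar>?k - (h n)\<^sup>2 * ?c\<bar> / (h n)\<^sup>2 \<le> B * A.rate_fun n / (h n)\<^sup>2"
            using h2[of n] by (intro divide_right_mono) auto
          moreover have "\<bar>?k - (h n)\<^sup>2 * ?c\<bar> / (h n)\<^sup>2 = \<bar>?k / (h n)\<^sup>2 - ?c\<bar>"
          proof -
            have "\<bar>y - (h n)\<^sup>2 * c\<bar> / (h n)\<^sup>2 = \<bar>(y - (h n)\<^sup>2 * c) / (h n)\<^sup>2\<bar>" for y c by (simp only: abs_divide abs_of_pos[OF h2])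
            moreover have "(y - (h n)\<^sup>2 * c) / (h n)\<^sup>2 = y / (h n)\<^sup>2 - c" for y c using h[of n] by (simp add: diff_divide_distrib)
            ultimately show ?thesis by simp
          qed
          ultimately show ?thesis
            using avg[of "\<lambda>_. 1" "\<lambda>_ _ _ _. 1" i j] unfolding times_divide_eq_right[symmetric] \<delta> by simp
        qed
        have noise: "\<bar>?A (\<lambda>e. r e * (\<phi> i (x e) * \<phi> j (y e) / (h n)\<^sup>2))\<bar> \<le> C' * ?d" if ij: "i \<in> {0, 1, 2}" "j \<in> {0, 1, 2}" for i j
        proof -
          have "\<bar>A.kernel_avg eps2 n (?F n i j s t) \<omega> - A.kernel_mean eps2 n (?F n i j s t)\<bar> \<le> C' * A.rate_fun n"
            using elim(2) ij s t by blast
          then have "\<bar>A.kernel_avg eps2 n (?F n i j s t) \<omega>\<bar> / (h n)\<^sup>2 \<le> C' * A.rate_fun n / (h n)\<^sup>2"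
            using h2[of n] unfolding mean2 by (intro divide_right_mono) auto
          then show ?thesis
            using avg[of r eps2 i j] h[of n] unfolding times_divide_eq_right[symmetric] \<delta> r_def by (simp add: abs_divide)
        qed
        let ?loss = "cov_loss K (h n) n (m n) (\<lambda>i j. Y i j \<omega>) (\<lambda>i j. T i j \<omega>) s t"
        obtain a1 a2 where "is_arg_min ?loss (\<lambda>_. True) (ch n s t \<omega>, a1, a2)"
          using est[OF s t \<omega>, of n] unfolding is_cov_estimate_def obs_eq by blast
        then have least: "?loss (ch n s t \<omega>, a1, a2) \<le> ?loss c" for c
          unfolding is_arg_min_def by (meson linorder_not_le)
        have loss: "?loss (c0, c1, c2) = ?A (\<lambda>e. w e * (z e - c0 - (h n * c1) * x e - (h n * c2) * y e)\<^sup>2)" for c0 c1 c2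
          unfolding cov_loss_def pair_avg_def sum_pairs_off w_def z_def x_def y_def using h[of n] by (simp add: mult_ac)
        define bias where "bias = (\<lambda>(i, j, k). second_moment (T i j \<omega>) (T i k \<omega>) - G s t - G1 s t * (T i j \<omega> - s) - G2 s t * (T i k \<omega> - t))"
        have resid: "z e - G s t - (h n * G1 s t) * x e - (h n * G2 s t) * y e = r e + bias e" for e
          unfolding z_def x_def y_def r_def bias_def eps2_def using h[of n] by (auto split: prod.splits)
        have w0: "0 \<le> w e" for e unfolding wx(1) \<phi>_def using KF(1) by simp
        \<comment> \<open>A nonzero product weight puts both coordinates into their windows at once,
          so the bivariate Taylor bound applies with radius \<open>h n\<close>.\<close>
        have wr: "w e \<noteq> 0 \<Longrightarrow> \<bar>bias e\<bar> \<le> C * (h n)\<^sup>2 \<and> \<bar>x e\<bar> \<le> 1 \<and> \<bar>y e\<bar> \<le> 1" for e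
        proof -
          assume "w e \<noteq> 0"
          then have xy: "\<bar>x e\<bar> \<le> 1" "\<bar>y e\<bar> \<le> 1"
            unfolding wx(1) \<phi>_def using KF(2)[of "x e"] KF(2)[of "y e"] by (auto simp: abs_le_iff)
          obtain i j k where e: "e = (i, j, k)" by (cases e)
          have "\<bar>T i j \<omega> - s\<bar> \<le> h n" "\<bar>T i k \<omega> - t\<bar> \<le> h n" using xy h[of n] unfolding e x_def y_def by (simp_all add: abs_divide)
          then have "\<bar>G (T i j \<omega>) (T i k \<omega>) - G s t - G1 s t * (T i j \<omega> - s) - G2 s t * (T i k \<omega> - t)\<bar> \<le> C * (h n)\<^sup>2"
            by (intro Taylor s t T_range'[OF \<omega>])
          then show ?thesis using xy G_eq[OF T_range'[OF \<omega>] T_range'[OF \<omega>]] unfolding e bias_def by simp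
        qed
        have Aw: "?A w \<le> W"
        proof -
          have "\<bar>?A w - S 0 (h n) s * S 0 (h n) t\<bar> \<le> B * ?d" using close[of 0 0] unfolding wx(1)[abs_def, symmetric] by (simp add: wx(1))
          moreover have "B * ?d \<le> 1" using elim(3) L by linarith
          moreover have "S 0 (h n) s * S 0 (h n) t \<le> M\<^sub>T\<^sup>2"
            unfolding power2_eq_square using NDs NDt qv(1) M\<^sub>T by (intro mult_mono) auto
          ultimately show ?thesis unfolding W_def by linarith
        qed
        have bias_avg: "\<bar>?A (\<lambda>e. w e * bias e * x e)\<bar> \<le> C * W * (h n)\<^sup>2" "\<bar>?A (\<lambda>e. w e * bias e * y e)\<bar> \<le> C * W * (h n)\<^sup>2"
          "\<bar>?A (\<lambda>e. w e * bias e)\<bar> \<le> C * W * (h n)\<^sup>2"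
        proof -
          have wt0: "0 \<le> ?wt n i" for i by (rule A.wt_nonneg)
          have wrx: "w e \<noteq> 0 \<Longrightarrow> \<bar>bias e\<bar> \<le> C * (h n)\<^sup>2 \<and> \<bar>x e\<bar> \<le> 1" and wry: "w e \<noteq> 0 \<Longrightarrow> \<bar>bias e\<bar> \<le> C * (h n)\<^sup>2 \<and> \<bar>y e\<bar> \<le> 1" for e
            using wr[of e] by blast+
          have "C * (h n)\<^sup>2 * ?A w \<le> C * (h n)\<^sup>2 * W" using Aw C0 by (intro mult_left_mono) auto
          moreover have "\<bar>?A (\<lambda>e. w e * bias e * x e)\<bar> \<le> ?A (\<lambda>e. C * (h n)\<^sup>2 * w e)" "\<bar>?A (\<lambda>e. w e * bias e)\<bar> \<le> ?A (\<lambda>e. C * (h n)\<^sup>2 * w e)"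
            "\<bar>?A (\<lambda>e. w e * bias e * y e)\<bar> \<le> ?A (\<lambda>e. C * (h n)\<^sup>2 * w e)"
            using window_le[OF w0 wrx] window_le[OF w0 wry] by (intro pair_avg_abs_le wt0; blast)+
          ultimately show "\<bar>?A (\<lambda>e. w e * bias e * x e)\<bar> \<le> C * W * (h n)\<^sup>2" "\<bar>?A (\<lambda>e. w e * bias e * y e)\<bar> \<le> C * W * (h n)\<^sup>2"
            "\<bar>?A (\<lambda>e. w e * bias e)\<bar> \<le> C * W * (h n)\<^sup>2"
            unfolding pair_avg_scale by (simp_all add: mult_ac)
        qed
        define R where "R = C' * ?d + C * W * (h n)\<^sup>2"
        have R0: "\<bar>?A (\<lambda>e. w e * (z e - G s t - (h n * G1 s t) * x e - (h n * G2 s t) * y e))\<bar> \<le> R"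
        proof -
          have "?A (\<lambda>e. w e * (r e + bias e)) = ?A (\<lambda>e. r e * (\<phi> 0 (x e) * \<phi> 0 (y e) / (h n)\<^sup>2)) + ?A (\<lambda>e. w e * bias e)"
            unfolding pair_avg_add[symmetric] wx(1)[symmetric] by (simp add: algebra_simps)
          then show ?thesis using noise[of 0 0] bias_avg(3) unfolding resid R_def by simp
        qed
        have R1: "\<bar>?A (\<lambda>e. w e * (z e - G s t - (h n * G1 s t) * x e - (h n * G2 s t) * y e) * x e)\<bar> \<le> R"
        proof -
          have "?A (\<lambda>e. w e * (r e + bias e) * x e) = ?A (\<lambda>e. r e * (\<phi> 1 (x e) * \<phi> 0 (y e) / (h n)\<^sup>2)) + ?A (\<lambda>e. w e * bias e * x e)"
            unfolding pair_avg_add[symmetric] wx(2)[symmetric] by (simp add: algebra_simps)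
          then show ?thesis using noise[of 1 0] bias_avg(1) unfolding resid R_def by simp
        qed
        have R2: "\<bar>?A (\<lambda>e. w e * (z e - G s t - (h n * G1 s t) * x e - (h n * G2 s t) * y e) * y e)\<bar> \<le> R"
        proof -
          have "?A (\<lambda>e. w e * (r e + bias e) * y e) = ?A (\<lambda>e. r e * (\<phi> 0 (x e) * \<phi> 1 (y e) / (h n)\<^sup>2)) + ?A (\<lambda>e. w e * bias e * y e)"
            unfolding pair_avg_add[symmetric] wx(3)[symmetric] by (simp add: algebra_simps)
          then show ?thesis using noise[of 0 1] bias_avg(2) unfolding resid R_def by simp
        qed
        have "\<bar>ch n s t \<omega> - G s t\<bar> \<le> 6 * R / (q\<^sup>2 / (2 + 5 / v))"
        proof (rule local_linear_error[where A = ?A and w = w and z = z and Q = "\<lambda>_. True" and ?x1.0 = x and ?x2.0 = y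
              and ?a1.0 = "h n * a1" and ?a2.0 = "h n * a2" and ?b1.0 = "h n * G1 s t" and ?b2.0 = "h n * G2 s t" and s = q and v = v
              and ?\<sigma>0.0 = "S 0 (h n) s" and ?\<sigma>1.0 = "S 1 (h n) s" and ?\<sigma>2.0 = "S 2 (h n) s"
              and ?\<tau>0.0 = "S 0 (h n) t" and ?\<tau>1.0 = "S 1 (h n) t" and ?\<tau>2.0 = "S 2 (h n) t"
              and \<eta> = "B * ?d", OF pair_avg_add pair_avg_scale])
          show "?A (\<lambda>e. w e * (z e - ch n s t \<omega> - h n * a1 * x e - h n * a2 * y e)\<^sup>2) \<le> ?A (\<lambda>e. w e * (z e - c0 - c1 * x e - c2 * y e)\<^sup>2)" for c0 c1 c2
            using least[of "(c0, c1 / h n, c2 / h n)"] h[of n] unfolding loss by simp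
          show "\<bar>?A (\<lambda>e. w e) - S 0 (h n) s * S 0 (h n) t\<bar> \<le> B * ?d" using close[of 0 0] unfolding wx(1) by simp
          show "\<bar>?A (\<lambda>e. w e * (x e)\<^sup>2) - S 2 (h n) s * S 0 (h n) t\<bar> \<le> B * ?d" using close[of 2 0] unfolding wx(4) by simp
          show "\<bar>?A (\<lambda>e. w e * (y e)\<^sup>2) - S 0 (h n) s * S 2 (h n) t\<bar> \<le> B * ?d" using close[of 0 2] unfolding wx(5) by simp
          show "\<bar>?A (\<lambda>e. w e * x e) - S 1 (h n) s * S 0 (h n) t\<bar> \<le> B * ?d" using close[of 1 0] unfolding wx(2) by simp
          show "\<bar>?A (\<lambda>e. w e * y e) - S 0 (h n) s * S 1 (h n) t\<bar> \<le> B * ?d" using close[of 0 1] unfolding wx(3) by simp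
          show "\<bar>?A (\<lambda>e. w e * (x e * y e)) - S 1 (h n) s * S 1 (h n) t\<bar> \<le> B * ?d" using close[of 1 1] unfolding wx(6) by simp
          show "6 * (B * ?d) \<le> q\<^sup>2 / (2 + 5 / v)" using elim(3) unfolding L_def by simp
        qed (use qv NDs NDt R0 R1 R2 in auto)
        also have "6 * R / (q\<^sup>2 / (2 + 5 / v)) \<le> (6 * (C' + C * W) / L) * ((h n)\<^sup>2 + ?d)"
        proof -
          have "R \<le> (C' + C * W) * ((h n)\<^sup>2 + ?d)"
          proof -
            have "(C' + C * W) * ((h n)\<^sup>2 + ?d) = R + (C' * (h n)\<^sup>2 + C * W * ?d)"
              unfolding R_def by (simp add: algebra_simps)
            moreover have "0 \<le> C' * (h n)\<^sup>2 + C * W * ?d" using d0 C'(1) C0 W0 by (intro add_nonneg_nonneg mult_nonneg_nonneg) auto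
            ultimately show ?thesis by linarith
          qed
          then have "6 / L * R \<le> 6 / L * ((C' + C * W) * ((h n)\<^sup>2 + ?d))" using L by (intro mult_left_mono) auto
          then show ?thesis unfolding L_def[symmetric] by (simp only: times_divide_eq_left times_divide_eq_right mult.assoc)
        qed
        finally show "\<bar>ch n s t \<omega> - G s t\<bar> \<le> (6 * (C' + C * W) / L) * ((h n)\<^sup>2 + ?d)" .
      qed
    qed
    moreover have "0 \<le> 6 * (C' + C * W) / L" using C'(1) C0 W0 L by (intro divide_nonneg_nonneg mult_nonneg_nonneg add_nonneg_nonneg) auto
    ultimately show ?case unfolding G_def by blast
  qed
qed

end

section \<open>From the two estimators to the covariance\<close>

theorem theorem3p3:
  fixes a b \<sigma> :: real
    and M :: "'w measure" and P :: "'p measure"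
    and X :: "real \<Rightarrow> 'p \<Rightarrow> real" and \<xi> :: "nat \<Rightarrow> 'w \<Rightarrow> 'p"
    and T U :: "nat \<Rightarrow> nat \<Rightarrow> 'w \<Rightarrow> real"
    and m :: "nat \<Rightarrow> nat \<Rightarrow> nat"
    and f\<^sub>T K :: "real \<Rightarrow> real"
    and h\<^sub>\<mu> h\<^sub>R :: "nat \<Rightarrow> real"
    and mu_hat :: "nat \<Rightarrow> real \<Rightarrow> 'w \<Rightarrow> real"
    and C_hat :: "nat \<Rightarrow> real \<Rightarrow> real \<Rightarrow> 'w \<Rightarrow> real"
  assumes "a < b"
    and "second_order_process a b P X"
    and "sampling_model a b M P \<xi> T U f\<^sub>T \<sigma>"
    and "\<And>n i. i < n \<Longrightarrow> 2 \<le> m n i"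
    and "\<And>n. 0 < h\<^sub>\<mu> n" and "\<And>n. 0 < h\<^sub>R n"
    and "condC1 a b f\<^sub>T" and "condC2 K"
    and "condC3 a b (mean_fun P X)" and "condC4 a b (cov_fun P X)"
    and "condC5 a b M P X U m h\<^sub>\<mu>" and "condC6 a b M P X U m h\<^sub>R"
    and "\<And>n t \<omega>. t \<in> {a..b} \<Longrightarrow> \<omega> \<in> space M \<Longrightarrow>
           is_mean_estimate K (h\<^sub>\<mu> n) n (m n) (\<lambda>i j. obs X \<xi> T U i j \<omega>) (\<lambda>i j. T i j \<omega>)
             t (mu_hat n t \<omega>)"
    and "\<And>n s t \<omega>. s \<in> {a..b} \<Longrightarrow> t \<in> {a..b} \<Longrightarrow> \<omega> \<in> space M \<Longrightarrow>
           is_cov_estimate K (h\<^sub>R n) n (m n) (\<lambda>i j. obs X \<xi> T U i j \<omega>) (\<lambda>i j. T i j \<omega>)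
             s t (C_hat n s t \<omega>)"
  shows "AE \<omega> in M.
           (\<forall>\<^sub>F n in sequentially. bdd_above
              ((\<lambda>(s, t). \<bar>R_hat C_hat mu_hat n s t \<omega> - cov_fun P X s t\<bar>) ` ({a..b} \<times> {a..b}))) \<and>
           (\<lambda>n. SUP (s, t)\<in>{a..b} \<times> {a..b}. \<bar>R_hat C_hat mu_hat n s t \<omega> - cov_fun P X s t\<bar>)
             \<in> O(\<lambda>n. (h\<^sub>\<mu> n)\<^sup>2 + delta1 m n (h\<^sub>\<mu> n) + (h\<^sub>R n)\<^sup>2 + delta2 m n (h\<^sub>R n))"
proof -
  let ?\<mu> = "mean_fun P X" and ?R = "cov_fun P X"
  note m = assms(4) and h\<mu> = assms(5) and hR = assms(6)
  obtain m\<^sub>T M\<^sub>T where mM: "0 < m\<^sub>T" "\<And>t. t \<in> {a..b} \<Longrightarrow> m\<^sub>T \<le> f\<^sub>T t \<and> f\<^sub>T t \<le> M\<^sub>T"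
    using assms(7) unfolding condC1_def by blast
  obtain l1 where h\<mu>0: "h\<^sub>\<mu> \<longlonglongrightarrow> 0" and l1: "2 < l1" and U1: "\<And>i j. integrable M (\<lambda>\<omega>. \<bar>U i j \<omega>\<bar> powr l1)"
    and X1: "finite_sup_moment a b P X l1"
    and rate1: "(\<lambda>n. inverse (beta1 m h\<^sub>\<mu> n) * (ln (real n) / real n) powr (1 - 2 / l1)) \<longlonglongrightarrow> 0"
    using assms(11) unfolding condC5_def beta1_def by blast
  obtain l2 where hR0: "h\<^sub>R \<longlonglongrightarrow> 0" and l2: "2 < l2" and U2: "\<And>i j. integrable M (\<lambda>\<omega>. \<bar>U i j \<omega>\<bar> powr (2 * l2))"
    and X2: "finite_sup_moment a b P X (2 * l2)"
    and rate2: "(\<lambda>n. inverse (beta2 m h\<^sub>R n) * (ln (real n) / real n) powr (1 - 2 / l2)) \<longlonglongrightarrow> 0"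
    using assms(12) unfolding condC6_def beta2_def by blast
  interpret prob_space M using assms(3) unfolding sampling_model_def by blast
  interpret fda_model M a b \<sigma> P X \<xi> T U f\<^sub>T m\<^sub>T M\<^sub>T
    by unfold_locales (use assms(1-3) mM in auto)
  \<comment> \<open>The same model is used with two moment orders, \<open>l1\<close> for single
    observations and \<open>2 * l2\<close> for products of two, each with its own amplitudes and
    envelopes.\<close>
  interpret F1: fda_moment M a b \<sigma> P X \<xi> T U f\<^sub>T m\<^sub>T M\<^sub>T l1
    by unfold_locales (use l1 X1 U1 in auto)
  interpret F2: fda_moment M a b \<sigma> P X \<xi> T U f\<^sub>T m\<^sub>T M\<^sub>T "2 * l2"
    by unfold_locales (use l2 X2 U2 in auto)
  define g1 where "g1 n = (h\<^sub>\<mu> n)\<^sup>2 + delta1 m n (h\<^sub>\<mu> n)" for n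
  define g2 where "g2 n = (h\<^sub>R n)\<^sup>2 + delta2 m n (h\<^sub>R n)" for n
  have rate_mean: "AE \<omega> in M. \<exists>B\<ge>0. \<forall>\<^sub>F n in sequentially. \<forall>t\<in>{a..b}. \<bar>mu_hat n t \<omega> - ?\<mu> t\<bar> \<le> B * g1 n"
    unfolding g1_def using F1.mean_rate[OF _ h\<mu> h\<mu>0 rate1 assms(8,9)] m assms(13) by blast
  have rate_cov: "AE \<omega> in M. \<exists>B\<ge>0. \<forall>\<^sub>F n in sequentially. \<forall>s\<in>{a..b}. \<forall>t\<in>{a..b}.
      \<bar>C_hat n s t \<omega> - (?R s t + ?\<mu> s * ?\<mu> t)\<bar> \<le> B * g2 n"
    unfolding g2_def using F2.cov_rate[OF _ hR hR0 l2 refl rate2 assms(8-10)] m assms(14) by blast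
  have delta1_lim: "(\<lambda>n. delta1 m n (h\<^sub>\<mu> n)) \<longlonglongrightarrow> 0"
    using delta_tendsto_0(1)[OF _ h\<mu> h\<mu>0 l1 rate1] m by blast
  have "g1 \<longlonglongrightarrow> 0" unfolding g1_def using tendsto_add[OF tendsto_power[OF h\<mu>0, of 2] delta1_lim] by simp
  \<comment> \<open>Keeps one factor of the quadratic error term bounded by a constant, so that the
    product stays of first order in \<open>g1\<close>.\<close>
  then have g1_le: "\<forall>\<^sub>F n in sequentially. g1 n < 1" by (rule order_tendstoD) simp
  obtain d where d: "0 \<le> d" "\<And>t. t \<in> {a..b} \<Longrightarrow> \<bar>?\<mu> t\<bar> \<le> d"
  proof
    show "0 \<le> F1.offset" using F1.\<mu>_le_offset[of a] assms(1) by auto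
  qed (rule F1.\<mu>_le_offset)
  from rate_mean rate_cov show ?thesis
  proof eventually_elim
    case (elim \<omega>)
    let ?err = "\<lambda>n. \<lambda>(s, t). \<bar>R_hat C_hat mu_hat n s t \<omega> - ?R s t\<bar>" and ?S = "{a..b} \<times> {a..b}"
    let ?g = "\<lambda>n. (h\<^sub>\<mu> n)\<^sup>2 + delta1 m n (h\<^sub>\<mu> n) + (h\<^sub>R n)\<^sup>2 + delta2 m n (h\<^sub>R n)"
    obtain B1 where B1: "0 \<le> B1" "\<forall>\<^sub>F n in sequentially. \<forall>t\<in>{a..b}. \<bar>mu_hat n t \<omega> - ?\<mu> t\<bar> \<le> B1 * g1 n"
      using elim by blast
    obtain B2 where B2: "0 \<le> B2" "\<forall>\<^sub>F n in sequentially. \<forall>s\<in>{a..b}. \<forall>t\<in>{a..b}. \<bar>C_hat n s t \<omega> - (?R s t + ?\<mu> s * ?\<mu> t)\<bar> \<le> B2 * g2 n"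
      using elim by blast
    define C where "C = B2 + B1 * (2 * d + B1)"
    have uniform: "\<forall>\<^sub>F n in sequentially. \<forall>x\<in>?S. ?err n x \<le> C * ?g n"
      using B1(2) B2(2) g1_le eventually_gt_at_top[of 0]
    proof eventually_elim
      case (elim n)
      have "0 \<le> delta1 m n (h\<^sub>\<mu> n)" "0 \<le> delta2 m n (h\<^sub>R n)"
        unfolding delta1_def delta2_def gam_def using h\<mu>[of n] hR[of n] elim
        by (auto intro!: divide_nonneg_nonneg mult_nonneg_nonneg add_nonneg_nonneg sum_nonneg)
      then have g: "0 \<le> g1 n" "0 \<le> g2 n" "?g n = g1 n + g2 n" unfolding g1_def g2_def by auto
      show ?case
      proof (clarify)
        fix s t assume s: "s \<in> {a..b}" and t: "t \<in> {a..b}"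
        define x y where "x = mu_hat n s \<omega> - ?\<mu> s" and "y = mu_hat n t \<omega> - ?\<mu> t"
        have x: "\<bar>x\<bar> \<le> B1 * g1 n" and y: "\<bar>y\<bar> \<le> B1 * g1 n" unfolding x_def y_def using elim s t by auto
        have "B1 * g1 n \<le> B1" using mult_left_mono[of "g1 n" 1 B1] B1(1) elim by simp
        then have y1: "\<bar>y\<bar> \<le> B1" using y by linarith
        have "\<bar>x * ?\<mu> t\<bar> \<le> B1 * g1 n * d" "\<bar>?\<mu> s * y\<bar> \<le> d * (B1 * g1 n)" "\<bar>x * y\<bar> \<le> B1 * g1 n * B1"
          unfolding abs_mult using x y y1 d(2)[OF s] d(2)[OF t] d(1) B1(1) g(1) by (auto intro!: mult_mono)
        \<comment> \<open>The error of a product of estimates: two terms linear in the mean errors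
          \<open>x\<close> and \<open>y\<close>, whose coefficients are bounded because the mean
          function is, and one quadratic term.\<close>
        moreover have "R_hat C_hat mu_hat n s t \<omega> - ?R s t =
            (C_hat n s t \<omega> - (?R s t + ?\<mu> s * ?\<mu> t)) - x * ?\<mu> t - ?\<mu> s * y - x * y"
          unfolding R_hat_def x_def y_def by (simp add: algebra_simps)
        moreover have "\<bar>C_hat n s t \<omega> - (?R s t + ?\<mu> s * ?\<mu> t)\<bar> \<le> B2 * g2 n" using elim s t by blast
        ultimately have "\<bar>R_hat C_hat mu_hat n s t \<omega> - ?R s t\<bar> \<le> B2 * g2 n + B1 * g1 n * d + d * (B1 * g1 n) + B1 * g1 n * B1"
          by linarith
        also have "\<dots> = B2 * g2 n + B1 * (2 * d + B1) * g1 n" by (simp add: algebra_simps)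
        also have "\<dots> \<le> C * g2 n + C * g1 n"
          unfolding C_def using g B1(1) B2(1) d(1) by (intro add_mono mult_right_mono) auto
        finally show "\<bar>R_hat C_hat mu_hat n s t \<omega> - ?R s t\<bar> \<le> C * ?g n" unfolding g(3) by (simp add: algebra_simps)
      qed
    qed
    \<comment> \<open>Over the reals a supremum carries information only for nonempty sets bounded
      above; boundedness comes from the uniform estimate, nonemptiness from
      \<open>a < b\<close>.\<close>
    have bdd: "\<forall>\<^sub>F n in sequentially. bdd_above (?err n ` ?S)"
      using uniform by eventually_elim (rule bdd_aboveI2, blast)
    have "(\<lambda>n. SUP x\<in>?S. ?err n x) \<in> O(?g)"
    proof (rule bigoI)
      show "\<forall>\<^sub>F n in sequentially. norm (SUP x\<in>?S. ?err n x) \<le> C * norm (?g n)"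
        using uniform bdd
      proof eventually_elim
        case (elim n)
        have ne: "(a, a) \<in> ?S" using assms(1) by auto
        have up: "(SUP x\<in>?S. ?err n x) \<le> C * ?g n" using elim(1) ne by (intro cSUP_least) auto
        have "0 \<le> ?err n (a, a)" by simp
        then have lo: "0 \<le> (SUP x\<in>?S. ?err n x)" using cSUP_upper2[OF elim(2) ne] by blast
        have C0: "0 \<le> C" unfolding C_def using B1(1) B2(1) d(1) by auto
        have "C * ?g n \<le> C * norm (?g n)" by (intro mult_left_mono C0) simp
        then show ?case using up lo by simp
      qed
    qed
    then show ?case using bdd by blast
  qed
qed

end
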